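(* Let $\mathcal{H}$ be a finite-dimensional Hilbert space, let $\mathcal{A}=(\mathcal{A}_n)_{n\ge1}$ be a sequence of sets $\mathcal{A}_n\subseteq\mathcal{D}(\mathcal{H}^{\otimes n})$, and let $\mathcal{B}_1\subseteq\mathcal{D}(\mathcal{H})$ be a non-empty, topologically closed set of states. Assume that every $\mathcal{A}_n$ is topologically closed and convex, and that $\mathcal{A}$ satisfies Axioms Q.I, Q.II, Q.III and Q.IV (see context). Then $$\mathrm{Stein}(\mathcal{A}\|\mathcal{B}_1^{\mathrm{iid}})=\operatorname{min^*}_{\mu\in\mathcal{P}(\mathcal{B}_1)}\ \lim_{n\to\infty}\frac1n\inf_{\rho_n\in\mathcal{A}_n}D\Big(\rho_n\,\Big\|\,\int_{\mathcal{B}_1}\mathrm{d}\mu(\sigma_1)\,\sigma_1^{\otimes n}\Big),$$ and $$\mathrm{Stein}(\mathcal{A}\|\mathcal{B}_1^{\mathrm{av}})=\mathrm{Stein}(\mathcal{A}\|\mathrm{co}(\mathcal{B}_1)^{\mathrm{av}})=\mathrm{Stein}(\mathcal{A}\|\mathrm{co}(\mathcal{B}_1)^{\mathrm{iid}})=\operatorname{min^*}_{\mu\in\mathcal{P}(\mathrm{co}(\mathcal{B}_1))}\ \lim_{n\to\infty}\frac1n\inf_{\rho_n\in\mathcal{A}_n}D\Big(\rho_n\,\Big\|\,\int_{\mathrm{co}(\mathcal{B}_1)}\mathrm{d}\mu(\sigma_1)\,\sigma_1^{\otimes n}\Big).$$ Here, in each formula, the set of measures $\mu$ for which the inner limit in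 $n$ exists is non-empty, and the minimum over that set exists.
   Context: $\mathcal{D}(\mathcal{K})$ denotes the set of density operators (positive semidefinite, trace one) on a finite-dimensional Hilbert space $\mathcal{K}$. For $X\le Y$ we mean $Y-X$ is positive semidefinite. For a set $\mathcal{F}_1\subseteq\mathcal{D}(\mathcal{H})$: $\mathcal{F}_1^{\otimes n,\mathrm{iid}}:=\{\rho^{\otimes n}:\rho\in\mathcal{F}_1\}$, $\mathcal{F}_1^{\mathrm{iid}}:=(\mathcal{F}_1^{\otimes n,\mathrm{iid}})_n$; $\mathcal{F}_1^{\otimes n,\mathrm{av}}:=\{\rho_1\otimes\cdots\otimes\rho_n:\rho_1,\dots,\rho_n\in\mathcal{F}_1\}$, $\mathcal{F}_1^{\mathrm{av}}:=(\mathcal{F}_1^{\otimes n,\mathrm{av}})_n$. $\mathrm{co}$ denotes convex hull. For sequences $\mathcal{A}=(\mathcal{A}_n)_n,\mathcal{B}=(\mathcal{B}_n)_n$ with $\mathcal{A}_n,\mathcal{B}_n\subseteq\mathcal{D}(\mathcal{H}^{\otimes n})$, define $\beta_\varepsilon(\mathcal{A}_n\|\mathcal{B}_n):=\inf\{\sup_{\sigma_n\in\mathcal{B}_n}\mathrm{Tr}[\sigma_nE_n]:0\le E_n\le\mathbb{1},\ \sup_{\rho_n\in\mathcal{A}_n}\mathrm{Tr}[\rho_n(\mathbb{1}-E_n)]\le\varepsilon\}$ and the Stein exponent $\mathrm{Stein}(\mathcal{A}\|\mathcal{B}):=\lim_{\varepsilon\to0^+}\liminf_{n\to\infty}-\frac1n\log\beta_\varepsilon(\mathcal{A}_n\|\mathcal{B}_n)$.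 $D(\rho\|\sigma)=\mathrm{Tr}[\rho(\log\rho-\log\sigma)]$ is the Umegaki relative entropy ($+\infty$ if $\mathrm{supp}\,\rho\not\subseteq\mathrm{supp}\,\sigma$). $\mathcal{P}(\mathcal{C})$ is the set of regular Borel probability measures on a compact set $\mathcal{C}$; $\operatorname{min^*}_\mu$ means the minimum restricted to those $\mu$ for which the inner limit in $n$ exists. Depolarising map: for a state $\tau$ and $\delta\in[0,1]$, $\Delta^\delta_\tau(X):=(1-\delta)X+\delta\,\tau\,\mathrm{Tr}X$ on Hermitian operators (on states, $(1-\delta)X+\delta\tau$). Axiom Q.I: there is $\tau\in\mathcal{F}_1$ such that for all $m,k\in\mathbb{N}^+$ and all $\rho_{mk}\in\mathcal{F}_{mk}$: (a) $\mathrm{supp}(\rho_{mk})\subseteq\mathrm{supp}(\tau)^{\otimes mk}$; (b) $(\Delta^\delta_{\tau^{\otimes k}})^{\otimes m}(\rho_{mk})\in\mathcal{F}_{mk}$ for all $\delta\in[0,1]$. Axiom Q.II: $\rho_k^{\otimes m}\in\mathcal{F}_{mk}$ for all $m,k\in\mathbb{N}^+$ and $\rho_k\in\mathcal{F}_k$. Axiom Q.III: each $\mathcal{F}_n$ is closed under permutations: $U_\pi\rho_nU_\pi^\dagger\in\mathcal{F}_n$ for all $\rho_n\in\mathcal{F}_n$ and $\pi\in S_n$, where $U_\pi$ permutes the tensor factors of $\mathcal{H}^{\otimes n}$. Axiom Q.IV: for all $k\in\mathbb{N}^+$ there is a neighbourhood $\mathcal{V}$ of $\mathbb{1}^{\otimes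 k}$ (identity on $\mathcal{H}^{\otimes k}$) such that for all $F_k\in\mathcal{V}$, all $n\in\mathbb{N}^+$ and all $\rho_{n+k}\in\mathcal{F}_{n+k}$: $\mathrm{Tr}_{n+1,\dots,n+k}[\rho_{n+k}(\mathbb{1}^{\otimes n}\otimes F_k)]\in\mathrm{cone}(\mathcal{F}_n):=\{\lambda\omega:\lambda\ge0,\omega\in\mathcal{F}_n\}$, where the partial trace is over the last $k$ subsystems. *)

theory Defs
  imports "HOL-Probability.Probability"
begin

text \<open>The Hilbert space H is spanned by an orthonormal basis indexed by a finite type 'd.
  H^(n-fold tensor) has the orthonormal basis indexed by the lists of length n over 'd.
  An operator on H^(n-fold tensor) is represented by its matrix entries; entries at
  indices of the wrong length are irrelevant and are kept zero by all constructions.\<close>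

type_synonym 'd op = "'d list \<Rightarrow> 'd list \<Rightarrow> complex"
type_synonym 'd vec = "'d list \<Rightarrow> complex"

definition basis :: "nat \<Rightarrow> 'd list set" where
  "basis n = {xs. length xs = n}"

definition is_op :: "nat \<Rightarrow> 'd op \<Rightarrow> bool" where
  "is_op n A \<longleftrightarrow> (\<forall>xs ys. (length xs \<noteq> n \<or> length ys \<noteq> n) \<longrightarrow> A xs ys = 0)"

definition ident :: "nat \<Rightarrow> 'd op" where
  "ident n = (\<lambda>xs ys. if length xs = n \<and> length ys = n \<and> xs = ys then 1 else 0)"

definition mplus :: "nat \<Rightarrow> 'd op \<Rightarrow> 'd op \<Rightarrow> 'd op" where
  "mplus n A B = (\<lambda>xs ys. if length xs = n \<and> length ys = n then A xs ys + B xs ys else 0)"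

definition mminus :: "nat \<Rightarrow> 'd op \<Rightarrow> 'd op \<Rightarrow> 'd op" where
  "mminus n A B = (\<lambda>xs ys. if length xs = n \<and> length ys = n then A xs ys - B xs ys else 0)"

definition mscale :: "nat \<Rightarrow> complex \<Rightarrow> 'd op \<Rightarrow> 'd op" where
  "mscale n c A = (\<lambda>xs ys. if length xs = n \<and> length ys = n then c * A xs ys else 0)"

definition mmul :: "nat \<Rightarrow> 'd op \<Rightarrow> 'd op \<Rightarrow> 'd op" where
  "mmul n A B = (\<lambda>xs ys. if length xs = n \<and> length ys = n
       then (\<Sum>zs\<in>basis n. A xs zs * B zs ys) else 0)"

definition mvec :: "nat \<Rightarrow> 'd op \<Rightarrow> 'd vec \<Rightarrow> 'd vec" where
  "mvec n A v = (\<lambda>xs. if length xs = n then (\<Sum>ys\<in>basis n. A xs ys * v ys) else 0)"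

definition trace :: "nat \<Rightarrow> 'd op \<Rightarrow> complex" where
  "trace n A = (\<Sum>xs\<in>basis n. A xs xs)"

definition hermitian :: "nat \<Rightarrow> 'd op \<Rightarrow> bool" where
  "hermitian n A \<longleftrightarrow> is_op n A \<and> (\<forall>xs ys. A ys xs = cnj (A xs ys))"

definition psd :: "nat \<Rightarrow> 'd op \<Rightarrow> bool" where
  "psd n A \<longleftrightarrow> hermitian n A \<and>
     (\<forall>v::'d vec. 0 \<le> Re (\<Sum>xs\<in>basis n. \<Sum>ys\<in>basis n. cnj (v xs) * A xs ys * v ys))"

definition loewner_le :: "nat \<Rightarrow> 'd op \<Rightarrow> 'd op \<Rightarrow> bool" where
  "loewner_le n X Y \<longleftrightarrow> is_op n X \<and> is_op n Y \<and> psd n (mminus n Y X)"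

definition density :: "nat \<Rightarrow> 'd op \<Rightarrow> bool" where
  "density n \<rho> \<longleftrightarrow> psd n \<rho> \<and> trace n \<rho> = 1"

definition states :: "nat \<Rightarrow> 'd op set" where
  "states n = {\<rho>. density n \<rho>}"

definition supp :: "nat \<Rightarrow> 'd op \<Rightarrow> 'd vec set" where
  "supp n A = {mvec n A v | v. True}"

definition tensor :: "nat \<Rightarrow> nat \<Rightarrow> 'd op \<Rightarrow> 'd op \<Rightarrow> 'd op" where
  "tensor n m A B = (\<lambda>xs ys. if length xs = n + m \<and> length ys = n + m
      then A (take n xs) (take n ys) * B (drop n xs) (drop n ys) else 0)"

definition blk :: "nat \<Rightarrow> nat \<Rightarrow> 'd list \<Rightarrow> 'd list" where
  "blk k j xs = take k (drop (j * k) xs)"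

definition tpow :: "nat \<Rightarrow> nat \<Rightarrow> 'd op \<Rightarrow> 'd op" where
  "tpow k m X = (\<lambda>xs ys. if length xs = m * k \<and> length ys = m * k
      then (\<Prod>j<m. X (blk k j xs) (blk k j ys)) else 0)"

definition munit :: "nat \<Rightarrow> 'd list \<Rightarrow> 'd list \<Rightarrow> 'd op" where
  "munit k as bs = (\<lambda>xs ys. if length xs = k \<and> length ys = k \<and> xs = as \<and> ys = bs then 1 else 0)"

text \<open>m-fold tensor power of a linear map Phi on operators on k sites, applied to an
  operator X on m*k sites (defined through the matrix elements of Phi).\<close>
definition map_tpow :: "nat \<Rightarrow> nat \<Rightarrow> ('d op \<Rightarrow> 'd op) \<Rightarrow> 'd op \<Rightarrow> 'd op" where
  "map_tpow k m Phi X = (\<lambda>as bs. if length as = m * k \<and> length bs = m * k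
      then (\<Sum>cs\<in>basis (m * k). \<Sum>ds\<in>basis (m * k).
              (\<Prod>j<m. Phi (munit k (blk k j cs) (blk k j ds)) (blk k j as) (blk k j bs)) * X cs ds)
      else 0)"

definition depol :: "nat \<Rightarrow> 'd op \<Rightarrow> real \<Rightarrow> 'd op \<Rightarrow> 'd op" where
  "depol k \<tau> \<delta> X = (\<lambda>xs ys. if length xs = k \<and> length ys = k
      then complex_of_real (1 - \<delta>) * X xs ys + complex_of_real \<delta> * \<tau> xs ys * trace k X else 0)"

definition ptrace_last :: "nat \<Rightarrow> nat \<Rightarrow> 'd op \<Rightarrow> 'd op" where
  "ptrace_last n k A = (\<lambda>xs ys. if length xs = n \<and> length ys = n
      then (\<Sum>zs\<in>basis k. A (xs @ zs) (ys @ zs)) else 0)"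

definition permute_list :: "nat \<Rightarrow> (nat \<Rightarrow> nat) \<Rightarrow> 'd list \<Rightarrow> 'd list" where
  "permute_list n \<pi> xs = map (\<lambda>i. xs ! \<pi> i) [0..<n]"

definition perm_op :: "nat \<Rightarrow> (nat \<Rightarrow> nat) \<Rightarrow> 'd op \<Rightarrow> 'd op" where
  "perm_op n \<pi> A = (\<lambda>xs ys. if length xs = n \<and> length ys = n
      then A (permute_list n \<pi> xs) (permute_list n \<pi> ys) else 0)"

definition cone :: "nat \<Rightarrow> 'd op set \<Rightarrow> 'd op set" where
  "cone n F = {mscale n (complex_of_real c) \<omega> | c \<omega>. c \<ge> 0 \<and> \<omega> \<in> F}"

definition eigendecomp :: "nat \<Rightarrow> 'd op \<Rightarrow> ('d list \<Rightarrow> real) \<Rightarrow> ('d list \<Rightarrow> 'd vec) \<Rightarrow> bool" where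
  "eigendecomp n A lam e \<longleftrightarrow>
     (\<forall>i\<in>basis n. \<forall>j\<in>basis n.
        (\<Sum>xs\<in>basis n. cnj (e i xs) * e j xs) = (if i = j then 1 else 0)) \<and>
     (\<forall>i\<in>basis n. \<forall>xs. length xs \<noteq> n \<longrightarrow> e i xs = 0) \<and>
     (\<forall>i\<in>basis n. mvec n A (e i) = (\<lambda>xs. complex_of_real (lam i) * e i xs))"

definition mfun :: "nat \<Rightarrow> (real \<Rightarrow> real) \<Rightarrow> 'd op \<Rightarrow> 'd op" where
  "mfun n f A = (let (lam, e) = (SOME p. eigendecomp n A (fst p) (snd p)) in
     (\<lambda>xs ys. if length xs = n \<and> length ys = n
        then (\<Sum>i\<in>basis n. complex_of_real (f (lam i)) * e i xs * cnj (e i ys)) else 0))"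

text \<open>Logarithm taken on the support (log 0 := 0 convention).\<close>
definition mlog :: "nat \<Rightarrow> 'd op \<Rightarrow> 'd op" where
  "mlog n A = mfun n (\<lambda>x. if x > 0 then ln x else 0) A"

definition relent :: "nat \<Rightarrow> 'd op \<Rightarrow> 'd op \<Rightarrow> ereal" where
  "relent n \<rho> \<sigma> = (if supp n \<rho> \<subseteq> supp n \<sigma>
      then ereal (Re (trace n (mmul n \<rho> (mminus n (mlog n \<rho>) (mlog n \<sigma>)))))
      else \<infinity>)"

definition beta :: "real \<Rightarrow> nat \<Rightarrow> 'd op set \<Rightarrow> 'd op set \<Rightarrow> ereal" where
  "beta \<epsilon> n A B = (INF E\<in>{E. is_op n E \<and> loewner_le n (\<lambda>_ _. 0) E \<and> loewner_le n E (ident n) \<and>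
                         (SUP \<rho>\<in>A. ereal (Re (trace n (mmul n \<rho> (mminus n (ident n) E))))) \<le> ereal \<epsilon>}.
                    (SUP \<sigma>\<in>B. ereal (Re (trace n (mmul n \<sigma> E)))))"

text \<open>-(1/n) log of an extended real in [0,1] (with -log 0 = +infinity).\<close>
definition neglog_rate :: "nat \<Rightarrow> ereal \<Rightarrow> ereal" where
  "neglog_rate n b = (if b \<le> 0 then \<infinity> else ereal (- ln (real_of_ereal b) / real n))"

definition stein :: "(nat \<Rightarrow> 'd op set) \<Rightarrow> (nat \<Rightarrow> 'd op set) \<Rightarrow> ereal" where
  "stein A B = Lim (at_right (0::real))
       (\<lambda>\<epsilon>. liminf (\<lambda>n. neglog_rate n (beta \<epsilon> n (A n) (B n))))"

text \<open>Single-site operators are represented as matrices complex^'d^'d (this carries the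
  Euclidean topology, used for closedness, convex hulls and Borel measures).\<close>
definition op1 :: "complex^'d^'d \<Rightarrow> 'd op" where
  "op1 \<sigma> = (\<lambda>xs ys. if length xs = 1 \<and> length ys = 1 then \<sigma> $ (hd xs) $ (hd ys) else 0)"

definition states1 :: "(complex^'d^'d) set" where
  "states1 = {\<sigma>. density 1 (op1 \<sigma>)}"

definition iid_seq :: "(complex^'d^'d) set \<Rightarrow> nat \<Rightarrow> 'd op set" where
  "iid_seq F n = {tpow 1 n (op1 \<sigma>) | \<sigma>. \<sigma> \<in> F}"

definition av_seq :: "(complex^'d^'d) set \<Rightarrow> nat \<Rightarrow> 'd op set" where
  "av_seq F n = {(\<lambda>xs ys. if length xs = n \<and> length ys = n
                     then (\<Prod>i<n. (\<sigma>s i) $ (xs ! i) $ (ys ! i)) else 0)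
                 | \<sigma>s. \<forall>i<n. \<sigma>s i \<in> F}"

text \<open>Regular Borel probability measures on the compact set C (on a Euclidean space every
  finite Borel measure is regular): Borel probability measures concentrated on C.\<close>
definition prob_on :: "(complex^'d^'d) set \<Rightarrow> (complex^'d^'d) measure set" where
  "prob_on C = {M. sets M = sets borel \<and> prob_space M \<and> emeasure M (UNIV - C) = 0}"

definition mixture :: "(complex^'d^'d) measure \<Rightarrow> nat \<Rightarrow> 'd op" where
  "mixture M n = (\<lambda>xs ys. if length xs = n \<and> length ys = n
      then (LINT \<sigma>|M. tpow 1 n (op1 \<sigma>) xs ys) else 0)"

definition rate_seq :: "(nat \<Rightarrow> 'd op set) \<Rightarrow> (complex^'d^'d) measure \<Rightarrow> nat \<Rightarrow> ereal" where
  "rate_seq A M n = ereal (1 / real n) * (INF \<rho>\<in>A n. relent n \<rho> (mixture M n))"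

text \<open>min* over mu in P(C) of lim_n rate_seq A mu n: the set of mu for which the limit
  exists is nonempty, the minimum over it is attained, and it equals v.\<close>
definition is_minstar :: "(nat \<Rightarrow> 'd op set) \<Rightarrow> (complex^'d^'d) set \<Rightarrow> ereal \<Rightarrow> bool" where
  "is_minstar A C v \<longleftrightarrow>
     (\<exists>M0\<in>prob_on C. (rate_seq A M0 \<longlonglongrightarrow> v) \<and>
        (\<forall>M\<in>prob_on C. \<forall>L. (rate_seq A M \<longlonglongrightarrow> L) \<longrightarrow> v \<le> L))"

definition convex_states :: "nat \<Rightarrow> 'd op set \<Rightarrow> bool" where
  "convex_states n F \<longleftrightarrow> (\<forall>\<rho>\<in>F. \<forall>\<sigma>\<in>F. \<forall>t::real. 0 \<le> t \<and> t \<le> 1 \<longrightarrow>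
      (\<lambda>xs ys. complex_of_real t * \<rho> xs ys + complex_of_real (1 - t) * \<sigma> xs ys) \<in> F)"

definition axiom_QI :: "(nat \<Rightarrow> 'd op set) \<Rightarrow> bool" where
  "axiom_QI F \<longleftrightarrow> (\<exists>\<tau>\<in>F 1. \<forall>m k. m \<ge> 1 \<and> k \<ge> 1 \<longrightarrow> (\<forall>\<rho>\<in>F (m * k).
      supp (m * k) \<rho> \<subseteq> supp (m * k) (tpow 1 (m * k) \<tau>) \<and>
      (\<forall>\<delta>::real. 0 \<le> \<delta> \<and> \<delta> \<le> 1 \<longrightarrow>
          map_tpow k m (depol k (tpow 1 k \<tau>) \<delta>) \<rho> \<in> F (m * k))))"

definition axiom_QII :: "(nat \<Rightarrow> 'd op set) \<Rightarrow> bool" where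
  "axiom_QII F \<longleftrightarrow> (\<forall>m k. m \<ge> 1 \<and> k \<ge> 1 \<longrightarrow> (\<forall>\<rho>\<in>F k. tpow k m \<rho> \<in> F (m * k)))"

definition axiom_QIII :: "(nat \<Rightarrow> 'd op set) \<Rightarrow> bool" where
  "axiom_QIII F \<longleftrightarrow> (\<forall>n \<ge> 1. \<forall>\<pi>. \<pi> permutes {..<n} \<longrightarrow> (\<forall>\<rho>\<in>F n. perm_op n \<pi> \<rho> \<in> F n))"

text \<open>Neighbourhood of the identity (within Hermitian operators on k sites), given by an
  entrywise ball (all norms are equivalent in finite dimension).\<close>
definition axiom_QIV :: "(nat \<Rightarrow> 'd op set) \<Rightarrow> bool" where
  "axiom_QIV F \<longleftrightarrow> (\<forall>k \<ge> 1. \<exists>e>0. \<forall>Fk. hermitian k Fk \<and>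
       (\<forall>xs\<in>basis k. \<forall>ys\<in>basis k. cmod (Fk xs ys - ident k xs ys) < e) \<longrightarrow>
       (\<forall>n \<ge> 1. \<forall>\<rho>\<in>F (n + k).
          ptrace_last n k (mmul (n + k) \<rho> (tensor n k (ident n) Fk)) \<in> cone n (F n)))"

end

(* A witness on k sites is a finite rank-one POVM (M_y) with weights l_y such that
   sum_y l_y Tr(rho M_y) >= v for all rho in A_k and sum_y exp(l_y) Tr(sigma^(x)k M_y) <= 1 for
   all sigma in C. All quantities in the theorem equal the supremum r of v/k over all witnesses.

   Stein >= r: measure disjoint blocks and threshold the sum of the l_y. The error of the second
   kind is bounded by Markov's inequality; that of the first kind by a Chernoff bound, because
   sum_y exp(-eta l_y) M_y is close to the identity for small eta, so that Axiom Q.IV lets one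
   strip off the blocks one at a time. For arbitrarily varying sigma and convex C, symmetrise the
   test over permutations: averaging without replacement costs only a polynomial factor.

   Stein <= limit for every mu: for a test E and w > 0,
   D(rho||sigma) >= ln w Tr(rho E) - (w - 1) Tr(sigma E), by an integral representation of the
   relative entropy and completing squares.

   Some mu attains r: if r n + 1 is not witnessed on n sites, a minimax argument gives rho in A_n
   and a finite mixture of sigma^(x)n for which every projective measurement has payoff at most
   r n + 1. Pinching turns this into a bound on D, up to the logarithm of the number of distinct
   eigenvalues of a permutation-invariant operator, which is polynomial in n. Mixing these finite
   mixtures over n with weights 1/((n+1)(n+2)) gives mu. *)
theory Submission
  imports Defs "HOL-Computational_Algebra.Fundamental_Theorem_Algebra" "HOL-Real_Asymp.Real_Asymp"
begin

section \<open>Spectral decomposition\<close>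

text \<open>What ties the exponent to the regularised entropy is the pay-off \<Sum> l_a P_a + 1 -
  \<Sum> exp(l_a) Q_a of scores l, where P and Q are the outcome distributions of \<rho> and
  \<sigma> in a measurement. Its supremum over l is the relative entropy of P and Q; unlike the form
  with - ln \<Sum> exp(l_a) Q_a it is affine in (\<rho>, \<sigma>), as a minimax exchange requires.
  The maximising side then randomises over orthonormal bases, and that is how a POVM arises. States
  of A_n need not factorise over blocks, so independence is replaced by Axiom Q.IV. It is available
  only near the identity and forces a small Chernoff parameter h, which is harmless because exp(- h
  l) differs from 1 - h l only to second order. The obstacle on the other side is that one measure
  must serve all n and that the limit must exist for it. Existence comes for free: the lower bound
  on the liminf holds for every measure, so an upper bound on the limsup suffices, and this
  tolerates any factor polynomial in n.\<close>

lemma homogeneous_system_nontrivial: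
  fixes a :: "'i \<Rightarrow> 'j \<Rightarrow> 'k::field"
  assumes "finite I" "finite J" "card I < card J"
  shows "\<exists>c. (\<exists>j\<in>J. c j \<noteq> 0) \<and> (\<forall>i\<in>I. (\<Sum>j\<in>J. c j * a i j) = 0)"
  using assms
proof (induction I arbitrary: J a rule: finite_induct)
  case empty
  then obtain j where "j \<in> J" by fastforce
  then show ?case by (intro exI[of _ "\<lambda>_. 1"]) auto
next
  case (insert i I)
  show ?case
  proof (cases "\<forall>j\<in>J. a i j = 0")
    case True
    have "card I < card J" using insert by simp
    from insert.IH[OF insert.prems(1) this, of a] True show ?thesis by auto
  next
    case False
    \<comment> \<open>Gaussian elimination with pivot \<open>a i j0\<close>. This lemma is the
      dimension count behind annihilating polynomials, completeness of orthonormal families, the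
      Caratheodory reduction and the bound on the number of eigenvalues.\<close>
    then obtain j0 where j0: "j0 \<in> J" "a i j0 \<noteq> 0" by blast
    define J' where "J' = J - {j0}"
    have fJ: "finite J'" and cJ: "card I < card J'" and J: "J = insert j0 J'" "j0 \<notin> J'"
      using insert j0 by (auto simp: J'_def)
    obtain c where c: "\<exists>j\<in>J'. c j \<noteq> 0"
        "\<forall>k\<in>I. (\<Sum>j\<in>J'. c j * (a k j - a k j0 * a i j / a i j0)) = 0"
      using insert.IH[OF fJ cJ, of "\<lambda>k j. a k j - a k j0 * a i j / a i j0"] by blast
    define s where "s = - (\<Sum>j\<in>J'. c j * a i j) / a i j0"
    define c' where "c' = c(j0 := s)"
    have split: "(\<Sum>j\<in>J. c' j * a k j) = s * a k j0 + (\<Sum>j\<in>J'. c j * a k j)" for k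
    proof -
      have "(\<Sum>j\<in>J'. c' j * a k j) = (\<Sum>j\<in>J'. c j * a k j)"
        using J(2) by (intro sum.cong) (auto simp: c'_def)
      then show ?thesis unfolding J(1) using fJ J(2) by (simp add: c'_def)
    qed
    have "(\<Sum>j\<in>J. c' j * a k j) = 0" if "k \<in> I" for k
    proof -
      have "(\<Sum>j\<in>J'. c j * (a k j - a k j0 * a i j / a i j0))
          = (\<Sum>j\<in>J'. c j * a k j) - a k j0 / a i j0 * (\<Sum>j\<in>J'. c j * a i j)"
        by (simp add: sum_subtractf sum_distrib_left algebra_simps)
      then have "(\<Sum>j\<in>J'. c j * a k j) = a k j0 / a i j0 * (\<Sum>j\<in>J'. c j * a i j)" using c(2) that by simp
      then show ?thesis unfolding split s_def by simp
    qed
    moreover have "(\<Sum>j\<in>J. c' j * a i j) = 0" unfolding split s_def using j0 by simp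
    moreover have "\<exists>j\<in>J. c' j \<noteq> 0" using c(1) J by (auto simp: c'_def)
    ultimately show ?thesis by (intro exI[of _ c']) auto
  qed
qed

section \<open>Polynomials in a linear map and eigenvectors\<close>

primrec horner :: "(('i \<Rightarrow> complex) \<Rightarrow> 'i \<Rightarrow> complex) \<Rightarrow> ('i \<Rightarrow> complex) \<Rightarrow> complex list \<Rightarrow> 'i \<Rightarrow> complex" where
  "horner T v [] = (\<lambda>_. 0)"
| "horner T v (c # cs) = (\<lambda>x. c * v x + T (horner T v cs) x)"

locale linear_action =
  fixes T :: "('i \<Rightarrow> complex) \<Rightarrow> 'i \<Rightarrow> complex"
  assumes lin: "T (\<lambda>x. a * u x + b * v x) = (\<lambda>x. a * T u x + b * T v x)"
begin

lemma T_zero: "T (\<lambda>_. 0) = (\<lambda>_. 0)"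
  using lin[of 0 "\<lambda>_. 0" 0 "\<lambda>_. 0"] by simp

text \<open>This is p(T) v, evaluated by Horner's scheme on the coefficient list.\<close>

definition act :: "complex poly \<Rightarrow> ('i \<Rightarrow> complex) \<Rightarrow> 'i \<Rightarrow> complex" where
  "act p v = horner T v (coeffs p)"

lemma act_0: "act 0 v = (\<lambda>_. 0)"
  by (simp add: act_def)

lemma act_pCons: "act (pCons c p) v = (\<lambda>x. c * v x + T (act p v) x)"
  by (auto simp: act_def cCons_def T_zero)

lemma act_add: "act (p + q) v = (\<lambda>x. act p v x + act q v x)"
proof (induction p q rule: poly_induct2)
  case (pCons a p b q)
  then show ?case
    using lin[of 1 "act p v" 1 "act q v"] by (simp add: act_pCons algebra_simps)
qed (simp add: act_0)

lemma act_smult: "act (smult c p) v = (\<lambda>x. c * act p v x)"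
proof (induction p)
  case (pCons a p)
  then show ?case
    using lin[of c "act p v" 0 "act p v"] by (simp add: act_pCons algebra_simps)
qed (simp add: act_0)

lemma act_monom: "act (monom c j) v = (\<lambda>x. c * (T ^^ j) v x)"
proof (induction j)
  case 0
  then show ?case by (simp add: monom_0 act_pCons act_0 T_zero)
next
  case (Suc j)
  then show ?case
    using lin[of c "(T ^^ j) v" 0 v] by (simp add: monom_Suc act_pCons)
qed

lemma act_sum: "finite J \<Longrightarrow> act (\<Sum>j\<in>J. p j) v = (\<lambda>x. \<Sum>j\<in>J. act (p j) v x)"
  by (induction J rule: finite_induct) (auto simp: act_0 act_add)

text \<open>A root z of p gives p = (X - z) q. Either \<open>act q v\<close> is nonzero and hence an
  eigenvector for z, or q annihilates v as well and has smaller degree.\<close>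

lemma eigenvector_of_annihilator:
  assumes sub: "\<And>u v a b. u \<in> S \<Longrightarrow> v \<in> S \<Longrightarrow> (\<lambda>x. a * u x + b * v x) \<in> S"
    and inv: "\<And>v. v \<in> S \<Longrightarrow> T v \<in> S"
    and v: "v \<in> S" "v \<noteq> (\<lambda>_. 0)" and p: "p \<noteq> 0" "act p v = (\<lambda>_. 0)"
  shows "\<exists>w\<in>S. w \<noteq> (\<lambda>_. 0) \<and> (\<exists>z. T w = (\<lambda>x. z * w x))"
  using p
proof (induction "degree p" arbitrary: p)
  case 0
  then obtain c where c: "p = [:c:]" by (metis degree_eq_zeroE)
  then have "c \<noteq> 0" using 0 by auto
  with 0 c v show ?case by (auto simp: act_pCons act_0 T_zero fun_eq_iff)
next
  case (Suc d)
  have "\<not> constant (poly p)" using Suc.hyps(2) by (simp add: constant_degree)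
  then obtain z where z: "poly p z = 0" using fundamental_theorem_of_algebra by blast
  define q where "q = synthetic_div p z"
  have pq: "p + smult z q = pCons 0 q" using synthetic_div_correct[of p z] z by (simp add: q_def)
  have dq: "degree q = d" using Suc.hyps(2) by (simp add: q_def degree_synthetic_div)
  have q0: "q \<noteq> 0" using pq Suc.prems(1) by auto
  have zero: "(\<lambda>_. 0) \<in> S" using sub[OF v(1) v(1), of 0 0] by simp
  have inS: "act r v \<in> S" for r
  proof (induction r)
    case (pCons a r)
    have "(\<lambda>x. a * v x + 1 * T (act r v) x) \<in> S" using sub inv v pCons by blast
    then show ?case by (simp add: act_pCons)
  qed (simp add: act_0 zero)
  have "act (p + smult z q) v = act (pCons 0 q) v" using pq by simp
  then have T: "T (act q v) = (\<lambda>x. z * act q v x)"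
    using Suc.prems(2) by (auto simp: act_add act_smult act_pCons fun_eq_iff)
  show ?case
  proof (cases "act q v = (\<lambda>_. 0)")
    case True
    then show ?thesis using Suc.hyps(1)[of q] dq q0 by simp
  next
    case False
    then show ?thesis using T inS by blast
  qed
qed

text \<open>The \<open>card I + 1\<close> vectors v, T v, T (T v), ... are supported on I, hence
  linearly dependent, and the dependence is an annihilating polynomial. The invariant subspace S is
  kept general because it will be an orthogonal complement and then an eigenspace inside it.\<close>

lemma eigenvector_exists:
  assumes sub: "\<And>u v a b. u \<in> S \<Longrightarrow> v \<in> S \<Longrightarrow> (\<lambda>x. a * u x + b * v x) \<in> S"
    and inv: "\<And>v. v \<in> S \<Longrightarrow> T v \<in> S"
    and v: "v \<in> S" "v \<noteq> (\<lambda>_. 0)"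
    and I: "finite I" "\<And>v x. v \<in> S \<Longrightarrow> x \<notin> I \<Longrightarrow> v x = 0"
  shows "\<exists>w\<in>S. w \<noteq> (\<lambda>_. 0) \<and> (\<exists>z. T w = (\<lambda>x. z * w x))"
proof -
  obtain c where c: "\<exists>j\<in>{..card I}. c j \<noteq> 0"
      "\<forall>x\<in>I. (\<Sum>j\<in>{..card I}. c j * (T ^^ j) v x) = 0"
    using homogeneous_system_nontrivial[of I "{..card I}" "\<lambda>x j. (T ^^ j) v x"] I(1) by auto
  define p where "p = (\<Sum>j\<le>card I. monom (c j) j)"
  have pow: "(T ^^ j) v \<in> S" for j by (induction j) (auto simp: v inv)
  have "act p v = (\<lambda>x. \<Sum>j\<le>card I. c j * (T ^^ j) v x)"
    by (simp add: p_def act_sum act_monom)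
  also have "\<dots> = (\<lambda>_. 0)"
  proof
    fix x show "(\<Sum>j\<le>card I. c j * (T ^^ j) v x) = 0"
      using c(2) I(2)[OF pow] by (cases "x \<in> I") auto
  qed
  finally have "act p v = (\<lambda>_. 0)" .
  moreover have "p \<noteq> 0"
  proof -
    obtain j where j: "j \<le> card I" "c j \<noteq> 0" using c(1) by auto
    have "coeff p j = c j" using j by (simp add: p_def coeff_sum coeff_monom)
    with j show ?thesis by auto
  qed
  ultimately show ?thesis using eigenvector_of_annihilator[of S v p] sub inv v by blast
qed

end

section \<open>Inner products, orthonormal bases and functional calculus\<close>

definition ip :: "'i set \<Rightarrow> ('i \<Rightarrow> complex) \<Rightarrow> ('i \<Rightarrow> complex) \<Rightarrow> complex" where
  "ip I u v = (\<Sum>x\<in>I. cnj (u x) * v x)"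

definition mv :: "'i set \<Rightarrow> ('i \<Rightarrow> 'i \<Rightarrow> complex) \<Rightarrow> ('i \<Rightarrow> complex) \<Rightarrow> 'i \<Rightarrow> complex" where
  "mv I A v = (\<lambda>x. if x \<in> I then \<Sum>y\<in>I. A x y * v y else 0)"

definition herm_on :: "'i set \<Rightarrow> ('i \<Rightarrow> 'i \<Rightarrow> complex) \<Rightarrow> bool" where
  "herm_on I A \<longleftrightarrow> (\<forall>x\<in>I. \<forall>y\<in>I. A y x = cnj (A x y))"

text \<open>Indexing the family by I itself builds in the dimension, so that orthonormality alone
  makes it a basis (\<open>onb_expand\<close>).\<close>

definition onb :: "'i set \<Rightarrow> ('i \<Rightarrow> 'i \<Rightarrow> complex) \<Rightarrow> bool" where
  "onb I e \<longleftrightarrow> (\<forall>i\<in>I. \<forall>j\<in>I. ip I (e i) (e j) = (if i = j then 1 else 0)) \<and>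
     (\<forall>i\<in>I. \<forall>x. x \<notin> I \<longrightarrow> e i x = 0)"

definition eigs :: "'i set \<Rightarrow> ('i \<Rightarrow> 'i \<Rightarrow> complex) \<Rightarrow> ('i \<Rightarrow> real) \<Rightarrow> ('i \<Rightarrow> 'i \<Rightarrow> complex) \<Rightarrow> bool" where
  "eigs I A l e \<longleftrightarrow> onb I e \<and> (\<forall>i\<in>I. mv I A (e i) = (\<lambda>x. complex_of_real (l i) * e i x))"

lemma ip_lin: "ip I u (\<lambda>x. a * v x + b * w x) = a * ip I u v + b * ip I u w"
  by (simp add: ip_def sum.distrib sum_distrib_left algebra_simps)

lemma ip_scale_right: "ip I u (\<lambda>x. a * v x) = a * ip I u v"
  using ip_lin[of I u a v 0 v] by simp

lemma ip_scale_left: "ip I (\<lambda>x. a * u x) v = cnj a * ip I u v"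
  by (simp add: ip_def sum_distrib_left algebra_simps)

lemma ip_cnj: "cnj (ip I u v) = ip I v u"
  by (simp add: ip_def mult.commute)

lemma ip_sum_right: "ip I u (\<lambda>x. \<Sum>j\<in>J. f j x) = (\<Sum>j\<in>J. ip I u (f j))"
  unfolding ip_def by (subst sum.swap) (simp add: sum_distrib_left)

lemma ip_self: "ip I u u = complex_of_real (\<Sum>x\<in>I. (cmod (u x))\<^sup>2)"
  by (simp add: ip_def complex_norm_square mult.commute del: of_real_power)

lemma ip_self_eq_0:
  assumes "finite I" "ip I u u = 0" "x \<in> I" shows "u x = 0"
proof -
  have "(\<Sum>x\<in>I. (cmod (u x))\<^sup>2) = 0" using assms(2) unfolding ip_self of_real_eq_0_iff .
  then show ?thesis using assms(1,3) by (simp add: sum_nonneg_eq_0_iff)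
qed

lemma mv_adjoint:
  assumes "herm_on I A" shows "ip I u (mv I A v) = ip I (mv I A u) v"
proof -
  have "ip I u (mv I A v) = (\<Sum>x\<in>I. \<Sum>y\<in>I. cnj (u x) * (A x y * v y))"
    by (simp add: ip_def mv_def sum_distrib_left)
  also have "\<dots> = (\<Sum>y\<in>I. \<Sum>x\<in>I. cnj (u x) * (A x y * v y))" by (rule sum.swap)
  also have "\<dots> = ip I (mv I A u) v"
    unfolding ip_def mv_def
  proof (intro sum.cong refl)
    fix y assume y: "y \<in> I"
    have "cnj (u x) * (A x y * v y) = cnj (A y x * u x) * v y" if "x \<in> I" for x
    proof -
      have "A x y = cnj (A y x)" using assms y that unfolding herm_on_def by blast
      then show ?thesis by simp
    qed
    then have "(\<Sum>x\<in>I. cnj (u x) * (A x y * v y)) = (\<Sum>x\<in>I. cnj (A y x * u x) * v y)"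
      by (intro sum.cong refl)
    then show "(\<Sum>x\<in>I. cnj (u x) * (A x y * v y)) = cnj (if y \<in> I then \<Sum>x\<in>I. A y x * u x else 0) * v y"
      using y by (simp add: sum_distrib_right)
  qed
  finally show ?thesis .
qed

lemma mv_lin: "mv I A (\<lambda>x. a * u x + b * v x) = (\<lambda>x. a * mv I A u x + b * mv I A v x)"
  by (auto simp: mv_def sum.distrib sum_distrib_left algebra_simps)

lemma linear_action_mv: "linear_action (mv I A)"
  by standard (rule mv_lin)

lemma mv_commute:
  assumes "\<And>x y. x \<in> I \<Longrightarrow> y \<in> I \<Longrightarrow> (\<Sum>z\<in>I. A x z * B z y) = (\<Sum>z\<in>I. B x z * A z y)"
  shows "mv I A (mv I B v) = mv I B (mv I A v)"
proof -
  have mm: "(\<Sum>y\<in>I. P x y * (\<Sum>z\<in>I. Q y z * v z)) = (\<Sum>z\<in>I. (\<Sum>y\<in>I. P x y * Q y z) * v z)" for P Q x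
    by (subst sum_distrib_right, subst sum.swap) (simp add: sum_distrib_left mult.assoc)
  show ?thesis by (rule ext) (simp add: mv_def mm assms cong: sum.cong)
qed

text \<open>Vectors are added one at a time. The orthogonal complement of those already found is
  invariant under both operators; an eigenspace of \<open>T1\<close> inside it is invariant under
  \<open>T2\<close>, because the two commute, and therefore contains a joint eigenvector.\<close>

lemma joint_eigenvectors:
  fixes T1 T2 :: "'i \<Rightarrow> 'i \<Rightarrow> complex"
  assumes I: "finite I" and h: "herm_on I T1" "herm_on I T2"
    and comm: "\<And>x y. x \<in> I \<Longrightarrow> y \<in> I \<Longrightarrow> (\<Sum>z\<in>I. T1 x z * T2 z y) = (\<Sum>z\<in>I. T2 x z * T1 z y)"
    and m: "m \<le> card I"
  shows "\<exists>(e :: nat \<Rightarrow> 'i \<Rightarrow> complex) l1 l2. (\<forall>i<m. \<forall>j<m. ip I (e i) (e j) = (if i = j then 1 else 0)) \<and>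
     (\<forall>i<m. \<forall>x. x \<notin> I \<longrightarrow> e i x = 0) \<and>
     (\<forall>i<m. mv I T1 (e i) = (\<lambda>x. complex_of_real (l1 i) * e i x)) \<and>
     (\<forall>i<m. mv I T2 (e i) = (\<lambda>x. complex_of_real (l2 i) * e i x))"
  using m
proof (induction m)
  case 0 then show ?case by simp
next
  case (Suc m)
  then obtain e l1 l2 where
    o: "\<forall>i<m. \<forall>j<m. ip I (e i) (e j) = (if i = j then 1 else 0)"
    and s: "\<forall>i<m. \<forall>x. x \<notin> I \<longrightarrow> e i x = 0"
    and e1: "\<forall>i<m. mv I T1 (e i) = (\<lambda>x. complex_of_real (l1 i) * e i x)"
    and e2: "\<forall>i<m. mv I T2 (e i) = (\<lambda>x. complex_of_real (l2 i) * e i x)" by auto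
  define S where "S = {v. (\<forall>x. x \<notin> I \<longrightarrow> v x = 0) \<and> (\<forall>i<m. ip I (e i) v = 0)}"
  have sub: "(\<lambda>x. a * u x + b * v x) \<in> S" if "u \<in> S" "v \<in> S" for u v a b
    using that by (auto simp: S_def ip_lin)
  have inv1: "mv I T1 v \<in> S" if "v \<in> S" for v
    using that e1 by (auto simp: S_def mv_adjoint[OF h(1)] ip_scale_left) (simp add: mv_def)
  have inv2: "mv I T2 v \<in> S" if "v \<in> S" for v
    using that e2 by (auto simp: S_def mv_adjoint[OF h(2)] ip_scale_left) (simp add: mv_def)
  have supp: "v x = 0" if "v \<in> S" "x \<notin> I" for v x using that by (simp add: S_def)
  \<comment> \<open>Orthogonality to m < \<open>card I\<close> vectors is a homogeneous system with
    fewer equations than unknowns, so the complement is nonzero.\<close>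
  obtain c where c: "\<exists>x\<in>I. c x \<noteq> 0" "\<forall>i\<in>{..<m}. (\<Sum>x\<in>I. c x * cnj (e i x)) = 0"
    using homogeneous_system_nontrivial[of "{..<m}" I "\<lambda>i x. cnj (e i x)"] I Suc.prems by auto
  define v where "v x = (if x \<in> I then c x else 0)" for x
  have v: "v \<in> S" "v \<noteq> (\<lambda>_. 0)"
    using c by (auto simp: S_def v_def ip_def fun_eq_iff mult.commute)
  obtain w z where w: "w \<in> S" "w \<noteq> (\<lambda>_. 0)" "mv I T1 w = (\<lambda>x. z * w x)"
    using linear_action.eigenvector_exists[OF linear_action_mv, of S I T1 v I] sub inv1 v I supp by blast
  define S' where "S' = {v \<in> S. mv I T1 v = (\<lambda>x. z * v x)}"
  have "mv I T2 v \<in> S'" if "v \<in> S'" for v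
  proof -
    have "mv I T1 (mv I T2 v) = mv I T2 (mv I T1 v)" by (rule mv_commute[OF comm])
    also have "\<dots> = mv I T2 (\<lambda>x. z * v x + 0 * v x)" using that by (simp add: S'_def)
    also have "\<dots> = (\<lambda>x. z * mv I T2 v x)" unfolding mv_lin by simp
    finally show ?thesis using that inv2 by (simp add: S'_def)
  qed
  moreover have "(\<lambda>x. a * u x + b * v x) \<in> S'" if "u \<in> S'" "v \<in> S'" for u v a b
    using that sub by (auto simp: S'_def mv_lin algebra_simps)
  moreover have "w \<in> S'" using w by (simp add: S'_def)
  moreover have "v x = 0" if "v \<in> S'" "x \<notin> I" for v x using that supp by (simp add: S'_def)
  ultimately obtain g y where g: "g \<in> S'" "g \<noteq> (\<lambda>_. 0)" "mv I T2 g = (\<lambda>x. y * g x)"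
    using linear_action.eigenvector_exists[OF linear_action_mv, of S' I T2 w I] w(2) I by blast
  have g1: "mv I T1 g = (\<lambda>x. z * g x)" and gS: "g \<in> S" using g by (auto simp: S'_def)
  have gg: "ip I g g \<noteq> 0"
  proof
    assume "ip I g g = 0"
    then have "g x = 0" for x using ip_self_eq_0[OF I] supp[OF gS] by (cases "x \<in> I") auto
    then show False using g(2) by auto
  qed
  \<comment> \<open>An eigenvalue of a Hermitian operator is real, by moving the operator across the
    inner product of g with itself.\<close>
  have realval: "\<mu> = complex_of_real (Re \<mu>)" if "herm_on I T" "mv I T g = (\<lambda>x. \<mu> * g x)" for T \<mu>
  proof -
    have "\<mu> * ip I g g = cnj \<mu> * ip I g g"
      using mv_adjoint[OF that(1), of g g] unfolding that(2) by (simp add: ip_scale_right ip_scale_left)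
    then have "\<mu> = cnj \<mu>" using gg by simp
    then show ?thesis by (metis complex_is_Real_iff Reals_cnj_iff of_real_Re)
  qed
  define r where "r = sqrt (\<Sum>x\<in>I. (cmod (g x))\<^sup>2)"
  have r: "r > 0" "ip I g g = complex_of_real (r * r)"
  proof -
    have s: "(\<Sum>x\<in>I. (cmod (g x))\<^sup>2) \<ge> 0" by (simp add: sum_nonneg)
    then have rr: "r * r = (\<Sum>x\<in>I. (cmod (g x))\<^sup>2)" by (simp add: r_def)
    show "ip I g g = complex_of_real (r * r)" unfolding rr by (rule ip_self)
    then have "r \<noteq> 0" using gg by auto
    then show "r > 0" using s by (simp add: r_def less_le)
  qed
  define f where "f = (\<lambda>x. complex_of_real (1 / r) * g x)"
  have ff: "ip I f f = 1"
  proof -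
    have "ip I f f = cnj (complex_of_real (1 / r)) * (complex_of_real (1 / r) * ip I g g)"
      unfolding f_def ip_scale_left ip_scale_right ..
    then show ?thesis using r by simp
  qed
  have ef: "ip I (e i) f = 0" if "i < m" for i
    using gS that unfolding f_def ip_scale_right by (simp add: S_def)
  have fe: "ip I f (e i) = 0" if "i < m" for i
    using ef[OF that] ip_cnj[of I "e i" f] by (metis complex_cnj_zero)
  have scale: "mv I T f = (\<lambda>x. \<mu> * f x)" if "mv I T g = (\<lambda>x. \<mu> * g x)" for T \<mu>
    using mv_lin[of I T "complex_of_real (1 / r)" g 0 g] that by (simp add: f_def fun_eq_iff)
  define e' where "e' = e(m := f)"
  define l1' where "l1' = l1(m := Re z)"
  define l2' where "l2' = l2(m := Re y)"
  have "\<forall>i<Suc m. \<forall>j<Suc m. ip I (e' i) (e' j) = (if i = j then 1 else 0)"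
    using o ff ef fe by (auto simp: e'_def less_Suc_eq)
  moreover have "\<forall>i<Suc m. \<forall>x. x \<notin> I \<longrightarrow> e' i x = 0"
    using s supp[OF gS] by (auto simp: e'_def less_Suc_eq f_def)
  moreover have "\<forall>i<Suc m. mv I T1 (e' i) = (\<lambda>x. complex_of_real (l1' i) * e' i x)"
    using e1 scale[OF g1] realval[OF h(1) g1] by (auto simp: e'_def l1'_def less_Suc_eq)
  moreover have "\<forall>i<Suc m. mv I T2 (e' i) = (\<lambda>x. complex_of_real (l2' i) * e' i x)"
    using e2 scale[OF g(3)] realval[OF h(2) g(3)] by (auto simp: e'_def l2'_def less_Suc_eq)
  ultimately show ?case by blast
qed

lemma joint_eigenbasis:
  fixes T1 T2 :: "'i \<Rightarrow> 'i \<Rightarrow> complex"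
  assumes I: "finite I" and h: "herm_on I T1" "herm_on I T2"
    and comm: "\<And>x y. x \<in> I \<Longrightarrow> y \<in> I \<Longrightarrow> (\<Sum>z\<in>I. T1 x z * T2 z y) = (\<Sum>z\<in>I. T2 x z * T1 z y)"
  shows "\<exists>e l1 l2. eigs I T1 l1 e \<and> eigs I T2 l2 e"
proof -
  obtain e :: "nat \<Rightarrow> 'i \<Rightarrow> complex" and l1 l2 where
    o: "\<forall>i<card I. \<forall>j<card I. ip I (e i) (e j) = (if i = j then 1 else 0)"
    and s: "\<forall>i<card I. \<forall>x. x \<notin> I \<longrightarrow> e i x = 0"
    and e1: "\<forall>i<card I. mv I T1 (e i) = (\<lambda>x. complex_of_real (l1 i) * e i x)"
    and e2: "\<forall>i<card I. mv I T2 (e i) = (\<lambda>x. complex_of_real (l2 i) * e i x)"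
    using joint_eigenvectors[OF I h comm order_refl] by auto
  obtain b where b: "bij_betw b I {..<card I}"
    using ex_bij_betw_finite_nat[OF I] by (auto simp: atLeast0LessThan)
  have bI: "b i < card I" if "i \<in> I" for i using b that by (auto simp: bij_betw_def)
  have inj: "b i = b j \<longleftrightarrow> i = j" if "i \<in> I" "j \<in> I" for i j
    using b that by (auto simp: bij_betw_def inj_on_def)
  show ?thesis
    using o s e1 e2 bI inj
    by (intro exI[of _ "\<lambda>i. e (b i)"] exI[of _ "\<lambda>i. l1 (b i)"] exI[of _ "\<lambda>i. l2 (b i)"])
      (auto simp: eigs_def onb_def)
qed

lemma eigenbasis_exists:
  assumes "finite I" "herm_on I T"
  shows "\<exists>e l. eigs I T l e"
  using joint_eigenbasis[OF assms(1,2,2)] by auto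

text \<open>The remainder w of v is orthogonal to all e_i. Together with them it makes
  \<open>card I + 1\<close> vectors on I, so there is a linear relation; pairing it with e_j removes
  the coefficient of e_j, and pairing what is left with w shows w = 0.\<close>

lemma onb_expand:
  assumes I: "finite I" and e: "onb I e" and x: "x \<in> I"
  shows "v x = (\<Sum>i\<in>I. ip I (e i) v * e i x)"
proof -
  define w where "w y = v y - (\<Sum>i\<in>I. ip I (e i) v * e i y)" for y
  have we: "ip I (e j) w = 0" if j: "j \<in> I" for j
  proof -
    have "ip I (e j) w = ip I (e j) (\<lambda>y. 1 * v y + (-1) * (\<Sum>i\<in>I. ip I (e i) v * e i y))"
      by (simp add: w_def[abs_def])
    also have "\<dots> = ip I (e j) v - (\<Sum>i\<in>I. ip I (e i) v * ip I (e j) (e i))"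
      unfolding ip_lin ip_sum_right ip_scale_right by simp
    also have "(\<Sum>i\<in>I. ip I (e i) v * ip I (e j) (e i)) = (\<Sum>i\<in>I. if i = j then ip I (e j) v else 0)"
      using e j by (intro sum.cong) (auto simp: onb_def)
    also have "\<dots> = ip I (e j) v" using I j by simp
    finally show ?thesis by simp
  qed
  \<comment> \<open>\<open>None\<close> indexes the remainder w, and \<open>Some i\<close> the basis
    vector e_i.\<close>
  obtain c where c: "\<exists>j\<in>insert None (Some ` I). c j \<noteq> 0"
      "\<forall>y\<in>I. (\<Sum>j\<in>insert None (Some ` I). c j * (case j of None \<Rightarrow> w y | Some i \<Rightarrow> e i y)) = 0"
    using homogeneous_system_nontrivial[of I "insert None (Some ` I)"
        "\<lambda>y j. case j of None \<Rightarrow> w y | Some i \<Rightarrow> e i y"] I by (auto simp: card_image)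
  have rel: "c None * w y + (\<Sum>i\<in>I. c (Some i) * e i y) = 0" if "y \<in> I" for y
    using c(2) that I by (auto simp: sum.reindex)
  have "ip I u (\<lambda>y. c None * w y + (\<Sum>i\<in>I. c (Some i) * e i y)) = 0" for u
    using rel by (simp add: ip_def)
  then have rel2: "c None * ip I u w + (\<Sum>i\<in>I. c (Some i) * ip I u (e i)) = 0" for u
    using ip_lin[of I u "c None" w 1 "\<lambda>y. \<Sum>i\<in>I. c (Some i) * e i y"]
    by (simp add: ip_sum_right ip_scale_right)
  have "c (Some j) = 0" if "j \<in> I" for j
  proof -
    have "(\<Sum>i\<in>I. c (Some i) * ip I (e j) (e i)) = (\<Sum>i\<in>I. if i = j then c (Some j) else 0)"
      using e that by (intro sum.cong) (auto simp: onb_def)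
    then show ?thesis using rel2[of "e j"] we[OF that] I that by simp
  qed
  then have "c None \<noteq> 0" "c None * ip I w w = 0" using c(1) rel2[of w] by auto
  then have "w x = 0" using ip_self_eq_0[OF I _ x] by simp
  then show ?thesis by (simp add: w_def)
qed

lemma onb_complete:
  assumes I: "finite I" and e: "onb I e" and "x \<in> I" "y \<in> I"
  shows "(\<Sum>i\<in>I. e i x * cnj (e i y)) = (if x = y then 1 else 0)"
proof -
  have "ip I (e i) (\<lambda>z. if z = y then 1 else 0) = cnj (e i y)" for i
    using I assms(4) by (simp add: ip_def if_distrib cong: if_cong)
  then show ?thesis
    using onb_expand[OF I e assms(3), of "\<lambda>z. if z = y then 1 else 0"] by (simp add: mult.commute)
qed

lemma onb_parseval:
  assumes I: "finite I" and e: "onb I e"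
  shows "ip I u v = (\<Sum>i\<in>I. cnj (ip I (e i) u) * ip I (e i) v)"
proof -
  have "ip I u v = ip I u (\<lambda>x. \<Sum>i\<in>I. ip I (e i) v * e i x)"
    unfolding ip_def[of _ u] by (intro sum.cong refl arg_cong2[of _ _ _ _ "(*)"] onb_expand[OF I e])
  also have "\<dots> = (\<Sum>i\<in>I. ip I (e i) v * ip I u (e i))" by (simp add: ip_sum_right ip_scale_right)
  finally show ?thesis by (simp add: ip_cnj mult.commute)
qed

lemma onb_trace:
  assumes I: "finite I" and e: "onb I e"
  shows "(\<Sum>i\<in>I. ip I (e i) (mv I A (e i))) = (\<Sum>x\<in>I. A x x)"
proof -
  have "(\<Sum>i\<in>I. ip I (e i) (mv I A (e i))) = (\<Sum>i\<in>I. \<Sum>x\<in>I. \<Sum>y\<in>I. A x y * (e i y * cnj (e i x)))"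
    by (simp add: ip_def mv_def sum_distrib_left algebra_simps)
  also have "\<dots> = (\<Sum>x\<in>I. \<Sum>y\<in>I. A x y * (\<Sum>i\<in>I. e i y * cnj (e i x)))"
    by (subst sum.swap, rule sum.cong[OF refl], subst sum.swap, simp add: sum_distrib_left)
  also have "\<dots> = (\<Sum>x\<in>I. \<Sum>y\<in>I. if y = x then A x x else 0)"
    by (intro sum.cong refl) (auto simp: onb_complete[OF I e])
  finally show ?thesis using I by simp
qed

lemma eigs_decomp:
  assumes I: "finite I" and e: "eigs I A l e" and "x \<in> I" "y \<in> I"
  shows "A x y = (\<Sum>i\<in>I. complex_of_real (l i) * e i x * cnj (e i y))"
proof -
  have o: "onb I e" using e by (simp add: eigs_def)
  have "(\<Sum>i\<in>I. complex_of_real (l i) * e i x * cnj (e i y)) = (\<Sum>i\<in>I. mv I A (e i) x * cnj (e i y))"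
    using e by (auto simp: eigs_def)
  also have "\<dots> = (\<Sum>i\<in>I. \<Sum>z\<in>I. A x z * (e i z * cnj (e i y)))"
    using assms(3) by (simp add: mv_def sum_distrib_right mult.assoc)
  also have "\<dots> = (\<Sum>z\<in>I. A x z * (\<Sum>i\<in>I. e i z * cnj (e i y)))"
    by (subst sum.swap) (simp add: sum_distrib_left)
  also have "\<dots> = (\<Sum>z\<in>I. if z = y then A x y else 0)"
    using assms by (intro sum.cong refl) (auto simp: onb_complete[OF I o])
  finally show ?thesis using I assms(4) by simp
qed

lemma eigs_overlap:
  assumes A: "herm_on I A" and e: "eigs I A l e" and f: "eigs I A q f" and "i \<in> I" "j \<in> I"
    and ne: "ip I (e i) (f j) \<noteq> 0"
  shows "l i = q j"
proof -
  have "ip I (e i) (mv I A (f j)) = ip I (mv I A (e i)) (f j)" by (rule mv_adjoint[OF A])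
  then have "complex_of_real (q j) * ip I (e i) (f j) = complex_of_real (l i) * ip I (e i) (f j)"
    using e f assms(4,5) by (simp add: eigs_def ip_scale_left ip_scale_right)
  then show ?thesis using ne by simp
qed

text \<open>Expanding the first basis in the second, only vectors with equal eigenvalues overlap.
  This lets a function of A be computed in a basis adapted to another operator, and shows that
  spectral projections inherit the symmetries of A.\<close>

lemma eigs_fun_unique:
  fixes h :: "real \<Rightarrow> complex"
  assumes I: "finite I" and A: "herm_on I A" and e: "eigs I A l e" and f: "eigs I A q f"
    and xy: "x \<in> I" "y \<in> I"
  shows "(\<Sum>i\<in>I. h (l i) * e i x * cnj (e i y)) = (\<Sum>j\<in>I. h (q j) * f j x * cnj (f j y))"
proof -
  have oe: "onb I e" and of: "onb I f" using e f by (auto simp: eigs_def)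
  have "(\<Sum>i\<in>I. h (l i) * e i x * cnj (e i y))
      = (\<Sum>i\<in>I. h (l i) * (\<Sum>j\<in>I. ip I (f j) (e i) * f j x) * cnj (e i y))"
    by (intro sum.cong refl arg_cong2[of _ _ _ _ "(*)"] onb_expand[OF I of xy(1)])
  also have "\<dots> = (\<Sum>i\<in>I. \<Sum>j\<in>I. h (q j) * f j x * (ip I (f j) (e i) * cnj (e i y)))"
  proof (intro sum.cong refl)
    fix i assume i: "i \<in> I"
    have "h (l i) * (ip I (f j) (e i) * f j x) * cnj (e i y) = h (q j) * f j x * (ip I (f j) (e i) * cnj (e i y))"
      if "j \<in> I" for j
      using eigs_overlap[OF A f e that i] by (cases "ip I (f j) (e i) = 0") auto
    then show "h (l i) * (\<Sum>j\<in>I. ip I (f j) (e i) * f j x) * cnj (e i y) =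
      (\<Sum>j\<in>I. h (q j) * f j x * (ip I (f j) (e i) * cnj (e i y)))"
      unfolding sum_distrib_left sum_distrib_right by (intro sum.cong refl)
  qed
  also have "\<dots> = (\<Sum>j\<in>I. h (q j) * f j x * (\<Sum>i\<in>I. ip I (f j) (e i) * cnj (e i y)))"
    by (subst sum.swap) (simp add: sum_distrib_left)
  also have "\<dots> = (\<Sum>j\<in>I. h (q j) * f j x * cnj (f j y))"
  proof (intro sum.cong refl arg_cong2[of _ _ _ _ "(*)"])
    fix j
    have "cnj (f j y) = cnj (\<Sum>i\<in>I. ip I (e i) (f j) * e i y)"
      by (rule arg_cong[OF onb_expand[OF I oe xy(2)]])
    then show "(\<Sum>i\<in>I. ip I (f j) (e i) * cnj (e i y)) = cnj (f j y)" by (simp add: ip_cnj)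
  qed
  finally show ?thesis .
qed

section \<open>Relative entropy and tests\<close>

definition psd_on :: "'i set \<Rightarrow> ('i \<Rightarrow> 'i \<Rightarrow> complex) \<Rightarrow> bool" where
  "psd_on I A \<longleftrightarrow> herm_on I A \<and> (\<forall>v. 0 \<le> Re (ip I v (mv I A v)))"

definition lnz :: "real \<Rightarrow> real" where
  "lnz x = (if x > 0 then ln x else 0)"

lemma eigs_ip:
  assumes I: "finite I" and e: "eigs I A l e" and i: "i \<in> I"
  shows "ip I (e i) (mv I A (e i)) = complex_of_real (l i)"
  using e i by (simp add: eigs_def onb_def ip_scale_right)

lemma eigs_quadratic:
  assumes I: "finite I" and A: "herm_on I A" and e: "eigs I A l e"
  shows "ip I v (mv I A v) = complex_of_real (\<Sum>i\<in>I. l i * (cmod (ip I (e i) v))\<^sup>2)"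
proof -
  have o: "onb I e" using e by (simp add: eigs_def)
  have "ip I v (mv I A v) = (\<Sum>i\<in>I. cnj (ip I (e i) v) * ip I (e i) (mv I A v))"
    by (rule onb_parseval[OF I o])
  also have "\<dots> = (\<Sum>i\<in>I. cnj (ip I (e i) v) * (complex_of_real (l i) * ip I (e i) v))"
    using e by (intro sum.cong refl) (simp add: mv_adjoint[OF A] eigs_def ip_scale_left)
  also have "\<dots> = (\<Sum>i\<in>I. complex_of_real (l i * (cmod (ip I (e i) v))\<^sup>2))"
    by (intro sum.cong refl) (simp add: complex_norm_square algebra_simps del: of_real_power)
  finally show ?thesis by simp
qed

lemma psd_eigenvalue_nonneg:
  assumes "finite I" "psd_on I A" "eigs I A l e" "i \<in> I"
  shows "l i \<ge> 0"
  using eigs_ip[OF assms(1,3,4)] assms(2) unfolding psd_on_def by (metis Re_complex_of_real)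

lemma eigs_trace_fun:
  fixes h :: "real \<Rightarrow> complex"
  shows "(\<Sum>i\<in>I. h (l i) * ip I (e i) (mv I R (e i)))
      = (\<Sum>x\<in>I. \<Sum>y\<in>I. R x y * (\<Sum>i\<in>I. h (l i) * e i y * cnj (e i x)))"
proof -
  have "(\<Sum>i\<in>I. h (l i) * ip I (e i) (mv I R (e i)))
      = (\<Sum>i\<in>I. \<Sum>x\<in>I. \<Sum>y\<in>I. R x y * (h (l i) * e i y * cnj (e i x)))"
    by (simp add: ip_def mv_def sum_distrib_left algebra_simps)
  also have "\<dots> = (\<Sum>x\<in>I. \<Sum>y\<in>I. R x y * (\<Sum>i\<in>I. h (l i) * e i y * cnj (e i x)))"
    by (subst sum.swap, rule sum.cong[OF refl], subst sum.swap, simp add: sum_distrib_left)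
  finally show ?thesis .
qed

lemma onb_norm_sum:
  assumes I: "finite I" and e: "onb I e"
  shows "(\<Sum>i\<in>I. (cmod (ip I (e i) v))\<^sup>2) = Re (ip I v v)"
proof -
  have "ip I v v = (\<Sum>i\<in>I. cnj (ip I (e i) v) * ip I (e i) v)" by (rule onb_parseval[OF I e])
  also have "\<dots> = (\<Sum>i\<in>I. complex_of_real ((cmod (ip I (e i) v))\<^sup>2))"
    by (intro sum.cong refl) (simp add: complex_norm_square algebra_simps del: of_real_power)
  finally show ?thesis by simp
qed

text \<open>Taylor's formula with integral remainder for f(x) = x ln x between q and p: the
  right-hand side is f(p) - f(q) - f'(q) (p - q), and f''(x) = 1 / x.\<close>

lemma has_integral_kl_term:
  fixes p q :: real
  assumes "p \<ge> 0" "q \<ge> 0" "q > 0 \<or> p = 0"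
  shows "((\<lambda>s. (1 - s) * (p - q)\<^sup>2 / ((1 - s) * q + s * p)) has_integral
           (p * (lnz p - lnz q) - p + q)) {0..1}"
proof (cases "p = 0")
  case True
  \<comment> \<open>For p = 0 the integrand is constantly q except at s = 1, where the quotient is 0
    / 0 = 0.\<close>
  have "((\<lambda>_. q) has_integral q) {0..1::real}"
    using has_integral_const_real[of q 0 1] by simp
  then have "((\<lambda>s. (1 - s) * (p - q)\<^sup>2 / ((1 - s) * q + s * p)) has_integral q) {0..1}"
    by (rule has_integral_spike_finite[rotated -1, of _ _ _ "{1}"])
      (auto simp: True power2_eq_square)
  then show ?thesis using True by simp
next
  case False
  then have p: "p > 0" and q: "q > 0" using assms by auto
  define u where "u s = (1 - s) * q + s * p" for s
  have u: "u s > 0" if "s \<in> {0..1}" for s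
  proof (cases "s = 0")
    case False
    then have "s * p > 0" "(1 - s) * q \<ge> 0" using that p q by auto
    then show ?thesis by (simp add: u_def)
  qed (simp add: u_def q)
  define F where "F s = u s * (ln (u s) - ln q) - u s + q + (1 - s) * (p - q) * (ln (u s) - ln q)" for s
  have D: "(F has_real_derivative ((1 - s) * (p - q)\<^sup>2 / u s)) (at s within {0..1})" if "s \<in> {0..1}" for s
  proof -
    have du: "(u has_real_derivative (p - q)) (at s within {0..1})"
      unfolding u_def by (auto intro!: derivative_eq_intros)
    show ?thesis
      unfolding F_def
      by (rule derivative_eq_intros du refl | use u[OF that] in force)+
         (use u[OF that] in \<open>simp add: field_simps power2_eq_square\<close>)
  qed
  have "((\<lambda>s. (1 - s) * (p - q)\<^sup>2 / u s) has_integral (F 1 - F 0)) {0..1}"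
    by (rule fundamental_theorem_of_calculus)
      (use D in \<open>auto simp: has_real_derivative_iff_has_vector_derivative\<close>)
  moreover have "F 1 - F 0 = p * (lnz p - lnz q) - p + q"
    using p q by (simp add: F_def u_def lnz_def)
  ultimately show ?thesis by (simp add: u_def)
qed

text \<open>The factor y = (w - 1) / (1 - s + s w) maximises 2 y (p - q) - y^2 ((1 - s) q + s p) at
  p = w, q = 1, that is, for a likelihood ratio w. For other P and Q it is merely an admissible
  choice, but one whose integral is elementary.\<close>

lemma has_integral_test_bound:
  fixes w P Q :: real
  assumes w: "w > 0"
  shows "((\<lambda>s. (1 - s) * (2 * ((w - 1) / (1 - s + s * w)) * (P - Q)
              - ((w - 1) / (1 - s + s * w))\<^sup>2 * ((1 - s) * Q + s * P))) has_integral
           (ln w * P - (w - 1) * Q)) {0..1}"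
proof -
  define v where "v s = 1 - s + s * w" for s
  have v: "v s > 0" if "s \<in> {0..1}" for s
  proof (cases "s = 0")
    case False
    then have "s * w > 0" "1 - s \<ge> 0" using that w by auto
    then show ?thesis by (simp add: v_def)
  qed (simp add: v_def)
  define F where "F s = P * (ln (v s) + s * (1 - s) * (w - 1) / v s) + Q * ((1 - s)\<^sup>2 * (w - 1) / v s)" for s
  have D: "(F has_real_derivative ((1 - s) * (2 * ((w - 1) / v s) * (P - Q)
              - ((w - 1) / v s)\<^sup>2 * ((1 - s) * Q + s * P)))) (at s within {0..1})" if "s \<in> {0..1}" for s
  proof -
    have dv: "(v has_real_derivative (w - 1)) (at s within {0..1})"
      unfolding v_def by (auto intro!: derivative_eq_intros)
    show ?thesis
      unfolding F_def
      by (rule derivative_eq_intros dv refl | use v[OF that] in force)+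
         (use v[OF that] in \<open>simp add: field_simps power2_eq_square\<close>)
  qed
  have "((\<lambda>s. (1 - s) * (2 * ((w - 1) / v s) * (P - Q)
              - ((w - 1) / v s)\<^sup>2 * ((1 - s) * Q + s * P))) has_integral (F 1 - F 0)) {0..1}"
    by (rule fundamental_theorem_of_calculus)
      (use D in \<open>auto simp: has_real_derivative_iff_has_vector_derivative\<close>)
  moreover have "F 1 - F 0 = ln w * P - (w - 1) * Q"
    by (simp add: F_def v_def algebra_simps)
  ultimately show ?thesis by (simp add: v_def)
qed

text \<open>This is E^2 \<le> E: positivity of E at v - E v and E \<le> 1 at E v combine to
  it.\<close>

lemma test_square_le:
  assumes I: "finite I" and E: "herm_on I E"
    and E0: "\<And>v. 0 \<le> Re (ip I v (mv I E v))" and E1: "\<And>v. Re (ip I v (mv I E v)) \<le> Re (ip I v v)"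
  shows "Re (ip I (mv I E v) (mv I E v)) \<le> Re (ip I v (mv I E v))"
proof -
  let ?u = "mv I E v"
  define a where "a = Re (ip I v ?u)"
  define b where "b = Re (ip I ?u ?u)"
  define c where "c = Re (ip I ?u (mv I E ?u))"
  define w where "w = (\<lambda>x. 1 * v x + (-1) * ?u x)"
  have ipw: "ip I w z = ip I v z - ip I ?u z" for z
    unfolding w_def ip_def by (simp add: algebra_simps sum_subtractf)
  have mw: "mv I E w = (\<lambda>x. 1 * ?u x + (-1) * mv I E ?u x)" unfolding w_def mv_lin ..
  have "ip I w (mv I E w) = ip I v ?u - ip I ?u ?u - (ip I v (mv I E ?u) - ip I ?u (mv I E ?u))"
    unfolding mw ip_lin ipw by (simp add: algebra_simps)
  moreover have "ip I v (mv I E ?u) = ip I ?u ?u" by (rule mv_adjoint[OF E])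
  ultimately have "Re (ip I w (mv I E w)) = a - 2 * b + c" by (simp add: a_def b_def c_def)
  then have "a - 2 * b + c \<ge> 0" using E0[of w] by simp
  moreover have "c \<le> b" using E1[of ?u] by (simp add: b_def c_def)
  ultimately show ?thesis by (simp add: a_def b_def)
qed

text \<open>Completing the square in \<open>y * z\<close>; at \<open>d = 0\<close> the right-hand side is the junk value \<open>0\<close>.\<close>
lemma square_completion:
  fixes z r :: complex and x y d :: real
  assumes "d \<ge> 0" "d = 0 \<Longrightarrow> x = 0 \<or> r = 0"
  shows "2 * y * (x * Re (cnj r * z)) - y\<^sup>2 * (d * (cmod z)\<^sup>2) \<le> (cmod r)\<^sup>2 * (x\<^sup>2 / d)"
proof (cases "d = 0")
  case True
  then show ?thesis using assms(2) by auto
next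
  case False
  then have d: "d > 0" using assms by simp
  have "2 * y * (x * Re (cnj r * z)) \<le> \<bar>2 * y * (x * Re (cnj r * z))\<bar>" by simp
  also have "\<dots> \<le> 2 * \<bar>y\<bar> * (\<bar>x\<bar> * (cmod r * cmod z))"
    using abs_Re_le_cmod[of "cnj r * z"] by (simp add: abs_mult norm_mult mult_left_mono)
  finally have 1: "2 * y * (x * Re (cnj r * z)) \<le> 2 * \<bar>y\<bar> * (\<bar>x\<bar> * (cmod r * cmod z))" .
  have "0 \<le> (d * (\<bar>y\<bar> * cmod z) - \<bar>x\<bar> * cmod r)\<^sup>2" by simp
  also have "\<dots> = d * (d * y\<^sup>2 * (cmod z)\<^sup>2) - d * (2 * \<bar>y\<bar> * (\<bar>x\<bar> * (cmod r * cmod z))) + x\<^sup>2 * (cmod r)\<^sup>2"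
    by (simp add: power2_diff power_mult_distrib) (simp add: power2_eq_square)
  finally have "d * (2 * \<bar>y\<bar> * (\<bar>x\<bar> * (cmod r * cmod z)) - y\<^sup>2 * (d * (cmod z)\<^sup>2)) \<le> x\<^sup>2 * (cmod r)\<^sup>2"
    by (simp add: algebra_simps)
  then have "2 * \<bar>y\<bar> * (\<bar>x\<bar> * (cmod r * cmod z)) - y\<^sup>2 * (d * (cmod z)\<^sup>2) \<le> (cmod r)\<^sup>2 * (x\<^sup>2 / d)"
    using d by (simp add: pos_le_divide_eq mult.commute)
  then show ?thesis using 1 by linarith
qed

text \<open>The relative entropy of two states is a sum of scalar terms in p_i and q_j, weighted by
  the overlaps \<open>c i j\<close> of the eigenvectors. Each term is an integral over s of a
  quotient with numerator (p_i - q_j)^2; for fixed s, completing the square against the matrix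
  element Z_ij of E between e_i and f_j makes the expectations of E appear linearly and those of E^2
  quadratically. The latter are absorbed by E^2 \<le> E.\<close>

lemma entropy_difference_ge_test:
  assumes I: "finite I" and \<rho>: "psd_on I \<rho>" "eigs I \<rho> p e" and \<sigma>: "psd_on I \<sigma>" "eigs I \<sigma> q f"
    and tr: "(\<Sum>i\<in>I. p i) = (\<Sum>j\<in>I. q j)"
    and supp: "\<And>j. j \<in> I \<Longrightarrow> q j = 0 \<Longrightarrow> ip I (f j) (mv I \<rho> (f j)) = 0"
    and E: "herm_on I E" "\<And>v. 0 \<le> Re (ip I v (mv I E v))" "\<And>v. Re (ip I v (mv I E v)) \<le> Re (ip I v v)"
    and w: "w > 0"
  shows "ln w * (\<Sum>i\<in>I. p i * Re (ip I (e i) (mv I E (e i)))) - (w - 1) * (\<Sum>j\<in>I. q j * Re (ip I (f j) (mv I E (f j))))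
    \<le> (\<Sum>i\<in>I. p i * lnz (p i)) - (\<Sum>j\<in>I. lnz (q j) * Re (ip I (f j) (mv I \<rho> (f j))))"
proof -
  have oe: "onb I e" and of: "onb I f" using \<rho> \<sigma> by (auto simp: eigs_def)
  have h\<rho>: "herm_on I \<rho>" using \<rho> by (simp add: psd_on_def)
  have p0: "p i \<ge> 0" if "i \<in> I" for i using psd_eigenvalue_nonneg[OF I \<rho> that] .
  have q0: "q i \<ge> 0" if "i \<in> I" for i using psd_eigenvalue_nonneg[OF I \<sigma> that] .
  define o1 where "o1 i j = ip I (e i) (f j)" for i j
  define Z where "Z i j = ip I (e i) (mv I E (f j))" for i j
  define c where "c i j = (cmod (o1 i j))\<^sup>2" for i j
  define P where "P = (\<Sum>i\<in>I. p i * Re (ip I (e i) (mv I E (e i))))"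
  define Q where "Q = (\<Sum>j\<in>I. q j * Re (ip I (f j) (mv I E (f j))))"
  have o1': "o1 i j = cnj (ip I (f j) (e i))" for i j by (simp add: o1_def ip_cnj)
  have Z': "Z i j = cnj (ip I (f j) (mv I E (e i)))" for i j by (simp add: Z_def ip_cnj mv_adjoint[OF E(1)])
  have c_i: "(\<Sum>i\<in>I. c i j) = 1" if "j \<in> I" for j
    using onb_norm_sum[OF I oe, of "f j"] of that by (simp add: c_def o1_def onb_def)
  have c_j: "(\<Sum>j\<in>I. c i j) = 1" if "i \<in> I" for i
    using onb_norm_sum[OF I of, of "e i"] oe that by (simp add: c_def o1' onb_def)
  have r: "Re (ip I (f j) (mv I \<rho> (f j))) = (\<Sum>i\<in>I. p i * c i j)" for j
    by (subst eigs_quadratic[OF I h\<rho> \<rho>(2)]) (simp add: c_def o1_def)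
  \<comment> \<open>The support condition in coordinates: whenever q_j = 0, every e_i overlapping
    f_j has p_i = 0, so no term of the double sum is infinite.\<close>
  have pc0: "p i = 0" if "i \<in> I" "j \<in> I" "q j = 0" "c i j \<noteq> 0" for i j
  proof -
    have "(\<Sum>i\<in>I. p i * c i j) = 0" using supp[OF that(2,3)] r[of j] by simp
    then have "p i * c i j = 0"
      using that(1) I p0 by (subst (asm) sum_nonneg_eq_0_iff) (auto simp: c_def)
    then show ?thesis using that by simp
  qed
  have Zo_j: "(\<Sum>j\<in>I. Re (cnj (o1 i j) * Z i j)) = Re (ip I (e i) (mv I E (e i)))" for i
  proof -
    have "ip I (e i) (mv I E (e i)) = (\<Sum>j\<in>I. cnj (cnj (o1 i j) * Z i j))"
      by (subst onb_parseval[OF I of]) (simp add: o1' Z')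
    then show ?thesis by simp
  qed
  have Zo_i: "(\<Sum>i\<in>I. Re (cnj (o1 i j) * Z i j)) = Re (ip I (f j) (mv I E (f j)))" for j
    by (subst onb_parseval[OF I oe]) (simp add: o1_def Z_def)
  \<comment> \<open>Summing the squared moduli of Z_ij over one index gives the expectation of E^2,
    and this is where E^2 \<le> E enters.\<close>
  have Z2_j: "(\<Sum>j\<in>I. (cmod (Z i j))\<^sup>2) \<le> Re (ip I (e i) (mv I E (e i)))" for i
    using onb_norm_sum[OF I of, of "mv I E (e i)"] test_square_le[OF I E, of "e i"] by (simp add: Z')
  have Z2_i: "(\<Sum>i\<in>I. (cmod (Z i j))\<^sup>2) \<le> Re (ip I (f j) (mv I E (f j)))" for j
    using onb_norm_sum[OF I oe, of "mv I E (f j)"] test_square_le[OF I E, of "f j"] by (simp add: Z_def)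
  define K where "K i j s = c i j * ((1 - s) * (p i - q j)\<^sup>2 / ((1 - s) * q j + s * p i))" for i j s
  define D where "D = (\<Sum>i\<in>I. p i * lnz (p i)) - (\<Sum>j\<in>I. lnz (q j) * Re (ip I (f j) (mv I \<rho> (f j))))"
  have Kint: "(K i j has_integral (c i j * (p i * (lnz (p i) - lnz (q j)) - p i + q j))) {0..1}"
    if "i \<in> I" "j \<in> I" for i j
  proof (cases "c i j = 0")
    case True
    then show ?thesis unfolding K_def by simp
  next
    case False
    have "q j > 0 \<or> p i = 0" using pc0[OF that _ False] q0[OF that(2)] by fastforce
    from has_integral_kl_term[OF p0[OF that(1)] q0[OF that(2)] this] show ?thesis
      unfolding K_def by (rule has_integral_mult_right)
  qed
  \<comment> \<open>The parts - p_i + q_j of the scalar terms cancel in total, since both spectra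
    have the same sum.\<close>
  have "(\<Sum>i\<in>I. \<Sum>j\<in>I. c i j * (p i * (lnz (p i) - lnz (q j)) - p i + q j)) =
     (\<Sum>i\<in>I. \<Sum>j\<in>I. p i * lnz (p i) * c i j) - (\<Sum>i\<in>I. \<Sum>j\<in>I. lnz (q j) * (p i * c i j))
     - (\<Sum>i\<in>I. \<Sum>j\<in>I. p i * c i j) + (\<Sum>i\<in>I. \<Sum>j\<in>I. q j * c i j)"
    by (simp add: sum.distrib sum_subtractf algebra_simps)
  also have "(\<Sum>i\<in>I. \<Sum>j\<in>I. p i * lnz (p i) * c i j) = (\<Sum>i\<in>I. p i * lnz (p i))"
    by (simp add: sum_distrib_left[symmetric] c_j)
  also have "(\<Sum>i\<in>I. \<Sum>j\<in>I. p i * c i j) = (\<Sum>i\<in>I. p i)"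
    by (simp add: sum_distrib_left[symmetric] c_j)
  also have "(\<Sum>i\<in>I. \<Sum>j\<in>I. q j * c i j) = (\<Sum>j\<in>I. q j)"
    by (subst sum.swap) (simp add: sum_distrib_left[symmetric] c_i)
  also have "(\<Sum>i\<in>I. \<Sum>j\<in>I. lnz (q j) * (p i * c i j)) = (\<Sum>j\<in>I. lnz (q j) * Re (ip I (f j) (mv I \<rho> (f j))))"
    by (subst sum.swap) (simp add: r sum_distrib_left)
  finally have Dsum: "(\<Sum>i\<in>I. \<Sum>j\<in>I. c i j * (p i * (lnz (p i) - lnz (q j)) - p i + q j)) = D"
    using tr by (simp add: D_def)
  have int: "((\<lambda>s. \<Sum>i\<in>I. \<Sum>j\<in>I. K i j s) has_integral D) {0..1}"
    unfolding Dsum[symmetric] by (intro has_integral_sum I Kint)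
  \<comment> \<open>Both sides are integrals over s and are compared pointwise. The endpoint s = 1
    is treated apart: there the factor 1 - s kills both integrands, while the denominators may
    vanish.\<close>
  have "ln w * P - (w - 1) * Q \<le> D"
  proof (rule has_integral_le[OF has_integral_test_bound[OF w, of P Q] int])
    fix s :: real assume s: "s \<in> {0..1}"
    define y where "y = (w - 1) / (1 - s + s * w)"
    show "(1 - s) * (2 * ((w - 1) / (1 - s + s * w)) * (P - Q)
         - ((w - 1) / (1 - s + s * w))\<^sup>2 * ((1 - s) * Q + s * P)) \<le> (\<Sum>i\<in>I. \<Sum>j\<in>I. K i j s)"
    proof (cases "s = 1")
      case True then show ?thesis by (simp add: K_def)
    next
      case False
      then have s1: "1 - s > 0" using s by auto
      have elem: "2 * y * ((p i - q j) * Re (cnj (o1 i j) * Z i j)) - y\<^sup>2 * (((1 - s) * q j + s * p i) * (cmod (Z i j))\<^sup>2)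
          \<le> (cmod (o1 i j))\<^sup>2 * ((p i - q j)\<^sup>2 / ((1 - s) * q j + s * p i))" if ij: "i \<in> I" "j \<in> I" for i j
      proof (rule square_completion)
        have a: "(1 - s) * q j \<ge> 0" "s * p i \<ge> 0" using s s1 p0[OF ij(1)] q0[OF ij(2)] by auto
        then show "(1 - s) * q j + s * p i \<ge> 0" by simp
        assume "(1 - s) * q j + s * p i = 0"
        with a have "(1 - s) * q j = 0" by linarith
        then have "q j = 0" using s1 by simp
        then show "p i - q j = 0 \<or> o1 i j = 0" using pc0[OF ij] by (auto simp: c_def)
      qed
      have c1: "(\<Sum>i\<in>I. \<Sum>j\<in>I. 2 * y * ((p i - q j) * Re (cnj (o1 i j) * Z i j)) - y\<^sup>2 * (((1 - s) * q j + s * p i) * (cmod (Z i j))\<^sup>2))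
        \<le> (\<Sum>i\<in>I. \<Sum>j\<in>I. (cmod (o1 i j))\<^sup>2 * ((p i - q j)\<^sup>2 / ((1 - s) * q j + s * p i)))"
        by (intro sum_mono elem)
      have c2: "(\<Sum>i\<in>I. \<Sum>j\<in>I. 2 * y * ((p i - q j) * Re (cnj (o1 i j) * Z i j)) - y\<^sup>2 * (((1 - s) * q j + s * p i) * (cmod (Z i j))\<^sup>2))
        = 2 * y * ((\<Sum>i\<in>I. \<Sum>j\<in>I. p i * Re (cnj (o1 i j) * Z i j)) - (\<Sum>i\<in>I. \<Sum>j\<in>I. q j * Re (cnj (o1 i j) * Z i j)))
          - y\<^sup>2 * ((1 - s) * (\<Sum>i\<in>I. \<Sum>j\<in>I. q j * (cmod (Z i j))\<^sup>2) + s * (\<Sum>i\<in>I. \<Sum>j\<in>I. p i * (cmod (Z i j))\<^sup>2))"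
        by (simp add: sum_subtractf sum.distrib sum_distrib_left algebra_simps)
      have c3: "(\<Sum>i\<in>I. \<Sum>j\<in>I. p i * Re (cnj (o1 i j) * Z i j)) = P"
        unfolding P_def by (simp only: sum_distrib_left[symmetric] Zo_j)
      have c4: "(\<Sum>i\<in>I. \<Sum>j\<in>I. q j * Re (cnj (o1 i j) * Z i j)) = Q"
        unfolding Q_def by (subst sum.swap) (simp only: sum_distrib_left[symmetric] Zo_i)
      have Pb: "(\<Sum>i\<in>I. \<Sum>j\<in>I. p i * (cmod (Z i j))\<^sup>2) \<le> P" (is "?zp \<le> P")
        unfolding P_def sum_distrib_left[symmetric] by (intro sum_mono mult_left_mono Z2_j p0)
      have Qb: "(\<Sum>i\<in>I. \<Sum>j\<in>I. q j * (cmod (Z i j))\<^sup>2) \<le> Q" (is "?zq \<le> Q")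
        unfolding Q_def by (subst sum.swap) (simp only: sum_distrib_left[symmetric], intro sum_mono mult_left_mono Z2_i q0)
      have c5: "y\<^sup>2 * ((1 - s) * ?zq + s * ?zp) \<le> y\<^sup>2 * ((1 - s) * Q + s * P)"
        using s s1 Pb Qb by (intro mult_left_mono add_mono) auto
      have chain: "2 * y * (P - Q) - z' \<le> b" if "a \<le> b" "a = 2 * y * (p' - q') - z" "p' = P" "q' = Q" "z \<le> z'"
        for a b p' q' z z' :: real using that by simp
      note chain[OF c1 c2 c3 c4 c5]
      then have "(1 - s) * (2 * y * (P - Q) - y\<^sup>2 * ((1 - s) * Q + s * P))
        \<le> (1 - s) * (\<Sum>i\<in>I. \<Sum>j\<in>I. (cmod (o1 i j))\<^sup>2 * ((p i - q j)\<^sup>2 / ((1 - s) * q j + s * p i)))"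
        using s1 by (intro mult_left_mono) auto
      also have "\<dots> = (\<Sum>i\<in>I. \<Sum>j\<in>I. K i j s)"
        by (simp add: sum_distrib_left K_def c_def algebra_simps)
      finally show ?thesis by (simp add: y_def)
    qed
  qed
  then show ?thesis by (simp add: P_def Q_def D_def)
qed

section \<open>Pinching and measured entropies\<close>

lemma cmod_sum_squared_le:
  fixes z :: "'a \<Rightarrow> complex"
  assumes "finite S"
  shows "(cmod (\<Sum>s\<in>S. z s))\<^sup>2 \<le> card S * (\<Sum>s\<in>S. (cmod (z s))\<^sup>2)"
proof -
  have "(cmod (\<Sum>s\<in>S. z s))\<^sup>2 \<le> (\<Sum>s\<in>S. cmod (z s) * 1)\<^sup>2"
    by (intro power_mono) (auto intro: norm_sum)
  also have "\<dots> \<le> (\<Sum>s\<in>S. (cmod (z s))\<^sup>2) * (\<Sum>s\<in>S. 1\<^sup>2)"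
    by (rule Cauchy_Schwarz_ineq_sum)
  finally show ?thesis by (simp add: mult.commute)
qed

lemma mv_sum_scale:
  "mv I A (\<lambda>x. \<Sum>b\<in>J. c b * g b x) = (\<lambda>x. \<Sum>b\<in>J. c b * mv I A (g b) x)"
proof
  fix x
  have "(\<Sum>y\<in>I. A x y * (\<Sum>b\<in>J. c b * g b y)) = (\<Sum>b\<in>J. c b * (\<Sum>y\<in>I. A x y * g b y))"
    unfolding sum_distrib_left by (subst sum.swap) (simp add: algebra_simps)
  then show "mv I A (\<lambda>x. \<Sum>b\<in>J. c b * g b x) x = (\<Sum>b\<in>J. c b * mv I A (g b) x)"
    by (simp add: mv_def)
qed

lemma ip_sum_scale:
  "ip I (\<lambda>x. \<Sum>a\<in>J. c a * g a x) (\<lambda>x. \<Sum>b\<in>K. d b * h b x)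
     = (\<Sum>a\<in>J. \<Sum>b\<in>K. cnj (c a) * d b * ip I (g a) (h b))"
proof -
  have l: "ip I (\<lambda>x. \<Sum>a\<in>J. c a * g a x) v = (\<Sum>a\<in>J. cnj (c a) * ip I (g a) v)" for v
  proof -
    have "cnj (ip I (\<lambda>x. \<Sum>a\<in>J. c a * g a x) v) = (\<Sum>a\<in>J. c a * ip I v (g a))"
      unfolding ip_cnj ip_sum_right ip_scale_right ..
    then have "cnj (cnj (ip I (\<lambda>x. \<Sum>a\<in>J. c a * g a x) v)) = cnj (\<Sum>a\<in>J. c a * ip I v (g a))" by simp
    then show ?thesis by (simp add: ip_cnj)
  qed
  show ?thesis unfolding l unfolding ip_sum_right ip_scale_right by (simp add: sum_distrib_left mult.assoc)
qed

text \<open>The pinching of \<rho> commutes with \<sigma>, so the two have a common eigenbasis. In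
  such a basis \<sigma> is diagonal and \<rho> has no off-diagonal entries inside an eigenspace of
  \<sigma>.\<close>

lemma pinched_eigenbasis:
  assumes I: "finite I" and \<rho>: "herm_on I \<rho>" and \<sigma>: "eigs I \<sigma> q f"
  shows "\<exists>g s. eigs I \<sigma> s g \<and> s ` I \<subseteq> q ` I \<and>
    (\<forall>a\<in>I. \<forall>b\<in>I. a \<noteq> b \<and> s a = s b \<longrightarrow> ip I (g a) (mv I \<rho> (g b)) = 0)"
proof -
  have of: "onb I f" using \<sigma> by (simp add: eigs_def)
  \<comment> \<open>In the coordinates of f, \<open>T\<close> is \<sigma> and \<open>R\<close> is
    the pinching of \<rho>: entries between different eigenvalues are deleted.\<close>
  define R where "R a b = (if q a = q b then ip I (f a) (mv I \<rho> (f b)) else 0)" for a b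
  define T where "T a b = (if a = b then complex_of_real (q a) else 0)" for a b
  have hT: "herm_on I T" by (auto simp: herm_on_def T_def)
  have hR: "herm_on I R" by (auto simp: herm_on_def R_def ip_cnj mv_adjoint[OF \<rho>])
  have comm: "(\<Sum>z\<in>I. T x z * R z y) = (\<Sum>z\<in>I. R x z * T z y)" if "x \<in> I" "y \<in> I" for x y
  proof -
    have "(\<Sum>z\<in>I. T x z * R z y) = (\<Sum>z\<in>I. if z = x then complex_of_real (q x) * R x y else 0)"
      by (intro sum.cong) (auto simp: T_def)
    moreover have "(\<Sum>z\<in>I. R x z * T z y) = (\<Sum>z\<in>I. if z = y then R x y * complex_of_real (q y) else 0)"
      by (intro sum.cong) (auto simp: T_def)
    ultimately show ?thesis using that I by (auto simp: R_def)
  qed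
  obtain h s r where h: "eigs I T s h" "eigs I R r h" using joint_eigenbasis[OF I hT hR comm] by blast
  have oh: "onb I h" using h by (simp add: eigs_def)
  \<comment> \<open>A joint eigenvector only involves coordinates that belong to its own eigenvalue
    of \<sigma>; this also bounds the set of values of s by that of q.\<close>
  have hs: "q b = s a" if "a \<in> I" "b \<in> I" "h a b \<noteq> 0" for a b
  proof -
    have "mv I T (h a) b = complex_of_real (s a) * h a b" using h that by (simp add: eigs_def)
    moreover have "mv I T (h a) b = (\<Sum>y\<in>I. if y = b then complex_of_real (q b) * h a b else 0)"
      using that unfolding mv_def by (auto simp: T_def intro!: sum.cong)
    ultimately have "complex_of_real (q b) * h a b = complex_of_real (s a) * h a b" using that I by simp
    then show ?thesis using that by simp
  qed
  define g where "g a = (\<lambda>x. \<Sum>b\<in>I. h a b * f b x)" for a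
  have ipg: "ip I (g a) (g a') = ip I (h a) (h a')" for a a'
  proof -
    have "ip I (g a) (g a') = (\<Sum>b\<in>I. \<Sum>b'\<in>I. cnj (h a b) * h a' b' * ip I (f b) (f b'))"
      unfolding g_def by (rule ip_sum_scale)
    also have "\<dots> = (\<Sum>b\<in>I. \<Sum>b'\<in>I. if b' = b then cnj (h a b) * h a' b else 0)"
      using of by (intro sum.cong refl) (auto simp: onb_def)
    finally show ?thesis using I by (simp add: ip_def)
  qed
  have "onb I g" using oh of unfolding onb_def ipg by (auto simp: g_def)
  moreover have "mv I \<sigma> (g a) = (\<lambda>x. complex_of_real (s a) * g a x)" if a: "a \<in> I" for a
  proof -
    have "mv I \<sigma> (g a) = (\<lambda>x. \<Sum>b\<in>I. h a b * mv I \<sigma> (f b) x)" unfolding g_def by (rule mv_sum_scale)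
    also have "\<dots> = (\<lambda>x. \<Sum>b\<in>I. complex_of_real (s a) * (h a b * f b x))"
    proof (intro ext sum.cong refl)
      fix x b assume b: "b \<in> I"
      show "h a b * mv I \<sigma> (f b) x = complex_of_real (s a) * (h a b * f b x)"
        using \<sigma> hs[OF a b] b by (cases "h a b = 0") (auto simp: eigs_def)
    qed
    finally show ?thesis by (simp add: g_def sum_distrib_left)
  qed
  ultimately have "eigs I \<sigma> s g" by (simp add: eigs_def)
  moreover have "s ` I \<subseteq> q ` I"
  proof (clarify)
    fix a assume a: "a \<in> I"
    then have "ip I (h a) (h a) = 1" using oh by (simp add: onb_def)
    then have "\<exists>b\<in>I. h a b \<noteq> 0" unfolding ip_def by (metis (no_types, lifting) mult_zero_right sum.neutral zero_neq_one)
    then obtain b where "b \<in> I" "h a b \<noteq> 0" by blast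
    then show "s a \<in> q ` I" using hs[OF a, of b] by (metis imageI)
  qed
  moreover have "ip I (g a) (mv I \<rho> (g a')) = 0" if "a \<in> I" "a' \<in> I" "a \<noteq> a'" "s a = s a'" for a a'
  proof -
    have "ip I (g a) (mv I \<rho> (g a')) = ip I (\<lambda>x. \<Sum>b\<in>I. h a b * f b x) (\<lambda>x. \<Sum>b\<in>I. h a' b * mv I \<rho> (f b) x)"
      unfolding g_def mv_sum_scale ..
    also have "\<dots> = (\<Sum>b\<in>I. \<Sum>b'\<in>I. cnj (h a b) * h a' b' * ip I (f b) (mv I \<rho> (f b')))"
      by (rule ip_sum_scale)
    also have "\<dots> = (\<Sum>b\<in>I. \<Sum>b'\<in>I. cnj (h a b) * (R b b' * h a' b'))"
    proof (intro sum.cong refl)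
      fix b b' assume b: "b \<in> I" "b' \<in> I"
      show "cnj (h a b) * h a' b' * ip I (f b) (mv I \<rho> (f b')) = cnj (h a b) * (R b b' * h a' b')"
        using hs[OF that(1) b(1)] hs[OF that(2) b(2)] that(4)
        by (cases "h a b = 0 \<or> h a' b' = 0") (auto simp: R_def)
    qed
    also have "\<dots> = ip I (h a) (mv I R (h a'))" by (simp add: ip_def mv_def sum_distrib_left)
    also have "\<dots> = 0" using h oh that by (simp add: eigs_def ip_scale_right onb_def)
    finally show ?thesis .
  qed
  ultimately show ?thesis by blast
qed

text \<open>The pinching inequality: \<rho> is at most N times its pinching, N being the number of
  distinct values of s. The vector with coefficients c is cut into N components, one per value;
  Cauchy-Schwarz costs the factor N, and inside a component \<rho> is diagonal. Only the spectral
  term p_i of \<rho> is retained on the left.\<close>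

lemma pinching_bound:
  assumes I: "finite I" and \<rho>: "psd_on I \<rho>" "eigs I \<rho> p e" and g: "onb I g"
    and blk: "\<And>a b. a \<in> I \<Longrightarrow> b \<in> I \<Longrightarrow> a \<noteq> b \<Longrightarrow> s a = s b \<Longrightarrow> ip I (g a) (mv I \<rho> (g b)) = 0"
    and i: "i \<in> I"
  shows "p i * (cmod (\<Sum>a\<in>I. c a * ip I (e i) (g a)))\<^sup>2
    \<le> card (s ` I) * (\<Sum>a\<in>I. (cmod (c a))\<^sup>2 * Re (ip I (g a) (mv I \<rho> (g a))))"
proof -
  have h: "herm_on I \<rho>" using \<rho> by (simp add: psd_on_def)
  have p0: "p i \<ge> 0" if "i \<in> I" for i using psd_eigenvalue_nonneg[OF I \<rho> that] .
  define v where "v t = (\<lambda>x. \<Sum>a\<in>{a\<in>I. s a = t}. c a * g a x)" for t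
  have "(\<Sum>a\<in>I. c a * ip I (e i) (g a)) = (\<Sum>t\<in>s ` I. \<Sum>a\<in>{a\<in>I. s a = t}. c a * ip I (e i) (g a))" for i
    using I by (rule sum.image_gen)
  also have "\<dots> i = (\<Sum>t\<in>s ` I. ip I (e i) (v t))" for i
    unfolding v_def ip_sum_right ip_scale_right ..
  finally have "(cmod (\<Sum>a\<in>I. c a * ip I (e i) (g a)))\<^sup>2 \<le> card (s ` I) * (\<Sum>t\<in>s ` I. (cmod (ip I (e i) (v t)))\<^sup>2)"
    using cmod_sum_squared_le[of "s ` I"] I by simp
  then have "p i * (cmod (\<Sum>a\<in>I. c a * ip I (e i) (g a)))\<^sup>2
      \<le> card (s ` I) * (\<Sum>t\<in>s ` I. p i * (cmod (ip I (e i) (v t)))\<^sup>2)"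
    using mult_left_mono[OF _ p0[OF i]] by (fastforce simp: sum_distrib_left[symmetric] algebra_simps)
  also have "\<dots> \<le> card (s ` I) * (\<Sum>t\<in>s ` I. \<Sum>i\<in>I. p i * (cmod (ip I (e i) (v t)))\<^sup>2)"
    using i I p0 by (intro mult_left_mono sum_mono member_le_sum[of i I "\<lambda>i. p i * (cmod (ip I (e i) (v _)))\<^sup>2"]) auto
  also have "(\<Sum>t\<in>s ` I. \<Sum>i\<in>I. p i * (cmod (ip I (e i) (v t)))\<^sup>2) = (\<Sum>t\<in>s ` I. Re (ip I (v t) (mv I \<rho> (v t))))"
    by (simp add: eigs_quadratic[OF I h \<rho>(2)])
  also have "\<dots> = (\<Sum>t\<in>s ` I. \<Sum>a\<in>{a\<in>I. s a = t}. (cmod (c a))\<^sup>2 * Re (ip I (g a) (mv I \<rho> (g a))))"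
  proof (intro sum.cong refl)
    fix t
    let ?J = "{a\<in>I. s a = t}"
    have "ip I (v t) (mv I \<rho> (v t)) = ip I (\<lambda>x. \<Sum>a\<in>?J. c a * g a x) (\<lambda>x. \<Sum>a\<in>?J. c a * mv I \<rho> (g a) x)"
      unfolding v_def mv_sum_scale ..
    also have "\<dots> = (\<Sum>a\<in>?J. \<Sum>b\<in>?J. cnj (c a) * c b * ip I (g a) (mv I \<rho> (g b)))" by (rule ip_sum_scale)
    also have "\<dots> = (\<Sum>a\<in>?J. \<Sum>b\<in>?J. if b = a then cnj (c a) * c a * ip I (g a) (mv I \<rho> (g a)) else 0)"
      using blk by (intro sum.cong refl) auto
    also have "\<dots> = (\<Sum>a\<in>?J. cnj (c a) * c a * ip I (g a) (mv I \<rho> (g a)))" using I by simp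
    also have "\<dots> = (\<Sum>a\<in>?J. complex_of_real ((cmod (c a))\<^sup>2) * ip I (g a) (mv I \<rho> (g a)))"
      by (intro sum.cong refl) (simp add: complex_norm_square mult.commute del: of_real_power)
    finally show "Re (ip I (v t) (mv I \<rho> (v t))) = (\<Sum>a\<in>?J. (cmod (c a))\<^sup>2 * Re (ip I (g a) (mv I \<rho> (g a))))"
      by simp
  qed
  also have "\<dots> = (\<Sum>a\<in>I. (cmod (c a))\<^sup>2 * Re (ip I (g a) (mv I \<rho> (g a))))"
    using I by (rule sum.image_gen[symmetric])
  finally show ?thesis .
qed

text \<open>Jensen's inequality for ln at the points 1 / x_a, obtained by averaging ln t \<le> t - 1
  at t = 1 / (x_a X), where X is the mean of 1 / x_a.\<close>

lemma ln_jensen: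
  fixes w x :: "'a \<Rightarrow> real"
  assumes "finite I" and w: "\<And>a. a \<in> I \<Longrightarrow> w a \<ge> 0" "(\<Sum>a\<in>I. w a) = 1" and x: "\<And>a. a \<in> I \<Longrightarrow> x a > 0"
  shows "0 < (\<Sum>a\<in>I. w a / x a)" "- ln (\<Sum>a\<in>I. w a / x a) \<le> (\<Sum>a\<in>I. w a * ln (x a))"
proof -
  define X where "X = (\<Sum>a\<in>I. w a / x a)"
  obtain b where b: "b \<in> I" "w b \<noteq> 0" using w(2) by (metis sum.neutral zero_neq_one)
  have "w b / x b > 0" using b w x by (simp add: less_le)
  also have "w b / x b \<le> X" unfolding X_def using assms b by (intro member_le_sum[of b I "\<lambda>a. w a / x a"]) (auto simp: less_imp_le)
  finally show X: "0 < (\<Sum>a\<in>I. w a / x a)" by (simp add: X_def)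
  then have X: "X > 0" by (simp add: X_def)
  have "w a * (1 - ln X) \<le> w a * ln (x a) + (w a / x a) / X" if a: "a \<in> I" for a
  proof -
    have "ln (1 / (x a * X)) \<le> 1 / (x a * X) - 1" using x[OF a] X by (intro ln_le_minus_one) simp
    then have "1 - ln X \<le> ln (x a) + 1 / (x a * X)" using x[OF a] X by (simp add: ln_div ln_mult)
    then have "w a * (1 - ln X) \<le> w a * (ln (x a) + 1 / (x a * X))" using w(1)[OF a] by (rule mult_left_mono)
    then show ?thesis by (simp add: algebra_simps)
  qed
  then have "(\<Sum>a\<in>I. w a * (1 - ln X)) \<le> (\<Sum>a\<in>I. w a * ln (x a) + (w a / x a) / X)" by (rule sum_mono)
  also have "\<dots> = (\<Sum>a\<in>I. w a * ln (x a)) + X / X"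
    unfolding sum.distrib sum_divide_distrib[symmetric] X_def ..
  finally show "- ln (\<Sum>a\<in>I. w a / x a) \<le> (\<Sum>a\<in>I. w a * ln (x a))"
    using X w(2) unfolding X_def[symmetric] sum_distrib_right[symmetric] by simp
qed

text \<open>If \<rho> had weight P > 0 on a kernel vector of \<sigma>, a score t there would earn t
  P and cost nothing, so the pay-off would be unbounded; t = (|v| + 1) / P already exceeds
  v.\<close>

lemma eigs_support_of_measured_bound:
  assumes I: "finite I" and \<rho>: "psd_on I \<rho>" and \<sigma>: "eigs I \<sigma> q f" "(\<Sum>j\<in>I. q j) = 1"
    and bound: "\<And>l. (\<Sum>a\<in>I. l a * Re (ip I (f a) (mv I \<rho> (f a)))) + 1
         - (\<Sum>a\<in>I. exp (l a) * Re (ip I (f a) (mv I \<sigma> (f a)))) \<le> v"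
    and j: "j \<in> I" "q j = 0"
  shows "Re (ip I (f j) (mv I \<rho> (f j))) = 0"
proof (rule ccontr)
  define P where "P = Re (ip I (f j) (mv I \<rho> (f j)))"
  assume "Re (ip I (f j) (mv I \<rho> (f j))) \<noteq> 0"
  then have P: "P > 0" using \<rho> by (simp add: psd_on_def P_def less_le)
  define t where "t = (\<bar>v\<bar> + 1) / P"
  have "(\<Sum>a\<in>I. (if a = j then t else 0) * Re (ip I (f a) (mv I \<rho> (f a)))) = (\<Sum>a\<in>I. if a = j then t * P else 0)"
    by (intro sum.cong) (auto simp: P_def)
  also have "\<dots> = t * P" using I j by simp
  also have "\<dots> = \<bar>v\<bar> + 1" using P by (simp add: t_def)
  finally have 1: "(\<Sum>a\<in>I. (if a = j then t else 0) * Re (ip I (f a) (mv I \<rho> (f a)))) = \<bar>v\<bar> + 1" .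
  have "(\<Sum>a\<in>I. exp (if a = j then t else 0) * Re (ip I (f a) (mv I \<sigma> (f a)))) = (\<Sum>a\<in>I. q a)"
    using j by (intro sum.cong) (auto simp: eigs_ip[OF I \<sigma>(1)])
  then show False using bound[of "\<lambda>a. if a = j then t else 0"] 1 \<sigma>(2) by simp
qed

text \<open>In the pinched basis let P be the diagonal of \<rho> and s that of \<sigma>. The
  measured pay-off at the scores ln (P / s) is the classical divergence of P and s. Its cross term
  agrees with that of \<rho> and \<sigma>, and its entropy term differs from that of \<rho> by at
  most ln N, by the pinching inequality.\<close>

lemma entropy_difference_le_measured:
  assumes I: "finite I" and \<rho>: "psd_on I \<rho>" "eigs I \<rho> p e" "(\<Sum>i\<in>I. p i) = 1"
    and \<sigma>: "psd_on I \<sigma>" "eigs I \<sigma> q f" "(\<Sum>j\<in>I. q j) = 1"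
    and bound: "\<And>g l. onb I g \<Longrightarrow> (\<Sum>a\<in>I. l a * Re (ip I (g a) (mv I \<rho> (g a)))) + 1
         - (\<Sum>a\<in>I. exp (l a) * Re (ip I (g a) (mv I \<sigma> (g a)))) \<le> v"
  shows "(\<Sum>i\<in>I. p i * lnz (p i)) - (\<Sum>j\<in>I. lnz (q j) * Re (ip I (f j) (mv I \<rho> (f j))))
     \<le> v + ln (card (q ` I))"
proof -
  have h\<rho>: "herm_on I \<rho>" and h\<sigma>: "herm_on I \<sigma>" using \<rho> \<sigma> by (simp_all add: psd_on_def)
  have oe: "onb I e" and of: "onb I f" using \<rho> \<sigma> by (auto simp: eigs_def)
  have p0: "p i \<ge> 0" if "i \<in> I" for i using psd_eigenvalue_nonneg[OF I \<rho>(1,2) that] .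
  obtain g s where g: "eigs I \<sigma> s g" and sq: "s ` I \<subseteq> q ` I"
    and blk: "\<forall>a\<in>I. \<forall>b\<in>I. a \<noteq> b \<and> s a = s b \<longrightarrow> ip I (g a) (mv I \<rho> (g b)) = 0"
    using pinched_eigenbasis[OF I h\<rho> \<sigma>(2)] by (elim exE conjE) (rule that)
  have og: "onb I g" using g by (simp add: eigs_def)
  have s0: "s a \<ge> 0" if "a \<in> I" for a using psd_eigenvalue_nonneg[OF I \<sigma>(1) g that] .
  have s1: "(\<Sum>a\<in>I. s a) = 1"
  proof -
    have "complex_of_real (\<Sum>a\<in>I. s a) = (\<Sum>a\<in>I. ip I (g a) (mv I \<sigma> (g a)))" by (simp add: eigs_ip[OF I g])
    also have "\<dots> = (\<Sum>a\<in>I. ip I (f a) (mv I \<sigma> (f a)))"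
      unfolding onb_trace[OF I og] onb_trace[OF I of] ..
    also have "\<dots> = complex_of_real (\<Sum>a\<in>I. q a)" by (simp add: eigs_ip[OF I \<sigma>(2)])
    finally show ?thesis using \<sigma>(3) by (metis of_real_eq_iff)
  qed
  define P where "P a = Re (ip I (g a) (mv I \<rho> (g a)))" for a
  have P0: "P a \<ge> 0" for a using \<rho>(1) by (simp add: P_def psd_on_def)
  define W where "W i a = (cmod (ip I (e i) (g a)))\<^sup>2" for i a
  have PW: "P a = (\<Sum>i\<in>I. p i * W i a)" for a
    by (simp add: P_def W_def eigs_quadratic[OF I h\<rho> \<rho>(2)])
  have W1: "(\<Sum>a\<in>I. W i a) = 1" if "i \<in> I" for i
  proof -
    have "W i a = (cmod (ip I (g a) (e i)))\<^sup>2" for a unfolding W_def by (metis complex_mod_cnj ip_cnj)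
    then show ?thesis using onb_norm_sum[OF I og, of "e i"] oe that by (simp add: onb_def)
  qed
  have P1: "(\<Sum>a\<in>I. P a) = 1"
    unfolding PW by (subst sum.swap) (simp add: sum_distrib_left[symmetric] W1 \<rho>(3))
  have PZ: "P a = 0" if "a \<in> I" "s a = 0" for a
    unfolding P_def using eigs_support_of_measured_bound[OF I \<rho>(1) g s1 _ that] bound[OF og] by blast
  define N where "N = card (q ` I)"
  have Ne: "I \<noteq> {}" using P1 by auto
  have N: "card (s ` I) \<le> N" "N > 0" using sq I Ne by (auto simp: N_def card_mono card_gt_0_iff)
  \<comment> \<open>The shift d > 0 keeps the logarithms finite where P vanishes; it is sent to 0 at
    the end.\<close>
  have main: "(\<Sum>i\<in>I. p i * lnz (p i)) - ln N \<le> (\<Sum>a\<in>I. P a * ln (P a + d))" if d: "d > 0" for d :: real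
  proof -
    have Pd: "P a + d > 0" for a using P0[of a] d by simp
    have row: "p i * lnz (p i) - p i * ln N \<le> (\<Sum>a\<in>I. p i * (W i a * ln (P a + d)))" if i: "i \<in> I" for i
    proof (cases "p i = 0")
      case False
      then have p: "p i > 0" using p0[OF i] by simp
      define X where "X = (\<Sum>a\<in>I. W i a / (P a + d))"
      note J = ln_jensen[of I "W i" "\<lambda>a. P a + d", OF I _ W1[OF i] Pd, folded X_def]
      have X: "X > 0" "- ln X \<le> (\<Sum>a\<in>I. W i a * ln (P a + d))" using J by (auto simp: W_def)
      \<comment> \<open>With D the diagonal operator of P in the basis g, these are the coefficients
        of (D + d)^(-1) e_i, and X is the expectation of (D + d)^(-1) in e_i. The pinching bound
        then reads p_i X^2 \<le> N X, which replaces operator monotonicity of the logarithm.\<close>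
      define c where "c a = cnj (ip I (e i) (g a)) / complex_of_real (P a + d)" for a
      have "c a * ip I (e i) (g a) = complex_of_real (W i a / (P a + d))" for a
        by (simp add: c_def W_def complex_norm_square mult.commute del: of_real_power of_real_add)
      then have "(\<Sum>a\<in>I. c a * ip I (e i) (g a)) = complex_of_real X" by (simp add: X_def)
      then have "p i * X\<^sup>2 = p i * (cmod (\<Sum>a\<in>I. c a * ip I (e i) (g a)))\<^sup>2" by simp
      also have "\<dots> \<le> card (s ` I) * (\<Sum>a\<in>I. (cmod (c a))\<^sup>2 * P a)"
        unfolding P_def by (rule pinching_bound[OF I \<rho>(1,2) og _ i]) (use blk in blast)
      also have "\<dots> \<le> N * X"
      proof (rule mult_mono)
        show "(\<Sum>a\<in>I. (cmod (c a))\<^sup>2 * P a) \<le> X" unfolding X_def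
        proof (rule sum_mono)
          fix a
          have "(cmod (c a))\<^sup>2 * P a = W i a / (P a + d) * (P a / (P a + d))"
            using Pd[of a] by (simp add: c_def norm_divide W_def power2_eq_square del: of_real_add)
          also have "\<dots> \<le> W i a / (P a + d) * 1"
            using Pd[of a] d by (intro mult_left_mono) (auto simp: W_def)
          finally show "(cmod (c a))\<^sup>2 * P a \<le> W i a / (P a + d)" by simp
        qed
      qed (use N P0 in \<open>auto intro!: sum_nonneg\<close>)
      finally have "p i * X \<le> N" using X(1) by (simp add: power2_eq_square)
      moreover have "0 < p i * X" using p X by simp
      ultimately have "ln (p i * X) \<le> ln N" using N(2) by (intro ln_mono) simp_all
      then have "ln (p i) - ln N \<le> (\<Sum>a\<in>I. W i a * ln (P a + d))" using p X by (simp add: ln_mult)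
      then have "p i * (ln (p i) - ln N) \<le> p i * (\<Sum>a\<in>I. W i a * ln (P a + d))" using p by (intro mult_left_mono) auto
      then show ?thesis using p by (simp add: lnz_def algebra_simps sum_distrib_left)
    qed simp
    have "(\<Sum>i\<in>I. p i * lnz (p i)) - ln N = (\<Sum>i\<in>I. p i * lnz (p i) - p i * ln N)"
      by (simp add: sum_subtractf sum_distrib_right[symmetric] \<rho>(3))
    also have "\<dots> \<le> (\<Sum>i\<in>I. \<Sum>a\<in>I. p i * (W i a * ln (P a + d)))" by (intro sum_mono row)
    also have "\<dots> = (\<Sum>a\<in>I. P a * ln (P a + d))"
      unfolding PW by (subst sum.swap) (simp add: sum_distrib_right mult.assoc)
    finally show ?thesis .
  qed
  \<comment> \<open>Tr \<rho> ln \<sigma> may be computed in any eigenbasis of \<sigma>, in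
    particular in the pinched one.\<close>
  have cross: "(\<Sum>a\<in>I. P a * lnz (s a)) = (\<Sum>j\<in>I. lnz (q j) * Re (ip I (f j) (mv I \<rho> (f j))))"
  proof -
    have "(\<Sum>a\<in>I. complex_of_real (lnz (s a)) * ip I (g a) (mv I \<rho> (g a)))
       = (\<Sum>j\<in>I. complex_of_real (lnz (q j)) * ip I (f j) (mv I \<rho> (f j)))"
      unfolding eigs_trace_fun[where h="\<lambda>x. complex_of_real (lnz x)"]
      by (intro sum.cong refl arg_cong2[of _ _ _ _ "(*)"] eigs_fun_unique[OF I h\<sigma> g \<sigma>(2), where h="\<lambda>x. complex_of_real (lnz x)"])
    then have "Re (\<Sum>a\<in>I. complex_of_real (lnz (s a)) * ip I (g a) (mv I \<rho> (g a)))
       = Re (\<Sum>j\<in>I. complex_of_real (lnz (q j)) * ip I (f j) (mv I \<rho> (f j)))" by simp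
    then show ?thesis by (simp add: P_def mult.commute)
  qed
  have fin: "(\<Sum>i\<in>I. p i * lnz (p i)) - (\<Sum>j\<in>I. lnz (q j) * Re (ip I (f j) (mv I \<rho> (f j)))) \<le> v + ln N + d * card I"
    if d: "d > 0" for d :: real
  proof -
    \<comment> \<open>The log-likelihood ratio. On the kernel of \<sigma> the score 0 does no harm,
      because P vanishes there by \<open>PZ\<close>.\<close>
    define l where "l a = (if s a > 0 then ln (P a + d) - ln (s a) else 0)" for a
    have Pd: "P a + d > 0" for a using P0[of a] d by simp
    have "(\<Sum>a\<in>I. l a * P a) = (\<Sum>a\<in>I. P a * ln (P a + d) - P a * lnz (s a))"
    proof (intro sum.cong refl)
      fix a assume a: "a \<in> I"
      show "l a * P a = P a * ln (P a + d) - P a * lnz (s a)"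
        using PZ[OF a] s0[OF a] by (cases "s a = 0") (auto simp: l_def lnz_def algebra_simps)
    qed
    moreover have "(\<Sum>a\<in>I. exp (l a) * Re (ip I (g a) (mv I \<sigma> (g a)))) \<le> (\<Sum>a\<in>I. P a + d)"
    proof (rule sum_mono)
      fix a assume a: "a \<in> I"
      show "exp (l a) * Re (ip I (g a) (mv I \<sigma> (g a))) \<le> P a + d"
        using s0[OF a] Pd[of a] by (cases "s a = 0") (auto simp: eigs_ip[OF I g a] l_def exp_diff)
    qed
    moreover have "(\<Sum>a\<in>I. P a + d) = 1 + d * card I" using P1 by (simp add: sum.distrib)
    ultimately have "(\<Sum>a\<in>I. P a * ln (P a + d)) - (\<Sum>a\<in>I. P a * lnz (s a)) \<le> v + d * card I"
      using bound[OF og, of l] by (simp add: P_def sum_subtractf)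
    then show ?thesis using main[OF d] cross by simp
  qed
  have "(\<Sum>i\<in>I. p i * lnz (p i)) - (\<Sum>j\<in>I. lnz (q j) * Re (ip I (f j) (mv I \<rho> (f j)))) \<le> v + ln N"
  proof (rule field_le_epsilon)
    fix \<epsilon> :: real assume "\<epsilon> > 0"
    then show "(\<Sum>i\<in>I. p i * lnz (p i)) - (\<Sum>j\<in>I. lnz (q j) * Re (ip I (f j) (mv I \<rho> (f j)))) \<le> v + ln N + \<epsilon>"
      using fin[of "\<epsilon> / card I"] Ne I by (simp add: card_gt_0_iff)
  qed
  then show ?thesis by (simp add: N_def)
qed

section \<open>Minimax and convex combinations\<close>

text \<open>Each z with u1 z < 0 bounds t from above by \<open>r z\<close>, and each z with u2 z < 0
  bounds it from below. The bounds are compatible: otherwise some point corresponding to a mixture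
  of two such z would make both pay-offs negative. The infimum of the upper bounds is a valid t. No
  linear structure on Z is used, only mixing of pay-off values.\<close>

lemma convexlike_minimax_two:
  fixes u1 u2 :: "'z \<Rightarrow> real"
  assumes cv: "\<And>z z' t. z \<in> Z \<Longrightarrow> z' \<in> Z \<Longrightarrow> 0 \<le> t \<Longrightarrow> t \<le> 1 \<Longrightarrow>
      \<exists>y\<in>Z. u1 y = t * u1 z + (1 - t) * u1 z' \<and> u2 y = t * u2 z + (1 - t) * u2 z'"
    and mx: "\<And>z. z \<in> Z \<Longrightarrow> 0 \<le> u1 z \<or> 0 \<le> u2 z"
  shows "\<exists>t. 0 \<le> t \<and> t \<le> 1 \<and> (\<forall>z\<in>Z. 0 \<le> t * u1 z + (1 - t) * u2 z)"
proof (cases "\<exists>z\<in>Z. u1 z < 0")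
  case False
  then show ?thesis by (intro exI[of _ 1]) (auto simp: not_less)
next
  case True
  define S where "S = {z\<in>Z. u1 z < 0}"
  define r where "r z = u2 z / (u2 z - u1 z)" for z
  have S0: "S \<noteq> {}" using True by (auto simp: S_def)
  have r0: "r z \<ge> 0" "r z \<le> 1" if "z \<in> S" for z
  proof -
    have a: "u1 z < 0" "u2 z \<ge> 0" using that mx[of z] by (auto simp: S_def)
    then have "u2 z - u1 z > 0" by linarith
    with a show "r z \<ge> 0" "r z \<le> 1" by (auto simp: r_def)
  qed
  have key: "u1 z' * u2 z \<ge> u1 z * u2 z'" if z: "z \<in> S" and z': "z' \<in> Z" "u2 z' < 0" for z z'
  proof (rule ccontr)
    define a b a' b' where "a = u1 z" and "b = u2 z" and "a' = u1 z'" and "b' = u2 z'"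
    assume "\<not> u1 z' * u2 z \<ge> u1 z * u2 z'"
    then have gap: "a * b' - a' * b > 0" by (simp add: a_def b_def a'_def b'_def)
    have sg: "a < 0" "b \<ge> 0" "a' \<ge> 0" "b' < 0"
      using z z' mx[of z] mx[of z'] by (auto simp: S_def a_def b_def a'_def b'_def)
    \<comment> \<open>The mixing ratio is pushed by h beyond the one at which the first pay-off
      vanishes. The first pay-off becomes negative, and half of the gap suffices to keep the second
      negative; b + 1 instead of b covers b = 0.\<close>
    define h where "h = (a * b' - a' * b) / (2 * (b + 1))"
    have h: "h > 0" using gap sg by (simp add: h_def)
    define x where "x = a' + h"
    have x: "x > 0" using h sg by (simp add: x_def)
    define t where "t = x / (x - a)"
    have t: "0 \<le> t" "t \<le> 1" "1 - t = - a / (x - a)" using x sg by (auto simp: t_def field_simps)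
    obtain y where y: "y \<in> Z" "u1 y = t * a + (1 - t) * a'" "u2 y = t * b + (1 - t) * b'"
      using cv[of z z' t] z z' t by (auto simp: S_def a_def b_def a'_def b'_def)
    have "u1 y = (x * a - a * a') / (x - a)" unfolding y t(3) by (simp add: t_def diff_divide_distrib)
    also have "x * a - a * a' = h * a" by (simp add: x_def algebra_simps)
    finally have "u1 y < 0" using h sg x by (simp add: divide_neg_pos mult_pos_neg)
    moreover have "u2 y = (x * b - a * b') / (x - a)" unfolding y t(3) by (simp add: t_def diff_divide_distrib)
    moreover have "x * b - a * b' < 0"
    proof -
      have "h * b \<le> h * (b + 1)" using h by (simp add: mult_left_mono)
      also have "\<dots> = (a * b' - a' * b) / 2" using sg by (simp add: h_def field_simps)
      also have "\<dots> < a * b' - a' * b" using gap by simp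
      finally show ?thesis by (simp add: x_def algebra_simps)
    qed
    ultimately have "u1 y < 0" "u2 y < 0" using sg x by (simp_all add: divide_neg_pos)
    then show False using mx[OF y(1)] by linarith
  qed
  define t where "t = Inf (r ` S)"
  have bdd: "bdd_below (r ` S)" using r0 by (intro bdd_belowI[of _ 0]) auto
  have t0: "t \<ge> 0" unfolding t_def using S0 r0 by (intro cInf_greatest) auto
  have tr: "t \<le> r z" if "z \<in> S" for z unfolding t_def using bdd that by (intro cInf_lower) auto
  have t1: "t \<le> 1" using S0 tr r0 by force
  have "0 \<le> t * u1 z + (1 - t) * u2 z" if z: "z \<in> Z" for z
  proof (cases "z \<in> S")
    case True
    have a: "u1 z < 0" "u2 z \<ge> 0" using True mx[of z] by (auto simp: S_def)
    then have d: "u2 z - u1 z > 0" by linarith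
    have "t * (u2 z - u1 z) \<le> u2 z" using tr[OF True] d by (simp add: r_def pos_le_divide_eq)
    then show ?thesis by (simp add: algebra_simps)
  next
    case False
    then have u1: "u1 z \<ge> 0" using z by (auto simp: S_def)
    show ?thesis
    proof (cases "u2 z \<ge> 0")
      case True then show ?thesis using t0 t1 u1 by simp
    next
      case False
      have d: "u1 z - u2 z > 0" using False u1 by linarith
      have "- u2 z / (u1 z - u2 z) \<le> t" unfolding t_def
      proof (rule cInf_greatest)
        fix y assume "y \<in> r ` S"
        then obtain z' where z': "z' \<in> S" "y = r z'" by auto
        have a: "u1 z' < 0" "u2 z' \<ge> 0" using z' mx[of z'] by (auto simp: S_def)
        then have d': "u2 z' - u1 z' > 0" by linarith
        have "- u2 z * (u2 z' - u1 z') \<le> u2 z' * (u1 z - u2 z)"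
          using key[OF z'(1) z] False by (simp add: algebra_simps)
        then show "- u2 z / (u1 z - u2 z) \<le> y" unfolding z' r_def using d d'
          by (subst pos_divide_le_eq[OF d]) (simp add: pos_le_divide_eq[OF d'] mult.commute)
      qed (use S0 in auto)
      then have "- u2 z \<le> t * (u1 z - u2 z)" unfolding pos_divide_le_eq[OF d] .
      then show ?thesis by (simp add: algebra_simps)
    qed
  qed
  then show ?thesis using t0 t1 by blast
qed

text \<open>A further pay-off u_j is only a threat where it is negative. That subset is again closed
  under mixing, so the induction hypothesis gives weights on J which work there; the resulting
  averaged pay-off and u_j form a two-pay-off problem on all of Z.\<close>

lemma convexlike_minimax_finite:
  fixes u :: "'j \<Rightarrow> 'z \<Rightarrow> real"
  assumes "finite J" "J \<noteq> {}"
    and "\<And>z z' t. z \<in> Z \<Longrightarrow> z' \<in> Z \<Longrightarrow> 0 \<le> t \<Longrightarrow> t \<le> 1 \<Longrightarrow>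
      \<exists>y\<in>Z. \<forall>j\<in>J. u j y = t * u j z + (1 - t) * u j z'"
    and "\<And>z. z \<in> Z \<Longrightarrow> \<exists>j\<in>J. 0 \<le> u j z"
  shows "\<exists>w. (\<forall>j\<in>J. 0 \<le> w j) \<and> (\<Sum>j\<in>J. w j) = 1 \<and> (\<forall>z\<in>Z. 0 \<le> (\<Sum>j\<in>J. w j * u j z))"
  using assms
proof (induction J arbitrary: Z rule: finite_ne_induct)
  case (singleton j)
  then show ?case by (intro exI[of _ "\<lambda>_. 1"]) auto
next
  case (insert j J)
  define Z' where "Z' = {z\<in>Z. u j z < 0}"
  have "\<exists>w. (\<forall>j\<in>J. 0 \<le> w j) \<and> (\<Sum>j\<in>J. w j) = 1 \<and> (\<forall>z\<in>Z'. 0 \<le> (\<Sum>j\<in>J. w j * u j z))"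
  proof (rule insert.IH)
    fix z z' t assume z: "z \<in> Z'" "z' \<in> Z'" and t: "0 \<le> t" "t \<le> (1::real)"
    obtain y where y: "y \<in> Z" "\<forall>k\<in>insert j J. u k y = t * u k z + (1 - t) * u k z'"
      using insert.prems(1)[of z z' t] z t by (auto simp: Z'_def)
    have "t * u j z + (1 - t) * u j z' < 0"
    proof (cases "t = 0")
      case False
      then have "t * u j z < 0" "(1 - t) * u j z' \<le> 0"
        using z t by (auto simp: Z'_def mult_pos_neg mult_nonneg_nonpos)
      then show ?thesis by linarith
    qed (use z in \<open>simp add: Z'_def\<close>)
    then show "\<exists>y\<in>Z'. \<forall>k\<in>J. u k y = t * u k z + (1 - t) * u k z'" using y by (auto simp: Z'_def)
  next
    fix z assume "z \<in> Z'"
    then show "\<exists>k\<in>J. 0 \<le> u k z" using insert.prems(2)[of z] by (auto simp: Z'_def)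
  qed
  then obtain w where w: "\<forall>j\<in>J. 0 \<le> w j" "(\<Sum>j\<in>J. w j) = 1" "\<forall>z\<in>Z'. 0 \<le> (\<Sum>j\<in>J. w j * u j z)" by blast
  define U where "U z = (\<Sum>j\<in>J. w j * u j z)" for z
  have "\<exists>t. 0 \<le> t \<and> t \<le> 1 \<and> (\<forall>z\<in>Z. 0 \<le> t * U z + (1 - t) * u j z)"
  proof (rule convexlike_minimax_two)
    fix z z' t assume z: "z \<in> Z" "z' \<in> Z" and t: "0 \<le> t" "t \<le> (1::real)"
    obtain y where y: "y \<in> Z" "\<forall>k\<in>insert j J. u k y = t * u k z + (1 - t) * u k z'"
      using insert.prems(1)[of z z' t] z t by auto
    have "U y = t * U z + (1 - t) * U z'"
      unfolding U_def sum_distrib_left sum.distrib[symmetric]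
    proof (intro sum.cong refl)
      fix k assume "k \<in> J"
      then have "u k y = t * u k z + (1 - t) * u k z'" using y(2) by blast
      then have "w k * u k y = w k * (t * u k z + (1 - t) * u k z')" by (rule arg_cong)
      then show "w k * u k y = t * (w k * u k z) + (1 - t) * (w k * u k z')" by (simp add: algebra_simps)
    qed
    then show "\<exists>y\<in>Z. U y = t * U z + (1 - t) * U z' \<and> u j y = t * u j z + (1 - t) * u j z'"
      using y by blast
  next
    fix z assume "z \<in> Z"
    then show "0 \<le> U z \<or> 0 \<le> u j z" using w(3) by (auto simp: U_def Z'_def not_less)
  qed
  then obtain t where t: "0 \<le> t" "t \<le> 1" "\<forall>z\<in>Z. 0 \<le> t * U z + (1 - t) * u j z" by blast
  define w' where "w' k = (if k = j then 1 - t else t * w k)" for k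
  have w'J: "(\<Sum>k\<in>J. w' k * x k) = t * (\<Sum>k\<in>J. w k * x k)" for x
    unfolding sum_distrib_left using insert.hyps by (intro sum.cong) (auto simp: w'_def)
  have "(\<Sum>k\<in>insert j J. w' k * x k) = t * (\<Sum>k\<in>J. w k * x k) + (1 - t) * x j" for x
    using insert.hyps by (simp add: w'J) (simp add: w'_def)
  note s = this
  have "(\<Sum>k\<in>insert j J. w' k) = 1" using s[of "\<lambda>_. 1"] w(2) by simp
  moreover have "\<forall>k\<in>insert j J. 0 \<le> w' k" using w t by (auto simp: w'_def)
  moreover have "\<forall>z\<in>Z. 0 \<le> (\<Sum>k\<in>insert j J. w' k * u k z)" using t(3) unfolding s U_def by blast
  ultimately show ?case by blast
qed

text \<open>The strict inequality makes the sets where u pays more than v open; they cover the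
  compact parameter set, so finitely many u suffice and the finite case applies. \<open>rep\<close>
  has to describe the points of Z only up to equality of all pay-offs.\<close>

lemma compact_minimax:
  fixes pay :: "'u \<Rightarrow> 'z \<Rightarrow> real" and rep :: "'t::topological_space \<Rightarrow> 'z"
  assumes \<Theta>: "compact \<Theta>" and Z: "Z \<noteq> {}"
    and cont: "\<And>u. u \<in> U \<Longrightarrow> continuous_on UNIV (\<lambda>\<theta>. pay u (rep \<theta>))"
    and repZ: "\<And>\<theta>. \<theta> \<in> \<Theta> \<Longrightarrow> \<exists>z\<in>Z. \<forall>u\<in>U. pay u z = pay u (rep \<theta>)"
    and Zrep: "\<And>z. z \<in> Z \<Longrightarrow> \<exists>\<theta>\<in>\<Theta>. \<forall>u\<in>U. pay u (rep \<theta>) = pay u z"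
    and cv: "\<And>z z' t. z \<in> Z \<Longrightarrow> z' \<in> Z \<Longrightarrow> 0 \<le> t \<Longrightarrow> t \<le> 1 \<Longrightarrow>
      \<exists>y\<in>Z. \<forall>u\<in>U. pay u y = t * pay u z + (1 - t) * pay u z'"
    and gt: "\<And>z. z \<in> Z \<Longrightarrow> \<exists>u\<in>U. v < pay u z"
  shows "\<exists>F w. finite F \<and> F \<subseteq> U \<and> (\<forall>u\<in>F. 0 \<le> w u) \<and> (\<Sum>u\<in>F. w u) = 1 \<and>
     (\<forall>z\<in>Z. v \<le> (\<Sum>u\<in>F. w u * pay u z))"
proof -
  have op: "open {\<theta>. v < pay u (rep \<theta>)}" if "u \<in> U" for u
    using open_Collect_less[OF continuous_on_const cont[OF that]] .
  have "\<Theta> \<subseteq> (\<Union>u\<in>U. {\<theta>. v < pay u (rep \<theta>)})"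
  proof
    fix \<theta> assume "\<theta> \<in> \<Theta>"
    then obtain z where "z \<in> Z" "\<forall>u\<in>U. pay u z = pay u (rep \<theta>)" using repZ by blast
    then show "\<theta> \<in> (\<Union>u\<in>U. {\<theta>. v < pay u (rep \<theta>)})" using gt[of z] by auto
  qed
  then obtain F where F: "F \<subseteq> U" "finite F" "\<Theta> \<subseteq> (\<Union>u\<in>F. {\<theta>. v < pay u (rep \<theta>)})"
    using compactE_image[OF \<Theta>, of U "\<lambda>u. {\<theta>. v < pay u (rep \<theta>)}"] op by metis
  have ge: "\<exists>u\<in>F. 0 \<le> pay u z - v" if z: "z \<in> Z" for z
  proof -
    obtain \<theta> where th: "\<theta> \<in> \<Theta>" "\<forall>u\<in>U. pay u (rep \<theta>) = pay u z" using Zrep[OF z] by blast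
    then obtain u where "u \<in> F" "v < pay u (rep \<theta>)" using F(3) by blast
    then show ?thesis using th F(1) by (intro bexI[of _ u]) auto
  qed
  have "F \<noteq> {}" using ge Z by blast
  have "\<exists>w. (\<forall>u\<in>F. 0 \<le> w u) \<and> (\<Sum>u\<in>F. w u) = 1 \<and> (\<forall>z\<in>Z. 0 \<le> (\<Sum>u\<in>F. w u * (pay u z - v)))"
  proof (rule convexlike_minimax_finite[OF F(2) \<open>F \<noteq> {}\<close> _ ge])
    fix z z' t assume "z \<in> Z" "z' \<in> Z" "0 \<le> t" "t \<le> (1::real)"
    then obtain y where y: "y \<in> Z" "\<forall>u\<in>U. pay u y = t * pay u z + (1 - t) * pay u z'" using cv by meson
    then show "\<exists>y\<in>Z. \<forall>j\<in>F. pay j y - v = t * (pay j z - v) + (1 - t) * (pay j z' - v)"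
      using F(1) by (intro bexI[of _ y]) (auto simp: algebra_simps)
  qed
  then obtain w where w: "\<forall>u\<in>F. 0 \<le> w u" "(\<Sum>u\<in>F. w u) = 1" "\<forall>z\<in>Z. 0 \<le> (\<Sum>u\<in>F. w u * (pay u z - v))" by blast
  have "(\<Sum>u\<in>F. w u * (pay u z - v)) = (\<Sum>u\<in>F. w u * pay u z) - v" for z
    using w(2) by (simp add: right_diff_distrib sum_subtractf sum_distrib_right[symmetric])
  then show ?thesis using w F by (intro exI[of _ F] exI[of _ w]) auto
qed

text \<open>More than \<open>card I + 1\<close> points admit a nontrivial relation that preserves
  total mass and all moments. Moving the weights along it until the first one vanishes removes a
  point.\<close>

lemma caratheodory_moments:
  fixes \<psi> :: "'i \<Rightarrow> 'x \<Rightarrow> real"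
  assumes "finite I" "finite S" "\<And>x. x \<in> S \<Longrightarrow> 0 \<le> w x" "(\<Sum>x\<in>S. w x) = 1"
  shows "\<exists>S' w'. S' \<subseteq> S \<and> card S' \<le> Suc (card I) \<and> (\<forall>x\<in>S'. 0 \<le> w' x) \<and> (\<Sum>x\<in>S'. w' x) = 1 \<and>
     (\<forall>i\<in>I. (\<Sum>x\<in>S'. w' x * \<psi> i x) = (\<Sum>x\<in>S. w x * \<psi> i x))"
  using assms(2-4)
proof (induction "card S" arbitrary: S w rule: less_induct)
  case less
  show ?case
  proof (cases "card S \<le> Suc (card I)")
    case True
    then show ?thesis using less.prems by (intro exI[of _ S] exI[of _ w]) auto
  next
    case False
    have "card (insert None (Some ` I)) < card S" using False assms(1) by (simp add: card_image)
    then obtain c where c: "\<exists>x\<in>S. c x \<noteq> 0"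
        "\<forall>i\<in>insert None (Some ` I). (\<Sum>x\<in>S. c x * (case i of None \<Rightarrow> 1 | Some i \<Rightarrow> \<psi> i x)) = 0"
      using homogeneous_system_nontrivial[of "insert None (Some ` I)" S
          "\<lambda>i x. case i of None \<Rightarrow> 1 | Some i \<Rightarrow> \<psi> i x"] assms(1) less.prems(1) by auto
    have c1: "(\<Sum>x\<in>S. c x) = 0" and c2: "\<And>i. i \<in> I \<Longrightarrow> (\<Sum>x\<in>S. c x * \<psi> i x) = 0" using c(2) by auto
    define S1 where "S1 = {x\<in>S. c x > 0}"
    have "S1 \<noteq> {}"
    proof
      assume "S1 = {}"
      then have "\<forall>x\<in>S. 0 \<le> - c x" by (auto simp: S1_def not_less)
      then have "\<forall>x\<in>S. - c x = 0"
        using sum_nonneg_eq_0_iff[OF less.prems(1), of "\<lambda>x. - c x"] c1 by (simp add: sum_negf)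
      then show False using c(1) by auto
    qed
    \<comment> \<open>The smallest ratio of weight to coefficient, over positive coefficients, is
      the largest step that keeps all weights nonnegative.\<close>
    then obtain x0 where x0: "x0 \<in> S1" "\<And>x. x \<in> S1 \<Longrightarrow> w x0 / c x0 \<le> w x / c x"
      using less.prems(1) arg_min_if_finite[of S1 "\<lambda>x. w x / c x"] by (force simp: S1_def not_less)
    define th where "th = w x0 / c x0"
    have x0S: "x0 \<in> S" "c x0 > 0" using x0 by (auto simp: S1_def)
    have th: "th \<ge> 0" using x0S less.prems(2)[of x0] by (simp add: th_def)
    define w' where "w' x = w x - th * c x" for x
    have w'0: "w' x0 = 0" using x0S by (simp add: w'_def th_def)
    have w'n: "0 \<le> w' x" if x: "x \<in> S" for x
    proof (cases "c x > 0")
      case True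
      then have "th \<le> w x / c x" using x0(2)[of x] x by (simp add: S1_def th_def)
      then show ?thesis using True by (simp add: w'_def pos_le_divide_eq)
    next
      case False
      then have "th * c x \<le> 0" using th by (simp add: mult_nonneg_nonpos)
      then show ?thesis using less.prems(2)[OF x] by (simp add: w'_def)
    qed
    have split: "(\<Sum>x\<in>S - {x0}. w' x * f x) = (\<Sum>x\<in>S. w x * f x) - th * (\<Sum>x\<in>S. c x * f x)" for f
    proof -
      have "(\<Sum>x\<in>S - {x0}. w' x * f x) = (\<Sum>x\<in>S. w' x * f x)"
        using less.prems(1) x0S w'0 by (subst sum.remove[of S x0]) auto
      then show ?thesis by (simp add: w'_def left_diff_distrib sum_subtractf sum_distrib_left mult.assoc)
    qed
    have "card (S - {x0}) < card S" using less.prems(1) x0S(1) by (rule card_Diff1_less)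
    moreover have "(\<Sum>x\<in>S - {x0}. w' x) = 1" using split[of "\<lambda>_. 1"] c1 less.prems(3) by simp
    ultimately obtain S' w'' where S': "S' \<subseteq> S - {x0}" "card S' \<le> Suc (card I)" "\<forall>x\<in>S'. 0 \<le> w'' x" "(\<Sum>x\<in>S'. w'' x) = 1"
      "\<forall>i\<in>I. (\<Sum>x\<in>S'. w'' x * \<psi> i x) = (\<Sum>x\<in>S - {x0}. w' x * \<psi> i x)"
      using less.hyps[of "S - {x0}" w'] less.prems(1) w'n by auto
    moreover have "(\<Sum>x\<in>S - {x0}. w' x * \<psi> i x) = (\<Sum>x\<in>S. w x * \<psi> i x)" if "i \<in> I" for i
      using split[of "\<psi> i"] c2[OF that] by simp
    ultimately show ?thesis by (intro exI[of _ S'] exI[of _ w'']) auto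
  qed
qed

text \<open>The number of points is made constant by padding with weight 0 and a repeated point, so
  that all mixtures are parametrised by one product space.\<close>

lemma caratheodory_indexed:
  fixes \<psi> :: "'i \<Rightarrow> 'x \<Rightarrow> real"
  assumes "finite I" "finite S" "\<And>x. x \<in> S \<Longrightarrow> 0 \<le> w x" "(\<Sum>x\<in>S. w x) = 1"
  shows "\<exists>(a::nat \<Rightarrow> real) (y::nat \<Rightarrow> 'x). (\<forall>k. 0 \<le> a k \<and> a k \<le> 1) \<and> (\<Sum>k<Suc (card I). a k) = 1 \<and> (\<forall>k. y k \<in> S) \<and>
     (\<forall>i\<in>I. (\<Sum>k<Suc (card I). a k * \<psi> i (y k)) = (\<Sum>x\<in>S. w x * \<psi> i x))"
proof -
  obtain S' w' where S': "S' \<subseteq> S" "card S' \<le> Suc (card I)" "\<forall>x\<in>S'. 0 \<le> w' x" "(\<Sum>x\<in>S'. w' x) = 1"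
     "\<forall>i\<in>I. (\<Sum>x\<in>S'. w' x * \<psi> i x) = (\<Sum>x\<in>S. w x * \<psi> i x)"
    using caratheodory_moments[OF assms, of \<psi>] by blast
  have fS': "finite S'" using S'(1) assms(2) finite_subset by blast
  obtain x0 where x0: "x0 \<in> S'" using S'(4) by fastforce
  obtain b where b: "bij_betw b {..<card S'} S'"
    using ex_bij_betw_nat_finite[OF fS'] by (auto simp: atLeast0LessThan)
  define a where "a k = (if k < card S' then w' (b k) else 0)" for k
  define y where "y k = (if k < card S' then b k else x0)" for k
  have bS: "b k \<in> S'" if "k < card S'" for k using b that by (auto simp: bij_betw_def)
  have sum: "(\<Sum>k<Suc (card I). a k * f (y k)) = (\<Sum>x\<in>S'. w' x * f x)" for f :: "'x \<Rightarrow> real"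
  proof -
    have "(\<Sum>k<Suc (card I). a k * f (y k)) = (\<Sum>k<card S'. a k * f (y k))"
      using S'(2) by (intro sum.mono_neutral_right) (auto simp: a_def)
    also have "\<dots> = (\<Sum>k<card S'. w' (b k) * f (b k))" by (intro sum.cong) (auto simp: a_def y_def)
    also have "\<dots> = (\<Sum>x\<in>S'. w' x * f x)" by (rule sum.reindex_bij_betw[OF b])
    finally show ?thesis .
  qed
  have le1: "w' x \<le> 1" if "x \<in> S'" for x
    using member_le_sum[of x S' w'] that S'(3,4) fS' by auto
  have "0 \<le> a k \<and> a k \<le> 1" for k using S'(3) bS le1 by (auto simp: a_def)
  moreover have "y k \<in> S" for k using bS x0 S'(1) by (auto simp: y_def)
  moreover have "(\<Sum>k<Suc (card I). a k) = 1" using sum[of "\<lambda>_. 1"] S'(4) by simp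
  ultimately show ?thesis using sum S'(5) by (intro exI[of _ a] exI[of _ y]) auto
qed

text \<open>Tychonoff's theorem. Operators are functions on all pairs of lists and carry the product
  topology, so their compactness is not literally that of a finite-dimensional space.\<close>

lemma compact_pointwise:
  fixes K :: "'i \<Rightarrow> 'a::topological_space set"
  assumes "\<And>i. compact (K i)"
  shows "compact {f. \<forall>i. f i \<in> K i}"
proof -
  have "compactin (product_topology (\<lambda>i. euclidean) UNIV) (PiE UNIV K)"
    using assms by (simp add: compactin_PiE)
  moreover have "PiE UNIV K = {f. \<forall>i. f i \<in> K i}" by (auto simp: PiE_def Pi_def)
  ultimately show ?thesis by (simp add: euclidean_product_topology)
qed

section \<open>Operators on tensor powers\<close>

lemma finite_basis [simp]: "finite (basis n :: 'd::finite list set)"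
  unfolding basis_def using finite_lists_length_eq[of "UNIV :: 'd set" n] by simp

lemma mem_basis [simp]: "xs \<in> basis n \<longleftrightarrow> length xs = n"
  by (simp add: basis_def)

lemma hermitian_iff: "hermitian n A \<longleftrightarrow> is_op n A \<and> herm_on (basis n) A"
proof
  assume h: "is_op n A \<and> herm_on (basis n) A"
  show "hermitian n A"
    unfolding hermitian_def
  proof (intro conjI allI)
    fix xs ys
    show "A ys xs = cnj (A xs ys)"
    proof (cases "length xs = n \<and> length ys = n")
      case True
      then have "xs \<in> basis n" "ys \<in> basis n" by simp_all
      then show ?thesis using h unfolding herm_on_def by blast
    next
      case False
      then have "A ys xs = 0" "A xs ys = 0" using h unfolding is_op_def by blast+
      then show ?thesis by simp
    qed
  qed (use h in simp)
next
  assume "hermitian n A"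
  then show "is_op n A \<and> herm_on (basis n) A" unfolding hermitian_def herm_on_def by blast
qed

lemma psd_iff: "psd n A \<longleftrightarrow> is_op n A \<and> psd_on (basis n) A"
proof -
  have "(\<Sum>xs\<in>basis n. \<Sum>ys\<in>basis n. cnj (v xs) * A xs ys * v ys) = ip (basis n) v (mv (basis n) A v)" for v
    by (simp add: ip_def mv_def sum_distrib_left mult.assoc)
  then show ?thesis by (auto simp: psd_def psd_on_def hermitian_iff)
qed

lemma mvec_eq_mv: "mvec n A v = mv (basis n) A v"
  by (simp add: mvec_def mv_def)

lemma eigendecomp_iff: "eigendecomp n A l e \<longleftrightarrow> eigs (basis n) A l e"
  by (simp add: eigendecomp_def eigs_def onb_def ip_def mvec_eq_mv)

definition trp :: "nat \<Rightarrow> 'd op \<Rightarrow> 'd op \<Rightarrow> complex" where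
  "trp n A B = (\<Sum>x\<in>basis n. \<Sum>y\<in>basis n. A x y * B y x)"

lemma trace_mmul: "trace n (mmul n A B) = trp n A B"
  by (simp add: trace_def mmul_def trp_def)

lemma trp_mminus: "trp n A (mminus n B C) = trp n A B - trp n A C"
  by (simp add: trp_def mminus_def sum_subtractf algebra_simps)

lemma trp_ident: "trp n A (ident n :: 'd::finite op) = trace n A"
proof -
  have "trp n A (ident n) = (\<Sum>x\<in>basis n. \<Sum>y\<in>basis n. if y = x then A x x else 0)"
    unfolding trp_def by (intro sum.cong refl) (auto simp: ident_def)
  then show ?thesis by (simp add: trace_def)
qed

definition mlogf :: "('d list \<Rightarrow> real) \<Rightarrow> ('d list \<Rightarrow> 'd vec) \<Rightarrow> nat \<Rightarrow> 'd op" where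
  "mlogf l e n = (\<lambda>xs ys. if length xs = n \<and> length ys = n
        then (\<Sum>i\<in>basis n. complex_of_real (lnz (l i)) * e i xs * cnj (e i ys)) else 0)"

text \<open>Exposes the eigenbasis chosen inside \<open>mfun\<close>, from which arguments about
  \<open>mlog\<close> can start.\<close>

lemma mlog_eigs:
  fixes A :: "'d::finite op"
  assumes "psd n A"
  shows "\<exists>l e. eigs (basis n) A l e \<and> mlog n A = mlogf l e n"
proof -
  have "\<exists>p. eigendecomp n A (fst p) (snd p)"
    using eigenbasis_exists[of "basis n" A] assms
    by (auto simp: psd_iff psd_on_def eigendecomp_iff)
  then have s: "eigendecomp n A (fst (SOME p. eigendecomp n A (fst p) (snd p))) (snd (SOME p. eigendecomp n A (fst p) (snd p)))"
    by (rule someI_ex)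
  obtain l e where le: "(SOME p. eigendecomp n A (fst p) (snd p)) = (l, e)" by (cases "SOME p. eigendecomp n A (fst p) (snd p)")
  show ?thesis
  proof (intro exI[of _ l] exI[of _ e] conjI)
    show "eigs (basis n) A l e" using s unfolding le by (simp add: eigendecomp_iff)
    show "mlog n A = mlogf l e n" unfolding mlog_def mfun_def le mlogf_def lnz_def by simp
  qed
qed

lemma trp_mlogf:
  fixes R :: "'d::finite op"
  shows "trp n R (mlogf l e n) = (\<Sum>i\<in>basis n. complex_of_real (lnz (l i)) * ip (basis n) (e i) (mv (basis n) R (e i)))"
  unfolding eigs_trace_fun[where h="\<lambda>x. complex_of_real (lnz x)"]
  by (simp add: trp_def mlogf_def)

lemma trp_eigs:
  fixes A :: "'d::finite op"
  assumes "eigs (basis n) A l e"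
  shows "trp n A B = (\<Sum>i\<in>basis n. complex_of_real (l i) * ip (basis n) (e i) (mv (basis n) B (e i)))"
proof -
  have "trp n A B = (\<Sum>x\<in>basis n. \<Sum>y\<in>basis n. B x y * A y x)"
    unfolding trp_def by (subst sum.swap) (simp add: mult.commute)
  also have "\<dots> = (\<Sum>x\<in>basis n. \<Sum>y\<in>basis n. B x y * (\<Sum>i\<in>basis n. complex_of_real (l i) * e i y * cnj (e i x)))"
    by (intro sum.cong refl arg_cong2[of _ _ _ _ "(*)"] eigs_decomp[OF finite_basis assms])
  finally show ?thesis unfolding eigs_trace_fun[where h=complex_of_real] .
qed

lemma psd_on_vanishing:
  assumes I: "finite I" and \<rho>: "psd_on I \<rho>" and v: "Re (ip I v (mv I \<rho> v)) = 0"
  shows "mv I \<rho> v = (\<lambda>_. 0)"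
proof -
  have h: "herm_on I \<rho>" using \<rho> by (simp add: psd_on_def)
  obtain e p where e: "eigs I \<rho> p e" using eigenbasis_exists[OF I h] by blast
  have oe: "onb I e" using e by (simp add: eigs_def)
  have "(\<Sum>i\<in>I. p i * (cmod (ip I (e i) v))\<^sup>2) = 0"
    using v unfolding eigs_quadratic[OF I h e] by simp
  then have z: "p i * (cmod (ip I (e i) v))\<^sup>2 = 0" if "i \<in> I" for i
    using psd_eigenvalue_nonneg[OF I \<rho> e] that I by (subst (asm) sum_nonneg_eq_0_iff) auto
  have "ip I (e i) (mv I \<rho> v) = 0" if "i \<in> I" for i
    using z[OF that] e that by (auto simp: mv_adjoint[OF h] eigs_def ip_scale_left)
  then have "mv I \<rho> v x = 0" if "x \<in> I" for x
    using onb_expand[OF I oe that, of "mv I \<rho> v"] by simp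
  then show ?thesis by (auto simp: mv_def fun_eq_iff)
qed

lemma supp_subset_iff:
  fixes \<rho> \<sigma> :: "'d::finite op"
  assumes \<rho>: "psd n \<rho>" and \<sigma>: "psd n \<sigma>" and f: "eigs (basis n) \<sigma> q f"
  shows "supp n \<rho> \<subseteq> supp n \<sigma> \<longleftrightarrow>
    (\<forall>j\<in>basis n. q j = 0 \<longrightarrow> Re (ip (basis n) (f j) (mv (basis n) \<rho> (f j))) = 0)"
proof -
  let ?I = "basis n :: 'd list set"
  have hr: "herm_on ?I \<rho>" and hs: "herm_on ?I \<sigma>" and pr: "psd_on ?I \<rho>"
    using \<rho> \<sigma> by (simp_all add: psd_iff psd_on_def)
  have of: "onb ?I f" using f by (simp add: eigs_def)
  show ?thesis
  proof
    assume sub: "supp n \<rho> \<subseteq> supp n \<sigma>"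
    show "\<forall>j\<in>?I. q j = 0 \<longrightarrow> Re (ip ?I (f j) (mv ?I \<rho> (f j))) = 0"
    proof (intro ballI impI)
      fix j :: "'d list" assume j: "j \<in> ?I" "q j = 0"
      have "mv ?I \<rho> (f j) \<in> supp n \<sigma>" using sub by (auto simp: supp_def mvec_eq_mv)
      then obtain v where v: "mv ?I \<rho> (f j) = mv ?I \<sigma> v" by (auto simp: supp_def mvec_eq_mv)
      have "mv ?I \<sigma> (f j) = (\<lambda>x. complex_of_real (q j) * f j x)" using f j(1) unfolding eigs_def by blast
      then have "ip ?I (f j) (mv ?I \<rho> (f j)) = 0"
        unfolding v mv_adjoint[OF hs] using j(2) by (simp add: ip_def)
      then show "Re (ip ?I (f j) (mv ?I \<rho> (f j))) = 0" by simp
    qed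
  next
    assume z: "\<forall>j\<in>?I. q j = 0 \<longrightarrow> Re (ip ?I (f j) (mv ?I \<rho> (f j))) = 0"
    show "supp n \<rho> \<subseteq> supp n \<sigma>"
    proof
      fix u assume "u \<in> supp n \<rho>"
      then obtain v where u: "u = mv ?I \<rho> v" by (auto simp: supp_def mvec_eq_mv)
      define c where "c j = ip ?I (f j) u" for j
      have c0: "c j = 0" if "j \<in> ?I" "q j = 0" for j
      proof -
        have "mv ?I \<rho> (f j) = (\<lambda>_. 0)" using psd_on_vanishing[OF _ pr] z that by simp
        then show ?thesis unfolding c_def u mv_adjoint[OF hr] by (simp add: ip_def)
      qed
      \<comment> \<open>A preimage of u under \<sigma>, by inverting the eigenvalues. For q_j = 0
        the quotient is 0, which is right because c_j = 0 by \<open>c0\<close>.\<close>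
      define w where "w = (\<lambda>x. \<Sum>j\<in>?I. (c j / complex_of_real (q j)) * f j x)"
      have "mv ?I \<sigma> w = (\<lambda>x. \<Sum>j\<in>?I. (c j / complex_of_real (q j)) * mv ?I \<sigma> (f j) x)"
        unfolding w_def by (rule mv_sum_scale)
      also have "\<dots> = (\<lambda>x. \<Sum>j\<in>?I. c j * f j x)"
      proof (intro ext sum.cong refl)
        fix x j assume j: "j \<in> ?I"
        then have "mv ?I \<sigma> (f j) = (\<lambda>x. complex_of_real (q j) * f j x)" using f unfolding eigs_def by blast
        then show "(c j / complex_of_real (q j)) * mv ?I \<sigma> (f j) x = c j * f j x"
          using c0[OF j] by (cases "q j = 0") auto
      qed
      also have "\<dots> = u"
      proof
        fix x show "(\<Sum>j\<in>?I. c j * f j x) = u x"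
        proof (cases "x \<in> ?I")
          case True then show ?thesis using onb_expand[OF finite_basis of True, of u] by (simp add: c_def)
        next
          case False
          then show ?thesis using of by (auto simp: onb_def u mv_def)
        qed
      qed
      finally show "u \<in> supp n \<sigma>" by (auto simp: supp_def mvec_eq_mv)
    qed
  qed
qed

text \<open>Puts the relative entropy into the spectral form of the two entropy estimates above,
  with the support condition read off the kernel of \<sigma>.\<close>

lemma relent_eigs:
  fixes \<rho> \<sigma> :: "'d::finite op"
  assumes \<rho>: "density n \<rho>" and \<sigma>: "density n \<sigma>"
  shows "\<exists>p e q f. eigs (basis n) \<rho> p e \<and> (\<Sum>i\<in>basis n. p i) = 1 \<and> eigs (basis n) \<sigma> q f \<and> (\<Sum>i\<in>basis n. q i) = 1 \<and>
    relent n \<rho> \<sigma> = (if \<forall>j\<in>basis n. q j = 0 \<longrightarrow> Re (ip (basis n) (f j) (mv (basis n) \<rho> (f j))) = 0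
      then ereal ((\<Sum>i\<in>basis n. p i * lnz (p i)) - (\<Sum>j\<in>basis n. lnz (q j) * Re (ip (basis n) (f j) (mv (basis n) \<rho> (f j)))))
      else \<infinity>)"
proof -
  let ?I = "basis n :: 'd list set"
  have pr: "psd n \<rho>" and ps: "psd n \<sigma>" using \<rho> \<sigma> by (auto simp: density_def)
  obtain p e where e: "eigs ?I \<rho> p e" "mlog n \<rho> = mlogf p e n" using mlog_eigs[OF pr] by blast
  obtain q f where f: "eigs ?I \<sigma> q f" "mlog n \<sigma> = mlogf q f n" using mlog_eigs[OF ps] by blast
  have tr1: "(\<Sum>i\<in>?I. l i) = 1" if "eigs ?I A l g" "density n A" for A l g
  proof -
    have "complex_of_real (\<Sum>i\<in>?I. l i) = (\<Sum>i\<in>?I. ip ?I (g i) (mv ?I A (g i)))" by (simp add: eigs_ip[OF _ that(1)])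
    also have "\<dots> = trace n A" using onb_trace[of ?I g A] that(1) by (simp add: eigs_def trace_def)
    also have "\<dots> = 1" using that by (simp add: density_def)
    finally show ?thesis by (metis of_real_1 of_real_eq_iff)
  qed
  have "Re (trp n \<rho> (mlog n \<rho>)) = (\<Sum>i\<in>?I. p i * lnz (p i))"
    unfolding e(2) trp_mlogf by (simp add: eigs_ip[OF _ e(1)] mult.commute)
  moreover have "Re (trp n \<rho> (mlog n \<sigma>)) = (\<Sum>j\<in>?I. lnz (q j) * Re (ip ?I (f j) (mv ?I \<rho> (f j))))"
    unfolding f(2) trp_mlogf by simp
  ultimately have "Re (trace n (mmul n \<rho> (mminus n (mlog n \<rho>) (mlog n \<sigma>))))
    = (\<Sum>i\<in>?I. p i * lnz (p i)) - (\<Sum>j\<in>?I. lnz (q j) * Re (ip ?I (f j) (mv ?I \<rho> (f j))))"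
    unfolding trace_mmul trp_mminus by simp
  then show ?thesis
    using e f tr1[OF e(1) \<rho>] tr1[OF f(1) \<sigma>] supp_subset_iff[OF pr ps f(1)]
    by (intro exI[of _ p] exI[of _ e] exI[of _ q] exI[of _ f]) (simp add: relent_def)
qed

text \<open>Taken at w = 1 this is nonnegativity of the relative entropy. Taken at w = 1 / b, for b
  slightly above the error of the second kind, it gives the converse and replaces monotonicity under
  measurements.\<close>

lemma relent_ge_test:
  fixes \<rho> \<sigma> E :: "'d::finite op"
  assumes \<rho>: "density n \<rho>" and \<sigma>: "density n \<sigma>"
    and E: "loewner_le n (\<lambda>_ _. 0) E" "loewner_le n E (ident n)" and w: "w > 0"
  shows "ereal (ln w * Re (trp n \<rho> E) - (w - 1) * Re (trp n \<sigma> E)) \<le> relent n \<rho> \<sigma>"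
proof -
  let ?I = "basis n :: 'd list set"
  obtain p e q f where e: "eigs ?I \<rho> p e" "(\<Sum>i\<in>?I. p i) = 1" and f: "eigs ?I \<sigma> q f" "(\<Sum>i\<in>?I. q i) = 1"
    and D: "relent n \<rho> \<sigma> = (if \<forall>j\<in>?I. q j = 0 \<longrightarrow> Re (ip ?I (f j) (mv ?I \<rho> (f j))) = 0
      then ereal ((\<Sum>i\<in>?I. p i * lnz (p i)) - (\<Sum>j\<in>?I. lnz (q j) * Re (ip ?I (f j) (mv ?I \<rho> (f j)))))
      else \<infinity>)"
    using relent_eigs[OF \<rho> \<sigma>] by (elim exE conjE) (rule that)
  have pr: "psd_on ?I \<rho>" and ps: "psd_on ?I \<sigma>" using \<rho> \<sigma> by (auto simp: density_def psd_iff)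
  have hr: "herm_on ?I \<rho>" using pr by (simp add: psd_on_def)
  have isE: "is_op n E" using E by (simp add: loewner_le_def)
  have "mminus n E (\<lambda>_ _. 0) = E" using isE by (auto simp: mminus_def is_op_def fun_eq_iff)
  then have E0: "psd_on ?I E" using E(1) by (simp add: loewner_le_def psd_iff)
  then have hE: "herm_on ?I E" by (simp add: psd_on_def)
  have E1: "Re (ip ?I v (mv ?I E v)) \<le> Re (ip ?I v v)" for v
  proof -
    have "0 \<le> Re (ip ?I v (mv ?I (mminus n (ident n) E) v))"
      using E(2) by (simp add: loewner_le_def psd_iff psd_on_def)
    also have "ip ?I v (mv ?I (mminus n (ident n) E) v) = ip ?I v v - ip ?I v (mv ?I E v)"
    proof -
      have "(\<Sum>y\<in>?I. mminus n (ident n) E x y * v y) = v x - (\<Sum>y\<in>?I. E x y * v y)" if "x \<in> ?I" for x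
      proof -
        have "(\<Sum>y\<in>?I. mminus n (ident n) E x y * v y) = (\<Sum>y\<in>?I. (if y = x then v x else 0) - E x y * v y)"
          using that by (intro sum.cong) (auto simp: mminus_def ident_def algebra_simps)
        then show ?thesis using that by (simp add: sum_subtractf)
      qed
      then show ?thesis by (simp add: ip_def mv_def sum_subtractf right_diff_distrib)
    qed
    finally show ?thesis by simp
  qed
  show ?thesis
  proof (cases "\<forall>j\<in>?I. q j = 0 \<longrightarrow> Re (ip ?I (f j) (mv ?I \<rho> (f j))) = 0")
    case True
    have z: "ip ?I (f j) (mv ?I \<rho> (f j)) = 0" if "j \<in> ?I" "q j = 0" for j
      using True that unfolding eigs_quadratic[OF finite_basis hr e(1)] by simp
    have "ln w * (\<Sum>i\<in>?I. p i * Re (ip ?I (e i) (mv ?I E (e i)))) - (w - 1) * (\<Sum>j\<in>?I. q j * Re (ip ?I (f j) (mv ?I E (f j))))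
       \<le> (\<Sum>i\<in>?I. p i * lnz (p i)) - (\<Sum>j\<in>?I. lnz (q j) * Re (ip ?I (f j) (mv ?I \<rho> (f j))))"
    proof (rule entropy_difference_ge_test[OF finite_basis pr e(1) ps f(1) _ z hE _ E1 w])
      show "(\<Sum>i\<in>?I. p i) = (\<Sum>j\<in>?I. q j)" using e(2) f(2) by simp
      show "0 \<le> Re (ip ?I v (mv ?I E v))" for v using E0 unfolding psd_on_def by blast
    qed
    moreover have "Re (trp n \<rho> E) = (\<Sum>i\<in>?I. p i * Re (ip ?I (e i) (mv ?I E (e i))))"
      unfolding trp_eigs[OF e(1)] by simp
    moreover have "Re (trp n \<sigma> E) = (\<Sum>i\<in>?I. q i * Re (ip ?I (f i) (mv ?I E (f i))))"
      unfolding trp_eigs[OF f(1)] by simp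
    ultimately show ?thesis unfolding D using True by simp
  next
    case False
    have "relent n \<rho> \<sigma> = \<infinity>" unfolding D using False by (rule if_not_P)
    then show ?thesis by simp
  qed
qed

lemma relent_le_measured:
  fixes \<rho> \<sigma> :: "'d::finite op"
  assumes \<rho>: "density n \<rho>" and \<sigma>: "density n \<sigma>"
    and bound: "\<And>g l. onb (basis n) g \<Longrightarrow> (\<Sum>a\<in>basis n. l a * Re (ip (basis n) (g a) (mv (basis n) \<rho> (g a)))) + 1
         - (\<Sum>a\<in>basis n. exp (l a) * Re (ip (basis n) (g a) (mv (basis n) \<sigma> (g a)))) \<le> v"
    and N: "\<And>q f. eigs (basis n) \<sigma> q f \<Longrightarrow> card (q ` basis n) \<le> N"
  shows "relent n \<rho> \<sigma> \<le> ereal (v + ln (real N))"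
proof -
  let ?I = "basis n :: 'd list set"
  obtain p e q f where e: "eigs ?I \<rho> p e" "(\<Sum>i\<in>?I. p i) = 1" and f: "eigs ?I \<sigma> q f" "(\<Sum>i\<in>?I. q i) = 1"
    and D: "relent n \<rho> \<sigma> = (if \<forall>j\<in>?I. q j = 0 \<longrightarrow> Re (ip ?I (f j) (mv ?I \<rho> (f j))) = 0
      then ereal ((\<Sum>i\<in>?I. p i * lnz (p i)) - (\<Sum>j\<in>?I. lnz (q j) * Re (ip ?I (f j) (mv ?I \<rho> (f j)))))
      else \<infinity>)"
    using relent_eigs[OF \<rho> \<sigma>] by (elim exE conjE) (rule that)
  have pr: "psd_on ?I \<rho>" and ps: "psd_on ?I \<sigma>" using \<rho> \<sigma> by (auto simp: density_def psd_iff)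
  have of: "onb ?I f" using f by (simp add: eigs_def)
  have "\<forall>j\<in>?I. q j = 0 \<longrightarrow> Re (ip ?I (f j) (mv ?I \<rho> (f j))) = 0"
    using eigs_support_of_measured_bound[OF finite_basis pr f bound[OF of]] by blast
  moreover have "(\<Sum>i\<in>?I. p i * lnz (p i)) - (\<Sum>j\<in>?I. lnz (q j) * Re (ip ?I (f j) (mv ?I \<rho> (f j)))) \<le> v + ln (card (q ` ?I))"
    by (rule entropy_difference_le_measured[OF finite_basis pr e ps f bound])
  moreover have "ln (real (card (q ` ?I))) \<le> ln (real N)"
  proof -
    have "?I \<noteq> {}" using e(2) by auto
    then have "card (q ` ?I) > 0" by (simp add: card_gt_0_iff)
    then show ?thesis using N[OF f(1)] by (intro ln_mono) auto
  qed
  ultimately show ?thesis unfolding D by simp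
qed

section \<open>Permutations of tensor factors and joint types\<close>

lemma permute_list_basis:
  assumes "\<pi> permutes {..<n}"
  shows "bij_betw (permute_list n \<pi>) (basis n) (basis n)"
proof (rule bij_betw_byWitness[where f' = "permute_list n (inv \<pi>)"])
  have 1: "\<pi> i < n" "inv \<pi> i < n" if "i < n" for i
    using permutes_in_image[OF assms] permutes_in_image[OF permutes_inv[OF assms]] that by auto
  show "\<forall>a\<in>basis n. permute_list n (inv \<pi>) (permute_list n \<pi> a) = a"
    using 1 permutes_inverses[OF assms] by (auto simp: permute_list_def intro!: nth_equalityI)
  show "\<forall>a\<in>basis n. permute_list n \<pi> (permute_list n (inv \<pi>) a) = a"
    using 1 permutes_inverses[OF assms] by (auto simp: permute_list_def intro!: nth_equalityI)
qed (auto simp: permute_list_def)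

lemma length_permute_list [simp]: "length (permute_list n \<pi> xs) = n"
  by (simp add: permute_list_def)

text \<open>The multiset of pairs is a complete invariant of a matrix index under simultaneous
  permutation of row and column lists; it plays the role of a joint type.\<close>

lemma mset_zip_permutation:
  assumes "length xs = n" "length ys = n" "length xs' = n" "length ys' = n"
    and eq: "mset (zip xs ys) = mset (zip xs' ys')"
  shows "\<exists>\<pi>. \<pi> permutes {..<n} \<and> xs' = permute_list n \<pi> xs \<and> ys' = permute_list n \<pi> ys"
proof -
  obtain \<pi> where \<pi>: "\<pi> permutes {..<length (zip xs ys)}" "Permutations.permute_list \<pi> (zip xs ys) = zip xs' ys'"
    using mset_eq_permutation[OF eq[symmetric]] by blast
  have p: "\<pi> permutes {..<n}" using \<pi>(1) assms by simp
  have lt: "\<pi> i < n" if "i < n" for i using permutes_in_image[OF p] that by auto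
  have "zip xs' ys' ! i = (xs ! \<pi> i, ys ! \<pi> i)" if "i < n" for i
    unfolding \<pi>(2)[symmetric] using that assms lt[OF that] by (simp add: permute_list_nth[OF \<pi>(1)])
  then have "xs' ! i = xs ! \<pi> i" "ys' ! i = ys ! \<pi> i" if "i < n" for i
    using that assms by auto
  then show ?thesis using p assms
    by (intro exI[of _ \<pi>]) (auto simp: permute_list_def intro!: nth_equalityI)
qed

lemma eigs_permute:
  fixes \<sigma> :: "'d::finite op"
  assumes \<pi>: "\<pi> permutes {..<n}" and e: "eigs (basis n) \<sigma> q f"
    and inv: "\<And>x y. x \<in> basis n \<Longrightarrow> y \<in> basis n \<Longrightarrow> \<sigma> (permute_list n \<pi> x) (permute_list n \<pi> y) = \<sigma> x y"
  shows "eigs (basis n) \<sigma> q (\<lambda>j x. if x \<in> basis n then f j (permute_list n \<pi> x) else 0)"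
proof -
  let ?I = "basis n :: 'd list set"
  let ?P = "permute_list n \<pi> :: 'd list \<Rightarrow> 'd list"
  let ?f = "\<lambda>j x. if x \<in> ?I then f j (?P x) else 0"
  note b = permute_list_basis[OF \<pi>, where 'a='d]
  have "ip ?I (?f i) (?f j) = ip ?I (f i) (f j)" for i j
  proof -
    have "ip ?I (?f i) (?f j) = (\<Sum>x\<in>?I. cnj (f i (?P x)) * f j (?P x))" by (simp add: ip_def)
    also have "\<dots> = ip ?I (f i) (f j)" unfolding ip_def by (rule sum.reindex_bij_betw[OF b])
    finally show ?thesis .
  qed
  then have "onb ?I ?f" using e by (simp add: eigs_def onb_def)
  moreover have "mv ?I \<sigma> (?f j) = (\<lambda>x. complex_of_real (q j) * ?f j x)" if j: "j \<in> ?I" for j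
  proof
    fix x
    show "mv ?I \<sigma> (?f j) x = complex_of_real (q j) * ?f j x"
    proof (cases "x \<in> ?I")
      case True
      have "mv ?I \<sigma> (?f j) x = (\<Sum>y\<in>?I. \<sigma> x y * f j (?P y))" using True by (simp add: mv_def)
      also have "\<dots> = (\<Sum>y\<in>?I. \<sigma> (?P x) (?P y) * f j (?P y))"
        using True by (intro sum.cong refl) (simp add: inv)
      also have "\<dots> = (\<Sum>y\<in>?I. \<sigma> (?P x) y * f j y)" by (rule sum.reindex_bij_betw[OF b])
      also have "\<dots> = mv ?I \<sigma> (f j) (?P x)" by (simp add: mv_def)
      also have "\<dots> = complex_of_real (q j) * f j (?P x)" using e j by (simp add: eigs_def)
      finally show ?thesis using True by simp
    qed (simp add: mv_def)
  qed
  ultimately show ?thesis by (simp add: eigs_def)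
qed

text \<open>The method of types: a multiset of n pairs is determined by its multiplicities, and each
  of these lies between 0 and n.\<close>

lemma card_pair_types:
  "card ((\<lambda>(x, y). mset (zip x y)) ` (basis n \<times> basis n :: ('d::finite list \<times> 'd list) set))
     \<le> (n + 1) ^ (CARD('d) * CARD('d))"
proof -
  let ?T = "(\<lambda>(x, y). mset (zip x y)) ` (basis n \<times> basis n :: ('d list \<times> 'd list) set)"
  have inj: "inj_on count ?T" by (auto intro: inj_onI simp: count_inject)
  have "count ` ?T \<subseteq> PiE UNIV (\<lambda>_. {..n})"
  proof
    fix h assume "h \<in> count ` ?T"
    then obtain x y :: "'d list" where xy: "h = count (mset (zip x y))" "length x = n" "length y = n" by auto
    then have "size (mset (zip x y)) = n" by simp
    then have "h ab \<le> n" for ab using count_le_size[of "mset (zip x y)" ab] xy by simp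
    then show "h \<in> PiE UNIV (\<lambda>_. {..n})" by auto
  qed
  then have "card (count ` ?T) \<le> card (PiE (UNIV :: ('d \<times> 'd) set) (\<lambda>_. {..n}))"
    by (intro card_mono finite_PiE) auto
  also have "\<dots> = (n + 1) ^ (CARD('d) * CARD('d))" by (simp add: card_PiE)
  finally show ?thesis using card_image[OF inj] by simp
qed

text \<open>The spectral projections of a permutation-invariant operator are themselves
  permutation-invariant, so each is a function on joint types. They are linearly independent, hence
  no more numerous than the types.\<close>

lemma card_eigenvalues_symmetric:
  fixes \<sigma> :: "'d::finite op"
  assumes h: "herm_on (basis n) \<sigma>" and e: "eigs (basis n) \<sigma> q f"
    and inv: "\<And>x y x' y'. x \<in> basis n \<Longrightarrow> y \<in> basis n \<Longrightarrow> x' \<in> basis n \<Longrightarrow> y' \<in> basis n \<Longrightarrow>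
       mset (zip x y) = mset (zip x' y') \<Longrightarrow> \<sigma> x y = \<sigma> x' y'"
  shows "card (q ` basis n) \<le> (n + 1) ^ (CARD('d) * CARD('d))"
proof -
  let ?I = "basis n :: 'd list set"
  let ?T = "(\<lambda>(x, y). mset (zip x y)) ` (?I \<times> ?I)"
  have of: "onb ?I f" using e by (simp add: eigs_def)
  \<comment> \<open>The spectral projection for the eigenvalue s.\<close>
  define Pr where "Pr s x y = (\<Sum>j\<in>?I. (if q j = s then 1 else 0) * f j x * cnj (f j y))" for s x y
  have Pinv: "Pr s x y = Pr s x' y'"
    if xy: "x \<in> ?I" "y \<in> ?I" "x' \<in> ?I" "y' \<in> ?I" and m: "mset (zip x y) = mset (zip x' y')" for s x y x' y'
  proof -
    obtain \<pi> where \<pi>: "\<pi> permutes {..<n}" "x' = permute_list n \<pi> x" "y' = permute_list n \<pi> y"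
      using mset_zip_permutation[of x n y x' y'] xy m by auto
    have lt: "\<pi> i < n" if "i < n" for i using permutes_in_image[OF \<pi>(1)] that by auto
    have pinv: "\<sigma> (permute_list n \<pi> u) (permute_list n \<pi> v) = \<sigma> u v" if "u \<in> ?I" "v \<in> ?I" for u v
    proof (rule inv)
      have "zip (permute_list n \<pi> u) (permute_list n \<pi> v) = Permutations.permute_list \<pi> (zip u v)"
        using that lt by (auto simp: permute_list_def Permutations.permute_list_def intro!: nth_equalityI)
      then show "mset (zip (permute_list n \<pi> u) (permute_list n \<pi> v)) = mset (zip u v)"
        using that \<pi>(1) by simp
    qed (use that in auto)
    have "Pr s x y = (\<Sum>j\<in>?I. (if q j = s then 1 else 0)
        * (if x \<in> ?I then f j (permute_list n \<pi> x) else 0) * cnj (if y \<in> ?I then f j (permute_list n \<pi> y) else 0))"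
      unfolding Pr_def
      by (rule eigs_fun_unique[OF finite_basis h e eigs_permute[OF \<pi>(1) e pinv] xy(1,2), where h="\<lambda>t. if t = s then 1 else 0"])
    also have "\<dots> = Pr s x' y'" unfolding Pr_def \<pi> using xy by simp
    finally show ?thesis .
  qed
  have "\<not> card ?T < card (q ` ?I)"
  proof
    assume "card ?T < card (q ` ?I)"
    \<comment> \<open>One equation per joint type, evaluated at a representative pair of lists; by
      \<open>Pinv\<close> the choice of representative is immaterial.\<close>
    then obtain c where c: "\<exists>s\<in>q ` ?I. c s \<noteq> 0"
      "\<forall>t\<in>?T. (\<Sum>s\<in>q ` ?I. c s * (case (SOME xy. xy \<in> ?I \<times> ?I \<and> (case xy of (x, y) \<Rightarrow> mset (zip x y)) = t) of (x, y) \<Rightarrow> Pr s x y)) = 0"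
      using homogeneous_system_nontrivial[of ?T "q ` ?I"
         "\<lambda>t s. case (SOME xy. xy \<in> ?I \<times> ?I \<and> (case xy of (x, y) \<Rightarrow> mset (zip x y)) = t) of (x, y) \<Rightarrow> Pr s x y"]
      by auto
    have z: "(\<Sum>s\<in>q ` ?I. c s * Pr s x y) = 0" if xy: "x \<in> ?I" "y \<in> ?I" for x y
    proof -
      let ?t = "mset (zip x y)"
      obtain x' y' where s: "(SOME xy. xy \<in> ?I \<times> ?I \<and> (case xy of (x, y) \<Rightarrow> mset (zip x y)) = ?t) = (x', y')"
        by (cases "SOME xy. xy \<in> ?I \<times> ?I \<and> (case xy of (x, y) \<Rightarrow> mset (zip x y)) = ?t")
      have "\<exists>xy. xy \<in> ?I \<times> ?I \<and> (case xy of (x, y) \<Rightarrow> mset (zip x y)) = ?t" using xy by (intro exI[of _ "(x, y)"]) auto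
      then have "(x', y') \<in> ?I \<times> ?I \<and> (case (x', y') of (x, y) \<Rightarrow> mset (zip x y)) = ?t"
        unfolding s[symmetric] by (rule someI_ex)
      then have P: "Pr s x y = Pr s x' y'" for s by (intro Pinv xy) auto
      have "?t \<in> ?T" using xy by force
      with c(2) have "(\<Sum>s\<in>q ` ?I. c s * (case (SOME xy. xy \<in> ?I \<times> ?I \<and> (case xy of (x, y) \<Rightarrow> mset (zip x y)) = ?t) of (x, y) \<Rightarrow> Pr s x y)) = 0"
        by (rule bspec)
      then show ?thesis unfolding s P by simp
    qed
    obtain j0 where j0: "j0 \<in> ?I" "c (q j0) \<noteq> 0" using c(1) by auto
    have "c (q j0) * f j0 x = 0" if x: "x \<in> ?I" for x
    proof -
      have exp: "(\<Sum>s\<in>q ` ?I. c s * Pr s x y) = (\<Sum>j\<in>?I. c (q j) * f j x * cnj (f j y))" for y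
      proof -
        have "(\<Sum>s\<in>q ` ?I. c s * Pr s x y) = (\<Sum>j\<in>?I. \<Sum>s\<in>q ` ?I. if s = q j then c (q j) * f j x * cnj (f j y) else 0)"
          unfolding Pr_def sum_distrib_left by (subst sum.swap, intro sum.cong refl) (simp add: mult.assoc)
        then show ?thesis by simp
      qed
      \<comment> \<open>Applying the vanishing combination of projections to the eigenvector
        \<open>f j0\<close> isolates its coefficient.\<close>
      have "0 = (\<Sum>y\<in>?I. (\<Sum>s\<in>q ` ?I. c s * Pr s x y) * f j0 y)" using z x by simp
      also have "\<dots> = (\<Sum>j\<in>?I. c (q j) * f j x * ip ?I (f j) (f j0))"
        unfolding exp ip_def sum_distrib_right sum_distrib_left by (subst sum.swap) (simp add: mult.assoc)
      also have "\<dots> = (\<Sum>j\<in>?I. if j = j0 then c (q j0) * f j0 x else 0)"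
        using of j0(1) by (intro sum.cong refl) (auto simp: onb_def)
      finally show ?thesis using j0(1) by simp
    qed
    then have "f j0 x = 0" if "x \<in> ?I" for x using j0(2) that by simp
    then have "ip ?I (f j0) (f j0) = 0" by (simp add: ip_def)
    then show False using of j0(1) by (simp add: onb_def)
  qed
  then show ?thesis using card_pair_types[where 'd='d, of n] by linarith
qed

section \<open>Tensor products by concatenation of index lists\<close>

lemma basis_append_bij: "bij_betw (\<lambda>(x, y). x @ y) (basis n \<times> basis m) (basis (n + m))"
  by (rule bij_betw_byWitness[where f' = "\<lambda>x. (take n x, drop n x)"]) auto

lemma sum_basis_append: "(\<Sum>x\<in>basis (n + m). f x) = (\<Sum>x\<in>basis n. \<Sum>y\<in>basis m. f (x @ y))"
  using sum.reindex_bij_betw[OF basis_append_bij, of f n m]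
  by (simp add: sum.cartesian_product case_prod_unfold)

lemma basis_0 [simp]: "basis 0 = {[]}"
  by (auto simp: basis_def)

lemma trp_append:
  "trp (n + m) X Y = (\<Sum>x\<in>basis n. \<Sum>z\<in>basis m. \<Sum>y\<in>basis n. \<Sum>w\<in>basis m. X (x @ z) (y @ w) * Y (y @ w) (x @ z))"
  unfolding trp_def sum_basis_append ..

lemma trp_factor:
  fixes C :: "'d::finite op"
  assumes C: "\<And>x y z w. x \<in> basis n \<Longrightarrow> y \<in> basis n \<Longrightarrow> z \<in> basis m \<Longrightarrow> w \<in> basis m \<Longrightarrow> C (x @ z) (y @ w) = A x y * B z w"
    and C': "\<And>x y z w. x \<in> basis n \<Longrightarrow> y \<in> basis n \<Longrightarrow> z \<in> basis m \<Longrightarrow> w \<in> basis m \<Longrightarrow> C' (x @ z) (y @ w) = A' x y * B' z w"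
  shows "trp (n + m) C C' = trp n A A' * trp m B B'"
proof -
  have "trp (n + m) C C' = (\<Sum>x\<in>basis n. \<Sum>z\<in>basis m. \<Sum>y\<in>basis n. \<Sum>w\<in>basis m. (A x y * A' y x) * (B z w * B' w z))"
    unfolding trp_append by (intro sum.cong refl) (simp add: C C')
  also have "\<dots> = (\<Sum>x\<in>basis n. \<Sum>z\<in>basis m. (\<Sum>y\<in>basis n. A x y * A' y x) * (\<Sum>w\<in>basis m. B z w * B' w z))"
    by (simp add: sum_product)
  also have "\<dots> = trp n A A' * trp m B B'" unfolding trp_def by (simp add: sum_product)
  finally show ?thesis .
qed

text \<open>Diagonalising the second factor turns the quadratic form of the product at v into a sum
  of quadratic forms of A at the partial inner products u_a of v with the eigenvectors e_a, weighted
  by the nonnegative eigenvalues of B.\<close>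

lemma psd_on_factor:
  fixes C :: "'d::finite op"
  assumes A: "psd_on (basis n) A" and B: "psd_on (basis m) B"
    and C: "\<And>x y z w. x \<in> basis n \<Longrightarrow> y \<in> basis n \<Longrightarrow> z \<in> basis m \<Longrightarrow> w \<in> basis m \<Longrightarrow> C (x @ z) (y @ w) = A x y * B z w"
  shows "psd_on (basis (n + m)) C"
  unfolding psd_on_def
proof (intro conjI allI)
  have hA: "herm_on (basis n) A" and hB: "herm_on (basis m) B" using A B by (auto simp: psd_on_def)
  show "herm_on (basis (n + m)) C"
    unfolding herm_on_def
  proof (intro ballI)
    fix u v :: "'d list" assume uv: "u \<in> basis (n + m)" "v \<in> basis (n + m)"
    define x z y w where "x = take n u" and "z = drop n u" and "y = take n v" and "w = drop n v"
    have l: "x \<in> basis n" "z \<in> basis m" "y \<in> basis n" "w \<in> basis m" and e: "u = x @ z" "v = y @ w"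
      using uv by (auto simp: x_def z_def y_def w_def)
    have "A y x = cnj (A x y)" "B w z = cnj (B z w)" using hA hB l unfolding herm_on_def by blast+
    then show "C v u = cnj (C u v)" unfolding e using l by (simp only: C) simp
  qed
  fix v :: "'d vec"
  obtain e l where e: "eigs (basis m) B l e" using eigenbasis_exists[OF finite_basis hB] by blast
  define u where "u a x = (\<Sum>z\<in>basis m. cnj (e a z) * v (x @ z))" for a x
  have "ip (basis (n + m)) v (mv (basis (n + m)) C v)
      = (\<Sum>x\<in>basis n. \<Sum>z\<in>basis m. \<Sum>y\<in>basis n. \<Sum>w\<in>basis m. cnj (v (x @ z)) * (C (x @ z) (y @ w) * v (y @ w)))"
    unfolding ip_def mv_def by (simp add: sum_basis_append sum_distrib_left)
  also have "\<dots> = (\<Sum>x\<in>basis n. \<Sum>z\<in>basis m. \<Sum>y\<in>basis n. \<Sum>w\<in>basis m. \<Sum>a\<in>basis m.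
      complex_of_real (l a) * ((cnj (v (x @ z)) * e a z) * (A x y * (cnj (e a w) * v (y @ w)))))"
    by (intro sum.cong refl) (simp add: C eigs_decomp[OF finite_basis e] sum_distrib_left sum_distrib_right algebra_simps)
  also have "\<dots> = (\<Sum>a\<in>basis m. \<Sum>x\<in>basis n. \<Sum>z\<in>basis m. \<Sum>y\<in>basis n. \<Sum>w\<in>basis m.
      complex_of_real (l a) * ((cnj (v (x @ z)) * e a z) * (A x y * (cnj (e a w) * v (y @ w)))))"
  proof -
    have "(\<Sum>x\<in>basis n. \<Sum>z\<in>basis m. \<Sum>y\<in>basis n. \<Sum>w\<in>basis m. \<Sum>a\<in>basis m. f a x z y w)
       = (\<Sum>a\<in>basis m. \<Sum>x\<in>basis n. \<Sum>z\<in>basis m. \<Sum>y\<in>basis n. \<Sum>w\<in>basis m. f a x z y w)"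
      for f :: "'d list \<Rightarrow> 'd list \<Rightarrow> 'd list \<Rightarrow> 'd list \<Rightarrow> 'd list \<Rightarrow> complex"
    proof -
      have "(\<Sum>x\<in>basis n. \<Sum>z\<in>basis m. \<Sum>y\<in>basis n. \<Sum>w\<in>basis m. \<Sum>a\<in>basis m. f a x z y w)
          = (\<Sum>x\<in>basis n. \<Sum>z\<in>basis m. \<Sum>y\<in>basis n. \<Sum>a\<in>basis m. \<Sum>w\<in>basis m. f a x z y w)"
        by (intro sum.cong refl sum.swap)
      also have "\<dots> = (\<Sum>x\<in>basis n. \<Sum>z\<in>basis m. \<Sum>a\<in>basis m. \<Sum>y\<in>basis n. \<Sum>w\<in>basis m. f a x z y w)"
        by (intro sum.cong refl sum.swap)
      also have "\<dots> = (\<Sum>x\<in>basis n. \<Sum>a\<in>basis m. \<Sum>z\<in>basis m. \<Sum>y\<in>basis n. \<Sum>w\<in>basis m. f a x z y w)"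
        by (intro sum.cong refl sum.swap)
      also have "\<dots> = (\<Sum>a\<in>basis m. \<Sum>x\<in>basis n. \<Sum>z\<in>basis m. \<Sum>y\<in>basis n. \<Sum>w\<in>basis m. f a x z y w)"
        by (rule sum.swap)
      finally show ?thesis .
    qed
    then show ?thesis .
  qed
  also have "\<dots> = (\<Sum>a\<in>basis m. complex_of_real (l a) * ip (basis n) (u a) (mv (basis n) A (u a)))"
  proof (intro sum.cong refl)
    fix a :: "'d list"
    have "(\<Sum>x\<in>basis n. \<Sum>z\<in>basis m. \<Sum>y\<in>basis n. \<Sum>w\<in>basis m.
        complex_of_real (l a) * ((cnj (v (x @ z)) * e a z) * (A x y * (cnj (e a w) * v (y @ w)))))
      = complex_of_real (l a) * (\<Sum>x\<in>basis n. \<Sum>z\<in>basis m. (cnj (v (x @ z)) * e a z) * (\<Sum>y\<in>basis n. A x y * u a y))"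
      by (simp add: u_def sum_distrib_left)
    also have "\<dots> = complex_of_real (l a) * (\<Sum>x\<in>basis n. cnj (u a x) * (\<Sum>y\<in>basis n. A x y * u a y))"
      by (simp add: u_def[of a x for x] sum_distrib_right mult.commute)
    also have "\<dots> = complex_of_real (l a) * ip (basis n) (u a) (mv (basis n) A (u a))"
      by (simp add: ip_def mv_def)
    finally show "(\<Sum>x\<in>basis n. \<Sum>z\<in>basis m. \<Sum>y\<in>basis n. \<Sum>w\<in>basis m.
        complex_of_real (l a) * ((cnj (v (x @ z)) * e a z) * (A x y * (cnj (e a w) * v (y @ w)))))
      = complex_of_real (l a) * ip (basis n) (u a) (mv (basis n) A (u a))" .
  qed
  finally have "Re (ip (basis (n + m)) v (mv (basis (n + m)) C v)) = (\<Sum>a\<in>basis m. l a * Re (ip (basis n) (u a) (mv (basis n) A (u a))))"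
    by simp
  also have "\<dots> \<ge> 0"
    using psd_eigenvalue_nonneg[OF finite_basis B e] A by (intro sum_nonneg mult_nonneg_nonneg) (auto simp: psd_on_def)
  finally show "0 \<le> Re (ip (basis (n + m)) v (mv (basis (n + m)) C v))" .
qed

text \<open>A single form for the members of \<open>av_seq\<close> and, with a constant family, of
  \<open>iid_seq\<close>.\<close>

definition avop :: "nat \<Rightarrow> (nat \<Rightarrow> complex^'d^'d) \<Rightarrow> 'd op" where
  "avop n \<sigma>s = (\<lambda>xs ys. if length xs = n \<and> length ys = n then (\<Prod>i<n. \<sigma>s i $ (xs ! i) $ (ys ! i)) else 0)"

lemma av_seq_eq: "av_seq F n = {avop n \<sigma>s | \<sigma>s. \<forall>i<n. \<sigma>s i \<in> F}"
  by (simp add: av_seq_def avop_def)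

lemma tpow_op1: "tpow 1 n (op1 \<sigma>) = avop n (\<lambda>_. \<sigma>)"
proof -
  have "take 1 (drop j xs) = [xs ! j]" if "j < length xs" for xs :: "'a list" and j
    using that by (simp add: Cons_nth_drop_Suc[symmetric])
  then show ?thesis
    by (auto simp: tpow_def avop_def fun_eq_iff blk_def op1_def intro!: prod.cong)
qed

lemma iid_seq_eq: "iid_seq F n = {avop n (\<lambda>_. \<sigma>) | \<sigma>. \<sigma> \<in> F}"
  unfolding iid_seq_def tpow_op1 ..

lemma avop_append:
  assumes "x \<in> basis n" "y \<in> basis n" "z \<in> basis m" "w \<in> basis m"
  shows "avop (n + m) \<sigma>s (x @ z) (y @ w) = avop n \<sigma>s x y * avop m (\<lambda>i. \<sigma>s (n + i)) z w"
proof -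
  have "(\<Prod>i<n + m. \<sigma>s i $ ((x @ z) ! i) $ ((y @ w) ! i))
      = (\<Prod>i<n. \<sigma>s i $ (x ! i) $ (y ! i)) * (\<Prod>i<m. \<sigma>s (n + i) $ (z ! i) $ (w ! i))"
    using assms
  proof (subst prod.atLeastLessThan_concat[of 0 n "n + m", symmetric, simplified atLeast0LessThan], simp_all)
    have "(\<Prod>i = n..<n + m. \<sigma>s i $ ((x @ z) ! i) $ ((y @ w) ! i)) = (\<Prod>i<m. \<sigma>s (n + i) $ ((x @ z) ! (n + i)) $ ((y @ w) ! (n + i)))"
      by (rule prod.reindex_bij_witness[of _ "\<lambda>i. n + i" "\<lambda>i. i - n"]) auto
    then show "(\<Prod>i<n. \<sigma>s i $ ((x @ z) ! i) $ ((y @ w) ! i)) * (\<Prod>i = n..<n + m. \<sigma>s i $ ((x @ z) ! i) $ ((y @ w) ! i)) =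
      (\<Prod>i<n. \<sigma>s i $ (x ! i) $ (y ! i)) * (\<Prod>i<m. \<sigma>s (n + i) $ (z ! i) $ (w ! i))"
      using assms by (simp add: nth_append)
  qed
  then show ?thesis using assms by (simp add: avop_def)
qed

lemma avop_1: "avop 1 \<sigma>s = op1 (\<sigma>s 0)"
proof -
  have "xs ! 0 = hd xs" if "length xs = Suc 0" for xs :: "'a list" using that by (cases xs) auto
  then show ?thesis by (auto simp: avop_def op1_def fun_eq_iff)
qed

lemma density_avop:
  fixes \<sigma>s :: "nat \<Rightarrow> complex^'d::finite^'d"
  assumes "\<And>i. i < n \<Longrightarrow> \<sigma>s i \<in> states1"
  shows "density n (avop n \<sigma>s)"
  using assms
proof (induction n)
  case 0
  then show ?case
    by (auto simp: density_def psd_iff is_op_def avop_def trace_def psd_on_def herm_on_def ip_def mv_def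
        complex_norm_square[symmetric] mult.commute[of "cnj _"] simp del: of_real_power)
next
  case (Suc n)
  then have IH: "density n (avop n \<sigma>s)" by simp
  have one: "density 1 (avop 1 (\<lambda>i. \<sigma>s (n + i)))"
    unfolding avop_1 using Suc.prems[of n] by (simp add: states1_def)
  note ap = avop_append[of _ n _ _ 1 _ \<sigma>s]
  have "psd_on (basis (n + 1)) (avop (n + 1) \<sigma>s)"
  proof (rule psd_on_factor[where A = "avop n \<sigma>s" and B = "avop 1 (\<lambda>i. \<sigma>s (n + i))"])
    show "psd_on (basis n) (avop n \<sigma>s)" "psd_on (basis 1) (avop 1 (\<lambda>i. \<sigma>s (n + i)))"
      using IH one unfolding density_def psd_iff by blast+
  qed (rule ap)
  moreover have "trace (n + 1) (avop (n + 1) \<sigma>s) = trace n (avop n \<sigma>s) * trace 1 (avop 1 (\<lambda>i. \<sigma>s (n + i)))"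
    unfolding trace_def sum_basis_append sum_product by (intro sum.cong refl ap) auto
  moreover have "is_op (Suc n) (avop (Suc n) \<sigma>s)" by (auto simp: is_op_def avop_def)
  ultimately show ?case using IH one by (simp add: density_def psd_iff)
qed

lemma tpow_append:
  assumes "x \<in> basis (m * k)" "y \<in> basis (m * k)" "z \<in> basis k" "w \<in> basis k"
  shows "tpow k (Suc m) F (x @ z) (y @ w) = tpow k m F x y * F z w"
proof -
  have b: "blk k j (u @ v) = blk k j u" if "j < m" "length u = m * k" "length v = k" for j and u v :: "'a list"
  proof -
    have "j * k + k \<le> m * k" using that(1) by (metis Suc_leI add.commute mult_Suc mult_le_mono1)
    then show ?thesis using that by (simp add: blk_def)
  qed
  have b': "blk k m (u @ v) = v" if "length u = m * k" "length v = k" for u v :: "'a list"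
    using that by (simp add: blk_def)
  show ?thesis using assms by (simp add: tpow_def b b')
qed

lemma tpow_Suc_0:
  assumes "x \<in> basis k" "y \<in> basis k"
  shows "tpow k (Suc 0) F x y = F x y"
  using tpow_append[of "[]" 0 k "[]" x y F] assms by (simp add: tpow_def)

lemma avop_ptrace:
  fixes \<sigma>s :: "nat \<Rightarrow> complex^'d::finite^'d"
  assumes "\<And>i. i < m \<Longrightarrow> \<sigma>s (n + i) \<in> states1"
  shows "ptrace_last n m (avop (n + m) \<sigma>s) = avop n \<sigma>s"
proof (intro ext)
  fix x y :: "'d list"
  show "ptrace_last n m (avop (n + m) \<sigma>s) x y = avop n \<sigma>s x y"
  proof (cases "length x = n \<and> length y = n")
    case True
    then have "ptrace_last n m (avop (n + m) \<sigma>s) x y = (\<Sum>z\<in>basis m. avop n \<sigma>s x y * avop m (\<lambda>i. \<sigma>s (n + i)) z z)"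
      unfolding ptrace_last_def by (auto intro!: sum.cong avop_append)
    also have "\<dots> = avop n \<sigma>s x y * trace m (avop m (\<lambda>i. \<sigma>s (n + i)))" by (simp add: trace_def sum_distrib_left)
    also have "\<dots> = avop n \<sigma>s x y" using density_avop[of m "\<lambda>i. \<sigma>s (n + i)"] assms by (simp add: density_def)
    finally show ?thesis .
  qed (auto simp: ptrace_last_def avop_def)
qed

text \<open>Rewrites the value of a product effect so that exactly the operator of Axiom Q.IV
  appears.\<close>

lemma trp_tensor_ptrace:
  fixes \<rho> :: "'d::finite op"
  shows "trp (n + k) \<rho> (tensor n k X Y) = trp n (ptrace_last n k (mmul (n + k) \<rho> (tensor n k (ident n) Y))) X"
proof -
  have mm: "mmul (n + k) \<rho> (tensor n k (ident n) Y) (x @ z) (y @ z) = (\<Sum>w\<in>basis k. \<rho> (x @ z) (y @ w) * Y w z)"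
    if "x \<in> basis n" "y \<in> basis n" "z \<in> basis k" for x y z
  proof -
    have "mmul (n + k) \<rho> (tensor n k (ident n) Y) (x @ z) (y @ z)
       = (\<Sum>u\<in>basis n. \<Sum>w\<in>basis k. \<rho> (x @ z) (u @ w) * ((if u = y then 1 else 0) * Y w z))"
      using that unfolding mmul_def sum_basis_append
      by (simp add: tensor_def ident_def)
    also have "\<dots> = (\<Sum>u\<in>basis n. if u = y then (\<Sum>w\<in>basis k. \<rho> (x @ z) (y @ w) * Y w z) else 0)"
      by (intro sum.cong refl) auto
    finally show ?thesis using that by simp
  qed
  have "trp (n + k) \<rho> (tensor n k X Y)
      = (\<Sum>x\<in>basis n. \<Sum>z\<in>basis k. \<Sum>y\<in>basis n. \<Sum>w\<in>basis k. \<rho> (x @ z) (y @ w) * (X y x * Y w z))"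
    unfolding trp_append by (intro sum.cong refl) (simp add: tensor_def)
  also have "\<dots> = (\<Sum>x\<in>basis n. \<Sum>y\<in>basis n. \<Sum>z\<in>basis k. \<Sum>w\<in>basis k. \<rho> (x @ z) (y @ w) * (X y x * Y w z))"
    by (intro sum.cong refl sum.swap)
  also have "\<dots> = (\<Sum>x\<in>basis n. \<Sum>y\<in>basis n. (\<Sum>z\<in>basis k. mmul (n + k) \<rho> (tensor n k (ident n) Y) (x @ z) (y @ z)) * X y x)"
    by (intro sum.cong refl)
       (simp add: mm sum_distrib_left sum_distrib_right mult.assoc mult.commute mult.left_commute)
  also have "\<dots> = trp n (ptrace_last n k (mmul (n + k) \<rho> (tensor n k (ident n) Y))) X"
    by (simp add: trp_def ptrace_last_def)
  finally show ?thesis .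
qed

lemma mmul_tensor_ident:
  fixes \<rho> :: "'d::finite op"
  assumes "is_op (n + k) \<rho>"
  shows "mmul (n + k) \<rho> (tensor n k (ident n) (ident k)) = \<rho>"
proof (intro ext)
  fix x y :: "'d list"
  show "mmul (n + k) \<rho> (tensor n k (ident n) (ident k)) x y = \<rho> x y"
  proof (cases "length x = n + k \<and> length y = n + k")
    case True
    have "mmul (n + k) \<rho> (tensor n k (ident n) (ident k)) x y = (\<Sum>z\<in>basis (n + k). \<rho> x z * tensor n k (ident n) (ident k) z y)"
      using True by (simp add: mmul_def)
    also have "\<dots> = (\<Sum>z\<in>basis (n + k). if z = y then \<rho> x y else 0)"
    proof (intro sum.cong refl)
      fix z :: "'d list" assume z: "z \<in> basis (n + k)"
      have "z = y \<longleftrightarrow> take n z = take n y \<and> drop n z = drop n y" by (metis append_take_drop_id)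
      then show "\<rho> x z * tensor n k (ident n) (ident k) z y = (if z = y then \<rho> x y else 0)"
        using True z by (auto simp: tensor_def ident_def)
    qed
    finally show ?thesis using True by simp
  next
    case False
    then show ?thesis using assms by (auto simp: mmul_def is_op_def)
  qed
qed

lemma trace_ptrace: "trace n (ptrace_last n k X) = trace (n + k) X"
  by (simp add: trace_def ptrace_last_def sum_basis_append)

lemma rotate_permutes:
  fixes n k :: nat
  shows "(\<lambda>i. if i < n then (i + k) mod n else i) permutes {..<n}"
proof (cases "n = 0")
  case False
  then have n: "n > 0" by simp
  show ?thesis
  proof (rule bij_imp_permutes)
    have inj: "inj_on (\<lambda>i. (i + k) mod n) {..<n}"
    proof -
      have "i = j" if "i \<le> j" "j < n" "(i + k) mod n = (j + k) mod n" for i j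
      proof -
        have "n dvd (j + k) - (i + k)" using that by (metis mod_eq_dvd_iff_nat add_le_mono1)
        then have "n dvd j - i" by simp
        then show ?thesis using that by (metis dvd_imp_le diff_is_0_eq' le_antisym less_imp_diff_less not_less zero_less_diff le_neq_implies_less)
      qed
      then show ?thesis by (intro inj_onI) (metis lessThan_iff nat_le_linear)
    qed
    have "inj_on (\<lambda>i. if i < n then (i + k) mod n else i) {..<n}"
      by (rule inj_on_cong[THEN iffD2, OF _ inj]) simp
    moreover have "(\<lambda>i. if i < n then (i + k) mod n else i) ` {..<n} \<subseteq> {..<n}" using n by auto
    ultimately show "bij_betw (\<lambda>i. if i < n then (i + k) mod n else i) {..<n} {..<n}"
      unfolding bij_betw_def using endo_inj_surj[of "{..<n}"] by blast
  qed auto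
qed (auto simp: permutes_def)

lemma perm_op_trp:
  fixes X :: "'d::finite op"
  assumes "\<pi> permutes {..<n}"
  shows "trp n (perm_op n \<pi> X) (perm_op n \<pi> Y) = trp n X Y"
proof -
  note b = permute_list_basis[OF assms, where 'a='d]
  have "trp n (perm_op n \<pi> X) (perm_op n \<pi> Y) =
     (\<Sum>x\<in>basis n. \<Sum>y\<in>basis n. X (permute_list n \<pi> x) (permute_list n \<pi> y) * Y (permute_list n \<pi> y) (permute_list n \<pi> x))"
    unfolding trp_def by (intro sum.cong refl) (simp add: perm_op_def)
  also have "\<dots> = (\<Sum>x\<in>basis n. \<Sum>y\<in>basis n. X (permute_list n \<pi> x) y * Y y (permute_list n \<pi> x))"
    by (intro sum.cong refl sum.reindex_bij_betw[OF b])
  also have "\<dots> = trp n X Y"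
    unfolding trp_def using sum.reindex_bij_betw[OF b, of "\<lambda>x. \<Sum>y\<in>basis n. X x y * Y y x"] by simp
  finally show ?thesis .
qed

lemma perm_op_inv:
  assumes \<pi>: "\<pi> permutes {..<n}" and "is_op n X"
  shows "perm_op n \<pi> (perm_op n (inv \<pi>) X) = X"
proof (intro ext)
  fix xs ys
  have 1: "\<pi> i < n" "inv \<pi> i < n" if "i < n" for i
    using permutes_in_image[OF \<pi>] permutes_in_image[OF permutes_inv[OF \<pi>]] that by auto
  have "permute_list n (inv \<pi>) (permute_list n \<pi> a) = a" if "length a = n" for a :: "'a list"
    using 1 permutes_inverses[OF \<pi>] that by (auto simp: permute_list_def intro!: nth_equalityI)
  then show "perm_op n \<pi> (perm_op n (inv \<pi>) X) xs ys = X xs ys"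
    using assms(2) by (auto simp: perm_op_def is_op_def)
qed

section \<open>Block tests\<close>

locale null_hypothesis =
  fixes A :: "nat \<Rightarrow> 'd::finite op set"
  assumes states: "\<And>n. n \<ge> 1 \<Longrightarrow> A n \<subseteq> states n"
    and closed_A: "\<And>n. n \<ge> 1 \<Longrightarrow> closed (A n)"
    and convex_A: "\<And>n. n \<ge> 1 \<Longrightarrow> convex_states n (A n)"
    and QIII: "axiom_QIII A" and QIV: "axiom_QIV A"
    and nonempty: "\<And>n. n \<ge> 1 \<Longrightarrow> A n \<noteq> {}"
begin

lemma A_density: "n \<ge> 1 \<Longrightarrow> \<rho> \<in> A n \<Longrightarrow> density n \<rho>"
  using states by (auto simp: states_def)

lemma A_is_op: "n \<ge> 1 \<Longrightarrow> \<rho> \<in> A n \<Longrightarrow> is_op n \<rho>"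
  using A_density by (auto simp: density_def psd_iff)

lemma A_trace: "n \<ge> 1 \<Longrightarrow> \<rho> \<in> A n \<Longrightarrow> trace n \<rho> = 1"
  using A_density by (auto simp: density_def)

text \<open>Axiom Q.IV at the identity puts the marginal into the cone, and comparing traces shows
  that the scale is 1.\<close>

lemma ptrace_mem:
  assumes n: "n \<ge> 1" and \<rho>: "\<rho> \<in> A (n + k)"
  shows "ptrace_last n k \<rho> \<in> A n"
proof (cases "k = 0")
  case True
  have "ptrace_last n 0 \<rho> = \<rho>"
    using A_is_op[of n \<rho>] \<rho> n True by (auto simp: ptrace_last_def fun_eq_iff is_op_def)
  then show ?thesis using True \<rho> by simp
next
  case False
  then have k: "k \<ge> 1" by simp
  have h: "hermitian k (ident k)" by (auto simp: hermitian_def is_op_def ident_def)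
  obtain e where "e > 0" and e: "\<forall>Fk. hermitian k Fk \<and>
       (\<forall>xs\<in>basis k. \<forall>ys\<in>basis k. cmod (Fk xs ys - ident k xs ys) < e) \<longrightarrow>
       (\<forall>n \<ge> 1. \<forall>\<rho>\<in>A (n + k).
          ptrace_last n k (mmul (n + k) \<rho> (tensor n k (ident n) Fk)) \<in> cone n (A n))"
    using QIV k unfolding axiom_QIV_def by blast
  have "ptrace_last n k (mmul (n + k) \<rho> (tensor n k (ident n) (ident k))) \<in> cone n (A n)"
    using e[rule_format, of "ident k"] h \<open>e > 0\<close> n \<rho> by simp
  moreover have "is_op (n + k) \<rho>" using A_is_op[of "n + k" \<rho>] n \<rho> by simp
  ultimately have "ptrace_last n k \<rho> \<in> cone n (A n)" by (simp add: mmul_tensor_ident)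
  then obtain c \<omega> where c: "ptrace_last n k \<rho> = mscale n (complex_of_real c) \<omega>" "\<omega> \<in> A n"
    by (auto simp: cone_def)
  have "trace n (ptrace_last n k \<rho>) = 1" using A_trace[of "n + k" \<rho>] n \<rho> by (simp add: trace_ptrace)
  moreover have "trace n (mscale n (complex_of_real c) \<omega>) = complex_of_real c"
    using A_trace[OF n c(2)] by (simp add: trace_def mscale_def sum_distrib_left[symmetric])
  ultimately have "complex_of_real c = 1" using c(1) by simp
  then have "ptrace_last n k \<rho> = \<omega>"
    using c(1) A_is_op[OF n c(2)] by (auto simp: mscale_def fun_eq_iff is_op_def)
  then show ?thesis using c(2) by simp
qed

text \<open>A cyclic shift brings the last k sites to the front. By Axiom Q.III the shifted state
  stays in the set, and the other n sites can then be traced out at the end.\<close>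

lemma last_marginal_mem:
  assumes n: "n \<ge> 1" and k: "k \<ge> 1" and \<rho>: "\<rho> \<in> A (n + k)"
  shows "(\<lambda>z w. if length z = k \<and> length w = k then (\<Sum>x\<in>basis n. \<rho> (x @ z) (x @ w)) else 0) \<in> A k"
proof -
  define \<pi> where "\<pi> = (\<lambda>i. if i < k + n then (i + k) mod (k + n) else i)"
  have \<pi>: "\<pi> permutes {..<k + n}" unfolding \<pi>_def by (rule rotate_permutes)
  have "perm_op (k + n) \<pi> \<rho> \<in> A (k + n)"
    using QIII \<rho> \<pi> k unfolding axiom_QIII_def by (simp add: add.commute)
  then have m: "ptrace_last k n (perm_op (k + n) \<pi> \<rho>) \<in> A k" by (rule ptrace_mem[OF k])
  have rot: "permute_list (k + n) \<pi> (z @ x) = x @ z" if "length z = k" "length x = n" for z x :: "'d list"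
  proof -
    have "permute_list (k + n) \<pi> (z @ x) = rotate k (z @ x)"
      using that by (intro nth_equalityI) (auto simp: permute_list_def \<pi>_def nth_rotate add.commute)
    then show ?thesis using rotate_append[of z x] that by simp
  qed
  have "ptrace_last k n (perm_op (k + n) \<pi> \<rho>)
     = (\<lambda>z w. if length z = k \<and> length w = k then (\<Sum>x\<in>basis n. \<rho> (x @ z) (x @ w)) else 0)"
    by (auto simp: ptrace_last_def perm_op_def rot fun_eq_iff intro!: sum.cong)
  with m show ?thesis by simp
qed

text \<open>The substitute for independence of blocks. Inserting F on the last block and tracing it
  out gives c \<omega> with \<omega> again in the set, where c is the expectation of F in the last
  marginal and so at most l; the remaining blocks are handled by induction. The number of blocks is
  positive because the axioms speak only of at least one site.\<close>

lemma trp_tpow_le_power: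
  assumes k: "k \<ge> 1" and F: "hermitian k F"
    and cone: "\<And>n \<rho>. n \<ge> 1 \<Longrightarrow> \<rho> \<in> A (n + k) \<Longrightarrow>
       ptrace_last n k (mmul (n + k) \<rho> (tensor n k (ident n) F)) \<in> cone n (A n)"
    and l: "\<And>\<rho>. \<rho> \<in> A k \<Longrightarrow> Re (trp k \<rho> F) \<le> l" and l0: "l \<ge> 0"
    and "\<rho> \<in> A (Suc m * k)"
  shows "Re (trp (Suc m * k) \<rho> (tpow k (Suc m) F)) \<le> l ^ Suc m"
  using assms(6)
proof (induction m arbitrary: \<rho>)
  case 0
  have "trp k \<rho> (tpow k (Suc 0) F) = trp k \<rho> F"
    unfolding trp_def by (intro sum.cong refl) (simp add: tpow_Suc_0)
  then show ?case using l[of \<rho>] 0 by simp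
next
  case (Suc m)
  define n where "n = Suc m * k"
  have n: "n \<ge> 1" using k by (simp add: n_def)
  have nk: "Suc (Suc m) * k = n + k" by (simp add: n_def)
  have \<rho>: "\<rho> \<in> A (n + k)" using Suc.prems unfolding nk .
  have t: "trp (n + k) \<rho> (tpow k (Suc (Suc m)) F) = trp (n + k) \<rho> (tensor n k (tpow k (Suc m) F) F)"
    unfolding trp_append
    by (intro sum.cong refl arg_cong2[of _ _ _ _ "(*)"]) (subst tpow_append, auto simp: n_def tensor_def)
  obtain c \<omega> where c: "ptrace_last n k (mmul (n + k) \<rho> (tensor n k (ident n) F)) = mscale n (complex_of_real c) \<omega>"
      "\<omega> \<in> A n" "c \<ge> 0"
    using cone[OF n \<rho>] by (auto simp: cone_def)
  have sc: "trp n (mscale n (complex_of_real c) \<omega>) X = complex_of_real c * trp n \<omega> X" for X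
    by (simp add: trp_def mscale_def sum_distrib_left mult.assoc)
  \<comment> \<open>Pairing with the identity reads off the scale c.\<close>
  have "complex_of_real c = trp n (mscale n (complex_of_real c) \<omega>) (ident n)"
    unfolding sc unfolding trp_ident using A_trace[OF n c(2)] by simp
  also have "\<dots> = trp (n + k) \<rho> (tensor n k (ident n) F)"
    unfolding c(1)[symmetric] trp_tensor_ptrace ..
  also have "\<dots> = trp k (\<lambda>z w. if length z = k \<and> length w = k then (\<Sum>x\<in>basis n. \<rho> (x @ z) (x @ w)) else 0) F"
  proof -
    have "trp (n + k) \<rho> (tensor n k (ident n) F)
        = (\<Sum>x\<in>basis n. \<Sum>z\<in>basis k. \<Sum>y\<in>basis n. if y = x then (\<Sum>w\<in>basis k. \<rho> (x @ z) (x @ w) * F w z) else 0)"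
      unfolding trp_append by (intro sum.cong refl) (auto simp: tensor_def ident_def)
    also have "\<dots> = (\<Sum>x\<in>basis n. \<Sum>z\<in>basis k. \<Sum>w\<in>basis k. \<rho> (x @ z) (x @ w) * F w z)" by simp
    also have "\<dots> = (\<Sum>z\<in>basis k. \<Sum>x\<in>basis n. \<Sum>w\<in>basis k. \<rho> (x @ z) (x @ w) * F w z)" by (rule sum.swap)
    also have "\<dots> = (\<Sum>z\<in>basis k. \<Sum>w\<in>basis k. \<Sum>x\<in>basis n. \<rho> (x @ z) (x @ w) * F w z)"
      by (intro sum.cong refl sum.swap)
    finally show ?thesis by (simp add: trp_def sum_distrib_right)
  qed
  finally have "c \<le> l" using l[OF last_marginal_mem[OF n k \<rho>]] by (metis Re_complex_of_real)
  have "Re (trp (n + k) \<rho> (tpow k (Suc (Suc m)) F)) = c * Re (trp n \<omega> (tpow k (Suc m) F))"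
    unfolding t trp_tensor_ptrace c(1) sc by simp
  also have "\<dots> \<le> c * l ^ Suc m"
    using Suc.IH[of \<omega>] c by (intro mult_left_mono) (simp_all add: n_def)
  also have "\<dots> \<le> l * l ^ Suc m" using \<open>c \<le> l\<close> l0 by (intro mult_right_mono) auto
  finally show ?case unfolding nk by simp
qed

end

section \<open>Tests and operations on them\<close>

definition is_test :: "nat \<Rightarrow> 'd op \<Rightarrow> bool" where
  "is_test n E \<longleftrightarrow> is_op n E \<and> herm_on (basis n) E \<and>
     (\<forall>v. 0 \<le> Re (ip (basis n) v (mv (basis n) E v)) \<and> Re (ip (basis n) v (mv (basis n) E v)) \<le> Re (ip (basis n) v v))"

lemma ip_mminus:
  "ip (basis n) v (mv (basis n) (mminus n X Y) v) = ip (basis n) v (mv (basis n) X v) - ip (basis n) v (mv (basis n) Y v)"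
proof -
  have "(\<Sum>y\<in>basis n. mminus n X Y x y * v y) = (\<Sum>y\<in>basis n. X x y * v y) - (\<Sum>y\<in>basis n. Y x y * v y)" if "x \<in> basis n" for x
    using that by (simp add: mminus_def sum_subtractf[symmetric] left_diff_distrib)
  then show ?thesis by (simp add: ip_def mv_def sum_subtractf right_diff_distrib)
qed

lemma ip_ident: "ip (basis n) v (mv (basis n) (ident n :: 'd::finite op) v) = ip (basis n) v v"
proof -
  have "(\<Sum>y\<in>basis n. ident n x y * v y) = v x" if "x \<in> basis n" for x :: "'d list"
  proof -
    have "(\<Sum>y\<in>basis n. ident n x y * v y) = (\<Sum>y\<in>basis n. if y = x then v x else 0)"
      using that by (intro sum.cong) (auto simp: ident_def)
    then show ?thesis using that by simp
  qed
  then show ?thesis by (simp add: ip_def mv_def)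
qed

lemma is_test_loewner:
  fixes E :: "'d::finite op"
  assumes "is_test n E"
  shows "loewner_le n (\<lambda>_ _. 0) E" "loewner_le n E (ident n)"
proof -
  have op: "is_op n E" and h: "herm_on (basis n) E" using assms by (auto simp: is_test_def)
  have "mminus n E (\<lambda>_ _. 0) = E" using op by (auto simp: mminus_def is_op_def fun_eq_iff)
  then show "loewner_le n (\<lambda>_ _. 0) E"
    using assms by (auto simp: loewner_le_def psd_iff psd_on_def is_test_def) (simp add: is_op_def)
  have i: "is_op n (ident n)" by (auto simp: is_op_def ident_def)
  have "herm_on (basis n) (mminus n (ident n) E)"
    unfolding herm_on_def
  proof (intro ballI)
    fix x y :: "'d list" assume xy: "x \<in> basis n" "y \<in> basis n"
    then have "E y x = cnj (E x y)" using h unfolding herm_on_def by blast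
    then show "mminus n (ident n) E y x = cnj (mminus n (ident n) E x y)"
      using xy by (auto simp: mminus_def ident_def)
  qed
  moreover have "is_op n (mminus n (ident n) E)" by (auto simp: is_op_def mminus_def)
  ultimately show "loewner_le n E (ident n)"
    using assms op i unfolding loewner_le_def psd_iff psd_on_def ip_mminus ip_ident by (auto simp: is_test_def)
qed

lemma beta_le_test:
  fixes E :: "'d::finite op"
  assumes E: "is_test n E"
    and I: "\<And>\<rho>. \<rho> \<in> A \<Longrightarrow> Re (trp n \<rho> (mminus n (ident n) E)) \<le> \<epsilon>"
    and II: "\<And>\<sigma>. \<sigma> \<in> B \<Longrightarrow> Re (trp n \<sigma> E) \<le> b"
  shows "beta \<epsilon> n A B \<le> ereal b"
proof -
  have "(SUP \<rho>\<in>A. ereal (Re (trace n (mmul n \<rho> (mminus n (ident n) E))))) \<le> ereal \<epsilon>"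
    using I by (intro SUP_least) (simp add: trace_mmul)
  then have "beta \<epsilon> n A B \<le> (SUP \<sigma>\<in>B. ereal (Re (trace n (mmul n \<sigma> E))))"
    unfolding beta_def using is_test_loewner[OF E] E by (intro INF_lower) (auto simp: is_test_def)
  also have "\<dots> \<le> ereal b" using II by (intro SUP_least) (simp add: trace_mmul)
  finally show ?thesis .
qed

lemma neglog_rate_ge:
  assumes "b \<le> ereal r" "r > 0" "n \<ge> 1"
  shows "ereal (- ln r / real n) \<le> neglog_rate n b"
proof (cases "b \<le> 0")
  case False
  then obtain s where s: "b = ereal s" "s > 0" "s \<le> r" using assms by (cases b) auto
  then have "ln s \<le> ln r" using assms by (intro ln_mono) auto
  then have "- ln r / real n \<le> - ln s / real n" using assms by (intro divide_right_mono) auto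
  then show ?thesis using s by (simp add: neglog_rate_def)
qed (simp add: neglog_rate_def)

text \<open>The extended test ignores the last j sites, which is needed when the number of sites is
  not a multiple of the block length. Its quadratic form is a sum of those of E over the basis lists
  of these sites.\<close>

lemma is_test_tensor_ident:
  fixes E :: "'d::finite op"
  assumes E: "is_test n E"
  shows "is_test (n + j) (tensor n j E (ident j))"
proof -
  let ?T = "tensor n j E (ident j)"
  have h: "herm_on (basis n) E" using E by (simp add: is_test_def)
  have "is_op (n + j) ?T" by (auto simp: is_op_def tensor_def)
  moreover have "herm_on (basis (n + j)) ?T"
    unfolding herm_on_def
  proof (intro ballI)
    fix x y :: "'d list" assume xy: "x \<in> basis (n + j)" "y \<in> basis (n + j)"
    have "take n x \<in> basis n" "take n y \<in> basis n" using xy by auto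
    then have "E (take n y) (take n x) = cnj (E (take n x) (take n y))" using h unfolding herm_on_def by blast
    then show "?T y x = cnj (?T x y)" using xy by (auto simp: tensor_def ident_def)
  qed
  moreover have q: "ip (basis (n + j)) v (mv (basis (n + j)) ?T v) = (\<Sum>z\<in>basis j. ip (basis n) (\<lambda>x. v (x @ z)) (mv (basis n) E (\<lambda>x. v (x @ z))))" for v
  proof -
    have "ip (basis (n + j)) v (mv (basis (n + j)) ?T v)
       = (\<Sum>x\<in>basis n. \<Sum>z\<in>basis j. cnj (v (x @ z)) * (\<Sum>y\<in>basis n. \<Sum>w\<in>basis j. ?T (x @ z) (y @ w) * v (y @ w)))"
      unfolding ip_def mv_def by (simp add: sum_basis_append)
    also have "\<dots> = (\<Sum>x\<in>basis n. \<Sum>z\<in>basis j. cnj (v (x @ z)) * (\<Sum>y\<in>basis n. E x y * v (y @ z)))"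
    proof (intro sum.cong refl arg_cong2[of _ _ _ _ "(*)"])
      fix x z y :: "'d list" assume l: "x \<in> basis n" "z \<in> basis j" "y \<in> basis n"
      have "(\<Sum>w\<in>basis j. ?T (x @ z) (y @ w) * v (y @ w)) = (\<Sum>w\<in>basis j. if w = z then E x y * v (y @ z) else 0)"
        using l by (intro sum.cong refl) (auto simp: tensor_def ident_def)
      then show "(\<Sum>w\<in>basis j. ?T (x @ z) (y @ w) * v (y @ w)) = E x y * v (y @ z)" using l by simp
    qed
    also have "\<dots> = (\<Sum>z\<in>basis j. \<Sum>x\<in>basis n. cnj (v (x @ z)) * (\<Sum>y\<in>basis n. E x y * v (y @ z)))"
      by (rule sum.swap)
    finally show ?thesis by (simp add: ip_def mv_def)
  qed
  moreover have q1: "ip (basis (n + j)) v v = (\<Sum>z\<in>basis j. ip (basis n) (\<lambda>x. v (x @ z)) (\<lambda>x. v (x @ z)))" for v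
    unfolding ip_def sum_basis_append by (rule sum.swap)
  moreover have "0 \<le> Re (ip (basis (n + j)) v (mv (basis (n + j)) ?T v))" for v
    unfolding q Re_sum using E by (intro sum_nonneg) (simp add: is_test_def)
  moreover have "Re (ip (basis (n + j)) v (mv (basis (n + j)) ?T v)) \<le> Re (ip (basis (n + j)) v v)" for v
    unfolding q q1 Re_sum using E by (intro sum_mono) (simp add: is_test_def)
  ultimately show ?thesis unfolding is_test_def by blast
qed

lemma is_test_perm:
  fixes E :: "'d::finite op"
  assumes E: "is_test n E" and \<pi>: "\<pi> permutes {..<n}"
  shows "is_test n (perm_op n \<pi> E)"
proof -
  let ?P = "permute_list n \<pi> :: 'd list \<Rightarrow> 'd list"
  note b = permute_list_basis[OF \<pi>, where 'a='d]
  have h: "herm_on (basis n) E" using E by (simp add: is_test_def)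
  have inj: "inj_on ?P (basis n)" using b by (simp add: bij_betw_def)
  have "is_op n (perm_op n \<pi> E)" by (auto simp: is_op_def perm_op_def)
  moreover have "herm_on (basis n) (perm_op n \<pi> E)"
    unfolding herm_on_def
  proof (intro ballI)
    fix x y :: "'d list" assume xy: "x \<in> basis n" "y \<in> basis n"
    have "?P x \<in> basis n" "?P y \<in> basis n" by simp_all
    then have "E (?P y) (?P x) = cnj (E (?P x) (?P y))" using h unfolding herm_on_def by blast
    then show "perm_op n \<pi> E y x = cnj (perm_op n \<pi> E x y)" using xy by (simp add: perm_op_def)
  qed
  moreover have "\<exists>u. ip (basis n) v (mv (basis n) (perm_op n \<pi> E) v) = ip (basis n) u (mv (basis n) E u) \<and> ip (basis n) v v = ip (basis n) u u" for v
  proof -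
    define u where "u y = v (inv_into (basis n) ?P y)" for y
    have u: "u (?P x) = v x" if "x \<in> basis n" for x using that inj by (simp add: u_def inv_into_f_f)
    have "ip (basis n) v v = (\<Sum>x\<in>basis n. cnj (u (?P x)) * u (?P x))" unfolding ip_def by (intro sum.cong refl) (simp add: u)
    also have "\<dots> = ip (basis n) u u" unfolding ip_def by (rule sum.reindex_bij_betw[OF b])
    finally have 1: "ip (basis n) v v = ip (basis n) u u" .
    have "ip (basis n) v (mv (basis n) (perm_op n \<pi> E) v)
        = (\<Sum>x\<in>basis n. cnj (u (?P x)) * (\<Sum>y\<in>basis n. E (?P x) (?P y) * u (?P y)))"
      unfolding ip_def mv_def by (intro sum.cong refl) (auto simp: u perm_op_def intro!: sum.cong)
    also have "\<dots> = (\<Sum>x\<in>basis n. cnj (u (?P x)) * (\<Sum>y\<in>basis n. E (?P x) y * u y))"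
      by (intro sum.cong refl arg_cong2[of _ _ _ _ "(*)"] sum.reindex_bij_betw[OF b])
    also have "\<dots> = (\<Sum>x\<in>basis n. cnj (u x) * (\<Sum>y\<in>basis n. E x y * u y))"
      by (rule sum.reindex_bij_betw[OF b])
    also have "\<dots> = ip (basis n) u (mv (basis n) E u)" by (simp add: ip_def mv_def)
    finally show ?thesis using 1 by blast
  qed
  ultimately show ?thesis using E unfolding is_test_def by metis
qed

lemma is_test_average:
  fixes E :: "'a \<Rightarrow> 'd::finite op"
  assumes S: "finite S" "S \<noteq> {}" and E: "\<And>s. s \<in> S \<Longrightarrow> is_test n (E s)"
  shows "is_test n (\<lambda>x y. (\<Sum>s\<in>S. E s x y) / of_nat (card S))"
proof -
  let ?A = "\<lambda>x y. (\<Sum>s\<in>S. E s x y) / of_nat (card S)"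
  have "is_op n ?A" using E by (simp add: is_op_def is_test_def)
  moreover have "herm_on (basis n) ?A"
    unfolding herm_on_def
  proof (intro ballI)
    fix x y :: "'d list" assume xy: "x \<in> basis n" "y \<in> basis n"
    have "E s y x = cnj (E s x y)" if "s \<in> S" for s using E[OF that] xy unfolding is_test_def herm_on_def by blast
    then have "(\<Sum>s\<in>S. E s y x) = (\<Sum>s\<in>S. cnj (E s x y))" by (intro sum.cong refl)
    then show "?A y x = cnj (?A x y)" by simp
  qed
  moreover have q: "ip (basis n) v (mv (basis n) ?A v) = (\<Sum>s\<in>S. ip (basis n) v (mv (basis n) (E s) v)) / of_nat (card S)" for v
  proof -
    have "ip (basis n) v (mv (basis n) ?A v) = (\<Sum>x\<in>basis n. \<Sum>y\<in>basis n. \<Sum>s\<in>S. cnj (v x) * (E s x y * v y) / of_nat (card S))"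
      unfolding ip_def mv_def by (intro sum.cong refl) (simp add: sum_distrib_left sum_distrib_right sum_divide_distrib)
    also have "\<dots> = (\<Sum>x\<in>basis n. \<Sum>s\<in>S. \<Sum>y\<in>basis n. cnj (v x) * (E s x y * v y) / of_nat (card S))"
      by (intro sum.cong refl sum.swap)
    also have "\<dots> = (\<Sum>s\<in>S. \<Sum>x\<in>basis n. \<Sum>y\<in>basis n. cnj (v x) * (E s x y * v y) / of_nat (card S))"
      by (rule sum.swap)
    finally show ?thesis by (simp add: ip_def mv_def sum_distrib_left sum_divide_distrib)
  qed
  moreover have "0 \<le> Re (ip (basis n) v (mv (basis n) ?A v)) \<and> Re (ip (basis n) v (mv (basis n) ?A v)) \<le> Re (ip (basis n) v v)" for v
  proof -
    have c: "real (card S) > 0" using S by (simp add: card_gt_0_iff)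
    have "Re (ip (basis n) v (mv (basis n) ?A v)) = (\<Sum>s\<in>S. Re (ip (basis n) v (mv (basis n) (E s) v))) / real (card S)"
      unfolding q by (metis Re_divide_of_nat Re_sum)
    moreover have "(\<Sum>s\<in>S. Re (ip (basis n) v (mv (basis n) (E s) v))) \<ge> 0"
      using E by (intro sum_nonneg) (auto simp: is_test_def)
    moreover have "(\<Sum>s\<in>S. Re (ip (basis n) v (mv (basis n) (E s) v))) \<le> (\<Sum>s\<in>S. Re (ip (basis n) v v))"
      using E by (intro sum_mono) (auto simp: is_test_def)
    ultimately show ?thesis using c by (simp add: pos_divide_le_eq mult.commute)
  qed
  ultimately show ?thesis by (auto simp: is_test_def)
qed

section \<open>Rank-one measurements and their tensor powers\<close>

definition rsum :: "nat \<Rightarrow> 's set \<Rightarrow> ('s \<Rightarrow> 'd vec) \<Rightarrow> ('s \<Rightarrow> real) \<Rightarrow> 'd op" where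
  "rsum n S \<phi> h = (\<lambda>x y. if length x = n \<and> length y = n
      then (\<Sum>s\<in>S. complex_of_real (h s) * \<phi> s x * cnj (\<phi> s y)) else 0)"

text \<open>The elements are the operators |\<phi>_s><\<phi>_s|. The vectors are not normalised, so
  the probabilities of a randomised choice of measurement can be absorbed into them.\<close>

definition povm :: "nat \<Rightarrow> 's set \<Rightarrow> ('s \<Rightarrow> 'd vec) \<Rightarrow> bool" where
  "povm n S \<phi> \<longleftrightarrow> finite S \<and> rsum n S \<phi> (\<lambda>_. 1) = ident n"

definition prb :: "nat \<Rightarrow> 'd op \<Rightarrow> 'd vec \<Rightarrow> real" where
  "prb n \<rho> v = Re (ip (basis n) v (mv (basis n) \<rho> v))"

lemma prb_nonneg: "psd n \<rho> \<Longrightarrow> prb n \<rho> v \<ge> 0"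
  by (simp add: prb_def psd_iff psd_on_def)

lemma hermitian_rsum: "hermitian n (rsum n S \<phi> h)"
  unfolding hermitian_def is_op_def rsum_def by (simp add: mult.commute mult.left_commute)

lemma trp_rsum:
  fixes \<rho> :: "'d::finite op"
  shows "Re (trp n \<rho> (rsum n S \<phi> h)) = (\<Sum>s\<in>S. h s * prb n \<rho> (\<phi> s))"
proof -
  have "trp n \<rho> (rsum n S \<phi> h) = (\<Sum>x\<in>basis n. \<Sum>y\<in>basis n. \<Sum>s\<in>S. complex_of_real (h s) * (cnj (\<phi> s x) * (\<rho> x y * \<phi> s y)))"
    unfolding trp_def by (intro sum.cong refl) (simp add: rsum_def sum_distrib_left mult.commute mult.left_commute)
  also have "\<dots> = (\<Sum>x\<in>basis n. \<Sum>s\<in>S. \<Sum>y\<in>basis n. complex_of_real (h s) * (cnj (\<phi> s x) * (\<rho> x y * \<phi> s y)))"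
    by (intro sum.cong refl sum.swap)
  also have "\<dots> = (\<Sum>s\<in>S. \<Sum>x\<in>basis n. \<Sum>y\<in>basis n. complex_of_real (h s) * (cnj (\<phi> s x) * (\<rho> x y * \<phi> s y)))"
    by (rule sum.swap)
  also have "\<dots> = (\<Sum>s\<in>S. complex_of_real (h s) * ip (basis n) (\<phi> s) (mv (basis n) \<rho> (\<phi> s)))"
    by (simp add: ip_def mv_def sum_distrib_left)
  finally show ?thesis by (simp add: prb_def)
qed

lemma ip_rsum:
  fixes v :: "'d::finite vec"
  shows "Re (ip (basis n) v (mv (basis n) (rsum n S \<phi> h) v)) = (\<Sum>s\<in>S. h s * (cmod (ip (basis n) (\<phi> s) v))\<^sup>2)"
proof -
  have "ip (basis n) v (mv (basis n) (rsum n S \<phi> h) v)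
     = (\<Sum>x\<in>basis n. \<Sum>y\<in>basis n. \<Sum>s\<in>S. complex_of_real (h s) * ((cnj (v x) * \<phi> s x) * (cnj (\<phi> s y) * v y)))"
    unfolding ip_def mv_def by (intro sum.cong refl) (simp add: rsum_def sum_distrib_left sum_distrib_right mult.assoc mult.left_commute)
  also have "\<dots> = (\<Sum>x\<in>basis n. \<Sum>s\<in>S. \<Sum>y\<in>basis n. complex_of_real (h s) * ((cnj (v x) * \<phi> s x) * (cnj (\<phi> s y) * v y)))"
    by (intro sum.cong refl sum.swap)
  also have "\<dots> = (\<Sum>s\<in>S. \<Sum>x\<in>basis n. \<Sum>y\<in>basis n. complex_of_real (h s) * ((cnj (v x) * \<phi> s x) * (cnj (\<phi> s y) * v y)))"
    by (rule sum.swap)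
  also have "\<dots> = (\<Sum>s\<in>S. complex_of_real (h s) * (ip (basis n) v (\<phi> s) * ip (basis n) (\<phi> s) v))"
    unfolding ip_def by (intro sum.cong refl, subst sum_product) (simp only: sum_distrib_left)
  also have "\<dots> = (\<Sum>s\<in>S. complex_of_real (h s * (cmod (ip (basis n) (\<phi> s) v))\<^sup>2))"
  proof (intro sum.cong refl)
    fix s
    have "ip (basis n) v (\<phi> s) * ip (basis n) (\<phi> s) v = complex_of_real ((cmod (ip (basis n) (\<phi> s) v))\<^sup>2)"
      unfolding complex_norm_square ip_cnj by (rule mult.commute)
    then show "complex_of_real (h s) * (ip (basis n) v (\<phi> s) * ip (basis n) (\<phi> s) v) = complex_of_real (h s * (cmod (ip (basis n) (\<phi> s) v))\<^sup>2)" by simp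
  qed
  finally show ?thesis by simp
qed

lemma povm_is_test:
  fixes \<phi> :: "'s \<Rightarrow> 'd::finite vec"
  assumes p: "povm n S \<phi>" and h: "\<And>s. s \<in> S \<Longrightarrow> 0 \<le> h s \<and> h s \<le> 1"
  shows "is_test n (rsum n S \<phi> h)"
proof -
  have one: "Re (ip (basis n) v v) = (\<Sum>s\<in>S. 1 * (cmod (ip (basis n) (\<phi> s) v))\<^sup>2)" for v
    unfolding ip_rsum[symmetric] using p by (simp add: povm_def ip_ident)
  have "(\<Sum>s\<in>S. h s * (cmod (ip (basis n) (\<phi> s) v))\<^sup>2) \<le> Re (ip (basis n) v v)" for v
    unfolding one using h by (intro sum_mono mult_right_mono) auto
  moreover have "(\<Sum>s\<in>S. h s * (cmod (ip (basis n) (\<phi> s) v))\<^sup>2) \<ge> 0" for v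
    using h by (intro sum_nonneg mult_nonneg_nonneg) auto
  ultimately show ?thesis
    using hermitian_rsum[of n S \<phi> h] by (simp add: is_test_def ip_rsum hermitian_iff)
qed

lemma rsum_mminus: "mminus n (rsum n S \<phi> g) (rsum n S \<phi> h) = rsum n S \<phi> (\<lambda>s. g s - h s)"
  by (auto simp: mminus_def rsum_def fun_eq_iff sum_subtractf[symmetric] algebra_simps)

definition wlists :: "'y set \<Rightarrow> nat \<Rightarrow> 'y list set" where
  "wlists Y m = {ys. set ys \<subseteq> Y \<and> length ys = m}"

text \<open>The product vector belonging to the outcome word \<open>ys\<close> when each of m blocks
  of k sites is measured separately.\<close>

definition blkvec :: "nat \<Rightarrow> nat \<Rightarrow> ('y \<Rightarrow> 'd vec) \<Rightarrow> 'y list \<Rightarrow> 'd vec" where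
  "blkvec k m \<phi> ys = (\<lambda>x. \<Prod>i<m. \<phi> (ys ! i) (blk k i x))"

lemma finite_wlists [simp]: "finite Y \<Longrightarrow> finite (wlists Y m)"
  unfolding wlists_def by (rule finite_lists_length_eq)

lemma prod_sum_wlists:
  fixes f :: "nat \<Rightarrow> 'y \<Rightarrow> 'a::comm_semiring_1"
  shows "(\<Prod>i<m. \<Sum>y\<in>Y. f i y) = (\<Sum>ys\<in>wlists Y m. \<Prod>i<m. f i (ys ! i))"
proof (induction m)
  case 0
  have "wlists Y 0 = {[]}" by (auto simp: wlists_def)
  then show ?case by simp
next
  case (Suc m)
  have bij: "bij_betw (\<lambda>(ys, y). ys @ [y]) (wlists Y m \<times> Y) (wlists Y (Suc m))"
  proof (rule bij_betw_byWitness[where f' = "\<lambda>ys. (butlast ys, last ys)"])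
    show "\<forall>ys\<in>wlists Y (Suc m). (case (butlast ys, last ys) of (ys, y) \<Rightarrow> ys @ [y]) = ys"
      by (auto simp: wlists_def intro!: append_butlast_last_id)
    show "(\<lambda>ys. (butlast ys, last ys)) ` wlists Y (Suc m) \<subseteq> wlists Y m \<times> Y"
    proof clarify
      fix ys assume ys: "ys \<in> wlists Y (Suc m)"
      then have "ys \<noteq> []" by (auto simp: wlists_def)
      then have "last ys \<in> set ys" by simp
      then show "butlast ys \<in> wlists Y m \<and> last ys \<in> Y" using ys by (auto simp: wlists_def dest: in_set_butlastD)
    qed
  qed (auto simp: wlists_def)
  have "(\<Prod>i<Suc m. \<Sum>y\<in>Y. f i y) = (\<Sum>ys\<in>wlists Y m. \<Sum>y\<in>Y. (\<Prod>i<m. f i (ys ! i)) * f m y)"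
    by (simp add: Suc sum_product)
  also have "\<dots> = (\<Sum>ys\<in>wlists Y m. \<Sum>y\<in>Y. \<Prod>i<Suc m. f i ((ys @ [y]) ! i))"
  proof (intro sum.cong refl)
    fix ys y assume "ys \<in> wlists Y m"
    then have "length ys = m" by (simp add: wlists_def)
    then show "(\<Prod>i<m. f i (ys ! i)) * f m y = (\<Prod>i<Suc m. f i ((ys @ [y]) ! i))"
      by (simp add: nth_append)
  qed
  also have "\<dots> = (\<Sum>ys\<in>wlists Y (Suc m). \<Prod>i<Suc m. f i (ys ! i))"
    using sum.reindex_bij_betw[OF bij, of "\<lambda>ys. \<Prod>i<Suc m. f i (ys ! i)"]
    by (simp add: sum.cartesian_product case_prod_unfold)
  finally show ?case .
qed

text \<open>Weights that are multiplicative over the outcome word come from a tensor power. This is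
  what turns exponential moments of a sum of scores into traces against \<open>tpow\<close>.\<close>

lemma tpow_rsum:
  fixes x y :: "'d list"
  assumes "x \<in> basis (m * k)" "y \<in> basis (m * k)"
  shows "tpow k m (rsum k Y \<phi> g) x y = rsum (m * k) (wlists Y m) (blkvec k m \<phi>) (\<lambda>ys. \<Prod>i<m. g (ys ! i)) x y"
proof -
  have lb: "length (blk k i u) = k" if "i < m" "length u = m * k" for i and u :: "'d list"
  proof -
    have "i * k + k \<le> m * k" using that(1) by (metis Suc_leI add.commute mult_Suc mult_le_mono1)
    then show ?thesis using that by (simp add: blk_def)
  qed
  have "tpow k m (rsum k Y \<phi> g) x y
      = (\<Prod>i<m. \<Sum>u\<in>Y. complex_of_real (g u) * \<phi> u (blk k i x) * cnj (\<phi> u (blk k i y)))"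
    using assms by (simp add: tpow_def) (intro prod.cong refl, simp add: rsum_def lb)
  also have "\<dots> = rsum (m * k) (wlists Y m) (blkvec k m \<phi>) (\<lambda>ys. \<Prod>i<m. g (ys ! i)) x y"
    unfolding prod_sum_wlists using assms by (simp add: rsum_def blkvec_def prod.distrib)
  finally show ?thesis .
qed

lemma tpow_ident:
  assumes "x \<in> basis (m * k)" "y \<in> basis (m * k)"
  shows "tpow k m (ident k) x y = ident (m * k) x y"
  using assms
proof (induction m arbitrary: x y)
  case 0 then show ?case by (simp add: tpow_def ident_def)
next
  case (Suc m)
  define x1 x2 y1 y2 where "x1 = take (m * k) x" and "x2 = drop (m * k) x" and "y1 = take (m * k) y" and "y2 = drop (m * k) y"
  have e: "x = x1 @ x2" "y = y1 @ y2" by (simp_all add: x1_def x2_def y1_def y2_def)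
  have l: "x1 \<in> basis (m * k)" "y1 \<in> basis (m * k)" "x2 \<in> basis k" "y2 \<in> basis k"
    using Suc.prems by (auto simp: x1_def x2_def y1_def y2_def)
  show ?case unfolding e using l Suc.IH[OF l(1,2)] by (simp add: tpow_append ident_def)
qed

lemma povm_blocks:
  fixes \<phi> :: "'y \<Rightarrow> 'd vec"
  assumes "povm k Y \<phi>"
  shows "povm (m * k) (wlists Y m) (blkvec k m \<phi>)"
proof -
  have "rsum (m * k) (wlists Y m) (blkvec k m \<phi>) (\<lambda>_. 1) = ident (m * k)"
  proof (intro ext)
    fix x y :: "'d list"
    show "rsum (m * k) (wlists Y m) (blkvec k m \<phi>) (\<lambda>_. 1) x y = ident (m * k) x y"
    proof (cases "length x = m * k \<and> length y = m * k")
      case True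
      then show ?thesis
        using tpow_rsum[of x m k y Y \<phi> "\<lambda>_. 1"] tpow_ident[of x m k y] assms by (simp add: povm_def)
    qed (auto simp: rsum_def ident_def)
  qed
  then show ?thesis using assms by (simp add: povm_def)
qed

lemma trp_tpow_rsum:
  fixes \<rho> :: "'d::finite op"
  shows "Re (trp (m * k) \<rho> (tpow k m (rsum k Y \<phi> g))) = (\<Sum>ys\<in>wlists Y m. (\<Prod>i<m. g (ys ! i)) * prb (m * k) \<rho> (blkvec k m \<phi> ys))"
proof -
  have "trp (m * k) \<rho> (tpow k m (rsum k Y \<phi> g)) = trp (m * k) \<rho> (rsum (m * k) (wlists Y m) (blkvec k m \<phi>) (\<lambda>ys. \<Prod>i<m. g (ys ! i)))"
    unfolding trp_def by (intro sum.cong refl) (simp add: tpow_rsum)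
  then show ?thesis by (simp add: trp_rsum)
qed

text \<open>Accepts the null hypothesis when the total score of the outcome word reaches c.\<close>

definition threshold_test :: "nat \<Rightarrow> nat \<Rightarrow> 'y set \<Rightarrow> ('y \<Rightarrow> 'd vec) \<Rightarrow> ('y \<Rightarrow> real) \<Rightarrow> real \<Rightarrow> 'd op" where
  "threshold_test k m Y \<phi> l c = rsum (m * k) (wlists Y m) (blkvec k m \<phi>)
     (\<lambda>ys. if c \<le> (\<Sum>i<m. l (ys ! i)) then 1 else 0)"

lemma threshold_is_test:
  assumes "povm k Y (\<phi> :: 'y \<Rightarrow> 'd::finite vec)"
  shows "is_test (m * k) (threshold_test k m Y \<phi> l c)"
  unfolding threshold_test_def by (rule povm_is_test[OF povm_blocks[OF assms]]) auto

text \<open>The indicator of a total score S < c is at most exp (h (c - S)), and the exponential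
  factorises over the blocks.\<close>

lemma threshold_type_I:
  fixes \<phi> :: "'y \<Rightarrow> 'd::finite vec"
  assumes p: "povm k Y \<phi>" and \<rho>: "psd (m * k) \<rho>" and h: "h \<ge> 0"
  shows "Re (trp (m * k) \<rho> (mminus (m * k) (ident (m * k)) (threshold_test k m Y \<phi> l c)))
    \<le> exp (h * c) * Re (trp (m * k) \<rho> (tpow k m (rsum k Y \<phi> (\<lambda>y. exp (- (h * l y))))))"
proof -
  let ?b = "blkvec k m \<phi>"
  have "ident (m * k) = rsum (m * k) (wlists Y m) ?b (\<lambda>_. 1)" using povm_blocks[OF p, of m] by (simp add: povm_def)
  then have "Re (trp (m * k) \<rho> (mminus (m * k) (ident (m * k)) (threshold_test k m Y \<phi> l c)))
     = (\<Sum>ys\<in>wlists Y m. (1 - (if c \<le> (\<Sum>i<m. l (ys ! i)) then 1 else 0)) * prb (m * k) \<rho> (?b ys))"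
    by (simp add: threshold_test_def rsum_mminus trp_rsum)
  also have "\<dots> \<le> (\<Sum>ys\<in>wlists Y m. exp (h * c) * ((\<Prod>i<m. exp (- (h * l (ys ! i)))) * prb (m * k) \<rho> (?b ys)))"
  proof (rule sum_mono)
    fix ys
    have "(\<Prod>i<m. exp (- (h * l (ys ! i)))) = exp (- (h * (\<Sum>i<m. l (ys ! i))))"
      by (simp add: exp_sum[symmetric] sum_negf sum_distrib_left)
    then have e: "exp (h * c) * (\<Prod>i<m. exp (- (h * l (ys ! i)))) = exp (h * (c - (\<Sum>i<m. l (ys ! i))))"
      by (simp add: exp_add[symmetric] algebra_simps)
    have "(1 - (if c \<le> (\<Sum>i<m. l (ys ! i)) then 1 else 0)) \<le> exp (h * (c - (\<Sum>i<m. l (ys ! i))))"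
      using h by simp
    then have "(1 - (if c \<le> (\<Sum>i<m. l (ys ! i)) then 1 else 0)) * prb (m * k) \<rho> (?b ys)
        \<le> exp (h * (c - (\<Sum>i<m. l (ys ! i)))) * prb (m * k) \<rho> (?b ys)"
      by (rule mult_right_mono) (rule prb_nonneg[OF \<rho>])
    then show "(1 - (if c \<le> (\<Sum>i<m. l (ys ! i)) then 1 else 0)) * prb (m * k) \<rho> (?b ys)
       \<le> exp (h * c) * ((\<Prod>i<m. exp (- (h * l (ys ! i)))) * prb (m * k) \<rho> (?b ys))"
      unfolding mult.assoc[symmetric] e .
  qed
  also have "\<dots> = exp (h * c) * Re (trp (m * k) \<rho> (tpow k m (rsum k Y \<phi> (\<lambda>y. exp (- (h * l y))))))"
    unfolding trp_tpow_rsum by (simp add: sum_distrib_left)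
  finally show ?thesis .
qed

text \<open>The indicator of a total score S \<ge> c is at most exp (S - c). The exponent has
  parameter 1 because a witness controls exactly the exponential moment of its scores.\<close>

lemma threshold_type_II:
  fixes \<phi> :: "'y \<Rightarrow> 'd::finite vec"
  assumes \<sigma>: "psd (m * k) \<sigma>"
  shows "Re (trp (m * k) \<sigma> (threshold_test k m Y \<phi> l c))
    \<le> exp (- c) * Re (trp (m * k) \<sigma> (tpow k m (rsum k Y \<phi> (\<lambda>y. exp (l y)))))"
proof -
  let ?b = "blkvec k m \<phi>"
  have "Re (trp (m * k) \<sigma> (threshold_test k m Y \<phi> l c))
     = (\<Sum>ys\<in>wlists Y m. (if c \<le> (\<Sum>i<m. l (ys ! i)) then 1 else 0) * prb (m * k) \<sigma> (?b ys))"
    by (simp add: threshold_test_def trp_rsum)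
  also have "\<dots> \<le> (\<Sum>ys\<in>wlists Y m. exp (- c) * ((\<Prod>i<m. exp (l (ys ! i))) * prb (m * k) \<sigma> (?b ys)))"
  proof (rule sum_mono)
    fix ys
    have e: "exp (- c) * (\<Prod>i<m. exp (l (ys ! i))) = exp ((\<Sum>i<m. l (ys ! i)) - c)"
      by (simp add: exp_sum[symmetric] exp_add[symmetric])
    have "(if c \<le> (\<Sum>i<m. l (ys ! i)) then 1 else 0) \<le> exp ((\<Sum>i<m. l (ys ! i)) - c)" by simp
    then have "(if c \<le> (\<Sum>i<m. l (ys ! i)) then 1 else 0) * prb (m * k) \<sigma> (?b ys)
        \<le> exp ((\<Sum>i<m. l (ys ! i)) - c) * prb (m * k) \<sigma> (?b ys)"
      by (rule mult_right_mono) (rule prb_nonneg[OF \<sigma>])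
    then show "(if c \<le> (\<Sum>i<m. l (ys ! i)) then 1 else 0) * prb (m * k) \<sigma> (?b ys)
       \<le> exp (- c) * ((\<Prod>i<m. exp (l (ys ! i))) * prb (m * k) \<sigma> (?b ys))"
      unfolding mult.assoc[symmetric] e .
  qed
  also have "\<dots> = exp (- c) * Re (trp (m * k) \<sigma> (tpow k m (rsum k Y \<phi> (\<lambda>y. exp (l y)))))"
    unfolding trp_tpow_rsum by (simp add: sum_distrib_left)
  finally show ?thesis .
qed

text \<open>Permutations are enumerated as lists rather than functions so that the last block can be
  split off by cutting a list.\<close>

definition permfun :: "nat \<Rightarrow> nat list \<Rightarrow> nat \<Rightarrow> nat" where
  "permfun n xs = (\<lambda>i. if i < n then xs ! i else i)"

lemma permfun_permutes:
  assumes "xs \<in> permutations_of_set {..<n}"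
  shows "permfun n xs permutes {..<n}"
proof (rule bij_imp_permutes)
  have xs: "distinct xs" "set xs = {..<n}" using assms by (auto simp: permutations_of_set_def)
  have len: "length xs = n" using distinct_card[OF xs(1)] xs(2) by simp
  have "bij_betw (\<lambda>i. xs ! i) {..<n} {..<n}" using len xs by (intro bij_betw_nth) auto
  then show "bij_betw (permfun n xs) {..<n} {..<n}"
    using bij_betw_cong[of "{..<n}" "permfun n xs" "\<lambda>i. xs ! i" "{..<n}"] by (simp add: permfun_def)
qed (simp add: permfun_def)

lemma trp_avg:
  "trp n \<rho> (\<lambda>x y. (\<Sum>s\<in>S. E s x y) / of_nat N) = (\<Sum>s\<in>S. trp n \<rho> (E s)) / of_nat N"
proof -
  have "trp n \<rho> (\<lambda>x y. (\<Sum>s\<in>S. E s x y) / of_nat N) = (\<Sum>x\<in>basis n. \<Sum>y\<in>basis n. \<Sum>s\<in>S. \<rho> x y * E s y x / of_nat N)"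
    by (simp add: trp_def sum_distrib_left sum_divide_distrib)
  also have "\<dots> = (\<Sum>x\<in>basis n. \<Sum>s\<in>S. \<Sum>y\<in>basis n. \<rho> x y * E s y x / of_nat N)"
    by (intro sum.cong refl sum.swap)
  also have "\<dots> = (\<Sum>s\<in>S. \<Sum>x\<in>basis n. \<Sum>y\<in>basis n. \<rho> x y * E s y x / of_nat N)"
    by (rule sum.swap)
  finally show ?thesis by (simp add: trp_def sum_divide_distrib)
qed

lemma trp_perm_right:
  fixes X :: "'d::finite op"
  assumes \<pi>: "\<pi> permutes {..<n}" and X: "is_op n X"
  shows "trp n X (perm_op n \<pi> E) = trp n (perm_op n (inv \<pi>) X) E"
  using perm_op_trp[OF \<pi>, of "perm_op n (inv \<pi>) X" E] perm_op_inv[OF \<pi> X] by simp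

lemma psd_perm_op:
  fixes X :: "'d::finite op"
  assumes X: "psd n X" and \<pi>: "\<pi> permutes {..<n}"
  shows "psd n (perm_op n \<pi> X)"
proof -
  let ?P = "permute_list n \<pi> :: 'd list \<Rightarrow> 'd list"
  note b = permute_list_basis[OF \<pi>, where 'a='d]
  have h: "herm_on (basis n) X" using X by (simp add: psd_iff psd_on_def)
  have inj: "inj_on ?P (basis n)" using b by (simp add: bij_betw_def)
  have "is_op n (perm_op n \<pi> X)" by (auto simp: is_op_def perm_op_def)
  moreover have "herm_on (basis n) (perm_op n \<pi> X)"
    unfolding herm_on_def
  proof (intro ballI)
    fix x y :: "'d list" assume xy: "x \<in> basis n" "y \<in> basis n"
    have "?P x \<in> basis n" "?P y \<in> basis n" by simp_all
    then have "X (?P y) (?P x) = cnj (X (?P x) (?P y))" using h unfolding herm_on_def by blast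
    then show "perm_op n \<pi> X y x = cnj (perm_op n \<pi> X x y)" using xy by (simp add: perm_op_def)
  qed
  moreover have "0 \<le> Re (ip (basis n) v (mv (basis n) (perm_op n \<pi> X) v))" for v
  proof -
    define u where "u y = v (inv_into (basis n) ?P y)" for y
    have u: "u (?P x) = v x" if "x \<in> basis n" for x using that inj by (simp add: u_def inv_into_f_f)
    have "ip (basis n) v (mv (basis n) (perm_op n \<pi> X) v)
        = (\<Sum>x\<in>basis n. cnj (u (?P x)) * (\<Sum>y\<in>basis n. X (?P x) (?P y) * u (?P y)))"
      unfolding ip_def mv_def by (intro sum.cong refl) (auto simp: u perm_op_def intro!: sum.cong)
    also have "\<dots> = (\<Sum>x\<in>basis n. cnj (u (?P x)) * (\<Sum>y\<in>basis n. X (?P x) y * u y))"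
      by (intro sum.cong refl arg_cong2[of _ _ _ _ "(*)"] sum.reindex_bij_betw[OF b])
    also have "\<dots> = (\<Sum>x\<in>basis n. cnj (u x) * (\<Sum>y\<in>basis n. X x y * u y))"
      by (rule sum.reindex_bij_betw[OF b])
    also have "\<dots> = ip (basis n) u (mv (basis n) X u)" by (simp add: ip_def mv_def)
    finally show ?thesis using X by (simp add: psd_iff psd_on_def)
  qed
  ultimately show ?thesis by (simp add: psd_iff psd_on_def)
qed

text \<open>For x > 0 this follows from (1 - x + x^2) (1 + x) = 1 + x^3 \<ge> 1 and 1 + x \<le> exp
  x.\<close>

lemma exp_minus_le_quadratic:
  fixes x :: real assumes "\<bar>x\<bar> \<le> 1" shows "exp (- x) \<le> 1 - x + x\<^sup>2"
proof (cases "x \<le> 0")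
  case True
  then have "exp (- x) \<le> 1 + (- x) + (- x)\<^sup>2" using assms by (intro exp_bound) auto
  then show ?thesis by simp
next
  case False
  have "1 \<le> (1 - x + x\<^sup>2) * (1 + x)" using False by (simp add: power2_eq_square algebra_simps)
  also have "\<dots> \<le> (1 - x + x\<^sup>2) * exp x"
    using assms exp_ge_add_one_self[of x] by (intro mult_left_mono) (auto simp: power2_eq_square)
  finally have "exp (- x) * 1 \<le> exp (- x) * ((1 - x + x\<^sup>2) * exp x)" by (intro mult_left_mono) auto
  then show ?thesis by (simp add: exp_minus field_simps)
qed

section \<open>Error bounds for symmetrised block tests\<close>

context null_hypothesis
begin

text \<open>The test is a threshold test on m blocks, averaged over all permutations of the m k
  sites and extended by the identity to j more sites. The number g measures what the average over
  permutations costs for the alternative: 1 for tensor powers, a power of m k for arbitrarily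
  varying states.\<close>

lemma beta_block_le:
  fixes \<phi> :: "'y \<Rightarrow> 'd vec" and l :: "'y \<Rightarrow> real" and B :: "nat \<Rightarrow> 'd op set"
  assumes k: "k \<ge> 1" and m: "m \<ge> 1" and p: "povm k Y \<phi>" and h: "h \<ge> 0"
    and cone: "\<And>n \<rho>. n \<ge> 1 \<Longrightarrow> \<rho> \<in> A (n + k) \<Longrightarrow>
       ptrace_last n k (mmul (n + k) \<rho> (tensor n k (ident n) (rsum k Y \<phi> (\<lambda>y. exp (- (h * l y)))))) \<in> cone n (A n)"
    and lam: "\<And>\<rho>. \<rho> \<in> A k \<Longrightarrow> Re (trp k \<rho> (rsum k Y \<phi> (\<lambda>y. exp (- (h * l y))))) \<le> lam" and lam0: "lam \<ge> 0"
    and Bpsd: "\<And>\<sigma>. \<sigma> \<in> B (m * k) \<Longrightarrow> psd (m * k) \<sigma>"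
    and Bpt: "\<And>\<sigma>. \<sigma> \<in> B (m * k + j) \<Longrightarrow> is_op (m * k + j) \<sigma> \<and> ptrace_last (m * k) j \<sigma> \<in> B (m * k)"
    and BII: "\<And>\<sigma>. \<sigma> \<in> B (m * k) \<Longrightarrow> (\<Sum>xs\<in>permutations_of_set {..<m * k}.
        Re (trp (m * k) (perm_op (m * k) (inv (permfun (m * k) xs)) \<sigma>) (tpow k m (rsum k Y \<phi> (\<lambda>y. exp (l y)))))) \<le> fact (m * k) * g"
    and eps: "exp (h * c) * lam ^ m \<le> \<epsilon>"
  shows "beta \<epsilon> (m * k + j) (A (m * k + j)) (B (m * k + j)) \<le> ereal (exp (- c) * g)"
proof -
  define n where "n = m * k"
  have n: "n \<ge> 1" using m k by (simp add: n_def)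
  define T where "T = threshold_test k m Y \<phi> l c"
  define P where "P = permutations_of_set {..<n}"
  have P: "finite P" "P \<noteq> {}" "card P = fact n" by (auto simp: P_def card_permutations_of_set)
  define E where "E = (\<lambda>x y. (\<Sum>xs\<in>P. perm_op n (permfun n xs) T x y) / of_nat (card P))"
  have \<pi>: "permfun n xs permutes {..<n}" if "xs \<in> P" for xs using that permfun_permutes by (simp add: P_def)
  have T: "is_test n T" unfolding T_def n_def by (rule threshold_is_test[OF p])
  have E: "is_test n E" unfolding E_def by (intro is_test_average P is_test_perm[OF T \<pi>])
  have trE: "Re (trp n X E) = (\<Sum>xs\<in>P. Re (trp n (perm_op n (inv (permfun n xs)) X) T)) / fact n" if X: "is_op n X" for X
  proof -
    have "trp n X E = (\<Sum>xs\<in>P. trp n (perm_op n (inv (permfun n xs)) X) T) / of_nat (card P)"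
      unfolding E_def trp_avg by (intro arg_cong2[of _ _ _ _ "(/)"] sum.cong refl trp_perm_right[OF \<pi> X])
    then show ?thesis unfolding P(3) by (metis Re_divide_of_nat Re_sum of_nat_fact)
  qed
  have one: "Re (trp N X (ident N)) = 1" if "X \<in> A N" "N \<ge> 1" for X N
    unfolding trp_ident using A_trace that by simp
  have T_I: "Re (trp n \<rho> T) \<ge> 1 - \<epsilon>" if \<rho>: "\<rho> \<in> A n" for \<rho>
  proof -
    obtain m' where m': "m = Suc m'" using m by (cases m) auto
    have "Re (trp n \<rho> (mminus n (ident n) T)) \<le> exp (h * c) * Re (trp n \<rho> (tpow k m (rsum k Y \<phi> (\<lambda>y. exp (- (h * l y))))))"
      unfolding T_def n_def using A_density[OF n \<rho>] by (intro threshold_type_I[OF p _ h]) (simp add: density_def n_def)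
    also have "\<dots> \<le> exp (h * c) * lam ^ m"
      using trp_tpow_le_power[OF k hermitian_rsum cone lam lam0, of \<rho> m'] \<rho> unfolding n_def m'
      by (intro mult_left_mono) auto
    finally show ?thesis using eps one[OF \<rho> n] unfolding trp_mminus by simp
  qed
  \<comment> \<open>Averaging does not spoil the error of the first kind, because permuted states
    stay in the set by Axiom Q.III.\<close>
  have E_I: "Re (trp n \<rho> E) \<ge> 1 - \<epsilon>" if \<rho>: "\<rho> \<in> A n" for \<rho>
  proof -
    have "perm_op n (inv (permfun n xs)) \<rho> \<in> A n" if "xs \<in> P" for xs
      using QIII \<rho> permutes_inv[OF \<pi>[OF that]] n unfolding axiom_QIII_def by blast
    then have "(\<Sum>xs\<in>P. 1 - \<epsilon>) \<le> (\<Sum>xs\<in>P. Re (trp n (perm_op n (inv (permfun n xs)) \<rho>) T))"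
      by (intro sum_mono T_I)
    then show ?thesis unfolding trE[OF A_is_op[OF n \<rho>]] using P(3) by (simp add: pos_le_divide_eq mult.commute)
  qed
  have E_II: "Re (trp n \<sigma> E) \<le> exp (- c) * g" if \<sigma>: "\<sigma> \<in> B n" for \<sigma>
  proof -
    have ps: "psd n \<sigma>" using Bpsd \<sigma> by (simp add: n_def)
    have "(\<Sum>xs\<in>P. Re (trp n (perm_op n (inv (permfun n xs)) \<sigma>) T))
       \<le> (\<Sum>xs\<in>P. exp (- c) * Re (trp n (perm_op n (inv (permfun n xs)) \<sigma>) (tpow k m (rsum k Y \<phi> (\<lambda>y. exp (l y))))))"
    proof (rule sum_mono)
      fix xs assume "xs \<in> P"
      have "psd n (perm_op n (inv (permfun n xs)) \<sigma>)" by (rule psd_perm_op[OF ps permutes_inv[OF \<pi>[OF \<open>xs \<in> P\<close>]]])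
      then show "Re (trp n (perm_op n (inv (permfun n xs)) \<sigma>) T)
          \<le> exp (- c) * Re (trp n (perm_op n (inv (permfun n xs)) \<sigma>) (tpow k m (rsum k Y \<phi> (\<lambda>y. exp (l y)))))"
        unfolding T_def n_def by (intro threshold_type_II)
    qed
    also have "\<dots> \<le> exp (- c) * (fact n * g)"
      unfolding sum_distrib_left[symmetric] using BII \<sigma> by (intro mult_left_mono) (auto simp: n_def P_def)
    finally show ?thesis unfolding trE[OF ps[unfolded psd_iff, THEN conjunct1]]
      by (simp add: pos_divide_le_eq mult.commute mult.left_commute)
  qed
  have red: "trp (n + j) X (tensor n j E (ident j)) = trp n (ptrace_last n j X) E" if "is_op (n + j) X" for X
    unfolding trp_tensor_ptrace mmul_tensor_ident[OF that] ..
  have "beta \<epsilon> (n + j) (A (n + j)) (B (n + j)) \<le> ereal (exp (- c) * g)"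
  proof (rule beta_le_test[OF is_test_tensor_ident[OF E]])
    fix \<rho> assume \<rho>: "\<rho> \<in> A (n + j)"
    have op: "is_op (n + j) \<rho>" using A_is_op[of "n + j"] \<rho> n by simp
    show "Re (trp (n + j) \<rho> (mminus (n + j) (ident (n + j)) (tensor n j E (ident j)))) \<le> \<epsilon>"
      using E_I[OF ptrace_mem[OF n \<rho>]] one[OF \<rho>] n unfolding trp_mminus red[OF op] by simp
  next
    fix \<sigma> assume \<sigma>: "\<sigma> \<in> B (n + j)"
    have "is_op (n + j) \<sigma>" "ptrace_last n j \<sigma> \<in> B n" using Bpt \<sigma> by (auto simp: n_def)
    then show "Re (trp (n + j) \<sigma> (tensor n j E (ident j))) \<le> exp (- c) * g"
      using E_II red by simp
  qed
  then show ?thesis by (simp add: n_def)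
qed

text \<open>With threshold m (a - d) the error of the first kind decays exponentially in m for a
  fixed small Chernoff parameter h, while that of the second kind is at most exp (- m (a - d)) g(m)
  with g subexponential.\<close>

lemma achievability:
  fixes \<phi> :: "'y \<Rightarrow> 'd vec" and l :: "'y \<Rightarrow> real" and B :: "nat \<Rightarrow> 'd op set" and g :: "nat \<Rightarrow> real"
  assumes k: "k \<ge> 1" and p: "povm k Y \<phi>"
    and a: "\<And>\<rho>. \<rho> \<in> A k \<Longrightarrow> a \<le> (\<Sum>y\<in>Y. l y * prb k \<rho> (\<phi> y))"
    and Bpsd: "\<And>n \<sigma>. \<sigma> \<in> B n \<Longrightarrow> psd n \<sigma>"
    and Bpt: "\<And>n j \<sigma>. \<sigma> \<in> B (n + j) \<Longrightarrow> ptrace_last n j \<sigma> \<in> B n"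
    and BII: "\<And>m \<sigma>. m \<ge> 1 \<Longrightarrow> \<sigma> \<in> B (m * k) \<Longrightarrow> (\<Sum>xs\<in>permutations_of_set {..<m * k}.
        Re (trp (m * k) (perm_op (m * k) (inv (permfun (m * k) xs)) \<sigma>) (tpow k m (rsum k Y \<phi> (\<lambda>y. exp (l y)))))) \<le> fact (m * k) * g m"
    and g0: "\<And>m. m \<ge> 1 \<Longrightarrow> g m > 0" and g: "(\<lambda>m. ln (g m) / real m) \<longlonglongrightarrow> 0"
    and eps: "\<epsilon> > 0"
  shows "ereal (a / real k) \<le> liminf (\<lambda>n. neglog_rate n (beta \<epsilon> n (A n) (B n)))"
proof -
  have ev: "\<forall>\<^sub>F n in sequentially. ereal t < neglog_rate n (beta \<epsilon> n (A n) (B n))" if t: "t < a / real k" for t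
  proof -
    \<comment> \<open>This means a = t k + 2 d: one d is given away in the threshold, the other pays
      for g and for the fewer than k leftover sites.\<close>
    define d where "d = (a - t * k) / 2"
    have kp: "real k > 0" using k by simp
    have d: "d > 0" using t kp by (simp add: d_def pos_less_divide_eq)
    have finY: "finite Y" using p by (simp add: povm_def)
    \<comment> \<open>A bound on all scores; the summand 1 ensures K \<ge> 1, so that division by K
      is safe.\<close>
    define K where "K = 1 + (\<Sum>y\<in>Y. \<bar>l y\<bar>)"
    have K: "K \<ge> 1" "\<And>y. y \<in> Y \<Longrightarrow> \<bar>l y\<bar> \<le> K"
    proof -
      show "K \<ge> 1" by (simp add: K_def sum_nonneg)
      fix y assume "y \<in> Y"
      then have "\<bar>l y\<bar> \<le> (\<Sum>y\<in>Y. \<bar>l y\<bar>)" using finY by (intro member_le_sum) auto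
      then show "\<bar>l y\<bar> \<le> K" by (simp add: K_def)
    qed
    define F where "F h = rsum k Y \<phi> (\<lambda>y. exp (- (h * l y)))" for h
    obtain e where "e > 0" and e: "\<forall>Fk. hermitian k Fk \<and>
         (\<forall>xs\<in>basis k. \<forall>ys\<in>basis k. cmod (Fk xs ys - ident k xs ys) < e) \<longrightarrow>
         (\<forall>n \<ge> 1. \<forall>\<rho>\<in>A (n + k).
            ptrace_last n k (mmul (n + k) \<rho> (tensor n k (ident n) Fk)) \<in> cone n (A n))"
      using QIV k unfolding axiom_QIV_def by blast
    \<comment> \<open>As h tends to 0 the weighted sum tends to the sum of all measurement
      operators, which is the identity. For small h it therefore lies in the neighbourhood of Axiom
      Q.IV.\<close>
    have lim: "((\<lambda>h. F h x y) \<longlongrightarrow> ident k x y) (at_right 0)" if "x \<in> basis k" "y \<in> basis k" for x y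
    proof -
      have "((\<lambda>h. \<Sum>s\<in>Y. complex_of_real (exp (- (h * l s))) * \<phi> s x * cnj (\<phi> s y)) \<longlongrightarrow>
          (\<Sum>s\<in>Y. complex_of_real (exp (- (0 * l s))) * \<phi> s x * cnj (\<phi> s y))) (at_right 0)"
        by (intro tendsto_intros)
      moreover have "(\<Sum>s\<in>Y. complex_of_real (exp (- (0 * l s))) * \<phi> s x * cnj (\<phi> s y)) = ident k x y"
      proof -
        have "rsum k Y \<phi> (\<lambda>_. 1) x y = ident k x y" using p by (simp add: povm_def)
        then show ?thesis using that by (simp add: rsum_def)
      qed
      ultimately show ?thesis using that by (simp add: F_def rsum_def)
    qed
    have "\<forall>\<^sub>F h in at_right 0. \<forall>x\<in>basis k. \<forall>y\<in>basis k. cmod (F h x y - ident k x y) < e"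
      using lim \<open>e > 0\<close> by (intro eventually_ball_finite ballI finite_basis) (simp add: tendsto_iff dist_norm)
    moreover have "\<forall>\<^sub>F h in at_right (0::real). h < min (1 / K) (d / (2 * K\<^sup>2))"
      using K(1) d by (intro eventually_at_rightI[of 0 "min (1 / K) (d / (2 * K\<^sup>2))"]) auto
    moreover have "\<forall>\<^sub>F h in at_right (0::real). h > 0" by (rule eventually_at_right_less)
    ultimately have "\<forall>\<^sub>F h in at_right 0. (\<forall>x\<in>basis k. \<forall>y\<in>basis k. cmod (F h x y - ident k x y) < e) \<and>
        h < min (1 / K) (d / (2 * K\<^sup>2)) \<and> h > 0" by eventually_elim auto
    then obtain h where h: "\<forall>x\<in>basis k. \<forall>y\<in>basis k. cmod (F h x y - ident k x y) < e"
        "h < 1 / K" "h < d / (2 * K\<^sup>2)" "h > 0"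
      using eventually_happens'[OF trivial_limit_at_right_real] by fastforce
    have cone: "ptrace_last n k (mmul (n + k) \<rho> (tensor n k (ident n) (rsum k Y \<phi> (\<lambda>y. exp (- (h * l y)))))) \<in> cone n (A n)"
      if "n \<ge> 1" "\<rho> \<in> A (n + k)" for n \<rho>
      using e[rule_format, of "F h" n \<rho>] h(1) that unfolding F_def by (simp add: hermitian_rsum)
    \<comment> \<open>The second-order bound on the exponential moment: the mean score is at least
      a, and all scores are at most K in modulus.\<close>
    define lam where "lam = 1 - h * a + h\<^sup>2 * K\<^sup>2"
    have lam: "Re (trp k \<rho> (rsum k Y \<phi> (\<lambda>y. exp (- (h * l y))))) \<le> lam \<and> 0 \<le> lam" if \<rho>: "\<rho> \<in> A k" for \<rho>
    proof -
      have pr: "prb k \<rho> v \<ge> 0" for v using A_density[OF k \<rho>] by (intro prb_nonneg) (simp add: density_def)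
      have "(\<Sum>y\<in>Y. 1 * prb k \<rho> (\<phi> y)) = Re (trp k \<rho> (ident k))"
        unfolding trp_rsum[symmetric] using p by (simp add: povm_def)
      then have one: "(\<Sum>y\<in>Y. prb k \<rho> (\<phi> y)) = 1" using A_trace[OF k \<rho>] by (simp add: trp_ident)
      have "Re (trp k \<rho> (rsum k Y \<phi> (\<lambda>y. exp (- (h * l y))))) = (\<Sum>y\<in>Y. exp (- (h * l y)) * prb k \<rho> (\<phi> y))"
        by (rule trp_rsum)
      also have "\<dots> \<le> (\<Sum>y\<in>Y. (1 - h * l y + h\<^sup>2 * K\<^sup>2) * prb k \<rho> (\<phi> y))"
      proof (intro sum_mono mult_right_mono pr)
        fix y assume y: "y \<in> Y"
        have "\<bar>h * l y\<bar> \<le> h * K" using K(2)[OF y] h(4) by (simp add: abs_mult)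
        also have "\<dots> \<le> 1" using h(2) K(1) by (simp add: pos_less_divide_eq)
        finally have "exp (- (h * l y)) \<le> 1 - h * l y + (h * l y)\<^sup>2" by (rule exp_minus_le_quadratic)
        moreover have "(h * l y)\<^sup>2 \<le> h\<^sup>2 * K\<^sup>2"
          using power_mono[OF K(2)[OF y], of 2] by (simp add: power_mult_distrib mult_left_mono)
        ultimately show "exp (- (h * l y)) \<le> 1 - h * l y + h\<^sup>2 * K\<^sup>2" by linarith
      qed
      also have "\<dots> = (\<Sum>y\<in>Y. prb k \<rho> (\<phi> y)) - h * (\<Sum>y\<in>Y. l y * prb k \<rho> (\<phi> y)) + h\<^sup>2 * K\<^sup>2 * (\<Sum>y\<in>Y. prb k \<rho> (\<phi> y))"
        by (simp add: algebra_simps sum.distrib sum_subtractf sum_distrib_left)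
      also have "\<dots> \<le> lam"
        using mult_left_mono[OF a[OF \<rho>], of h] h(4) unfolding one by (simp add: lam_def)
      finally have le: "Re (trp k \<rho> (rsum k Y \<phi> (\<lambda>y. exp (- (h * l y))))) \<le> lam" .
      moreover have "Re (trp k \<rho> (rsum k Y \<phi> (\<lambda>y. exp (- (h * l y))))) \<ge> 0"
        unfolding trp_rsum by (intro sum_nonneg mult_nonneg_nonneg pr) simp
      ultimately show ?thesis by linarith
    qed
    have lam0: "lam \<ge> 0" using lam nonempty[OF k] by blast
    have lamexp: "lam \<le> exp (- h * a + h\<^sup>2 * K\<^sup>2)"
    proof -
      have "lam = 1 + (- h * a + h\<^sup>2 * K\<^sup>2)" by (simp add: lam_def)
      then show ?thesis by (metis exp_ge_add_one_self)
    qed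
    \<comment> \<open>The exponent per block is h (a - d) - h a + h^2 K^2 = - h d + h^2 K^2, and it
      is at most - h d / 2 because h < d / (2 K^2).\<close>
    define r where "r = h * d / 2"
    have r: "r > 0" using h d by (simp add: r_def)
    have hK: "h * (h * K\<^sup>2) \<le> h * (d / 2)"
    proof -
      have "K\<^sup>2 > 0" using K(1) by simp
      then have "h * (2 * K\<^sup>2) < d" using h(3) by (simp add: pos_less_divide_eq)
      then have "h * K\<^sup>2 \<le> d / 2" by linarith
      then show ?thesis using h(4) by (intro mult_left_mono) auto
    qed
    have typeI: "exp (h * (m * (a - d))) * lam ^ m \<le> exp (- r) ^ m" for m :: nat
    proof -
      have "exp (h * (m * (a - d))) * lam ^ m \<le> exp (h * (m * (a - d))) * exp (- h * a + h\<^sup>2 * K\<^sup>2) ^ m"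
        using lam0 lamexp by (intro mult_left_mono power_mono) auto
      also have "\<dots> = exp (real m * (h * (a - d) + (- h * a + h\<^sup>2 * K\<^sup>2)))"
        by (simp add: exp_of_nat_mult[symmetric] exp_add[symmetric] algebra_simps)
      also have "\<dots> \<le> exp (real m * (- r))"
        using hK by (subst exp_le_cancel_iff, intro mult_left_mono) (auto simp: r_def algebra_simps power2_eq_square)
      also have "\<dots> = exp (- r) ^ m" by (rule exp_of_nat_mult)
      finally show ?thesis .
    qed
    have "(\<lambda>m. exp (- r) ^ m) \<longlonglongrightarrow> 0" using r by (intro LIMSEQ_realpow_zero) auto
    then have ev1: "\<forall>\<^sub>F m in sequentially. exp (- r) ^ m < \<epsilon>" using eps by (intro order_tendstoD(2))
    have ev2: "\<forall>\<^sub>F m in sequentially. ln (g m) / real m < d / 2" using d by (intro order_tendstoD(2)[OF g]) simp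
    \<comment> \<open>Makes t j negligible against m d / 2 for all j < k, whatever the sign of
      t.\<close>
    have ev3: "\<forall>\<^sub>F m in sequentially. \<bar>t\<bar> * k < real m * (d / 2)"
    proof -
      have "\<forall>\<^sub>F m in sequentially. real m > \<bar>t\<bar> * k / (d / 2)"
        using filterlim_real_sequentially by (simp add: filterlim_at_top_dense)
      then show ?thesis by eventually_elim (use d in \<open>simp add: pos_divide_less_eq\<close>)
    qed
    have ev4: "\<forall>\<^sub>F m::nat in sequentially. m \<ge> 1" by (rule eventually_ge_at_top)
    have "\<forall>\<^sub>F m in sequentially. \<forall>j<k. ereal t < neglog_rate (m * k + j) (beta \<epsilon> (m * k + j) (A (m * k + j)) (B (m * k + j)))"
      using ev1 ev2 ev3 ev4
    proof (eventually_elim, intro allI impI)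
      fix m j :: nat assume m: "exp (- r) ^ m < \<epsilon>" "ln (g m) / real m < d / 2" "\<bar>t\<bar> * k < real m * (d / 2)" "m \<ge> 1" and j: "j < k"
      define c where "c = real m * (a - d)"
      have "1 * 1 \<le> m * k" using m(4) k by (intro mult_le_mono)
      then have mk: "m * k + j \<ge> 1" by linarith
      have "beta \<epsilon> (m * k + j) (A (m * k + j)) (B (m * k + j)) \<le> ereal (exp (- c) * g m)"
      proof (rule beta_block_le[OF k m(4) p less_imp_le[OF h(4)] cone _ lam0 Bpsd _ BII[OF m(4)]])
        show "Re (trp k \<rho> (rsum k Y \<phi> (\<lambda>y. exp (- (h * l y))))) \<le> lam" if "\<rho> \<in> A k" for \<rho> using lam[OF that] by blast
        show "is_op (m * k + j) \<sigma> \<and> ptrace_last (m * k) j \<sigma> \<in> B (m * k)" if "\<sigma> \<in> B (m * k + j)" for \<sigma>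
          using Bpsd[OF that] Bpt[OF that] by (simp add: psd_iff)
        show "exp (h * c) * lam ^ m \<le> \<epsilon>" using typeI[of m] m(1) by (simp add: c_def)
      qed auto
      then have "ereal (- ln (exp (- c) * g m) / real (m * k + j)) \<le> neglog_rate (m * k + j) (beta \<epsilon> (m * k + j) (A (m * k + j)) (B (m * k + j)))"
        using g0[OF m(4)] mk by (intro neglog_rate_ge) auto
      moreover have "t < - ln (exp (- c) * g m) / real (m * k + j)"
      proof -
        have pos: "real (m * k + j) > 0" using mk by linarith
        have lng: "ln (g m) < real m * (d / 2)" using m(2,4) by (simp add: pos_divide_less_eq mult.commute)
        have 1: "t * real (m * k + j) = m * (t * k) + t * j" by (simp add: algebra_simps)
        have 2: "t * j \<le> \<bar>t\<bar> * k" using j by (intro mult_mono) auto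
        have "a = t * k + 2 * d" unfolding d_def by argo
        then have 3: "c = m * (t * k) + m * d" by (simp add: c_def algebra_simps)
        have 4: "- ln (exp (- c) * g m) = c - ln (g m)" using g0[OF m(4)] by (simp add: ln_mult)
        have "t * real (m * k + j) < - ln (exp (- c) * g m)" unfolding 1 4 using 3 2 m(3) lng by linarith
        then show ?thesis unfolding pos_less_divide_eq[OF pos] .
      qed
      ultimately show "ereal t < neglog_rate (m * k + j) (beta \<epsilon> (m * k + j) (A (m * k + j)) (B (m * k + j)))"
        by (meson less_ereal.simps(1) order_less_le_trans)
    qed
    then obtain M where M: "\<And>m j. m \<ge> M \<Longrightarrow> j < k \<Longrightarrow> ereal t < neglog_rate (m * k + j) (beta \<epsilon> (m * k + j) (A (m * k + j)) (B (m * k + j)))"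
      unfolding eventually_sequentially by blast
    have "ereal t < neglog_rate n (beta \<epsilon> n (A n) (B n))" if "n \<ge> M * k" for n
    proof -
      have "n div k \<ge> M" using that k by (simp add: less_eq_div_iff_mult_less_eq)
      moreover have "n mod k < k" using k by simp
      moreover have "n div k * k + n mod k = n" by simp
      ultimately show ?thesis using M by metis
    qed
    then show ?thesis unfolding eventually_sequentially by blast
  qed
  show ?thesis
    unfolding le_Liminf_iff
  proof (intro allI impI)
    fix y assume y: "y < ereal (a / real k)"
    obtain t where "y < ereal t" "t < a / real k"
      using ereal_dense2[OF y] by auto
    from ev[OF this(2)] this(1) show "\<forall>\<^sub>F n in sequentially. y < neglog_rate n (beta \<epsilon> n (A n) (B n))"
      by (auto elim!: eventually_mono)
  qed
qed

end

text \<open>The traces belonging to different blocks get multiplied. Real parts are not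
  multiplicative, so it has to be known that the traces are real.\<close>

lemma trp_rsum_of_real:
  fixes \<rho> :: "'d::finite op"
  assumes "herm_on (basis n) \<rho>"
  shows "trp n \<rho> (rsum n S \<phi> h) = complex_of_real (\<Sum>s\<in>S. h s * prb n \<rho> (\<phi> s))"
proof -
  have "trp n \<rho> (rsum n S \<phi> h) = (\<Sum>x\<in>basis n. \<Sum>y\<in>basis n. \<Sum>s\<in>S. complex_of_real (h s) * (cnj (\<phi> s x) * (\<rho> x y * \<phi> s y)))"
    unfolding trp_def by (intro sum.cong refl) (simp add: rsum_def sum_distrib_left mult.commute mult.left_commute)
  also have "\<dots> = (\<Sum>x\<in>basis n. \<Sum>s\<in>S. \<Sum>y\<in>basis n. complex_of_real (h s) * (cnj (\<phi> s x) * (\<rho> x y * \<phi> s y)))"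
    by (intro sum.cong refl sum.swap)
  also have "\<dots> = (\<Sum>s\<in>S. \<Sum>x\<in>basis n. \<Sum>y\<in>basis n. complex_of_real (h s) * (cnj (\<phi> s x) * (\<rho> x y * \<phi> s y)))"
    by (rule sum.swap)
  also have "\<dots> = (\<Sum>s\<in>S. complex_of_real (h s) * ip (basis n) (\<phi> s) (mv (basis n) \<rho> (\<phi> s)))"
    by (simp add: ip_def mv_def sum_distrib_left)
  also have "\<dots> = (\<Sum>s\<in>S. complex_of_real (h s) * complex_of_real (prb n \<rho> (\<phi> s)))"
  proof (intro sum.cong refl arg_cong2[of _ _ _ _ "(*)"])
    fix s
    have "cnj (ip (basis n) (\<phi> s) (mv (basis n) \<rho> (\<phi> s))) = ip (basis n) (\<phi> s) (mv (basis n) \<rho> (\<phi> s))"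
      unfolding ip_cnj by (rule mv_adjoint[OF assms, symmetric])
    then show "ip (basis n) (\<phi> s) (mv (basis n) \<rho> (\<phi> s)) = complex_of_real (prb n \<rho> (\<phi> s))"
      unfolding prb_def by (metis Reals_cnj_iff complex_is_Real_iff of_real_Re)
  qed
  finally show ?thesis by simp
qed

section \<open>Product states over blocks and sampling without replacement\<close>

lemma perm_op_avop:
  assumes \<pi>: "\<pi> permutes {..<n}"
  shows "perm_op n (inv \<pi>) (avop n \<sigma>s) = avop n (\<lambda>i. \<sigma>s (\<pi> i))"
proof (intro ext)
  fix x y
  show "perm_op n (inv \<pi>) (avop n \<sigma>s) x y = avop n (\<lambda>i. \<sigma>s (\<pi> i)) x y"
  proof (cases "length x = n \<and> length y = n")
    case True
    have "(\<Prod>i<n. \<sigma>s i $ (x ! inv \<pi> i) $ (y ! inv \<pi> i)) = (\<Prod>i<n. \<sigma>s (\<pi> i) $ (x ! inv \<pi> (\<pi> i)) $ (y ! inv \<pi> (\<pi> i)))"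
      using prod.permute[OF \<pi>, of "\<lambda>i. \<sigma>s i $ (x ! inv \<pi> i) $ (y ! inv \<pi> i)"] by (simp add: o_def)
    also have "\<dots> = (\<Prod>i<n. \<sigma>s (\<pi> i) $ (x ! i) $ (y ! i))" by (simp add: permutes_inverses[OF \<pi>])
    finally show ?thesis using True by (simp add: perm_op_def avop_def permute_list_def)
  qed (auto simp: perm_op_def avop_def)
qed

lemma trp_avop_tpow:
  fixes G :: "'d::finite op"
  shows "trp (m * k) (avop (m * k) \<tau>) (tpow k m G) = (\<Prod>b<m. trp k (avop k (\<lambda>i. \<tau> (b * k + i))) G)"
proof (induction m)
  case 0
  then show ?case by (simp add: trp_def avop_def tpow_def)
next
  case (Suc m)
  have "trp (m * k + k) (avop (m * k + k) \<tau>) (tpow k (Suc m) G)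
     = trp (m * k) (avop (m * k) \<tau>) (tpow k m G) * trp k (avop k (\<lambda>i. \<tau> (m * k + i))) G"
    by (rule trp_factor) (rule avop_append tpow_append; assumption)+
  then show ?case by (simp add: Suc add.commute)
qed

lemma fact_add_ge: "fact n * real n ^ k \<le> fact (n + k)"
proof (induction k)
  case (Suc k)
  have "fact n * real n ^ Suc k = (fact n * real n ^ k) * real n" by simp
  also have "\<dots> \<le> fact (n + k) * real (Suc (n + k))" using Suc by (intro mult_mono) auto
  finally show ?case by (simp add: mult.commute)
qed simp

text \<open>Induction with a shift by one block: the factor (m k)^k left over from the previous step
  is absorbed by (m k + k)! / (m k)!, and the new factor is left over in turn. The left side thus
  exceeds (m k)! by at most a polynomial factor.\<close>

lemma prod_block_powers_le:
  assumes "m \<ge> 1"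
  shows "(\<Prod>b<m. real (Suc b * k) ^ k) \<le> fact (m * k) * real (m * k) ^ k"
  using assms
proof (induction m rule: dec_induct)
  case base
  have "1 * real k ^ k \<le> fact k * real k ^ k" by (intro mult_right_mono) (auto simp: fact_ge_1)
  then show ?case by simp
next
  case (step m)
  have "(\<Prod>b<Suc m. real (Suc b * k) ^ k) \<le> fact (m * k) * real (m * k) ^ k * real (Suc m * k) ^ k"
    using step.IH by (simp add: mult_right_mono)
  also have "\<dots> \<le> fact (m * k + k) * real (Suc m * k) ^ k"
    by (intro mult_right_mono fact_add_ge) simp
  finally show ?case by (simp add: add.commute)
qed

text \<open>The last k entries are chosen first, and the rest is an arrangement of what
  remains.\<close>

lemma permutations_split_bij:
  assumes S: "finite S" "card S = n + k"
  shows "bij_betw (\<lambda>(ys, zs). zs @ ys)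
     (SIGMA ys:{ys. distinct ys \<and> length ys = k \<and> set ys \<subseteq> S}. permutations_of_set (S - set ys))
     (permutations_of_set S)"
proof (rule bij_betw_byWitness[where f' = "\<lambda>xs. (drop n xs, take n xs)"])
  have len: "length zs = n" if "distinct ys" "length ys = k" "set ys \<subseteq> S" "zs \<in> permutations_of_set (S - set ys)" for ys zs
  proof -
    have "length zs = card (S - set ys)" using that(4) by (auto simp: permutations_of_set_def distinct_card[symmetric])
    also have "\<dots> = n" using that(1-3) S by (simp add: card_Diff_subset distinct_card)
    finally show ?thesis .
  qed
  show "\<forall>a\<in>SIGMA ys:{ys. distinct ys \<and> length ys = k \<and> set ys \<subseteq> S}. permutations_of_set (S - set ys).
       (drop n (case a of (ys, zs) \<Rightarrow> zs @ ys), take n (case a of (ys, zs) \<Rightarrow> zs @ ys)) = a"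
  proof
    fix a assume "a \<in> (SIGMA ys:{ys. distinct ys \<and> length ys = k \<and> set ys \<subseteq> S}. permutations_of_set (S - set ys))"
    then obtain ys zs where a: "a = (ys, zs)" "distinct ys" "length ys = k" "set ys \<subseteq> S" "zs \<in> permutations_of_set (S - set ys)"
      by (elim SigmaE) blast
    then show "(drop n (case a of (ys, zs) \<Rightarrow> zs @ ys), take n (case a of (ys, zs) \<Rightarrow> zs @ ys)) = a"
      using len[OF a(2-5)] by simp
  qed
  show "\<forall>a'\<in>permutations_of_set S. (case (drop n a', take n a') of (ys, zs) \<Rightarrow> zs @ ys) = a'" by simp
  show "(\<lambda>(ys, zs). zs @ ys) ` (SIGMA ys:{ys. distinct ys \<and> length ys = k \<and> set ys \<subseteq> S}. permutations_of_set (S - set ys))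
     \<subseteq> permutations_of_set S"
    by (auto simp: permutations_of_set_def)
  show "(\<lambda>xs. (drop n xs, take n xs)) ` permutations_of_set S
     \<subseteq> (SIGMA ys:{ys. distinct ys \<and> length ys = k \<and> set ys \<subseteq> S}. permutations_of_set (S - set ys))"
  proof
    fix p assume "p \<in> (\<lambda>xs. (drop n xs, take n xs)) ` permutations_of_set S"
    then obtain xs where xs: "p = (drop n xs, take n xs)" "set xs = S" "distinct xs"
      by (auto simp: permutations_of_set_def)
    have l: "length xs = n + k" using distinct_card[OF xs(3)] xs(2) S by simp
    have d: "set (take n xs) \<inter> set (drop n xs) = {}" using xs(3) by (metis set_take_disj_set_drop_if_distinct order_refl)
    have u: "set (take n xs) \<union> set (drop n xs) = S" using xs(2) by (metis append_take_drop_id set_append)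
    show "p \<in> (SIGMA ys:{ys. distinct ys \<and> length ys = k \<and> set ys \<subseteq> S}. permutations_of_set (S - set ys))"
      using xs l d u by (auto simp: permutations_of_set_def)
  qed
qed

text \<open>In a random arrangement the blocks are drawn without replacement. For the last block the
  distinct words are enlarged to all words over S, which is allowed since \<gamma> is nonnegative,
  and the sum over all words is controlled by \<open>avg\<close>. The other blocks arrange a smaller
  set, so \<open>avg\<close> must be available for every nonempty subset.\<close>

lemma sum_permutations_blocks_le:
  fixes \<gamma> :: "(nat \<Rightarrow> 'c) \<Rightarrow> real"
  assumes cong: "\<And>\<tau> \<tau>'. (\<And>i. i < k \<Longrightarrow> \<tau> i = \<tau>' i) \<Longrightarrow> \<gamma> \<tau> = \<gamma> \<tau>'"
    and nn: "\<And>ys. ys \<in> wlists U k \<Longrightarrow> 0 \<le> \<gamma> (\<lambda>i. f (ys ! i))"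
    and avg: "\<And>S. finite S \<Longrightarrow> S \<noteq> {} \<Longrightarrow> S \<subseteq> U \<Longrightarrow> (\<Sum>ys\<in>wlists S k. \<gamma> (\<lambda>i. f (ys ! i))) \<le> real (card S) ^ k"
    and k: "k \<ge> 1" and S: "finite S" "S \<subseteq> U" "card S = m * k"
  shows "(\<Sum>xs\<in>permutations_of_set S. \<Prod>b<m. \<gamma> (\<lambda>i. f (xs ! (b * k + i)))) \<le> (\<Prod>b<m. real (Suc b * k) ^ k)"
  using S
proof (induction m arbitrary: S)
  case 0
  then have "S = {}" by simp
  then show ?case by simp
next
  case (Suc m)
  let ?D = "{ys. distinct ys \<and> length ys = k \<and> set ys \<subseteq> S}"
  have cS: "card S = m * k + k" using Suc.prems by simp
  have Dsub: "?D \<subseteq> wlists S k" by (auto simp: wlists_def)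
  have finD: "finite ?D" by (rule finite_subset[OF Dsub]) (simp add: Suc.prems)
  have S0: "S \<noteq> {}" using cS k by auto
  have wU: "wlists S k \<subseteq> wlists U k" using Suc.prems by (auto simp: wlists_def)
  have "(\<Sum>xs\<in>permutations_of_set S. \<Prod>b<Suc m. \<gamma> (\<lambda>i. f (xs ! (b * k + i))))
     = (\<Sum>ys\<in>?D. \<Sum>zs\<in>permutations_of_set (S - set ys). \<Prod>b<Suc m. \<gamma> (\<lambda>i. f ((zs @ ys) ! (b * k + i))))"
  proof -
    have "(\<Sum>xs\<in>permutations_of_set S. \<Prod>b<Suc m. \<gamma> (\<lambda>i. f (xs ! (b * k + i))))
      = (\<Sum>p\<in>(SIGMA ys:?D. permutations_of_set (S - set ys)). \<Prod>b<Suc m. \<gamma> (\<lambda>i. f ((case p of (ys, zs) \<Rightarrow> zs @ ys) ! (b * k + i))))"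
      by (rule sum.reindex_bij_betw[OF permutations_split_bij[OF Suc.prems(1) cS], symmetric])
    also have "\<dots> = (\<Sum>ys\<in>?D. \<Sum>zs\<in>permutations_of_set (S - set ys). \<Prod>b<Suc m. \<gamma> (\<lambda>i. f ((zs @ ys) ! (b * k + i))))"
      by (subst sum.Sigma[OF finD]) (auto simp: case_prod_unfold)
    finally show ?thesis .
  qed
  also have "\<dots> = (\<Sum>ys\<in>?D. (\<Sum>zs\<in>permutations_of_set (S - set ys). \<Prod>b<m. \<gamma> (\<lambda>i. f (zs ! (b * k + i)))) * \<gamma> (\<lambda>i. f (ys ! i)))"
  proof (rule sum.cong[OF refl])
    fix ys assume ys: "ys \<in> ?D"
    have cs: "card (S - set ys) = m * k" using ys cS Suc.prems by (simp add: card_Diff_subset distinct_card)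
    show "(\<Sum>zs\<in>permutations_of_set (S - set ys). \<Prod>b<Suc m. \<gamma> (\<lambda>i. f ((zs @ ys) ! (b * k + i))))
      = (\<Sum>zs\<in>permutations_of_set (S - set ys). \<Prod>b<m. \<gamma> (\<lambda>i. f (zs ! (b * k + i)))) * \<gamma> (\<lambda>i. f (ys ! i))"
      unfolding sum_distrib_right
    proof (rule sum.cong[OF refl])
      fix zs assume "zs \<in> permutations_of_set (S - set ys)"
      then have lz: "length zs = m * k" using cs by (auto simp: permutations_of_set_def distinct_card[symmetric])
      have 1: "\<gamma> (\<lambda>i. f ((zs @ ys) ! (b * k + i))) = \<gamma> (\<lambda>i. f (zs ! (b * k + i)))" if b: "b < m" for b
      proof (rule cong)
        fix i assume "i < k"
        then have "b * k + i < b * k + k" by simp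
        also have "\<dots> \<le> m * k" using b by (metis Suc_leI add.commute mult_Suc mult_le_mono1)
        finally show "f ((zs @ ys) ! (b * k + i)) = f (zs ! (b * k + i))" using lz by (simp add: nth_append)
      qed
      have 2: "\<gamma> (\<lambda>i. f ((zs @ ys) ! (m * k + i))) = \<gamma> (\<lambda>i. f (ys ! i))"
        by (rule cong) (simp add: nth_append lz)
      show "(\<Prod>b<Suc m. \<gamma> (\<lambda>i. f ((zs @ ys) ! (b * k + i)))) = (\<Prod>b<m. \<gamma> (\<lambda>i. f (zs ! (b * k + i)))) * \<gamma> (\<lambda>i. f (ys ! i))"
        using 1 2 by simp
    qed
  qed
  also have "\<dots> \<le> (\<Sum>ys\<in>?D. (\<Prod>b<m. real (Suc b * k) ^ k) * \<gamma> (\<lambda>i. f (ys ! i)))"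
  proof (rule sum_mono)
    fix ys assume ys: "ys \<in> ?D"
    have cs: "card (S - set ys) = m * k" using ys cS Suc.prems by (simp add: card_Diff_subset distinct_card)
    have "(\<Sum>zs\<in>permutations_of_set (S - set ys). \<Prod>b<m. \<gamma> (\<lambda>i. f (zs ! (b * k + i)))) \<le> (\<Prod>b<m. real (Suc b * k) ^ k)"
      using Suc.prems cs by (intro Suc.IH) auto
    then show "(\<Sum>zs\<in>permutations_of_set (S - set ys). \<Prod>b<m. \<gamma> (\<lambda>i. f (zs ! (b * k + i)))) * \<gamma> (\<lambda>i. f (ys ! i))
        \<le> (\<Prod>b<m. real (Suc b * k) ^ k) * \<gamma> (\<lambda>i. f (ys ! i))"
      using ys Dsub wU nn by (intro mult_right_mono) auto
  qed
  also have "\<dots> = (\<Prod>b<m. real (Suc b * k) ^ k) * (\<Sum>ys\<in>?D. \<gamma> (\<lambda>i. f (ys ! i)))"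
    by (simp add: sum_distrib_left)
  also have "\<dots> \<le> (\<Prod>b<m. real (Suc b * k) ^ k) * real (card S) ^ k"
  proof (rule mult_left_mono)
    \<comment> \<open>Dropping distinctness: this is the passage from drawing without to drawing
      with replacement.\<close>
    have "(\<Sum>ys\<in>?D. \<gamma> (\<lambda>i. f (ys ! i))) \<le> (\<Sum>ys\<in>wlists S k. \<gamma> (\<lambda>i. f (ys ! i)))"
      using Dsub wU nn Suc.prems by (intro sum_mono2) auto
    also have "\<dots> \<le> real (card S) ^ k" using Suc.prems S0 by (intro avg) auto
    finally show "(\<Sum>ys\<in>?D. \<gamma> (\<lambda>i. f (ys ! i))) \<le> real (card S) ^ k" .
  qed (simp add: prod_nonneg)
  finally show ?case using Suc.prems by simp
qed

text \<open>The index type of the POVM is fixed to what the minimax argument produces: a basis vector of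
  one of finitely many orthonormal bases with values.\<close>
definition witness :: "(nat \<Rightarrow> 'd op set) \<Rightarrow> (complex^'d^'d) set \<Rightarrow> nat \<Rightarrow> real \<Rightarrow> bool" where
  "witness A C k v \<longleftrightarrow> (\<exists>(Y :: ((('d list \<Rightarrow> 'd vec) \<times> ('d list \<Rightarrow> real)) \<times> 'd list) set) \<phi> l. povm k Y \<phi> \<and>
     (\<forall>\<rho>\<in>A k. v \<le> (\<Sum>y\<in>Y. l y * prb k \<rho> (\<phi> y))) \<and>
     (\<forall>\<sigma>\<in>C. (\<Sum>y\<in>Y. exp (l y) * prb k (avop k (\<lambda>_. \<sigma>)) (\<phi> y)) \<le> 1))"

lemma trp_avop_rsum:
  fixes \<tau> :: "nat \<Rightarrow> complex^'d::finite^'d"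
  assumes "\<And>i. i < k \<Longrightarrow> \<tau> i \<in> states1"
  shows "trp k (avop k \<tau>) (rsum k Y \<phi> h) = complex_of_real (\<Sum>y\<in>Y. h y * prb k (avop k \<tau>) (\<phi> y))"
  using density_avop[of k \<tau>] assms by (intro trp_rsum_of_real) (auto simp: density_def psd_iff psd_on_def)

lemma sum_prb_nonneg:
  fixes \<tau> :: "nat \<Rightarrow> complex^'d::finite^'d"
  assumes "\<And>i. i < k \<Longrightarrow> \<tau> i \<in> states1" "\<And>y. y \<in> Y \<Longrightarrow> 0 \<le> h y"
  shows "0 \<le> (\<Sum>y\<in>Y. h y * prb k (avop k \<tau>) (\<phi> y))"
  using density_avop[of k \<tau>] assms by (intro sum_nonneg mult_nonneg_nonneg prb_nonneg) (auto simp: density_def)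

text \<open>Tensor powers are fixed by permutations, so each term of the sum over permutations is
  the m-th power of a single-block value at most 1, and g = 1.\<close>

lemma (in null_hypothesis) achievability_iid:
  assumes k: "k \<ge> 1" and W: "witness A C k v" and C: "C \<subseteq> states1" and eps: "\<epsilon> > 0"
  shows "ereal (v / real k) \<le> liminf (\<lambda>n. neglog_rate n (beta \<epsilon> n (A n) (iid_seq C n)))"
proof -
  obtain Y :: "((('d list \<Rightarrow> 'd vec) \<times> ('d list \<Rightarrow> real)) \<times> 'd list) set" and \<phi> l where
    p: "povm k Y \<phi>" and a: "\<forall>\<rho>\<in>A k. v \<le> (\<Sum>y\<in>Y. l y * prb k \<rho> (\<phi> y))"
    and g: "\<forall>\<sigma>\<in>C. (\<Sum>y\<in>Y. exp (l y) * prb k (avop k (\<lambda>_. \<sigma>)) (\<phi> y)) \<le> 1"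
    using W unfolding witness_def by (elim exE conjE) (rule that)
  show ?thesis
  proof (rule achievability[OF k p, where l=l and g="\<lambda>_. 1"])
    show "v \<le> (\<Sum>y\<in>Y. l y * prb k \<rho> (\<phi> y))" if "\<rho> \<in> A k" for \<rho> using a that by blast
    show "psd n \<sigma>" if st: "\<sigma> \<in> iid_seq C n" for n \<sigma>
    proof -
      obtain s where "\<sigma> = avop n (\<lambda>_. s)" "s \<in> C" using st unfolding iid_seq_eq by blast
      then show ?thesis using density_avop[of n "\<lambda>_. s"] C by (auto simp: density_def)
    qed
    show "ptrace_last n j \<sigma> \<in> iid_seq C n" if st: "\<sigma> \<in> iid_seq C (n + j)" for n j \<sigma>
    proof -
      obtain s where s: "\<sigma> = avop (n + j) (\<lambda>_. s)" "s \<in> C" using st unfolding iid_seq_eq by blast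
      then have "ptrace_last n j \<sigma> = avop n (\<lambda>_. s)" using C by (simp add: avop_ptrace subset_iff)
      then show ?thesis using s unfolding iid_seq_eq by blast
    qed
    fix m \<sigma> assume m: "1 \<le> m" and "\<sigma> \<in> iid_seq C (m * k)"
    then obtain s where s: "\<sigma> = avop (m * k) (\<lambda>_. s)" "s \<in> C" unfolding iid_seq_eq by blast
    define x where "x = (\<Sum>y\<in>Y. exp (l y) * prb k (avop k (\<lambda>_. s)) (\<phi> y))"
    have x: "0 \<le> x" "x \<le> 1" using sum_prb_nonneg[of k "\<lambda>_. s" Y] g s(2) C by (auto simp: x_def)
    have "trp (m * k) \<sigma> (tpow k m (rsum k Y \<phi> (\<lambda>y. exp (l y)))) = complex_of_real (x ^ m)"
    proof -
      have "trp k (avop k (\<lambda>_. s)) (rsum k Y \<phi> (\<lambda>y. exp (l y))) = complex_of_real x"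
        unfolding x_def by (rule trp_avop_rsum) (use s(2) C in auto)
      then show ?thesis unfolding s trp_avop_tpow by simp
    qed
    then have le: "Re (trp (m * k) \<sigma> (tpow k m (rsum k Y \<phi> (\<lambda>y. exp (l y))))) \<le> 1"
      using x by (simp add: power_le_one)
    have "(\<Sum>xs\<in>permutations_of_set {..<m * k}.
        Re (trp (m * k) (perm_op (m * k) (inv (permfun (m * k) xs)) \<sigma>) (tpow k m (rsum k Y \<phi> (\<lambda>y. exp (l y))))))
        \<le> (\<Sum>xs\<in>permutations_of_set {..<m * k}. 1)"
    proof (rule sum_mono)
      fix xs assume "xs \<in> permutations_of_set {..<m * k}"
      then have "perm_op (m * k) (inv (permfun (m * k) xs)) \<sigma> = \<sigma>"
        unfolding s by (simp add: perm_op_avop permfun_permutes)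
      then show "Re (trp (m * k) (perm_op (m * k) (inv (permfun (m * k) xs)) \<sigma>) (tpow k m (rsum k Y \<phi> (\<lambda>y. exp (l y))))) \<le> 1"
        using le by simp
    qed
    then show "(\<Sum>xs\<in>permutations_of_set {..<m * k}.
        Re (trp (m * k) (perm_op (m * k) (inv (permfun (m * k) xs)) \<sigma>) (tpow k m (rsum k Y \<phi> (\<lambda>y. exp (l y))))))
        \<le> fact (m * k) * 1"
      by simp
  qed (auto simp: eps)
qed

text \<open>By multilinearity, the product states over all words average to the tensor power of the
  average state.\<close>

lemma sum_wlists_avop:
  fixes \<sigma>s :: "nat \<Rightarrow> complex^'d::finite^'d" and G :: "'d op"
  assumes S: "finite S" "S \<noteq> {}"
  shows "(\<Sum>ys\<in>wlists S k. Re (trp k (avop k (\<lambda>i. \<sigma>s (ys ! i))) G))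
     = real (card S) ^ k * Re (trp k (avop k (\<lambda>_. \<Sum>s\<in>S. (1 / real (card S)) *\<^sub>R \<sigma>s s)) G)"
proof -
  let ?m = "\<Sum>s\<in>S. (1 / real (card S)) *\<^sub>R \<sigma>s s"
  have c: "card S > 0" using S by (simp add: card_gt_0_iff)
  have comp: "of_nat (card S) * ?m $ a $ b = (\<Sum>s\<in>S. \<sigma>s s $ a $ b)" for a b
  proof -
    have "?m $ a $ b = (\<Sum>s\<in>S. \<sigma>s s $ a $ b) / of_nat (card S)"
      by (simp add: sum_divide_distrib scaleR_conv_of_real[where 'a=complex])
    then show ?thesis using c by simp
  qed
  have ent: "(\<Sum>ys\<in>wlists S k. avop k (\<lambda>i. \<sigma>s (ys ! i)) x y) = of_nat (card S) ^ k * avop k (\<lambda>_. ?m) x y"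
    if "x \<in> basis k" "y \<in> basis k" for x y
  proof -
    have "(\<Sum>ys\<in>wlists S k. avop k (\<lambda>i. \<sigma>s (ys ! i)) x y) = (\<Prod>i<k. \<Sum>s\<in>S. \<sigma>s s $ (x ! i) $ (y ! i))"
      using that by (simp add: avop_def prod_sum_wlists)
    also have "\<dots> = (\<Prod>i<k. of_nat (card S) * ?m $ (x ! i) $ (y ! i))" unfolding comp ..
    also have "\<dots> = of_nat (card S) ^ k * avop k (\<lambda>_. ?m) x y" using that by (simp add: avop_def prod.distrib)
    finally show ?thesis .
  qed
  have "(\<Sum>ys\<in>wlists S k. trp k (avop k (\<lambda>i. \<sigma>s (ys ! i))) G)
      = (\<Sum>x\<in>basis k. \<Sum>ys\<in>wlists S k. \<Sum>y\<in>basis k. avop k (\<lambda>i. \<sigma>s (ys ! i)) x y * G y x)"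
    unfolding trp_def by (rule sum.swap)
  also have "\<dots> = (\<Sum>x\<in>basis k. \<Sum>y\<in>basis k. \<Sum>ys\<in>wlists S k. avop k (\<lambda>i. \<sigma>s (ys ! i)) x y * G y x)"
    by (intro sum.cong refl sum.swap)
  also have "\<dots> = (\<Sum>x\<in>basis k. \<Sum>y\<in>basis k. of_nat (card S) ^ k * (avop k (\<lambda>_. ?m) x y * G y x))"
    unfolding sum_distrib_right[symmetric] by (intro sum.cong refl) (simp only: ent mult.assoc)
  also have "\<dots> = of_nat (card S) ^ k * trp k (avop k (\<lambda>_. ?m)) G" by (simp add: trp_def sum_distrib_left)
  finally have "(\<Sum>ys\<in>wlists S k. trp k (avop k (\<lambda>i. \<sigma>s (ys ! i))) G) = complex_of_real (real (card S) ^ k) * trp k (avop k (\<lambda>_. ?m)) G"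
    by simp
  then have "Re (\<Sum>ys\<in>wlists S k. trp k (avop k (\<lambda>i. \<sigma>s (ys ! i))) G) = Re (complex_of_real (real (card S) ^ k) * trp k (avop k (\<lambda>_. ?m)) G)"
    by (rule arg_cong)
  then show ?thesis by (simp del: of_real_power)
qed

text \<open>Drawing k of the \<sigma>_i with replacement produces on average the tensor power of
  their mean, to which the witness applies since C is convex. Drawing without replacement costs the
  factor (m k)^k, whose logarithm divided by m tends to 0.\<close>

lemma (in null_hypothesis) achievability_av:
  assumes k: "k \<ge> 1" and W: "witness A C k v" and C: "C \<subseteq> states1" and cv: "convex C" and eps: "\<epsilon> > 0"
  shows "ereal (v / real k) \<le> liminf (\<lambda>n. neglog_rate n (beta \<epsilon> n (A n) (av_seq C n)))"
proof -
  obtain Y :: "((('d list \<Rightarrow> 'd vec) \<times> ('d list \<Rightarrow> real)) \<times> 'd list) set" and \<phi> l where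
    p: "povm k Y \<phi>" and a: "\<forall>\<rho>\<in>A k. v \<le> (\<Sum>y\<in>Y. l y * prb k \<rho> (\<phi> y))"
    and g: "\<forall>\<sigma>\<in>C. (\<Sum>y\<in>Y. exp (l y) * prb k (avop k (\<lambda>_. \<sigma>)) (\<phi> y)) \<le> 1"
    using W unfolding witness_def by (elim exE conjE) (rule that)
  define G where "G = rsum k Y \<phi> (\<lambda>y. exp (l y))"
  show ?thesis
  proof (rule achievability[OF k p, where l=l and g="\<lambda>m. real (m * k) ^ k"])
    show "v \<le> (\<Sum>y\<in>Y. l y * prb k \<rho> (\<phi> y))" if "\<rho> \<in> A k" for \<rho> using a that by blast
    show "psd n \<sigma>" if st: "\<sigma> \<in> av_seq C n" for n \<sigma>
    proof -
      obtain \<sigma>s where "\<sigma> = avop n \<sigma>s" "\<forall>i<n. \<sigma>s i \<in> C" using st unfolding av_seq_eq by blast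
      then show ?thesis using density_avop[of n \<sigma>s] C by (auto simp: density_def)
    qed
    show "ptrace_last n j \<sigma> \<in> av_seq C n" if st: "\<sigma> \<in> av_seq C (n + j)" for n j \<sigma>
    proof -
      obtain \<sigma>s where s: "\<sigma> = avop (n + j) \<sigma>s" "\<forall>i<n + j. \<sigma>s i \<in> C" using st unfolding av_seq_eq by blast
      have "ptrace_last n j \<sigma> = avop n \<sigma>s" unfolding s(1) by (rule avop_ptrace) (use s(2) C in auto)
      then show ?thesis using s unfolding av_seq_eq by fastforce
    qed
    fix m \<sigma> assume m: "1 \<le> m" and "\<sigma> \<in> av_seq C (m * k)"
    then obtain \<sigma>s where s: "\<sigma> = avop (m * k) \<sigma>s" "\<forall>i<m * k. \<sigma>s i \<in> C" unfolding av_seq_eq by blast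
    define \<gamma> where "\<gamma> \<tau> = Re (trp k (avop k \<tau>) G)" for \<tau>
    have \<gamma>c: "\<gamma> \<tau> = \<gamma> \<tau>'" if "\<And>i. i < k \<Longrightarrow> \<tau> i = \<tau>' i" for \<tau> \<tau>'
    proof -
      have "avop k \<tau> = avop k \<tau>'" using that by (auto simp: avop_def fun_eq_iff intro!: prod.cong)
      then show ?thesis by (simp add: \<gamma>_def)
    qed
    have \<gamma>r: "trp k (avop k \<tau>) G = complex_of_real (\<gamma> \<tau>)" "\<gamma> \<tau> \<ge> 0" if "\<And>i. i < k \<Longrightarrow> \<tau> i \<in> states1" for \<tau>
    proof -
      have e: "trp k (avop k \<tau>) G = complex_of_real (\<Sum>y\<in>Y. exp (l y) * prb k (avop k \<tau>) (\<phi> y))"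
        unfolding G_def by (rule trp_avop_rsum) (rule that)
      then show "trp k (avop k \<tau>) G = complex_of_real (\<gamma> \<tau>)" unfolding \<gamma>_def e Re_complex_of_real ..
      show "\<gamma> \<tau> \<ge> 0" unfolding \<gamma>_def e Re_complex_of_real
        by (rule sum_prb_nonneg) (auto intro: that)
    qed
    have sum: "(\<Sum>xs\<in>permutations_of_set {..<m * k}. \<Prod>b<m. \<gamma> (\<lambda>i. \<sigma>s (xs ! (b * k + i)))) \<le> (\<Prod>b<m. real (Suc b * k) ^ k)"
    proof (rule sum_permutations_blocks_le[where U="{..<m * k}"])
      show "0 \<le> \<gamma> (\<lambda>i. \<sigma>s (ys ! i))" if "ys \<in> wlists {..<m * k} k" for ys
      proof (rule \<gamma>r(2))
        fix i assume "i < k"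
        then have "ys ! i \<in> set ys" using that by (simp add: wlists_def)
        then show "\<sigma>s (ys ! i) \<in> states1" using that s(2) C by (auto simp: wlists_def)
      qed
      show "(\<Sum>ys\<in>wlists S k. \<gamma> (\<lambda>i. \<sigma>s (ys ! i))) \<le> real (card S) ^ k" if S: "finite S" "S \<noteq> {}" "S \<subseteq> {..<m * k}" for S
      proof -
        let ?m = "\<Sum>s\<in>S. (1 / real (card S)) *\<^sub>R \<sigma>s s"
        \<comment> \<open>Convexity of C enters here: the witness constrains only tensor powers of
          members of C.\<close>
        have "?m \<in> C"
          using S s(2) by (intro convex_sum[OF S(1) cv]) (auto simp: card_gt_0_iff)
        have "\<gamma> (\<lambda>_. ?m) = (\<Sum>y\<in>Y. exp (l y) * prb k (avop k (\<lambda>_. ?m)) (\<phi> y))"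
        proof -
          have "trp k (avop k (\<lambda>_. ?m)) G = complex_of_real (\<Sum>y\<in>Y. exp (l y) * prb k (avop k (\<lambda>_. ?m)) (\<phi> y))"
            unfolding G_def by (rule trp_avop_rsum) (use \<open>?m \<in> C\<close> C in auto)
          then show ?thesis unfolding \<gamma>_def by (simp only: Re_complex_of_real)
        qed
        then have "\<gamma> (\<lambda>_. ?m) \<le> 1" using g \<open>?m \<in> C\<close> by simp
        then have "real (card S) ^ k * \<gamma> (\<lambda>_. ?m) \<le> real (card S) ^ k * 1" by (intro mult_left_mono) auto
        then show ?thesis unfolding \<gamma>_def sum_wlists_avop[OF S(1,2)] by simp
      qed
      show "\<gamma> \<tau> = \<gamma> \<tau>'" if "\<And>i. i < k \<Longrightarrow> \<tau> i = \<tau>' i" for \<tau> \<tau>' by (rule \<gamma>c) (rule that)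
    qed (use k in auto)
    have "(\<Sum>xs\<in>permutations_of_set {..<m * k}. Re (trp (m * k) (perm_op (m * k) (inv (permfun (m * k) xs)) \<sigma>) (tpow k m G)))
      = (\<Sum>xs\<in>permutations_of_set {..<m * k}. \<Prod>b<m. \<gamma> (\<lambda>i. \<sigma>s (xs ! (b * k + i))))"
    proof (rule sum.cong[OF refl])
      fix xs assume xs: "xs \<in> permutations_of_set {..<m * k}"
      have lt: "b * k + i < m * k" if "b < m" "i < k" for b i
      proof -
        have "b * k + i < b * k + k" using that by simp
        also have "\<dots> \<le> m * k" using that(1) by (metis Suc_leI add.commute mult_Suc mult_le_mono1)
        finally show ?thesis .
      qed
      have xsl: "set xs = {..<m * k}" "length xs = m * k"
        using xs by (auto simp: permutations_of_set_def distinct_card[symmetric])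
      have pf: "permfun (m * k) xs (b * k + i) = xs ! (b * k + i)" "xs ! (b * k + i) < m * k" if "b < m" "i < k" for b i
        using lt[OF that] xsl nth_mem[of "b * k + i" xs] by (auto simp: permfun_def)
      have "trp (m * k) (perm_op (m * k) (inv (permfun (m * k) xs)) \<sigma>) (tpow k m G)
         = (\<Prod>b<m. trp k (avop k (\<lambda>i. \<sigma>s (permfun (m * k) xs (b * k + i)))) G)"
        unfolding s perm_op_avop[OF permfun_permutes[OF xs]] trp_avop_tpow ..
      also have "\<dots> = (\<Prod>b<m. complex_of_real (\<gamma> (\<lambda>i. \<sigma>s (xs ! (b * k + i)))))"
      proof (rule prod.cong[OF refl])
        fix b assume b: "b \<in> {..<m}"
        have "trp k (avop k (\<lambda>i. \<sigma>s (permfun (m * k) xs (b * k + i)))) G = complex_of_real (\<gamma> (\<lambda>i. \<sigma>s (permfun (m * k) xs (b * k + i))))"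
          using pf b s(2) C by (intro \<gamma>r(1)) auto
        also have "\<gamma> (\<lambda>i. \<sigma>s (permfun (m * k) xs (b * k + i))) = \<gamma> (\<lambda>i. \<sigma>s (xs ! (b * k + i)))"
          using pf b by (intro \<gamma>c) auto
        finally show "trp k (avop k (\<lambda>i. \<sigma>s (permfun (m * k) xs (b * k + i)))) G = complex_of_real (\<gamma> (\<lambda>i. \<sigma>s (xs ! (b * k + i))))" .
      qed
      finally show "Re (trp (m * k) (perm_op (m * k) (inv (permfun (m * k) xs)) \<sigma>) (tpow k m G)) = (\<Prod>b<m. \<gamma> (\<lambda>i. \<sigma>s (xs ! (b * k + i))))"
        by (metis Re_complex_of_real of_real_prod)
    qed
    also have "\<dots> \<le> fact (m * k) * real (m * k) ^ k" using sum prod_block_powers_le[OF m, of k] by linarith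
    finally show "(\<Sum>xs\<in>permutations_of_set {..<m * k}.
        Re (trp (m * k) (perm_op (m * k) (inv (permfun (m * k) xs)) \<sigma>) (tpow k m (rsum k Y \<phi> (\<lambda>y. exp (l y))))))
        \<le> fact (m * k) * real (m * k) ^ k" by (simp add: G_def)
  next
    show "(\<lambda>m. ln (real (m * k) ^ k) / real m) \<longlonglongrightarrow> 0"
    proof (rule Lim_transform_eventually)
      have "(\<lambda>m. real k * (ln (real k) / real m) + real k * (ln (real m) / real m)) \<longlonglongrightarrow> real k * 0 + real k * 0"
        by (intro tendsto_intros lim_const_over_n lim_ln_over_n)
      then show "(\<lambda>m. real k * (ln (real k) / real m) + real k * (ln (real m) / real m)) \<longlonglongrightarrow> 0" by simp
      show "\<forall>\<^sub>F m in sequentially. real k * (ln (real k) / real m) + real k * (ln (real m) / real m) = ln (real (m * k) ^ k) / real m"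
        using eventually_ge_at_top[of 1]
      proof eventually_elim
        case (elim m)
        have "ln (real (m * k) ^ k) = real k * (ln (real m) + ln (real k))"
          using k elim by (simp add: ln_realpow ln_mult)
        then show ?case by (simp add: add_divide_distrib algebra_simps)
      qed
    qed
    show "0 < real (m * k) ^ k" if "1 \<le> m" for m using that k by simp
  qed (rule eps)
qed

section \<open>Arbitrarily varying states of a convex hull\<close>

lemma avop_update_affine:
  fixes a b :: "complex^'d^'d"
  assumes m: "m < n"
  shows "avop n (\<sigma>s(m := u *\<^sub>R a + v *\<^sub>R b)) x y
     = complex_of_real u * avop n (\<sigma>s(m := a)) x y + complex_of_real v * avop n (\<sigma>s(m := b)) x y"
proof -
  have "(\<Prod>i<n. (\<sigma>s(m := c)) i $ (x ! i) $ (y ! i)) = c $ (x ! m) $ (y ! m) * (\<Prod>i\<in>{..<n} - {m}. \<sigma>s i $ (x ! i) $ (y ! i))" for c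
    using m by (subst prod.remove[of _ m]) (auto intro!: prod.cong)
  note upd = this
  show ?thesis
    unfolding avop_def upd
    by (simp add: scaleR_conv_of_real[where 'a=complex] distrib_right mult.assoc)
qed

text \<open>The expectation is affine in each tensor factor. Factors in the hull are replaced one at
  a time: the choices at a single site that do not exceed the supremum form a convex set containing
  F, hence containing its hull.\<close>

lemma sup_av_hull:
  fixes F :: "(complex^'d::finite^'d) set" and E :: "'d op"
  shows "(SUP \<sigma>\<in>av_seq (convex hull F) n. ereal (Re (trp n \<sigma> E))) = (SUP \<sigma>\<in>av_seq F n. ereal (Re (trp n \<sigma> E)))"
proof (rule antisym)
  let ?s = "SUP \<sigma>\<in>av_seq F n. ereal (Re (trp n \<sigma> E))"
  define f where "f \<sigma>s = Re (trp n (avop n \<sigma>s) E)" for \<sigma>s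
  have aff: "f (\<sigma>s(m := u *\<^sub>R a + v *\<^sub>R b)) = u * f (\<sigma>s(m := a)) + v * f (\<sigma>s(m := b))" if "m < n" for \<sigma>s m u v a b
  proof -
    have "trp n (avop n (\<sigma>s(m := u *\<^sub>R a + v *\<^sub>R b))) E
       = complex_of_real u * trp n (avop n (\<sigma>s(m := a))) E + complex_of_real v * trp n (avop n (\<sigma>s(m := b))) E"
      unfolding trp_def avop_update_affine[OF that] by (simp add: sum_distrib_left sum.distrib algebra_simps)
    then show ?thesis by (simp add: f_def)
  qed
  have "ereal (f \<sigma>s) \<le> ?s" if "m \<le> n" "\<forall>i<m. \<sigma>s i \<in> convex hull F" "\<forall>i. m \<le> i \<and> i < n \<longrightarrow> \<sigma>s i \<in> F" for m \<sigma>s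
    using that
  proof (induction m arbitrary: \<sigma>s)
    case 0
    then have "avop n \<sigma>s \<in> av_seq F n" unfolding av_seq_eq by blast
    then show ?case unfolding f_def by (rule SUP_upper)
  next
    case (Suc m)
    define T where "T = {\<tau>. ereal (f (\<sigma>s(m := \<tau>))) \<le> ?s}"
    have "F \<subseteq> T" unfolding T_def
    proof clarify
      fix \<tau> assume "\<tau> \<in> F"
      then show "ereal (f (\<sigma>s(m := \<tau>))) \<le> ?s"
        using Suc.prems by (intro Suc.IH) (auto simp: less_Suc_eq)
    qed
    moreover have "convex T"
    proof (rule convexI)
      fix a b and u v :: real assume ab: "a \<in> T" "b \<in> T" and uv: "0 \<le> u" "0 \<le> v" "u + v = 1"
      have m: "m < n" using Suc.prems by simp
      show "u *\<^sub>R a + v *\<^sub>R b \<in> T"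
      proof (cases ?s)
        case (real r)
        then have "f (\<sigma>s(m := a)) \<le> r" "f (\<sigma>s(m := b)) \<le> r" using ab by (auto simp: T_def)
        then have "u * f (\<sigma>s(m := a)) + v * f (\<sigma>s(m := b)) \<le> u * r + v * r" using uv by (intro add_mono mult_left_mono) auto
        also have "\<dots> = r" using uv by (simp add: distrib_right[symmetric])
        finally show ?thesis using real by (simp add: T_def aff[OF m])
      qed (use ab in \<open>auto simp: T_def\<close>)
    qed
    ultimately have "convex hull F \<subseteq> T" by (rule hull_minimal)
    then have "\<sigma>s m \<in> T" using Suc.prems by auto
    then show ?case by (simp add: T_def)
  qed
  note le = this[of n, OF order_refl]
  show "(SUP \<sigma>\<in>av_seq (convex hull F) n. ereal (Re (trp n \<sigma> E))) \<le> ?s"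
  proof (rule SUP_least)
    fix \<sigma> assume "\<sigma> \<in> av_seq (convex hull F) n"
    then obtain \<sigma>s where "\<sigma> = avop n \<sigma>s" "\<forall>i<n. \<sigma>s i \<in> convex hull F" unfolding av_seq_eq by blast
    moreover from this have "ereal (f \<sigma>s) \<le> ?s" by (intro le) auto
    ultimately show "ereal (Re (trp n \<sigma> E)) \<le> ?s" by (simp add: f_def)
  qed
  have "av_seq F n \<subseteq> av_seq (convex hull F) n" unfolding av_seq_eq using hull_subset[of F convex] by blast
  then show "?s \<le> (SUP \<sigma>\<in>av_seq (convex hull F) n. ereal (Re (trp n \<sigma> E)))" by (rule SUP_subset_mono) simp
qed

text \<open>The alternative enters \<open>beta\<close> only through the supremum for a fixed
  test.\<close>

lemma stein_av_hull:
  fixes F :: "(complex^'d::finite^'d) set"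
  shows "stein A (av_seq (convex hull F)) = stein A (av_seq F)"
  unfolding stein_def beta_def trace_mmul sup_av_hull ..

section \<open>Mixtures of tensor powers\<close>

text \<open>A crude bound from the spectral decomposition: the eigenvalues sum to 1 and unit vectors
  have entries of modulus at most 1. It gives compactness of the sets of states and integrability
  under mixing measures.\<close>

lemma density_entry_bound:
  fixes \<rho> :: "'d::finite op"
  assumes "density n \<rho>"
  shows "cmod (\<rho> x y) \<le> 1"
proof (cases "length x = n \<and> length y = n")
  case True
  let ?I = "basis n :: 'd list set"
  have ps: "psd_on ?I \<rho>" and h: "herm_on ?I \<rho>" using assms by (auto simp: density_def psd_iff psd_on_def)
  obtain e p where e: "eigs ?I \<rho> p e" using eigenbasis_exists[OF finite_basis h] by blast
  have oe: "onb ?I e" using e by (simp add: eigs_def)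
  have p0: "p i \<ge> 0" if "i \<in> ?I" for i using psd_eigenvalue_nonneg[OF finite_basis ps e that] .
  have "complex_of_real (\<Sum>i\<in>?I. p i) = (\<Sum>i\<in>?I. ip ?I (e i) (mv ?I \<rho> (e i)))" by (simp add: eigs_ip[OF _ e])
  also have "\<dots> = trace n \<rho>" using onb_trace[OF finite_basis oe] by (simp add: trace_def)
  also have "\<dots> = 1" using assms by (simp add: density_def)
  finally have p1: "(\<Sum>i\<in>?I. p i) = 1" by (metis of_real_1 of_real_eq_iff)
  have e1: "cmod (e i z) \<le> 1" if "i \<in> ?I" "z \<in> ?I" for i z
  proof -
    have "(cmod (e i z))\<^sup>2 \<le> (\<Sum>z\<in>?I. (cmod (e i z))\<^sup>2)" using that by (intro member_le_sum) auto
    also have "\<dots> = 1"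
    proof -
      have "ip ?I (e i) (e i) = 1" using oe that(1) by (simp add: onb_def)
      then show ?thesis unfolding ip_self by (metis of_real_1 of_real_eq_iff)
    qed
    finally show ?thesis by (simp add: power_le_one_iff abs_square_le_1)
  qed
  have "cmod (\<rho> x y) = cmod (\<Sum>i\<in>?I. complex_of_real (p i) * e i x * cnj (e i y))"
    using eigs_decomp[OF finite_basis e] True by simp
  also have "\<dots> \<le> (\<Sum>i\<in>?I. p i * 1)"
  proof (rule sum_norm_le)
    fix i assume i: "i \<in> ?I"
    have "cmod (complex_of_real (p i) * e i x * cnj (e i y)) = p i * (cmod (e i x) * cmod (e i y))"
      using p0[OF i] by (simp add: norm_mult)
    also have "\<dots> \<le> p i * (1 * 1)" using p0[OF i] e1[OF i] True by (intro mult_left_mono mult_mono) auto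
    finally show "cmod (complex_of_real (p i) * e i x * cnj (e i y)) \<le> p i * 1" by simp
  qed
  finally show ?thesis using p1 by simp
next
  case False
  then have "\<rho> x y = 0" using assms by (auto simp: density_def psd_iff is_op_def)
  then show ?thesis by simp
qed

lemma continuous_avop: "continuous_on UNIV (\<lambda>\<sigma>. avop n (\<lambda>_. \<sigma>) x y)"
  unfolding avop_def by (cases "length x = n \<and> length y = n") (auto intro!: continuous_intros)

text \<open>The entries of a tensor power depend only on the joint type of the index, a property
  that survives integration over \<sigma> and bounds the number of eigenvalues of a mixture.\<close>

lemma avop_mset:
  assumes "length x = n" "length y = n" "length x' = n" "length y' = n"
    and "mset (zip x y) = mset (zip x' y')"
  shows "avop n (\<lambda>_. \<sigma>) x y = avop n (\<lambda>_. \<sigma>) x' y'"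
proof -
  have "avop n (\<lambda>_. \<sigma>) u v = prod_mset (image_mset (\<lambda>(a, b). \<sigma> $ a $ b) (mset (zip u v)))" if "length u = n" "length v = n" for u v
  proof -
    have "avop n (\<lambda>_. \<sigma>) u v = (\<Prod>i<n. (map (\<lambda>(a, b). \<sigma> $ a $ b) (zip u v)) ! i)"
      using that by (auto simp: avop_def intro!: prod.cong)
    also have "\<dots> = prod_list (map (\<lambda>(a, b). \<sigma> $ a $ b) (zip u v))"
      using that by (simp add: prod.list_conv_set_nth atLeast0LessThan)
    also have "\<dots> = prod_mset (mset (map (\<lambda>(a, b). \<sigma> $ a $ b) (zip u v)))" by (rule prod_mset_prod_list[symmetric])
    finally show ?thesis by simp
  qed
  then show ?thesis using assms by simp
qed

locale mixing_measure =
  fixes C :: "(complex^'d::finite^'d) set" and M :: "(complex^'d^'d) measure"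
  assumes C: "closed C" "C \<subseteq> states1" and M: "M \<in> prob_on C"
begin

sublocale prob_space M
  using M by (simp add: prob_on_def)

lemma sets_M [measurable_cong]: "sets M = sets borel"
  using M by (simp add: prob_on_def)

lemma AE_C: "AE \<sigma> in M. \<sigma> \<in> C"
proof -
  have "UNIV - C \<in> null_sets M" using M C by (auto simp: prob_on_def null_sets_def)
  then show ?thesis by (rule AE_I') auto
qed

lemma avop_measurable: "(\<lambda>\<sigma>. avop n (\<lambda>_. \<sigma>) x y) \<in> borel_measurable M"
proof -
  have "(\<lambda>\<sigma>. avop n (\<lambda>_. \<sigma>) x y) \<in> borel_measurable borel"
    by (rule borel_measurable_continuous_onI[OF continuous_avop])
  then show ?thesis by (simp add: measurable_cong_sets[OF sets_M refl])
qed

lemma avop_integrable: "integrable M (\<lambda>\<sigma>. avop n (\<lambda>_. \<sigma>) x y)"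
proof (rule integrable_const_bound[where B=1])
  show "AE \<sigma> in M. cmod (avop n (\<lambda>_. \<sigma>) x y) \<le> 1"
    using AE_C by eventually_elim (use C(2) in \<open>auto intro!: density_entry_bound density_avop\<close>)
qed (rule avop_measurable)

lemma mixture_entry: "mixture M n x y = (LINT \<sigma>|M. avop n (\<lambda>_. \<sigma>) x y)"
proof (cases "length x = n \<and> length y = n")
  case False
  then have "avop n (\<lambda>_. \<sigma>) x y = 0" for \<sigma> :: "complex^'d^'d" by (auto simp: avop_def)
  then show ?thesis using False unfolding mixture_def tpow_op1 by auto
qed (simp add: mixture_def tpow_op1 del: One_nat_def)

lemma trp_integrable: "integrable M (\<lambda>\<sigma>. trp n (avop n (\<lambda>_. \<sigma>)) X)"
  unfolding trp_def
  by (intro Bochner_Integration.integrable_sum Bochner_Integration.integrable_mult_left avop_integrable)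

lemma trp_mixture: "trp n (mixture M n) X = (LINT \<sigma>|M. trp n (avop n (\<lambda>_. \<sigma>)) X)"
proof -
  have "(LINT \<sigma>|M. trp n (avop n (\<lambda>_. \<sigma>)) X)
     = (\<Sum>x\<in>basis n. (LINT \<sigma>|M. (\<Sum>y\<in>basis n. avop n (\<lambda>_. \<sigma>) x y * X y x)))"
    unfolding trp_def
    by (intro Bochner_Integration.integral_sum Bochner_Integration.integrable_sum
        Bochner_Integration.integrable_mult_left avop_integrable)
  also have "\<dots> = (\<Sum>x\<in>basis n. \<Sum>y\<in>basis n. (LINT \<sigma>|M. avop n (\<lambda>_. \<sigma>) x y * X y x))"
    by (intro sum.cong refl Bochner_Integration.integral_sum Bochner_Integration.integrable_mult_left avop_integrable)
  finally show ?thesis by (simp add: trp_def mixture_entry)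
qed

lemma prb_eq_trp: "prb n X v = Re (trp n X (\<lambda>y x. v y * cnj (v x)))"
  by (simp add: prb_def trp_def ip_def mv_def sum_distrib_left mult.commute mult.left_commute)

lemma prb_integrable: "integrable M (\<lambda>\<sigma>. prb n (avop n (\<lambda>_. \<sigma>)) v)"
  unfolding prb_eq_trp by (intro integrable_Re trp_integrable)

lemma prb_mixture: "prb n (mixture M n) v = (LINT \<sigma>|M. prb n (avop n (\<lambda>_. \<sigma>)) v)"
  unfolding prb_eq_trp trp_mixture by (rule integral_Re[OF trp_integrable, symmetric])

lemma density_mixture: "density n (mixture M n)"
proof -
  have "is_op n (mixture M n)" by (auto simp: is_op_def mixture_def)
  moreover have "herm_on (basis n) (mixture M n)"
    unfolding herm_on_def mixture_entry
  proof (intro ballI)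
    fix x y :: "'d list" assume xy: "x \<in> basis n" "y \<in> basis n"
    have "(LINT \<sigma>|M. avop n (\<lambda>_. \<sigma>) y x) = (LINT \<sigma>|M. cnj (avop n (\<lambda>_. \<sigma>) x y))"
    proof (rule integral_cong_AE)
      show "AE \<sigma> in M. avop n (\<lambda>_. \<sigma>) y x = cnj (avop n (\<lambda>_. \<sigma>) x y)"
        using AE_C
      proof eventually_elim
        case (elim \<sigma>)
        then have "density n (avop n (\<lambda>_. \<sigma>))" using C(2) by (intro density_avop) auto
        then have "herm_on (basis n) (avop n (\<lambda>_. \<sigma>))" by (simp add: density_def psd_iff psd_on_def)
        then show ?case using xy unfolding herm_on_def by blast
      qed
      show "(\<lambda>\<sigma>. cnj (avop n (\<lambda>_. \<sigma>) x y)) \<in> borel_measurable M"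
        using integrable_cnj[OF avop_integrable] by (rule borel_measurable_integrable)
    qed (rule avop_measurable)
    then show "(LINT \<sigma>|M. avop n (\<lambda>_. \<sigma>) y x) = cnj (LINT \<sigma>|M. avop n (\<lambda>_. \<sigma>) x y)"
      by simp
  qed
  moreover have "0 \<le> Re (ip (basis n) v (mv (basis n) (mixture M n) v))" for v
    unfolding prb_def[symmetric] prb_mixture
  proof (rule integral_nonneg_AE)
    show "AE \<sigma> in M. 0 \<le> prb n (avop n (\<lambda>_. \<sigma>)) v"
      using AE_C
    proof eventually_elim
      case (elim \<sigma>)
      then have "density n (avop n (\<lambda>_. \<sigma>))" using C(2) by (intro density_avop) auto
      then show ?case by (intro prb_nonneg) (simp add: density_def)
    qed
  qed
  moreover have "trace n (mixture M n) = 1"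
  proof -
    have "trace n (mixture M n) = (LINT \<sigma>|M. trp n (avop n (\<lambda>_. \<sigma>)) (ident n))"
      unfolding trp_ident[symmetric] by (rule trp_mixture)
    also have "\<dots> = (LINT \<sigma>|M. 1)"
    proof (rule integral_cong_AE)
      show "AE \<sigma> in M. trp n (avop n (\<lambda>_. \<sigma>)) (ident n) = 1"
        using AE_C
      proof eventually_elim
        case (elim \<sigma>)
        then have "density n (avop n (\<lambda>_. \<sigma>))" using C(2) by (intro density_avop) auto
        then show ?case by (simp add: density_def trp_ident)
      qed
      show "(\<lambda>\<sigma>. trp n (avop n (\<lambda>_. \<sigma>)) (ident n)) \<in> borel_measurable M"
        using trp_integrable by (rule borel_measurable_integrable)
    qed simp
    finally show ?thesis by (simp add: prob_space)
  qed
  ultimately show ?thesis by (simp add: density_def psd_iff psd_on_def)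
qed

lemma card_eigenvalues_mixture:
  assumes "eigs (basis n) (mixture M n) q f"
  shows "card (q ` basis n) \<le> (n + 1) ^ (CARD('d) * CARD('d))"
proof (rule card_eigenvalues_symmetric[OF _ assms])
  show "herm_on (basis n) (mixture M n)" using density_mixture by (simp add: density_def psd_iff psd_on_def)
  fix x y x' y' :: "'d list"
  assume "x \<in> basis n" "y \<in> basis n" "x' \<in> basis n" "y' \<in> basis n" "mset (zip x y) = mset (zip x' y')"
  then have "avop n (\<lambda>_. \<sigma>) x y = avop n (\<lambda>_. \<sigma>) x' y'" for \<sigma> :: "complex^'d^'d" by (intro avop_mset) auto
  then show "mixture M n x y = mixture M n x' y'" by (simp add: mixture_entry)
qed

lemma trp_mixture_le:
  assumes "\<And>\<sigma>. \<sigma> \<in> C \<Longrightarrow> Re (trp n (avop n (\<lambda>_. \<sigma>)) E) \<le> b"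
  shows "Re (trp n (mixture M n) E) \<le> b"
proof -
  have "Re (trp n (mixture M n) E) = (LINT \<sigma>|M. Re (trp n (avop n (\<lambda>_. \<sigma>)) E))"
    unfolding trp_mixture by (rule integral_Re[OF trp_integrable, symmetric])
  also have "\<dots> \<le> (LINT \<sigma>|M. b)"
  proof (rule integral_mono_AE)
    show "AE \<sigma> in M. Re (trp n (avop n (\<lambda>_. \<sigma>)) E) \<le> b" using AE_C by eventually_elim (rule assms)
  qed (auto intro: integrable_Re trp_integrable)
  finally show ?thesis by (simp add: prob_space)
qed

end

section \<open>Lower bound on the entropy rate for every measure\<close>

lemma is_test_ident: "is_test n (ident n :: 'd::finite op)"
proof -
  have "is_op n (ident n)" by (auto simp: is_op_def ident_def)
  moreover have "herm_on (basis n) (ident n)" by (auto simp: herm_on_def ident_def)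
  moreover have "0 \<le> Re (ip (basis n) v v)" for v :: "'d vec" by (simp add: ip_self sum_nonneg)
  ultimately show ?thesis by (simp add: is_test_def ip_ident)
qed

context null_hypothesis
begin

lemma beta_le_one:
  assumes "\<epsilon> \<ge> 0" "\<And>\<sigma>. \<sigma> \<in> B \<Longrightarrow> density n \<sigma>"
  shows "beta \<epsilon> n (A n) B \<le> 1"
proof -
  have "beta \<epsilon> n (A n) B \<le> ereal 1"
  proof (rule beta_le_test[OF is_test_ident])
    show "Re (trp n \<rho> (mminus n (ident n) (ident n))) \<le> \<epsilon>" for \<rho> unfolding trp_mminus using assms(1) by simp
    show "Re (trp n \<sigma> (ident n)) \<le> 1" if "\<sigma> \<in> B" for \<sigma> using assms(2)[OF that] by (simp add: trp_ident density_def)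
  qed
  then show ?thesis by (simp add: one_ereal_def)
qed

text \<open>A test with errors \<epsilon> and b forces the relative entropy d to satisfy d \<ge> (1
  - \<epsilon>) ln (1 / b) - (1 / b - 1) b, where the last term is less than 1; this is the loss of
  1 / n in the rate. An error bound for all members of C passes to the mixture by
  integration.\<close>

lemma converse:
  assumes C: "closed C" "C \<subseteq> states1" and M: "M \<in> prob_on C" and n: "n \<ge> 1"
    and eps: "0 < \<epsilon>" "\<epsilon> < 1" and t: "ereal t \<le> neglog_rate n (beta \<epsilon> n (A n) (iid_seq C n))"
  shows "ereal ((1 - \<epsilon>) * t - 1 / real n) \<le> rate_seq A M n"
proof -
  interpret mm: mixing_measure C M by unfold_locales (use C M in auto)
  have "ereal (real n * ((1 - \<epsilon>) * t) - 1) \<le> relent n \<rho> (mixture M n)" if \<rho>: "\<rho> \<in> A n" for \<rho>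
  proof -
    have d\<rho>: "density n \<rho>" using A_density[OF n \<rho>] .
    let ?\<sigma> = "mixture M n"
    have D0: "0 \<le> relent n \<rho> ?\<sigma>"
      using relent_ge_test[OF d\<rho> mm.density_mixture is_test_loewner[OF is_test_ident], of 1] by (simp add: zero_ereal_def)
    show ?thesis
    proof (cases "relent n \<rho> ?\<sigma>")
      case PInf then show ?thesis by simp
    next
      case MInf then show ?thesis using D0 by simp
    next
      case (real d)
      have d0: "d \<ge> 0" using D0 real by (simp add: zero_ereal_def)
      \<comment> \<open>Chosen so that (1 - \<epsilon>) ln (1 / x) = d + 1; the extra 1 outweighs
        the term (1 / b - 1) b.\<close>
      define x where "x = exp (- ((d + 1) / (1 - \<epsilon>)))"
      have x: "x > 0" "x < 1" using d0 eps by (auto simp: x_def)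
      have "ereal x \<le> beta \<epsilon> n (A n) (iid_seq C n)"
        unfolding beta_def
      proof (rule INF_greatest)
        fix E :: "'d op"
        assume "E \<in> {E. is_op n E \<and> loewner_le n (\<lambda>_ _. 0) E \<and> loewner_le n E (ident n) \<and>
                         (SUP \<rho>\<in>A n. ereal (Re (trace n (mmul n \<rho> (mminus n (ident n) E))))) \<le> ereal \<epsilon>}"
        then have E: "loewner_le n (\<lambda>_ _. 0) E" "loewner_le n E (ident n)"
          and I: "(SUP \<rho>\<in>A n. ereal (Re (trace n (mmul n \<rho> (mminus n (ident n) E))))) \<le> ereal \<epsilon>" by auto
        let ?s = "SUP \<sigma>\<in>iid_seq C n. ereal (Re (trace n (mmul n \<sigma> E)))"
        show "ereal x \<le> ?s"
        proof (rule ccontr)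
          assume "\<not> ereal x \<le> ?s"
          then have "?s < ereal x" by simp
          \<comment> \<open>The maximum with 0 guarantees that b is positive, so that w = 1 / b
            makes sense even when the supremum is not positive.\<close>
          then have "max ?s 0 < ereal x" using x by simp
          then obtain b where b: "max ?s 0 < ereal b" "b < x" using ereal_dense2 by (metis less_ereal.simps(1))
          have b0: "b > 0" "b < 1" using b x by (auto simp: zero_ereal_def)
          have "Re (trp n (avop n (\<lambda>_. \<sigma>)) E) \<le> b" if "\<sigma> \<in> C" for \<sigma>
          proof -
            have "avop n (\<lambda>_. \<sigma>) \<in> iid_seq C n" using that unfolding iid_seq_eq by blast
            then have "ereal (Re (trace n (mmul n (avop n (\<lambda>_. \<sigma>)) E))) \<le> ?s" by (rule SUP_upper)
            also have "\<dots> \<le> ereal b" using b(1) by (simp add: less_imp_le)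
            finally show ?thesis by (simp add: trace_mmul)
          qed
          then have Q: "Re (trp n ?\<sigma> E) \<le> b" by (rule mm.trp_mixture_le)
          have "ereal (Re (trp n \<rho> (mminus n (ident n) E))) \<le> ereal \<epsilon>"
            using order_trans[OF SUP_upper[OF \<rho>, of "\<lambda>\<rho>. ereal (Re (trace n (mmul n \<rho> (mminus n (ident n) E))))"] I]
            by (simp add: trace_mmul)
          then have P: "Re (trp n \<rho> E) \<ge> 1 - \<epsilon>"
            using d\<rho> unfolding trp_mminus trp_ident by (simp add: density_def)
          have "ereal (ln (1 / b) * Re (trp n \<rho> E) - (1 / b - 1) * Re (trp n ?\<sigma> E)) \<le> ereal d"
            using relent_ge_test[OF d\<rho> mm.density_mixture E, of "1 / b"] b0 real by simp
          then have dd: "ln (1 / b) * Re (trp n \<rho> E) - (1 / b - 1) * Re (trp n ?\<sigma> E) \<le> d" by simp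
          have lnb: "ln (1 / b) > (d + 1) / (1 - \<epsilon>)"
          proof -
            have "ln b < ln x" using b b0 by simp
            then show ?thesis using b0 by (simp add: x_def ln_div)
          qed
          then have lnpos: "ln (1 / b) > 0" using d0 eps by (smt (verit) divide_nonneg_pos)
          have c1: "d + 1 < (1 - \<epsilon>) * ln (1 / b)" using lnb eps by (simp add: pos_divide_less_eq mult.commute)
          have c2: "(1 - \<epsilon>) * ln (1 / b) \<le> ln (1 / b) * Re (trp n \<rho> E)"
            using mult_left_mono[OF P less_imp_le[OF lnpos]] by (simp add: mult.commute)
          have c3: "(1 / b - 1) * Re (trp n ?\<sigma> E) \<le> (1 / b - 1) * b" using Q b0 by (intro mult_left_mono) auto
          have "d + 1 < d + (1 / b - 1) * b" using c1 c2 c3 dd by linarith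
          also have "(1 / b - 1) * b = 1 - b" using b0 by (simp add: field_simps)
          finally show False using b0 by simp
        qed
      qed
      then have "neglog_rate n (beta \<epsilon> n (A n) (iid_seq C n)) \<le> ereal (- ln x / real n)"
      proof -
        let ?b = "beta \<epsilon> n (A n) (iid_seq C n)"
        assume ge: "ereal x \<le> ?b"
        have "?b \<le> 1"
        proof (rule beta_le_one)
          fix \<sigma> assume "\<sigma> \<in> iid_seq C n"
          then obtain s where "\<sigma> = avop n (\<lambda>_. s)" "s \<in> C" unfolding iid_seq_eq by blast
          then show "density n \<sigma>" using C(2) by (auto intro: density_avop)
        qed (use eps in simp)
        then obtain y where y: "?b = ereal y" "x \<le> y" using ge by (cases ?b) auto
        have "ln x \<le> ln y" using x y by (intro ln_mono) auto
        then have "- ln y / real n \<le> - ln x / real n" by (intro divide_right_mono) auto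
        then show ?thesis using y x by (simp add: neglog_rate_def)
      qed
      then have "t \<le> - ln x / real n" using t by (metis ereal_less_eq(3) order_trans)
      then have "t * real n \<le> - ln x" using n by (simp only: pos_le_divide_eq of_nat_0_less_iff)
      then have "t * real n \<le> (d + 1) / (1 - \<epsilon>)" by (simp add: x_def)
      moreover have "1 - \<epsilon> > 0" using eps by simp
      ultimately have "t * real n * (1 - \<epsilon>) \<le> d + 1" by (simp add: pos_le_divide_eq)
      then show ?thesis using real by (simp add: algebra_simps)
    qed
  qed
  then have "ereal (real n * ((1 - \<epsilon>) * t) - 1) \<le> (INF \<rho>\<in>A n. relent n \<rho> (mixture M n))" by (intro INF_greatest)
  then have "ereal (1 / real n) * ereal (real n * ((1 - \<epsilon>) * t) - 1) \<le> rate_seq A M n"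
    unfolding rate_seq_def by (intro ereal_mult_left_mono) auto
  moreover have "1 / real n * (real n * ((1 - \<epsilon>) * t) - 1) = (1 - \<epsilon>) * t - 1 / real n"
    using n by (simp add: field_simps)
  ultimately show ?thesis by simp
qed

end

section \<open>Existence of a minimising measure\<close>

text \<open>The basis is \<open>fst u\<close>, the scores are \<open>snd u\<close>. When the outcome
  distributions p and q are strictly positive, the scores ln (p / q) give exactly the relative
  entropy of p and q.\<close>

definition pay :: "nat \<Rightarrow> ('d list \<Rightarrow> 'd vec) \<times> ('d list \<Rightarrow> real) \<Rightarrow> 'd op \<Rightarrow> 'd op \<Rightarrow> real" where
  "pay n u \<rho> \<sigma> = (\<Sum>a\<in>basis n. snd u a * prb n \<rho> (fst u a)) + 1 - (\<Sum>a\<in>basis n. exp (snd u a) * prb n \<sigma> (fst u a))"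

text \<open>The number N of points is a parameter of its own, and w and x are total functions on the
  naturals, so that for fixed N the weights and points range over product spaces.\<close>

definition fmix :: "nat \<Rightarrow> nat \<Rightarrow> (nat \<Rightarrow> real) \<Rightarrow> (nat \<Rightarrow> complex^'d^'d) \<Rightarrow> 'd op" where
  "fmix n N w x = (\<lambda>a b. \<Sum>k<N. complex_of_real (w k) * avop n (\<lambda>_. x k) a b)"

lemma prb_fmix: "prb n (fmix n N w x) v = (\<Sum>k<N. w k * prb n (avop n (\<lambda>_. x k)) v)"
proof -
  have "ip (basis n) v (mv (basis n) (fmix n N w x) v)
     = (\<Sum>a\<in>basis n. \<Sum>b\<in>basis n. \<Sum>k<N. complex_of_real (w k) * (cnj (v a) * (avop n (\<lambda>_. x k) a b * v b)))"
    by (simp add: ip_def mv_def fmix_def sum_distrib_left sum_distrib_right mult.assoc mult.left_commute)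
  also have "\<dots> = (\<Sum>a\<in>basis n. \<Sum>k<N. \<Sum>b\<in>basis n. complex_of_real (w k) * (cnj (v a) * (avop n (\<lambda>_. x k) a b * v b)))"
    by (intro sum.cong refl sum.swap)
  also have "\<dots> = (\<Sum>k<N. \<Sum>a\<in>basis n. \<Sum>b\<in>basis n. complex_of_real (w k) * (cnj (v a) * (avop n (\<lambda>_. x k) a b * v b)))"
    by (rule sum.swap)
  also have "\<dots> = (\<Sum>k<N. complex_of_real (w k) * ip (basis n) v (mv (basis n) (avop n (\<lambda>_. x k)) v))"
    by (simp add: ip_def mv_def sum_distrib_left)
  finally show ?thesis by (simp add: prb_def)
qed

lemma prb_affine:
  "prb n (\<lambda>a b. complex_of_real s * X a b + complex_of_real t * Y a b) v = s * prb n X v + t * prb n Y v"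
proof -
  have "ip (basis n) v (mv (basis n) (\<lambda>a b. complex_of_real s * X a b + complex_of_real t * Y a b) v)
     = complex_of_real s * ip (basis n) v (mv (basis n) X v) + complex_of_real t * ip (basis n) v (mv (basis n) Y v)"
    by (simp add: ip_def mv_def sum_distrib_left sum.distrib algebra_simps)
  then show ?thesis by (simp add: prb_def)
qed

lemma prb_cong:
  assumes "\<And>a b. a \<in> basis n \<Longrightarrow> b \<in> basis n \<Longrightarrow> X a b = Y a b"
  shows "prb n X v = prb n Y v"
proof -
  have "mv (basis n) X v = mv (basis n) Y v"
    unfolding mv_def using assms by (intro ext if_cong refl sum.cong) auto
  then show ?thesis by (simp add: prb_def)
qed

text \<open>The boolean selects the real or the imaginary part of a matrix entry; these are the real
  moments a reduced mixture must reproduce.\<close>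

definition moments :: "nat \<Rightarrow> ('d list \<times> 'd list \<times> bool) set" where
  "moments n = basis n \<times> basis n \<times> UNIV"

lemma finite_moments [simp]: "finite (moments n :: ('d::finite list \<times> 'd list \<times> bool) set)"
  by (simp add: moments_def)

text \<open>A combination of two N-point mixtures has 2 N points. Since N is one more than the
  number of real moments, Caratheodory's theorem brings it back to N points with the same operator,
  so the N-point mixtures are closed under mixing.\<close>

lemma fmix_caratheodory:
  fixes x x' :: "nat \<Rightarrow> complex^'d::finite^'d"
  assumes N: "N = Suc (card (moments n :: ('d list \<times> 'd list \<times> bool) set))"
    and w: "\<forall>k. 0 \<le> w k" "(\<Sum>k<N. w k) = 1" and w': "\<forall>k. 0 \<le> w' k" "(\<Sum>k<N. w' k) = 1"
    and x: "\<forall>k. x k \<in> C" "\<forall>k. x' k \<in> C" and t: "0 \<le> t" "t \<le> 1"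
  shows "\<exists>(a :: nat \<Rightarrow> real) y. (\<forall>k. 0 \<le> a k \<and> a k \<le> 1) \<and> (\<Sum>k<N. a k) = 1 \<and> (\<forall>k. y k \<in> C) \<and>
     (\<forall>v. prb n (fmix n N a y) v = t * prb n (fmix n N w x) v + (1 - t) * prb n (fmix n N w' x') v)"
proof -
  \<comment> \<open>The points of both mixtures, tagged by the mixture they come from.\<close>
  define S where "S = (UNIV :: bool set) \<times> {..<N}"
  define pt where "pt s = (if fst s then x (snd s) else x' (snd s))" for s
  define W where "W s = (if fst s then t * w (snd s) else (1 - t) * w' (snd s))" for s
  define \<psi> where "\<psi> i s = (case i of (a, b, r) \<Rightarrow> (if r then Re (avop n (\<lambda>_. pt s) a b) else Im (avop n (\<lambda>_. pt s) a b)))"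
    for i :: "'d list \<times> 'd list \<times> bool" and s
  have sumS: "(\<Sum>s\<in>S. f s) = (\<Sum>k<N. f (True, k)) + (\<Sum>k<N. f (False, k))" for f :: "bool \<times> nat \<Rightarrow> 'a::comm_monoid_add"
    unfolding S_def sum.cartesian_product[symmetric, of "\<lambda>p q. f (p, q)", simplified] by (simp add: UNIV_bool add.commute)
  have W1: "(\<Sum>s\<in>S. W s) = 1"
    unfolding sumS by (simp add: W_def sum_distrib_left[symmetric] w w')
  have "\<exists>(a::nat \<Rightarrow> real) (y::nat \<Rightarrow> bool \<times> nat). (\<forall>k. 0 \<le> a k \<and> a k \<le> 1) \<and> (\<Sum>k<Suc (card (moments n :: ('d list \<times> 'd list \<times> bool) set)). a k) = 1 \<and> (\<forall>k. y k \<in> S) \<and>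
     (\<forall>i\<in>moments n. (\<Sum>k<Suc (card (moments n :: ('d list \<times> 'd list \<times> bool) set)). a k * \<psi> i (y k)) = (\<Sum>s\<in>S. W s * \<psi> i s))"
    by (rule caratheodory_indexed) (use w w' t W1 in \<open>auto simp: S_def W_def\<close>)
  then obtain a :: "nat \<Rightarrow> real" and y :: "nat \<Rightarrow> bool \<times> nat" where a: "\<forall>k. 0 \<le> a k \<and> a k \<le> 1" "(\<Sum>k<N. a k) = 1"
    and mom: "\<forall>i\<in>moments n. (\<Sum>k<N. a k * \<psi> i (y k)) = (\<Sum>s\<in>S. W s * \<psi> i s)"
    unfolding N[symmetric] by blast
  have ent: "fmix n N a (\<lambda>k. pt (y k)) c b = complex_of_real t * fmix n N w x c b + complex_of_real (1 - t) * fmix n N w' x' c b"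
    if "c \<in> basis n" "b \<in> basis n" for c b
  proof -
    have "(c, b, r) \<in> moments n" for r using that by (simp add: moments_def)
    then have m: "(\<Sum>k<N. a k * \<psi> (c, b, r) (y k)) = (\<Sum>s\<in>S. W s * \<psi> (c, b, r) s)" for r using mom by blast
    have "fmix n N a (\<lambda>k. pt (y k)) c b = (\<Sum>s\<in>S. complex_of_real (W s) * avop n (\<lambda>_. pt s) c b)"
    proof (rule complex_eqI)
      show "Re (fmix n N a (\<lambda>k. pt (y k)) c b) = Re (\<Sum>s\<in>S. complex_of_real (W s) * avop n (\<lambda>_. pt s) c b)"
        using m[of True] by (simp add: fmix_def \<psi>_def)
      show "Im (fmix n N a (\<lambda>k. pt (y k)) c b) = Im (\<Sum>s\<in>S. complex_of_real (W s) * avop n (\<lambda>_. pt s) c b)"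
        using m[of False] by (simp add: fmix_def \<psi>_def)
    qed
    also have "\<dots> = complex_of_real t * fmix n N w x c b + complex_of_real (1 - t) * fmix n N w' x' c b"
      unfolding sumS by (simp add: W_def pt_def fmix_def sum_distrib_left mult.assoc)
    finally show ?thesis .
  qed
  have "prb n (fmix n N a (\<lambda>k. pt (y k))) v = t * prb n (fmix n N w x) v + (1 - t) * prb n (fmix n N w' x') v" for v
    unfolding prb_affine[symmetric] by (rule prb_cong) (rule ent)
  moreover have "pt s \<in> C" for s using x by (simp add: pt_def)
  ultimately show ?thesis using a by (intro exI[of _ a] exI[of _ "\<lambda>k. pt (y k)"]) auto
qed

lemma continuous_op_entry: "continuous_on UNIV (\<lambda>\<rho> :: 'd op. \<rho> a b)"
  by (rule continuous_on_product_then_coordinatewise[OF continuous_on_product_coordinates])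

lemma continuous_avop_coord:
  "continuous_on UNIV (\<lambda>x :: nat \<Rightarrow> complex^'d^'d. avop n (\<lambda>_. x k) a b)"
proof -
  have c: "continuous_on UNIV (\<lambda>x :: nat \<Rightarrow> complex^'d^'d. x k)" by (rule continuous_on_product_coordinates)
  show ?thesis using continuous_on_compose2[OF continuous_avop c] by simp
qed

lemma continuous_prb:
  assumes "\<And>a b. continuous_on UNIV (\<lambda>\<theta>. X \<theta> a b)"
  shows "continuous_on UNIV (\<lambda>\<theta>. prb n (X \<theta>) v)"
proof -
  have "prb n (X \<theta>) v = Re (\<Sum>a\<in>basis n. \<Sum>b\<in>basis n. cnj (v a) * (X \<theta> a b * v b))" for \<theta>
    by (simp add: prb_def ip_def mv_def sum_distrib_left)
  moreover have "continuous_on UNIV (\<lambda>\<theta>. Re (\<Sum>a\<in>basis n. \<Sum>b\<in>basis n. cnj (v a) * (X \<theta> a b * v b)))"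
    by (intro continuous_intros assms)
  ultimately show ?thesis by simp
qed

context null_hypothesis
begin

text \<open>Entries of density operators lie in the unit disc, so a closed set of them sits inside a
  product of compact sets.\<close>

lemma compact_A:
  assumes "n \<ge> 1"
  shows "compact (A n)"
proof -
  have "compact {\<rho> :: 'd op. \<forall>x. \<rho> x \<in> {f. \<forall>y. f y \<in> cball 0 1}}"
    by (intro compact_pointwise) auto
  then have "compact ({\<rho> :: 'd op. \<forall>x. \<rho> x \<in> {f. \<forall>y. f y \<in> cball 0 1}} \<inter> A n)"
    using closed_A[OF assms] by (rule compact_Int_closed)
  moreover have "A n \<subseteq> {\<rho> :: 'd op. \<forall>x. \<rho> x \<in> {f. \<forall>y. f y \<in> cball 0 1}}"
    using density_entry_bound[OF A_density[OF assms]] by auto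
  ultimately show ?thesis by (simp add: Int_absorb1)
qed

text \<open>Choosing the basis u with probability w_u is a POVM on pairs (u, a). The averaged
  pay-off is L \<rho> + 1 - G \<sigma>; lowering all scores by ln g, with g the supremum of G,
  enforces the constraint on C, and ln g \<le> g - 1 shows that the guaranteed score does not drop
  below v.\<close>

lemma witness_of_finite_family:
  fixes F :: "(('d list \<Rightarrow> 'd vec) \<times> ('d list \<Rightarrow> real)) set"
  assumes n: "n \<ge> 1" and C: "C \<subseteq> states1" "C \<noteq> {}"
    and F: "finite F" "\<And>u. u \<in> F \<Longrightarrow> onb (basis n) (fst u)" and w: "\<And>u. u \<in> F \<Longrightarrow> 0 \<le> w u" "(\<Sum>u\<in>F. w u) = 1"
    and ge: "\<And>\<rho> \<sigma>. \<rho> \<in> A n \<Longrightarrow> \<sigma> \<in> C \<Longrightarrow> v \<le> (\<Sum>u\<in>F. w u * pay n u \<rho> (avop n (\<lambda>_. \<sigma>)))"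
  shows "witness A C n v"
proof -
  define Y where "Y = F \<times> (basis n :: 'd list set)"
  \<comment> \<open>The square root of the probability of u scales the vectors, so that each
    rank-one operator carries the factor w_u.\<close>
  define \<phi> where "\<phi> y = (\<lambda>a. complex_of_real (sqrt (w (fst y))) * fst (fst y) (snd y) a)"
    for y :: "(('d list \<Rightarrow> 'd vec) \<times> ('d list \<Rightarrow> real)) \<times> 'd list"
  define l where "l y = snd (fst y) (snd y)" for y :: "(('d list \<Rightarrow> 'd vec) \<times> ('d list \<Rightarrow> real)) \<times> 'd list"
  have sumY: "(\<Sum>y\<in>Y. f y) = (\<Sum>u\<in>F. \<Sum>a\<in>basis n. f (u, a))" for f :: "_ \<Rightarrow> 'z::comm_monoid_add"
    unfolding Y_def by (simp add: sum.cartesian_product case_prod_unfold)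
  have prb\<phi>: "prb n \<rho> (\<phi> (u, a)) = w u * prb n \<rho> (fst u a)" if "u \<in> F" for \<rho> u a
  proof -
    have "prb n \<rho> (\<lambda>x. complex_of_real c * z x) = c * c * prb n \<rho> z" for c z
    proof -
      have "ip (basis n) (\<lambda>x. complex_of_real c * z x) (mv (basis n) \<rho> (\<lambda>x. complex_of_real c * z x))
         = complex_of_real (c * c) * ip (basis n) z (mv (basis n) \<rho> z)"
        by (simp add: ip_def mv_def sum_distrib_left mult.assoc mult.left_commute)
      then show ?thesis by (simp add: prb_def)
    qed
    then show ?thesis using w(1)[OF that] by (simp add: \<phi>_def)
  qed
  have povm: "povm n Y \<phi>"
    unfolding povm_def
  proof (intro conjI ext)
    show "finite Y" using F by (simp add: Y_def)
    fix x y :: "'d list"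
    show "rsum n Y \<phi> (\<lambda>_. 1) x y = ident n x y"
    proof (cases "length x = n \<and> length y = n")
      case True
      have "rsum n Y \<phi> (\<lambda>_. 1) x y = (\<Sum>u\<in>F. complex_of_real (w u) * (\<Sum>a\<in>basis n. fst u a x * cnj (fst u a y)))"
      proof -
        have sq: "complex_of_real (sqrt (w u)) * z * (complex_of_real (sqrt (w u)) * z') = complex_of_real (w u) * (z * z')"
          if "u \<in> F" for u z z'
        proof -
          have "complex_of_real (sqrt (w u)) * complex_of_real (sqrt (w u)) = complex_of_real (w u)"
            using w(1)[OF that] by (simp flip: of_real_mult)
          then show ?thesis by (metis mult.assoc mult.left_commute)
        qed
        have "rsum n Y \<phi> (\<lambda>_. 1) x y = (\<Sum>u\<in>F. \<Sum>a\<in>basis n.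
            complex_of_real (sqrt (w u)) * fst u a x * (complex_of_real (sqrt (w u)) * cnj (fst u a y)))"
          using True by (simp add: rsum_def sumY \<phi>_def)
        also have "\<dots> = (\<Sum>u\<in>F. \<Sum>a\<in>basis n. complex_of_real (w u) * (fst u a x * cnj (fst u a y)))"
          by (intro sum.cong refl sq)
        finally show ?thesis by (simp add: sum_distrib_left)
      qed
      also have "\<dots> = (\<Sum>u\<in>F. complex_of_real (w u) * (if x = y then 1 else 0))"
        using True F(2) by (intro sum.cong refl) (simp add: onb_complete)
      also have "\<dots> = ident n x y"
      proof -
        have "(\<Sum>u\<in>F. complex_of_real (w u)) = 1" using w(2) by (metis of_real_1 of_real_sum)
        then show ?thesis using True by (simp add: ident_def)
      qed
      finally show ?thesis .
    qed (auto simp: rsum_def ident_def)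
  qed
  define L where "L \<rho> = (\<Sum>y\<in>Y. l y * prb n \<rho> (\<phi> y))" for \<rho>
  define G where "G \<sigma> = (\<Sum>y\<in>Y. exp (l y) * prb n (avop n (\<lambda>_. \<sigma>)) (\<phi> y))" for \<sigma>
  have LG: "v \<le> L \<rho> + 1 - G \<sigma>" if "\<rho> \<in> A n" "\<sigma> \<in> C" for \<rho> \<sigma>
  proof -
    have "(\<Sum>u\<in>F. w u * pay n u \<rho> (avop n (\<lambda>_. \<sigma>))) = L \<rho> + (\<Sum>u\<in>F. w u) - G \<sigma>"
      unfolding L_def G_def sumY pay_def
      by (simp add: prb\<phi> l_def algebra_simps sum_distrib_left sum.distrib sum_subtractf)
    then show ?thesis using ge[OF that] w(2) by simp
  qed
  have dens: "density n (avop n (\<lambda>_. \<sigma>))" if "\<sigma> \<in> C" for \<sigma> using that C by (intro density_avop) auto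
  have tot: "(\<Sum>y\<in>Y. prb n X (\<phi> y)) = 1" if "density n X" for X
  proof -
    have "(\<Sum>y\<in>Y. 1 * prb n X (\<phi> y)) = Re (trp n X (ident n))"
      unfolding trp_rsum[symmetric] using povm by (simp add: povm_def)
    then show ?thesis using that by (simp add: trp_ident density_def)
  qed
  have Gpos: "G \<sigma> > 0" if sC: "\<sigma> \<in> C" for \<sigma>
  proof -
    have nn: "prb n (avop n (\<lambda>_. \<sigma>)) z \<ge> 0" for z using dens[OF sC] by (intro prb_nonneg) (simp add: density_def)
    have fY: "finite Y" using povm by (simp add: povm_def)
    obtain y where y: "y \<in> Y" "prb n (avop n (\<lambda>_. \<sigma>)) (\<phi> y) \<noteq> 0"
      using tot[OF dens[OF sC]] by (metis (no_types, lifting) sum.neutral zero_neq_one)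
    then show ?thesis unfolding G_def using fY nn
      by (intro sum_pos2[of Y y]) (auto simp: less_le)
  qed
  obtain \<rho>0 \<sigma>0 where ne: "\<rho>0 \<in> A n" "\<sigma>0 \<in> C" using nonempty[OF n] C(2) by blast
  \<comment> \<open>The supremum is finite because any fixed \<rho> in A_n bounds G through
    \<open>LG\<close>.\<close>
  define g where "g = (SUP \<sigma>\<in>C. G \<sigma>)"
  have bdd: "bdd_above (G ` C)" using LG[OF ne(1)] by (intro bdd_aboveI[of _ "L \<rho>0 + 1 - v"]) (auto simp: algebra_simps)
  have Gg: "G \<sigma> \<le> g" if "\<sigma> \<in> C" for \<sigma> unfolding g_def by (rule cSUP_upper[OF that bdd])
  have g0: "g > 0" using Gg[OF ne(2)] Gpos[OF ne(2)] by linarith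
  have Lg: "v \<le> L \<rho> - ln g" if "\<rho> \<in> A n" for \<rho>
  proof -
    have "g \<le> L \<rho> + 1 - v" unfolding g_def using LG[OF that] C(2) by (intro cSUP_least) (auto simp: algebra_simps)
    then show ?thesis using ln_le_minus_one[OF g0] by linarith
  qed
  have "\<forall>\<rho>\<in>A n. v \<le> (\<Sum>y\<in>Y. (l y - ln g) * prb n \<rho> (\<phi> y))"
  proof
    fix \<rho> assume \<rho>: "\<rho> \<in> A n"
    have "(\<Sum>y\<in>Y. (l y - ln g) * prb n \<rho> (\<phi> y)) = L \<rho> - ln g * (\<Sum>y\<in>Y. prb n \<rho> (\<phi> y))"
      by (simp add: L_def algebra_simps sum_subtractf sum_distrib_left)
    then show "v \<le> (\<Sum>y\<in>Y. (l y - ln g) * prb n \<rho> (\<phi> y))" using tot[OF A_density[OF n \<rho>]] Lg[OF \<rho>] by simp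
  qed
  moreover have "\<forall>\<sigma>\<in>C. (\<Sum>y\<in>Y. exp (l y - ln g) * prb n (avop n (\<lambda>_. \<sigma>)) (\<phi> y)) \<le> 1"
  proof
    fix \<sigma> assume \<sigma>: "\<sigma> \<in> C"
    have "(\<Sum>y\<in>Y. exp (l y - ln g) * prb n (avop n (\<lambda>_. \<sigma>)) (\<phi> y)) = G \<sigma> / g"
      using g0 by (simp add: G_def exp_diff sum_divide_distrib)
    then show "(\<Sum>y\<in>Y. exp (l y - ln g) * prb n (avop n (\<lambda>_. \<sigma>)) (\<phi> y)) \<le> 1" using Gg[OF \<sigma>] g0 by simp
  qed
  ultimately show ?thesis
    unfolding witness_def using povm by (intro exI[of _ Y] exI[of _ \<phi>] exI[of _ "\<lambda>y. l y - ln g"] conjI)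
qed

text \<open>If every pair of a state and a mixture could be beaten by some basis with scores, the
  minimax theorem would give a finite randomised family that guarantees v against all pairs. Against
  point masses this is a witness.\<close>

lemma no_witness_minimizer:
  assumes n: "n \<ge> 1" and C: "compact C" "C \<subseteq> states1" "C \<noteq> {}" and nw: "\<not> witness A C n v"
  shows "\<exists>\<rho>\<in>A n. \<exists>N w x. (\<forall>k. 0 \<le> w k) \<and> (\<Sum>k<N. w k) = 1 \<and> (\<forall>k. x k \<in> C) \<and>
     (\<forall>u. onb (basis n) (fst u) \<longrightarrow> pay n u \<rho> (fmix n N w x) \<le> v)"
proof (rule ccontr)
  assume neg: "\<not> ?thesis"
  define N where "N = Suc (card (moments n :: ('d list \<times> 'd list \<times> bool) set))"
  \<comment> \<open>All weights are confined to [0, 1], including those with k \<ge> N that do not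
    enter the mixture, so that the set of parameters is compact in the product topology.\<close>
  define \<Theta> where "\<Theta> = A n \<times> ({w. \<forall>k. w k \<in> {0..1}} \<inter> {w :: nat \<Rightarrow> real. (\<Sum>k<N. w k) = 1}) \<times> {x :: nat \<Rightarrow> complex^'d^'d. \<forall>k. x k \<in> C}"
  define U where "U = {u :: ('d list \<Rightarrow> 'd vec) \<times> ('d list \<Rightarrow> real). onb (basis n) (fst u)}"
  define P where "P u \<theta> = (case \<theta> of (\<rho>, w, x) \<Rightarrow> pay n u \<rho> (fmix n N w x))"
    for u and \<theta> :: "'d op \<times> (nat \<Rightarrow> real) \<times> (nat \<Rightarrow> complex^'d^'d)"
  have comp: "compact \<Theta>"
  proof -
    have "closed {w :: nat \<Rightarrow> real. (\<Sum>k<N. w k) = 1}"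
      by (intro closed_Collect_eq continuous_intros continuous_on_product_coordinates)
    then have "compact ({w. \<forall>k. w k \<in> {0..1}} \<inter> {w :: nat \<Rightarrow> real. (\<Sum>k<N. w k) = 1})"
      by (intro compact_Int_closed compact_pointwise) auto
    then show ?thesis unfolding \<Theta>_def using compact_A[OF n] C(1)
      by (intro compact_Times compact_pointwise) auto
  qed
  obtain \<rho>0 \<sigma>0 where ne: "\<rho>0 \<in> A n" "\<sigma>0 \<in> C" using nonempty[OF n] C(3) by blast
  have ne\<Theta>: "(\<rho>0, \<lambda>k. if k = 0 then 1 else 0, \<lambda>_. \<sigma>0) \<in> \<Theta>"
    using ne by (auto simp: \<Theta>_def N_def)
  have prbaff: "pay n u (\<lambda>a b. complex_of_real t * \<rho> a b + complex_of_real (1 - t) * \<rho>' a b) X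
       = t * pay n u \<rho> Y + (1 - t) * pay n u \<rho>' Y'"
    if "\<And>v. prb n X v = t * prb n Y v + (1 - t) * prb n Y' v" for u t \<rho> \<rho>' X Y Y'
    unfolding pay_def prb_affine that
    by (simp add: algebra_simps sum.distrib sum_subtractf sum_distrib_left)
  have "\<exists>F w. finite F \<and> F \<subseteq> U \<and> (\<forall>u\<in>F. 0 \<le> w u) \<and> (\<Sum>u\<in>F. w u) = 1 \<and>
     (\<forall>z\<in>\<Theta>. v \<le> (\<Sum>u\<in>F. w u * P u z))"
  proof (rule compact_minimax[OF comp, where rep="\<lambda>\<theta>. \<theta>"])
    show "\<Theta> \<noteq> {}" using ne\<Theta> by blast
    fix u assume u: "u \<in> U"
    have c1: "continuous_on UNIV (\<lambda>\<theta> :: 'd op \<times> (nat \<Rightarrow> real) \<times> (nat \<Rightarrow> complex^'d^'d). fst \<theta> a b)" for a b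
      using continuous_on_compose2[OF continuous_op_entry[of a b] continuous_on_fst[OF continuous_on_id]] by simp
    have c2: "continuous_on UNIV (\<lambda>\<theta> :: 'd op \<times> (nat \<Rightarrow> real) \<times> (nat \<Rightarrow> complex^'d^'d). fst (snd \<theta>) k)" for k
      using continuous_on_compose2[OF continuous_on_product_coordinates[of k] continuous_on_fst[OF continuous_on_snd[OF continuous_on_id]]] by simp
    have c3: "continuous_on UNIV (\<lambda>\<theta> :: 'd op \<times> (nat \<Rightarrow> real) \<times> (nat \<Rightarrow> complex^'d^'d). avop n (\<lambda>_. snd (snd \<theta>) k) a b)" for k a b
      using continuous_on_compose2[OF continuous_avop_coord[of n k a b] continuous_on_snd[OF continuous_on_snd[OF continuous_on_id]]] by simp
    have c4: "continuous_on UNIV (\<lambda>\<theta> :: 'd op \<times> (nat \<Rightarrow> real) \<times> (nat \<Rightarrow> complex^'d^'d). fmix n N (fst (snd \<theta>)) (snd (snd \<theta>)) a b)" for a b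
      unfolding fmix_def by (intro continuous_intros c2 c3)
    have "continuous_on UNIV (\<lambda>\<theta>. pay n u (fst \<theta>) (fmix n N (fst (snd \<theta>)) (snd (snd \<theta>))))"
      unfolding pay_def by (intro continuous_intros continuous_prb c1 c4)
    then show "continuous_on UNIV (\<lambda>\<theta>. P u \<theta>)" by (simp add: P_def case_prod_unfold)
  next
    fix z z' :: "'d op \<times> (nat \<Rightarrow> real) \<times> (nat \<Rightarrow> complex^'d^'d)" and t :: real
    assume z: "z \<in> \<Theta>" "z' \<in> \<Theta>" and t: "0 \<le> t" "t \<le> 1"
    obtain \<rho> w x where zz: "z = (\<rho>, w, x)" by (cases z)
    obtain \<rho>' w' x' where zz': "z' = (\<rho>', w', x')" by (cases z')
    have h: "\<rho> \<in> A n" "\<forall>k. 0 \<le> w k" "(\<Sum>k<N. w k) = 1" "\<forall>k. x k \<in> C"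
      "\<rho>' \<in> A n" "\<forall>k. 0 \<le> w' k" "(\<Sum>k<N. w' k) = 1" "\<forall>k. x' k \<in> C"
      using z by (auto simp: zz zz' \<Theta>_def)
    obtain a y where ay: "\<forall>k. 0 \<le> a k \<and> a k \<le> (1::real)" "(\<Sum>k<N. a k) = 1" "\<forall>k. y k \<in> C"
       "\<And>v. prb n (fmix n N a y) v = t * prb n (fmix n N w x) v + (1 - t) * prb n (fmix n N w' x') v"
      using fmix_caratheodory[OF N_def h(2,3,6,7,4,8) t] by (elim exE conjE) (rule that; blast)
    let ?\<rho> = "\<lambda>a b. complex_of_real t * \<rho> a b + complex_of_real (1 - t) * \<rho>' a b"
    have "?\<rho> \<in> A n" using convex_A[OF n] h(1,5) t unfolding convex_states_def by blast
    then have "(?\<rho>, a, y) \<in> \<Theta>" using ay by (auto simp: \<Theta>_def)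
    moreover have "P u (?\<rho>, a, y) = t * P u z + (1 - t) * P u z'" for u
      unfolding P_def zz zz' prod.case by (rule prbaff) (rule ay(4))
    ultimately show "\<exists>y\<in>\<Theta>. \<forall>u\<in>U. P u y = t * P u z + (1 - t) * P u z'" by blast
  next
    fix z :: "'d op \<times> (nat \<Rightarrow> real) \<times> (nat \<Rightarrow> complex^'d^'d)"
    assume "z \<in> \<Theta>"
    then obtain \<rho> w x where zz: "z = (\<rho>, w, x)" "\<rho> \<in> A n" "\<forall>k. 0 \<le> w k" "(\<Sum>k<N. w k) = 1" "\<forall>k. x k \<in> C"
      by (auto simp: \<Theta>_def)
    then obtain u where "onb (basis n) (fst u)" "\<not> pay n u \<rho> (fmix n N w x) \<le> v" using neg by blast
    then show "\<exists>u\<in>U. v < P u z" by (intro bexI[of _ u]) (auto simp: U_def P_def zz)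
  qed auto
  then obtain F W where F: "finite F" "F \<subseteq> U" "\<forall>u\<in>F. 0 \<le> W u" "(\<Sum>u\<in>F. W u) = 1"
    and ge: "\<forall>z\<in>\<Theta>. v \<le> (\<Sum>u\<in>F. W u * P u z)" by blast
  have "witness A C n v"
  proof (rule witness_of_finite_family[OF n C(2,3) F(1), where w=W])
    fix \<rho> \<sigma> assume rs: "\<rho> \<in> A n" "\<sigma> \<in> C"
    \<comment> \<open>This would only restate a point mass in the N-point parametrisation: all
      weight sits on k = 0.\<close>
    let ?w = "\<lambda>k::nat. if k = 0 then 1 else 0 :: real"
    have "(\<rho>, ?w, \<lambda>_. \<sigma>) \<in> \<Theta>" using rs by (auto simp: \<Theta>_def N_def)
    then have "v \<le> (\<Sum>u\<in>F. W u * pay n u \<rho> (fmix n N ?w (\<lambda>_. \<sigma>)))" using ge by (auto simp: P_def)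
    moreover have "fmix n N ?w (\<lambda>_. \<sigma>) = avop n (\<lambda>_. \<sigma>)"
    proof (intro ext)
      fix a b
      have "fmix n N ?w (\<lambda>_. \<sigma>) a b = (\<Sum>k<N. if k = 0 then avop n (\<lambda>_. \<sigma>) a b else 0)"
        unfolding fmix_def by (intro sum.cong) auto
      then show "fmix n N ?w (\<lambda>_. \<sigma>) a b = avop n (\<lambda>_. \<sigma>) a b" by (simp add: N_def)
    qed
    ultimately show "v \<le> (\<Sum>u\<in>F. W u * pay n u \<rho> (avop n (\<lambda>_. \<sigma>)))" by simp
  qed (use F in \<open>auto simp: U_def\<close>)
  then show False using nw by blast
qed

end

section \<open>One measure dominating a sequence of finite mixtures\<close>

lemma pmf_of_sums:
  fixes f :: "nat \<Rightarrow> real"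
  assumes "\<And>k. 0 \<le> f k" "f sums 1"
  shows "\<exists>p. \<forall>k. pmf p k = f k"
proof -
  have "(\<integral>\<^sup>+k. ennreal (f k) \<partial>count_space UNIV) = (\<Sum>k. ennreal (f k))" by (rule nn_integral_count_space_nat)
  also have "\<dots> = ennreal 1" using assms by (rule suminf_ennreal_eq)
  finally have "(\<integral>\<^sup>+k. ennreal (f k) \<partial>count_space UNIV) = 1" by simp
  then have "\<forall>k. pmf (embed_pmf f) k = f k" using assms(1) by (intro allI pmf_embed_pmf) auto
  then show ?thesis by blast
qed

text \<open>A two-stage draw: first an index n, then a point of the n-th mixture. Whatever the
  number of sites, the resulting mixture contains the n-th one with the probability of drawing n,
  and that probability decays only polynomially.\<close>

lemma dominating_mixture:
  fixes x :: "nat \<Rightarrow> nat \<Rightarrow> complex^'d::finite^'d"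
  assumes C: "closed C" "C \<subseteq> states1"
    and w: "\<And>n k. 0 \<le> w n k" "\<And>n. (\<Sum>k<N n. w n k) = 1" and x: "\<And>n k. x n k \<in> C"
  shows "\<exists>M\<in>prob_on C. \<forall>n v. 1 / (real (n + 1) * real (n + 2)) * prb n (fmix n (N n) (w n) (x n)) v \<le> prb n (mixture M n) v"
proof -
  define c where "c n = 1 / (real (n + 1) * real (n + 2))" for n :: nat
  \<comment> \<open>The weights telescope: 1 / ((n + 1) (n + 2)) = 1 / (n + 1) - 1 / (n + 2), with
    total 1.\<close>
  have "(\<lambda>n. 1 / real (n + 1)) \<longlonglongrightarrow> 0" by real_asymp
  then have "(\<lambda>n. 1 / real (n + 1) - 1 / real (Suc n + 1)) sums (1 / real (0 + 1) - 0)" by (rule telescope_sums')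
  moreover have "1 / real (n + 1) - 1 / real (Suc n + 1) = c n" for n by (simp add: c_def field_simps)
  ultimately have "c sums 1" by simp
  then obtain q where q: "\<forall>n. pmf q n = c n" using pmf_of_sums[of c] by (auto simp: c_def)
  have "\<exists>p. \<forall>k. pmf p k = (if k < N n then w n k else 0)" for n
  proof (rule pmf_of_sums)
    have "(\<lambda>k. if k \<in> {..<N n} then w n k else 0) sums (\<Sum>k<N n. w n k)" by (rule sums_If_finite_set) simp
    then show "(\<lambda>k. if k < N n then w n k else 0) sums 1" by (simp add: w(2))
  qed (use w in auto)
  then obtain \<kappa> where \<kappa>: "\<And>n k. pmf (\<kappa> n) k = (if k < N n then w n k else 0)" by metis
  \<comment> \<open>\<open>P\<close> is the discrete law of the two-stage draw; \<open>M\<close> is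
    the same law viewed on the Borel sets, as \<open>prob_on\<close> demands.\<close>
  define P where "P = bind_pmf q (\<lambda>n. map_pmf (x n) (\<kappa> n))"
  define M where "M = distr (measure_pmf P) borel (\<lambda>y. y)"
  have setP: "set_pmf P \<subseteq> C" using x by (auto simp: P_def)
  have "emeasure M (UNIV - C) = 0"
  proof -
    have "UNIV - C \<in> sets borel" using C(1) by auto
    then have "emeasure M (UNIV - C) = emeasure (measure_pmf P) (UNIV - C)" by (simp add: M_def emeasure_distr)
    moreover have "measure (measure_pmf P) (UNIV - C) = 0" using setP by (auto simp: measure_pmf_zero_iff)
    ultimately show ?thesis by (simp add: measure_pmf.emeasure_eq_measure)
  qed
  moreover have "prob_space M" unfolding M_def by (intro measure_pmf.prob_space_distr) simp
  ultimately have M: "M \<in> prob_on C" by (simp add: prob_on_def M_def)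
  interpret mm: mixing_measure C M by unfold_locales (use C M in auto)
  have "c n * prb n (fmix n (N n) (w n) (x n)) v \<le> prb n (mixture M n) v" for n v
  proof -
    define h where "h \<sigma> = prb n (avop n (\<lambda>_. \<sigma>)) v" for \<sigma> :: "complex^'d^'d"
    have h0: "0 \<le> h \<sigma>" if "\<sigma> \<in> C" for \<sigma>
      unfolding h_def using density_avop[of n "\<lambda>_. \<sigma>"] that C(2) by (intro prb_nonneg) (auto simp: density_def)
    have hM: "h \<in> borel_measurable borel"
      unfolding h_def by (intro borel_measurable_continuous_onI continuous_prb continuous_avop)
    have H0: "0 \<le> (\<Sum>k<N n. w n k * h (x n k))" using w x h0 by (intro sum_nonneg mult_nonneg_nonneg) auto
    have "ennreal (c n) * ennreal (\<Sum>k<N n. w n k * h (x n k)) = (\<integral>\<^sup>+k. ennreal (h (x n k)) \<partial>\<kappa> n) * emeasure (measure_pmf q) {n}"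
    proof -
      have "(\<integral>\<^sup>+k. ennreal (h (x n k)) \<partial>\<kappa> n) = (\<Sum>k<N n. ennreal (h (x n k)) * ennreal (pmf (\<kappa> n) k))"
        by (rule nn_integral_measure_pmf_support) (auto simp: set_pmf_iff \<kappa> split: if_splits)
      also have "\<dots> = (\<Sum>k<N n. ennreal (w n k * h (x n k)))"
        using w x h0 by (intro sum.cong refl) (simp add: \<kappa> ennreal_mult' mult.commute)
      also have "\<dots> = ennreal (\<Sum>k<N n. w n k * h (x n k))"
        using w x h0 by (intro sum_ennreal) auto
      finally show ?thesis using q by (simp add: emeasure_pmf_single mult.commute)
    qed
    also have "\<dots> = (\<integral>\<^sup>+j. (\<integral>\<^sup>+k. ennreal (h (x n k)) \<partial>\<kappa> n) * indicator {n} j \<partial>q)"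
      by (rule nn_integral_cmult_indicator[symmetric]) simp
    \<comment> \<open>All first-stage outcomes other than n are restored; their contributions are
      nonnegative.\<close>
    also have "\<dots> \<le> (\<integral>\<^sup>+j. (\<integral>\<^sup>+k. ennreal (h (x j k)) \<partial>\<kappa> j) \<partial>q)"
      by (rule nn_integral_mono) (auto simp: indicator_def)
    also have "\<dots> = (\<integral>\<^sup>+\<sigma>. ennreal (h \<sigma>) \<partial>P)"
      by (simp add: P_def)
    also have "\<dots> = (\<integral>\<^sup>+\<sigma>. ennreal (h \<sigma>) \<partial>M)"
      unfolding M_def using hM by (subst nn_integral_distr) auto
    also have "\<dots> = ennreal (LINT \<sigma>|M. h \<sigma>)"
    proof (rule nn_integral_eq_integral)
      show "integrable M h" unfolding h_def by (rule mm.prb_integrable)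
      show "AE \<sigma> in M. 0 \<le> h \<sigma>" using mm.AE_C by eventually_elim (rule h0)
    qed
    also have "(LINT \<sigma>|M. h \<sigma>) = prb n (mixture M n) v" unfolding h_def by (rule mm.prb_mixture[symmetric])
    finally have "ennreal (c n * (\<Sum>k<N n. w n k * h (x n k))) \<le> ennreal (prb n (mixture M n) v)"
      by (subst ennreal_mult[OF _ H0]) (simp_all add: c_def)
    moreover have "0 \<le> prb n (mixture M n) v" using mm.density_mixture by (intro prb_nonneg) (simp add: density_def)
    ultimately have "c n * (\<Sum>k<N n. w n k * h (x n k)) \<le> prb n (mixture M n) v" by (simp add: ennreal_le_iff)
    then show ?thesis by (simp add: prb_fmix h_def)
  qed
  then show ?thesis using M by (intro bexI[of _ M]) (auto simp: c_def)
qed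

lemma neglog_rate_antimono:
  assumes "b \<le> b'" "b' \<le> 1" "n \<ge> 1"
  shows "neglog_rate n b' \<le> neglog_rate n b"
proof (cases "b' \<le> 0")
  case True
  then show ?thesis using assms(1) by (simp add: neglog_rate_def)
next
  case False
  then obtain r where r: "b' = ereal r" "r > 0" using assms(2) by (cases b') auto
  have "neglog_rate n b' = ereal (- ln r / real n)" using r by (simp add: neglog_rate_def)
  also have "\<dots> \<le> neglog_rate n b" using assms r by (intro neglog_rate_ge) auto
  finally show ?thesis .
qed

text \<open>The upper estimate bounds S \<epsilon> only up to the factor 1 - \<epsilon>, which
  disappears in the limit. It is phrased with real t below S \<epsilon>, so that no division of
  extended reals occurs.\<close>

lemma Lim_of_sandwich:
  fixes S :: "real \<Rightarrow> ereal"
  assumes lo: "\<And>\<epsilon>. \<epsilon> > 0 \<Longrightarrow> r \<le> S \<epsilon>"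
    and hi: "\<And>\<epsilon> t. 0 < \<epsilon> \<Longrightarrow> \<epsilon> < 1 \<Longrightarrow> ereal t < S \<epsilon> \<Longrightarrow> ereal ((1 - \<epsilon>) * t) \<le> r"
  shows "Lim (at_right 0) S = r"
proof -
  have pos: "\<forall>\<^sub>F \<epsilon> in at_right (0::real). \<epsilon> > 0" by (rule eventually_at_right_less)
  have lt1: "\<forall>\<^sub>F \<epsilon> in at_right (0::real). \<epsilon> < 1" by (rule eventually_at_rightI[of 0 1]) auto
  have "(S \<longlongrightarrow> r) (at_right 0)"
  proof (rule order_tendstoI)
    fix a assume a: "a < r"
    show "\<forall>\<^sub>F \<epsilon> in at_right 0. a < S \<epsilon>" using pos by eventually_elim (use a lo in \<open>force intro: less_le_trans\<close>)
  next
    fix a assume a: "r < a"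
    obtain t' where t': "r < ereal t'" "ereal t' < a" using ereal_dense2[OF a] by blast
    obtain t'' where t'': "r < ereal t''" "t'' < t'" using ereal_dense2[OF t'(1)] by auto
    have "((\<lambda>\<epsilon>. (1 - \<epsilon>) * t') \<longlongrightarrow> (1 - 0) * t') (at_right 0)" by (intro tendsto_intros)
    then have "\<forall>\<^sub>F \<epsilon> in at_right 0. t'' < (1 - \<epsilon>) * t'" using t''(2) by (intro order_tendstoD(1)) auto
    with pos lt1 show "\<forall>\<^sub>F \<epsilon> in at_right 0. S \<epsilon> < a"
    proof eventually_elim
      case (elim \<epsilon>)
      have "S \<epsilon> \<le> ereal t'"
      proof (rule ccontr)
        assume "\<not> S \<epsilon> \<le> ereal t'"
        then have "ereal ((1 - \<epsilon>) * t') \<le> r" using hi elim by simp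
        moreover have "r < ereal ((1 - \<epsilon>) * t')" using t''(1) elim by (meson less_ereal.simps(1) less_trans)
        ultimately show False by simp
      qed
      then show ?case using t'(2) by simp
    qed
  qed
  then show ?thesis by (intro tendsto_Lim) auto
qed

section \<open>Identification of the exponents with the witness rate\<close>

context null_hypothesis
begin

text \<open>Measuring the standard basis with all scores 0 shows that the witness rate is
  nonnegative, in particular not - \<infinity>. The first component of the index is a dummy imposed
  by the index type.\<close>

lemma witness_zero:
  assumes k: "k \<ge> 1" and C: "C \<subseteq> states1"
  shows "witness A C k 0"
proof -
  define Y :: "((('d list \<Rightarrow> 'd vec) \<times> ('d list \<Rightarrow> real)) \<times> 'd list) set" where "Y = {(\<lambda>_ _. 0, \<lambda>_. 0)} \<times> basis k"
  define \<phi> :: "(('d list \<Rightarrow> 'd vec) \<times> ('d list \<Rightarrow> real)) \<times> 'd list \<Rightarrow> 'd vec" where "\<phi> y = (\<lambda>x. if x = snd y then 1 else 0)" for y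
  have sumY: "(\<Sum>y\<in>Y. f y) = (\<Sum>a\<in>basis k. f ((\<lambda>_ _. 0, \<lambda>_. 0), a))" for f :: "_ \<Rightarrow> 'z::comm_monoid_add"
    unfolding Y_def by (simp add: sum.cartesian_product[symmetric, of "\<lambda>p q. f (p, q)", simplified])
  have p: "povm k Y \<phi>"
    unfolding povm_def
  proof (intro conjI ext)
    show "finite Y" by (simp add: Y_def)
    fix x y :: "'d list"
    show "rsum k Y \<phi> (\<lambda>_. 1) x y = ident k x y"
    proof (cases "length x = k \<and> length y = k")
      case True
      then have "rsum k Y \<phi> (\<lambda>_. 1) x y = (\<Sum>a\<in>basis k. (if x = a then 1 else 0) * cnj (if y = a then 1 else 0))"
        by (simp add: rsum_def sumY \<phi>_def)
      also have "\<dots> = (\<Sum>a\<in>basis k. if a = x then (if x = y then 1 else 0) else 0)"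
        by (intro sum.cong) auto
      finally show ?thesis using True by (simp add: ident_def)
    qed (auto simp: rsum_def ident_def)
  qed
  have "(\<Sum>y\<in>Y. exp 0 * prb k (avop k (\<lambda>_. \<sigma>)) (\<phi> y)) \<le> 1" if "\<sigma> \<in> C" for \<sigma>
  proof -
    have "density k (avop k (\<lambda>_. \<sigma>))" using that C by (intro density_avop) auto
    moreover have "(\<Sum>y\<in>Y. 1 * prb k (avop k (\<lambda>_. \<sigma>)) (\<phi> y)) = Re (trp k (avop k (\<lambda>_. \<sigma>)) (ident k))"
      unfolding trp_rsum[symmetric] using p by (simp add: povm_def)
    ultimately show ?thesis by (simp add: trp_ident density_def)
  qed
  then show ?thesis
    unfolding witness_def using p by (intro exI[of _ Y] exI[of _ \<phi>] exI[of _ "\<lambda>_. 0"]) auto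
qed

text \<open>If the mixture dominates c X, raising all scores by ln c compares the two exponential
  terms, so a pay-off bound against X becomes one against the mixture at the price - ln c. The
  passage from measured pay-offs to the relative entropy then costs the logarithm of the number of
  eigenvalues.\<close>

lemma relent_dominated:
  assumes n: "n \<ge> 1" and C: "closed C" "C \<subseteq> states1" and M: "M \<in> prob_on C" and \<rho>: "\<rho> \<in> A n" and c: "c > 0"
    and dom: "\<And>v. c * prb n X v \<le> prb n (mixture M n) v"
    and pay: "\<And>u. onb (basis n) (fst u) \<Longrightarrow> pay n u \<rho> X \<le> b"
  shows "relent n \<rho> (mixture M n) \<le> ereal (b - ln c + ln (real ((n + 1) ^ (CARD('d) * CARD('d)))))"
proof -
  interpret mm: mixing_measure C M by unfold_locales (use C M in auto)
  show ?thesis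
  proof (rule relent_le_measured[OF A_density[OF n \<rho>] mm.density_mixture _ mm.card_eigenvalues_mixture])
    fix g :: "'d list \<Rightarrow> 'd vec" and l :: "'d list \<Rightarrow> real" assume g: "onb (basis n) g"
    have one: "(\<Sum>a\<in>basis n. prb n \<rho> (g a)) = 1"
    proof -
      have "(\<Sum>a\<in>basis n. ip (basis n) (g a) (mv (basis n) \<rho> (g a))) = trace n \<rho>"
        unfolding trace_def by (rule onb_trace[OF finite_basis g])
      then have "Re (\<Sum>a\<in>basis n. ip (basis n) (g a) (mv (basis n) \<rho> (g a))) = 1" using A_trace[OF n \<rho>] by simp
      then show ?thesis by (simp add: prb_def)
    qed
    \<comment> \<open>The pay-off bound is used at the shifted scores l + ln c.\<close>
    have "(\<Sum>a\<in>basis n. (l a + ln c) * prb n \<rho> (g a)) + 1 - (\<Sum>a\<in>basis n. exp (l a + ln c) * prb n X (g a)) \<le> b"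
      using pay[of "(g, \<lambda>a. l a + ln c)"] g by (simp add: pay_def)
    moreover have "(\<Sum>a\<in>basis n. (l a + ln c) * prb n \<rho> (g a)) = (\<Sum>a\<in>basis n. l a * prb n \<rho> (g a)) + ln c"
      using one by (simp add: distrib_right sum.distrib sum_distrib_left[symmetric])
    moreover have "(\<Sum>a\<in>basis n. exp (l a + ln c) * prb n X (g a)) \<le> (\<Sum>a\<in>basis n. exp (l a) * prb n (mixture M n) (g a))"
    proof (rule sum_mono)
      fix a
      have "exp (l a + ln c) * prb n X (g a) = exp (l a) * (c * prb n X (g a))" using c by (simp add: exp_add)
      also have "\<dots> \<le> exp (l a) * prb n (mixture M n) (g a)" by (intro mult_left_mono dom) simp
      finally show "exp (l a + ln c) * prb n X (g a) \<le> exp (l a) * prb n (mixture M n) (g a)" .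
    qed
    ultimately show "(\<Sum>a\<in>basis n. l a * Re (ip (basis n) (g a) (mv (basis n) \<rho> (g a)))) + 1
         - (\<Sum>a\<in>basis n. exp (l a) * Re (ip (basis n) (g a) (mv (basis n) (mixture M n) (g a)))) \<le> b - ln c"
      unfolding prb_def[symmetric] by linarith
  qed
qed

text \<open>Achievability gives r \<le> S \<epsilon> for every \<epsilon>, and with the converse
  this bounds the liminf of the rate from below by r for every measure. A measure whose rate tends
  to r then serves twice: it is the minimiser, and the converse applied to it bounds S \<epsilon>
  from above.\<close>

theorem stein_minstar:
  assumes C: "compact C" "C \<subseteq> states1" "C \<noteq> {}"
  shows "is_minstar A C (stein A (iid_seq C))"
    and "convex C \<Longrightarrow> stein A (av_seq C) = stein A (iid_seq C)"
proof -
  have clC: "closed C" using C(1) by (rule compact_imp_closed)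
  define T where "T = {(k, v). k \<ge> 1 \<and> witness A C k v}"
  define r where "r = (SUP (k, v)\<in>T. ereal (v / real k))"
  define S where "S \<epsilon> = liminf (\<lambda>n. neglog_rate n (beta \<epsilon> n (A n) (iid_seq C n)))" for \<epsilon>
  define S' where "S' \<epsilon> = liminf (\<lambda>n. neglog_rate n (beta \<epsilon> n (A n) (av_seq C n)))" for \<epsilon>
  have wr: "ereal (v / real k) \<le> r" if "k \<ge> 1" "witness A C k v" for k v
  proof -
    have "(k, v) \<in> T" using that by (simp add: T_def)
    then show ?thesis unfolding r_def by (rule SUP_upper2) simp
  qed
  have lo: "r \<le> S \<epsilon>" if "\<epsilon> > 0" for \<epsilon>
    unfolding r_def S_def by (rule SUP_least) (use achievability_iid[OF _ _ C(2) that] in \<open>auto simp: T_def\<close>)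
  have lo': "r \<le> S' \<epsilon>" if "\<epsilon> > 0" "convex C" for \<epsilon>
    unfolding r_def S'_def by (rule SUP_least) (use achievability_av[OF _ _ C(2) that(2,1)] in \<open>auto simp: T_def\<close>)
  have r0: "0 \<le> r" using wr[OF order_refl witness_zero[OF order_refl C(2)]] by (simp add: zero_ereal_def)
  have conv: "\<forall>\<^sub>F n in sequentially. ereal ((1 - \<epsilon>) * t - 1 / real n) \<le> rate_seq A M n"
    if "M \<in> prob_on C" "0 < \<epsilon>" "\<epsilon> < 1" "ereal t < S \<epsilon>" for M \<epsilon> t
  proof -
    have "\<forall>\<^sub>F n in sequentially. ereal t < neglog_rate n (beta \<epsilon> n (A n) (iid_seq C n))"
      using that(4) unfolding S_def by (rule less_LiminfD)
    then show ?thesis using eventually_ge_at_top[of 1]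
      by eventually_elim (intro converse[OF clC C(2) that(1) _ that(2,3)], auto)
  qed
  \<comment> \<open>This holds for every measure and eventually in n, without assuming that the rate
    converges; so the limit for the constructed measure will need an upper bound only.\<close>
  have low: "\<forall>\<^sub>F n in sequentially. y < rate_seq A M n" if M: "M \<in> prob_on C" and y: "y < r" for M y
  proof -
    obtain t' where t': "y < ereal t'" "ereal t' < r" using ereal_dense2[OF y] by blast
    obtain t where t: "t' < t" "ereal t < r" using ereal_dense2[OF t'(2)] by auto
    define d where "d = (t - t') / 2"
    have d: "d > 0" using t by (simp add: d_def)
    \<comment> \<open>Small enough that \<epsilon> t \<le> d, hence (1 - \<epsilon>) t \<ge> t' + d;
      the remaining d absorbs 1 / n.\<close>
    define \<epsilon> where "\<epsilon> = min (1 / 2) (d / (\<bar>t\<bar> + 1))"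
    have e: "0 < \<epsilon>" "\<epsilon> < 1" using d by (auto simp: \<epsilon>_def min_def)
    have "\<epsilon> * t \<le> d"
    proof -
      have "\<epsilon> * t \<le> \<epsilon> * (\<bar>t\<bar> + 1)" using e by (intro mult_left_mono) auto
      also have "\<dots> \<le> d / (\<bar>t\<bar> + 1) * (\<bar>t\<bar> + 1)" by (intro mult_right_mono) (auto simp: \<epsilon>_def)
      also have "\<dots> = d" by (simp add: add_nonneg_eq_0_iff)
      finally show ?thesis .
    qed
    moreover have "t = t' + 2 * d" unfolding d_def by argo
    moreover have "(1 - \<epsilon>) * t = t - \<epsilon> * t" by (simp add: algebra_simps)
    ultimately have et: "(1 - \<epsilon>) * t \<ge> t' + d" by linarith
    have "ereal t < S \<epsilon>" using t(2) lo[OF e(1)] by (rule less_le_trans)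
    then have ev: "\<forall>\<^sub>F n in sequentially. ereal ((1 - \<epsilon>) * t - 1 / real n) \<le> rate_seq A M n" by (rule conv[OF M e])
    have "(\<lambda>n. 1 / real n) \<longlonglongrightarrow> 0" by (rule lim_1_over_n)
    then have "\<forall>\<^sub>F n in sequentially. 1 / real n < d" using d by (rule order_tendstoD(2))
    with ev show ?thesis
    proof eventually_elim
      case (elim n)
      have "t' < (1 - \<epsilon>) * t - 1 / real n" using et elim(2) by linarith
      then have "y < ereal ((1 - \<epsilon>) * t - 1 / real n)" using t'(1) by (meson less_ereal.simps(1) less_trans)
      then show ?case using elim(1) by (rule less_le_trans)
    qed
  qed
  have min: "r \<le> L" if "M \<in> prob_on C" "rate_seq A M \<longlonglongrightarrow> L" for M L
  proof (rule ccontr)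
    assume "\<not> r \<le> L"
    then obtain y where y: "L < y" "y < r" by (meson dense not_le)
    have "\<forall>\<^sub>F n in sequentially. rate_seq A M n < y" using that(2) y(1) by (rule order_tendstoD(2))
    with low[OF that(1) y(2)] have "\<forall>\<^sub>F n in sequentially. False" by eventually_elim auto
    then show False by simp
  qed
  obtain M where M: "M \<in> prob_on C" and lim: "rate_seq A M \<longlonglongrightarrow> r"
  proof (cases "r = \<infinity>")
    case True
    \<comment> \<open>For infinite r the lower bound alone forces every rate to infinity, so any
      measure on C will do.\<close>
    obtain \<sigma>0 where s0: "\<sigma>0 \<in> C" using C(3) by blast
    define w :: "nat \<Rightarrow> nat \<Rightarrow> real" where "w n k = (if k = 0 then 1 else 0)" for n k
    have w: "0 \<le> w n k" "(\<Sum>k<1. w n k) = 1" for n k by (simp_all add: w_def)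
    obtain M where M: "M \<in> prob_on C"
      using dominating_mixture[OF clC C(2), of w "\<lambda>_. 1" "\<lambda>_ _. \<sigma>0", OF w s0] by blast
    have "rate_seq A M \<longlonglongrightarrow> r" by (rule order_tendstoI) (use low[OF M] True in auto)
    with M show ?thesis by (rule that)
  next
    case False
    then obtain r' where r': "r = ereal r'" using r0 by (cases r) auto
    \<comment> \<open>A witness of this value would have rate r' + 1 / n, above the supremum. The
      extra 1 vanishes after division by n.\<close>
    have nw: "\<not> witness A C n (real n * r' + 1)" if n: "n \<ge> 1" for n
    proof
      assume "witness A C n (real n * r' + 1)"
      from wr[OF n this] have "(real n * r' + 1) / real n \<le> r'" by (simp add: r')
      then show False using n by (simp add: divide_le_eq)
    qed
    \<comment> \<open>The family must be indexed by all naturals, but nothing is known about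
      \<open>A 0\<close>; index 0 repeats the case of one site.\<close>
    define m where "m n = max n 1" for n :: nat
    have "\<exists>\<rho> N w x. \<rho> \<in> A (m n) \<and> (\<forall>k. 0 \<le> w k) \<and> (\<Sum>k<N. w k) = 1 \<and> (\<forall>k. x k \<in> C) \<and>
       (\<forall>u. onb (basis (m n)) (fst u) \<longrightarrow> pay (m n) u \<rho> (fmix (m n) N w x) \<le> real (m n) * r' + 1)" for n
    proof -
      have "m n \<ge> 1" by (simp add: m_def)
      from no_witness_minimizer[OF this C nw[OF this]] show ?thesis by blast
    qed
    then obtain \<rho> N w x where f: "\<And>n. \<rho> n \<in> A (m n)" "\<And>n k. 0 \<le> w n k" "\<And>n. (\<Sum>k<N n. w n k) = 1" "\<And>n k. x n k \<in> C"
       "\<And>n u. onb (basis (m n)) (fst u) \<Longrightarrow> pay (m n) u (\<rho> n) (fmix (m n) (N n) (w n) (x n)) \<le> real (m n) * r' + 1"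
      by metis
    obtain M where M: "M \<in> prob_on C"
      and dom: "\<And>n v. 1 / (real (n + 1) * real (n + 2)) * prb n (fmix n (N n) (w n) (x n)) v \<le> prb n (mixture M n) v"
      using dominating_mixture[OF clC C(2), of w N x, OF f(2-4)] by blast
    define D where "D = CARD('d) * CARD('d)"
    \<comment> \<open>The three corrections are the surplus 1 of the missing witness, the price of
      the weight 1 / ((n + 1) (n + 2)) and the price of pinching. All are at most logarithmic in n
      before the division by n.\<close>
    define h where "h n = r' + (1 + ln (real (n + 1) * real (n + 2)) + real D * ln (real (n + 1))) / real n" for n :: nat
    have up: "rate_seq A M n \<le> ereal (h n)" if n: "n \<ge> 1" for n
    proof -
      have mn: "m n = n" using n by (simp add: m_def)
      have "relent n (\<rho> n) (mixture M n) \<le> ereal (real n * r' + 1 - ln (1 / (real (n + 1) * real (n + 2))) + ln (real ((n + 1) ^ D)))"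
        unfolding D_def
        by (rule relent_dominated[OF n clC C(2) M, where X="fmix n (N n) (w n) (x n)"])
           (use f(1,5)[of n] dom in \<open>auto simp: mn\<close>)
      also have "real n * r' + 1 - ln (1 / (real (n + 1) * real (n + 2))) + ln (real ((n + 1) ^ D)) = real n * h n"
      proof -
        have "ln (1 / (real (n + 1) * real (n + 2))) = - ln (real (n + 1) * real (n + 2))"
          by (subst ln_div) auto
        moreover have "ln (real ((n + 1) ^ D)) = real D * ln (real (n + 1))"
          unfolding of_nat_power by (rule ln_realpow)
        moreover have "real n * h n = real n * r' + (1 + ln (real (n + 1) * real (n + 2)) + real D * ln (real (n + 1)))"
          unfolding h_def distrib_left using n by simp
        ultimately show ?thesis by linarith
      qed
      finally have le: "relent n (\<rho> n) (mixture M n) \<le> ereal (real n * h n)" .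
      have "rate_seq A M n \<le> ereal (1 / real n) * relent n (\<rho> n) (mixture M n)"
        unfolding rate_seq_def using f(1)[of n] by (intro ereal_mult_left_mono INF_lower) (auto simp: mn)
      also have "\<dots> \<le> ereal (1 / real n) * ereal (real n * h n)" using le by (intro ereal_mult_left_mono) auto
      also have "\<dots> = ereal (h n)" using n by simp
      finally show ?thesis .
    qed
    have "h \<longlonglongrightarrow> r' + 0"
      unfolding h_def add_divide_distrib[of "1 + _"] times_divide_eq_right[symmetric]
      by (intro tendsto_add tendsto_const tendsto_add_zero tendsto_mult_right_zero) real_asymp+
    then have hl: "(\<lambda>n. ereal (h n)) \<longlonglongrightarrow> r" by (simp add: r')
    have "rate_seq A M \<longlonglongrightarrow> r"
    proof (rule order_tendstoI)
      fix a assume "r < a"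
      with hl have "\<forall>\<^sub>F n in sequentially. ereal (h n) < a" by (rule order_tendstoD(2))
      then show "\<forall>\<^sub>F n in sequentially. rate_seq A M n < a"
        using eventually_ge_at_top[of 1] by eventually_elim (use up in \<open>force intro: le_less_trans\<close>)
    qed (rule low[OF M])
    with M show ?thesis by (rule that)
  qed
  \<comment> \<open>The converse along the constructed measure, whose rate is known to tend to
    r.\<close>
  have hi: "ereal ((1 - \<epsilon>) * t) \<le> r" if "0 < \<epsilon>" "\<epsilon> < 1" "ereal t < S \<epsilon>" for \<epsilon> t
  proof (rule tendsto_le[OF sequentially_bot lim _ conv[OF M that]])
    have "(\<lambda>n. (1 - \<epsilon>) * t - 1 / real n) \<longlonglongrightarrow> (1 - \<epsilon>) * t - 0" by (intro tendsto_intros lim_1_over_n)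
    then show "(\<lambda>n. ereal ((1 - \<epsilon>) * t - 1 / real n)) \<longlonglongrightarrow> ereal ((1 - \<epsilon>) * t)" by simp
  qed
  have st: "stein A (iid_seq C) = r"
    unfolding stein_def S_def[symmetric] by (rule Lim_of_sandwich[OF lo hi])
  show "is_minstar A C (stein A (iid_seq C))"
    unfolding is_minstar_def st using M lim min by blast
  show "stein A (av_seq C) = stein A (iid_seq C)" if cv: "convex C"
  proof -
    \<comment> \<open>Tensor powers are among the arbitrarily varying states, so the error of the
      second kind can only grow and the upper bound carries over.\<close>
    have "S' \<epsilon> \<le> S \<epsilon>" if "\<epsilon> > 0" for \<epsilon>
      unfolding S_def S'_def
    proof (rule Liminf_mono)
      show "\<forall>\<^sub>F n in sequentially. neglog_rate n (beta \<epsilon> n (A n) (av_seq C n)) \<le> neglog_rate n (beta \<epsilon> n (A n) (iid_seq C n))"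
        using eventually_ge_at_top[of 1]
      proof eventually_elim
        case (elim n)
        have "iid_seq C n \<subseteq> av_seq C n" unfolding iid_seq_eq av_seq_eq by blast
        then have "beta \<epsilon> n (A n) (iid_seq C n) \<le> beta \<epsilon> n (A n) (av_seq C n)"
          unfolding beta_def by (intro INF_mono' SUP_subset_mono) auto
        moreover have "beta \<epsilon> n (A n) (av_seq C n) \<le> 1"
        proof (rule beta_le_one)
          fix \<sigma> assume "\<sigma> \<in> av_seq C n"
          then obtain \<sigma>s where "\<sigma> = avop n \<sigma>s" "\<forall>i<n. \<sigma>s i \<in> C" unfolding av_seq_eq by blast
          then show "density n \<sigma>" using density_avop[of n \<sigma>s] C(2) by auto
        qed (use that in simp)
        ultimately show ?case using elim by (rule neglog_rate_antimono)
      qed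
    qed
    then have "ereal ((1 - \<epsilon>) * t) \<le> r" if "0 < \<epsilon>" "\<epsilon> < 1" "ereal t < S' \<epsilon>" for \<epsilon> t
      using hi[OF that(1,2)] that by (meson less_le_trans)
    then have "stein A (av_seq C) = r"
      unfolding stein_def S'_def[symmetric] by (intro Lim_of_sandwich) (auto intro: lo' cv)
    then show ?thesis using st by simp
  qed
qed

end

section \<open>The convex and bounded set of single-site states\<close>

lemma bounded_states1: "bounded (states1 :: (complex^'d::finite^'d) set)"
proof (rule boundedI)
  fix \<sigma> :: "complex^'d^'d" assume s: "\<sigma> \<in> states1"
  have e: "norm (\<sigma> $ a $ b) \<le> 1" for a b
    using density_entry_bound[of 1 "op1 \<sigma>" "[a]" "[b]"] s by (simp add: states1_def op1_def)
  have "norm \<sigma> \<le> (\<Sum>a\<in>UNIV. norm (\<sigma> $ a))" unfolding norm_vec_def by (rule L2_set_le_sum) simp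
  also have "\<dots> \<le> (\<Sum>a\<in>(UNIV :: 'd set). \<Sum>b\<in>(UNIV :: 'd set). 1)"
  proof (rule sum_mono)
    fix a
    have "norm (\<sigma> $ a) \<le> (\<Sum>b\<in>UNIV. norm (\<sigma> $ a $ b))" unfolding norm_vec_def[of "\<sigma> $ a"] by (rule L2_set_le_sum) simp
    also have "\<dots> \<le> (\<Sum>b\<in>(UNIV :: 'd set). 1)" by (intro sum_mono e)
    finally show "norm (\<sigma> $ a) \<le> (\<Sum>b\<in>(UNIV :: 'd set). 1)" .
  qed
  finally show "norm \<sigma> \<le> (\<Sum>a\<in>(UNIV :: 'd set). \<Sum>b\<in>(UNIV :: 'd set). 1)" .
qed

lemma convex_states1: "convex (states1 :: (complex^'d::finite^'d) set)"
proof (rule convexI)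
  fix \<sigma> \<tau> :: "complex^'d^'d" and u v :: real
  assume st: "\<sigma> \<in> states1" "\<tau> \<in> states1" and uv: "0 \<le> u" "0 \<le> v" "u + v = 1"
  have ds: "density 1 (op1 \<sigma>)" and dt: "density 1 (op1 \<tau>)" using st by (auto simp: states1_def)
  let ?X = "\<lambda>x y. complex_of_real u * op1 \<sigma> x y + complex_of_real v * op1 \<tau> x y"
  have eq: "op1 (u *\<^sub>R \<sigma> + v *\<^sub>R \<tau>) = ?X"
    by (auto simp: op1_def fun_eq_iff scaleR_conv_of_real[where 'a=complex])
  have "herm_on (basis 1) ?X"
    unfolding herm_on_def
  proof (intro ballI)
    fix x y :: "'d list" assume xy: "x \<in> basis 1" "y \<in> basis 1"
    have "op1 \<sigma> y x = cnj (op1 \<sigma> x y)" "op1 \<tau> y x = cnj (op1 \<tau> x y)"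
      using ds dt xy unfolding density_def psd_iff psd_on_def herm_on_def by blast+
    then show "?X y x = cnj (?X x y)" by simp
  qed
  moreover have "is_op 1 ?X" using ds dt unfolding density_def psd_iff is_op_def by auto
  moreover have "0 \<le> prb 1 ?X z" for z
    unfolding prb_affine using uv ds dt by (intro add_nonneg_nonneg mult_nonneg_nonneg prb_nonneg) (auto simp: density_def)
  moreover have "trace 1 ?X = 1"
  proof -
    have "trace 1 ?X = complex_of_real u * trace 1 (op1 \<sigma>) + complex_of_real v * trace 1 (op1 \<tau>)"
      by (simp add: trace_def sum.distrib sum_distrib_left)
    also have "\<dots> = complex_of_real (u + v)" using ds dt by (simp add: density_def)
    finally show ?thesis using uv by simp
  qed
  ultimately have "density 1 ?X" by (simp add: density_def psd_iff psd_on_def prb_def)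
  then show "u *\<^sub>R \<sigma> + v *\<^sub>R \<tau> \<in> states1" by (simp add: states1_def eq)
qed

theorem mainTheorem1:
  fixes A :: "nat \<Rightarrow> ('d::finite) op set"
    and B1 :: "(complex^'d^'d) set"
  assumes A_states: "\<And>n. n \<ge> 1 \<Longrightarrow> A n \<subseteq> states n"
    and A_closed: "\<And>n. n \<ge> 1 \<Longrightarrow> closed (A n)"
    and A_convex: "\<And>n. n \<ge> 1 \<Longrightarrow> convex_states n (A n)"
    and QI: "axiom_QI A" and QII: "axiom_QII A" and QIII: "axiom_QIII A" and QIV: "axiom_QIV A"
    and B1_states: "B1 \<subseteq> states1"
    and B1_ne: "B1 \<noteq> {}"
    and B1_closed: "closed B1"
  shows "is_minstar A B1 (stein A (iid_seq B1))
       \<and> stein A (av_seq B1) = stein A (av_seq (convex hull B1))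
       \<and> stein A (av_seq (convex hull B1)) = stein A (iid_seq (convex hull B1))
       \<and> is_minstar A (convex hull B1) (stein A (iid_seq (convex hull B1)))"
proof -
  have "A n \<noteq> {}" if "n \<ge> 1" for n
  proof -
    obtain \<tau> where "\<tau> \<in> A 1" using QI unfolding axiom_QI_def by blast
    then have "tpow 1 n \<tau> \<in> A (n * 1)" using QII that unfolding axiom_QII_def by blast
    then show ?thesis by auto
  qed
  then interpret null_hypothesis A
    using A_states A_closed A_convex QIII QIV by unfold_locales
  have B: "compact B1"
    using B1_closed bounded_subset[OF bounded_states1 B1_states] by (simp add: compact_eq_bounded_closed)
  have H: "compact (convex hull B1)" "convex hull B1 \<subseteq> states1" "convex hull B1 \<noteq> {}"
    using compact_convex_hull[OF B] hull_minimal[of B1 states1 convex] B1_states convex_states1 B1_ne by auto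
  show ?thesis
    using stein_minstar(1)[OF B B1_states B1_ne] stein_av_hull[of A B1]
      stein_minstar(2)[OF H convex_convex_hull] stein_minstar(1)[OF H] by simp
qed

end
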